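(* Let $T>0$, let $\Omega\subset\mathbb{R}^N$ be a (sufficiently smooth) bounded domain, $\Omega_T=(0,T)\times\Omega$, and let $(k,l)\in\mathcal{PC}$. Let $m\ge 1$, $u_0\in L_{m+1}(\Omega)$, $f\in L_{m+1}(\Omega_T)$ and $a\in L_\infty(\Omega_T)$ be such that $0<a_1\le a(t,x)\le a_2$ for a.a. $(t,x)\in\Omega_T$, with two constants $a_1,a_2>0$. Let $u$ be a function on $\Omega_T$ with $u\ge 0$ in $\Omega_T$, and assume that one of the following conditions is satisfied. (D) $au^m\in L_2((0,T);\mathring{H}^1_2(\Omega))$, and for every nonnegative $\psi\in\mathring{H}^1_2(\Omega)$ and every $n\in\mathbb{N}$, $$\int_\Omega\Big(\psi\,\partial_t\big(k_n\ast[u-u_0]\big)+[h_n\ast\nabla(au^m)]\cdot\nabla\psi\Big)\,dx\le\int_\Omega(h_n\ast f)\,\psi\,dx\quad\text{for a.a. }t\in(0,T).\qquad(\star)$$ (N) $au^m\in L_2((0,T);H^1_2(\Omega))$, and $(\star)$ holds for every nonnegative $\psi\in H^1_2(\Omega)$ and every $n\in\mathbb{N}$. Assume further that $k\ast u\in C([0,T];L_2(\Omega))$ and $(k\ast u)|_{t=0}=0$. Then $$\int_0^T\!\!\int_\Omega u^{m+1}\,dx\,dt+\frac{1}{a_1}\int_0^T\!\!\int_\Omega\big[k(T-t)+k(t)\big]\,\big|l\overset{T}{\ast}\nabla(au^m)\big|^2\,dx\,dt\le C(m)\Big(\frac{a_2}{a_1}\Big)^{m+1}\Big(T\|u_0\|_{L_{m+1}(\Omega)}^{m+1}+\|l\|_{L_1((0,T))}^{m+1}\|f\|_{L_{m+1}(\Omega_T)}^{m+1}\Big),$$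 where $C(m)=\frac{2(4m)^m}{(m+1)^{m+1}}$.
   Context: Condition $\mathcal{PC}$: $(k,l)\in\mathcal{PC}$ means that $k\in L_{1,loc}([0,\infty))$ is nonnegative and nonincreasing and $l\in L_{1,loc}([0,\infty))$ satisfies $k\ast l=1$ on $(0,\infty)$ (such $l$ is automatically nonnegative). Convolutions in time: $(k\ast v)(t)=\int_0^t k(t-\tau)v(\tau)\,d\tau$ and $(l\overset{T}{\ast}g)(t)=\int_t^T l(\tau-t)g(\tau)\,d\tau$ for $t\in(0,T)$. In $k_n\ast[u-u_0]$ the function $u_0=u_0(x)$ is regarded as constant in time. Regularized kernels: for $n\in\mathbb{N}$, $h_n\in L_{1,loc}([0,\infty))$ is the unique solution of $h_n(t)+n(h_n\ast l)(t)=n\,l(t)$, $t>0$, and $k_n=k\ast h_n$. Known facts: $h_n\ge0$, $k_n$ is nonnegative, nonincreasing and locally absolutely continuous on $[0,\infty)$ with locally integrable derivative. Spaces: $H^1_2(\Omega)$ is the Sobolev space $W^{1,2}(\Omega)$ and $\mathring{H}^1_2(\Omega)$ is the closure of $C_0^\infty(\Omega)$ in $H^1_2(\Omega)$. The inequality $(\star)$ is the time-regularized weak formulation of $\partial_t(k\ast[u-u_0])-\Delta(au^m)\le f$ with homogeneous Dirichlet condition (case D) or Neumann condition (case N). *)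

theory Defs
  imports "HOL-Analysis.Analysis"
begin

text \<open>Elements of function spaces are represented by functions, and all identities between them
  are understood almost everywhere with respect to (completed) Lebesgue measure.\<close>

definition Lp_space :: "real \<Rightarrow> 'a measure \<Rightarrow> ('a \<Rightarrow> 'b::euclidean_space) set" where
  "Lp_space p M = {f \<in> borel_measurable M. integrable M (\<lambda>x. norm (f x) powr p)}"

definition Lp_norm :: "real \<Rightarrow> 'a measure \<Rightarrow> ('a \<Rightarrow> 'b::euclidean_space) \<Rightarrow> real" where
  "Lp_norm p M f = (LINT x|M. norm (f x) powr p) powr (1 / p)"

definition Linf_space :: "'a measure \<Rightarrow> ('a \<Rightarrow> real) set" where
  "Linf_space M = {f \<in> borel_measurable M. \<exists>C. AE x in M. \<bar>f x\<bar> \<le> C}"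

text \<open>\<open>k \<in> L\<^bsub>1,loc\<^esub>([0,\<infinity>))\<close>: integrability up to and including the origin.\<close>

definition L1loc_halfline :: "(real \<Rightarrow> real) \<Rightarrow> bool" where
  "L1loc_halfline k \<longleftrightarrow> (\<forall>T>0. set_integrable lebesgue {0..T} k)"

definition time_conv :: "(real \<Rightarrow> real) \<Rightarrow> (real \<Rightarrow> 'b::euclidean_space) \<Rightarrow> real \<Rightarrow> 'b" where
  "time_conv k v t = (LINT s:{0..t}|lebesgue. k (t - s) *\<^sub>R v s)"

definition dual_conv :: "real \<Rightarrow> (real \<Rightarrow> real) \<Rightarrow> (real \<Rightarrow> 'b::euclidean_space) \<Rightarrow> real \<Rightarrow> 'b" where
  "dual_conv T l g t = (LINT s:{t..T}|lebesgue. l (s - t) *\<^sub>R g s)"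

text \<open>Monotonicity is required on the open half-line only: \<open>k\<close> may be singular at \<open>0\<close>.
  The convolution of two locally integrable functions is only defined almost everywhere,
  hence so is the equation \<open>k * l = 1\<close>.\<close>

definition cond_PC :: "(real \<Rightarrow> real) \<Rightarrow> (real \<Rightarrow> real) \<Rightarrow> bool" where
  "cond_PC k l \<longleftrightarrow>
     L1loc_halfline k \<and> (\<forall>t>0. 0 \<le> k t) \<and> (\<forall>s t. 0 < s \<and> s \<le> t \<longrightarrow> k t \<le> k s) \<and>
     L1loc_halfline l \<and> (AE t in lebesgue_on {0<..}. time_conv k l t = 1)"

text \<open>The equation determining \<open>h\<^sub>n\<close>; its solution is unique up to null sets.\<close>

definition is_regularizer :: "(real \<Rightarrow> real) \<Rightarrow> nat \<Rightarrow> (real \<Rightarrow> real) \<Rightarrow> bool" where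
  "is_regularizer l n h \<longleftrightarrow>
     L1loc_halfline h \<and>
     (AE t in lebesgue_on {0<..}. h t + real n * time_conv h l t = real n * l t)"

primrec C_k :: "nat \<Rightarrow> ('a::euclidean_space \<Rightarrow> real) \<Rightarrow> bool" where
  "C_k 0 f \<longleftrightarrow> continuous_on UNIV f"
| "C_k (Suc j) f \<longleftrightarrow>
     f differentiable_on UNIV \<and> (\<forall>e\<in>Basis. C_k j (\<lambda>x. frechet_derivative f (at x) e))"

definition test_functions :: "'a::euclidean_space set \<Rightarrow> ('a \<Rightarrow> real) set" where
  "test_functions \<Omega> =
     {\<phi>. (\<forall>j. C_k j \<phi>) \<and> compact (closure {x. \<phi> x \<noteq> 0}) \<and> closure {x. \<phi> x \<noteq> 0} \<subseteq> \<Omega>}"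

definition weak_gradient ::
    "'a::euclidean_space set \<Rightarrow> ('a \<Rightarrow> real) \<Rightarrow> ('a \<Rightarrow> 'a) \<Rightarrow> bool" where
  "weak_gradient \<Omega> v g \<longleftrightarrow>
     (\<forall>K. compact K \<and> K \<subseteq> \<Omega> \<longrightarrow> set_integrable lebesgue K v \<and> set_integrable lebesgue K g) \<and>
     (\<forall>\<phi>\<in>test_functions \<Omega>. \<forall>e\<in>Basis.
        (LINT x|lebesgue_on \<Omega>. v x * frechet_derivative \<phi> (at x) e)
          = - (LINT x|lebesgue_on \<Omega>. (g x \<bullet> e) * \<phi> x))"

text \<open>A weak gradient is unique up to null sets, so the choice is immaterial.\<close>

definition wgrad :: "'a::euclidean_space set \<Rightarrow> ('a \<Rightarrow> real) \<Rightarrow> 'a \<Rightarrow> 'a" where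
  "wgrad \<Omega> v = (SOME g. weak_gradient \<Omega> v g)"

definition H1 :: "'a::euclidean_space set \<Rightarrow> ('a \<Rightarrow> real) set" where
  "H1 \<Omega> = {v \<in> Lp_space 2 (lebesgue_on \<Omega>).
             \<exists>g \<in> Lp_space 2 (lebesgue_on \<Omega>). weak_gradient \<Omega> v g}"

definition H1_norm :: "'a::euclidean_space set \<Rightarrow> ('a \<Rightarrow> real) \<Rightarrow> real" where
  "H1_norm \<Omega> v =
     sqrt ((Lp_norm 2 (lebesgue_on \<Omega>) v)\<^sup>2 + (Lp_norm 2 (lebesgue_on \<Omega>) (wgrad \<Omega> v))\<^sup>2)"

definition H1_zero :: "'a::euclidean_space set \<Rightarrow> ('a \<Rightarrow> real) set" where
  "H1_zero \<Omega> = {v \<in> H1 \<Omega>. \<exists>\<phi>. (\<forall>j::nat. \<phi> j \<in> test_functions \<Omega>) \<and>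
                   (\<lambda>j. H1_norm \<Omega> (\<lambda>x. \<phi> j x - v x)) \<longlonglongrightarrow> 0}"

text \<open>Bochner space \<open>L\<^sub>2((0,T);X)\<close> for a subspace \<open>X\<close> of \<open>H1 \<Omega>\<close> with the \<open>H1\<close> norm: strong
  measurability (a.e. limit of \<open>X\<close>-valued simple functions) and square integrability of the norm.\<close>

definition L2_bochner ::
    "'a::euclidean_space set \<Rightarrow> real \<Rightarrow> ('a \<Rightarrow> real) set \<Rightarrow> (real \<Rightarrow> 'a \<Rightarrow> real) \<Rightarrow> bool" where
  "L2_bochner \<Omega> T X v \<longleftrightarrow>
     (AE t in lebesgue_on {0<..<T}. v t \<in> X) \<and>
     (\<exists>S :: nat \<Rightarrow> real \<Rightarrow> 'a \<Rightarrow> real.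
        (\<forall>j. S j ` {0<..<T} \<subseteq> X \<and> finite (S j ` {0<..<T}) \<and>
             (\<forall>z. {t \<in> {0<..<T}. S j t = z} \<in> sets lebesgue)) \<and>
        (AE t in lebesgue_on {0<..<T}. (\<lambda>j. H1_norm \<Omega> (\<lambda>x. S j t x - v t x)) \<longlonglongrightarrow> 0)) \<and>
     integrable (lebesgue_on {0<..<T}) (\<lambda>t. (H1_norm \<Omega> (v t))\<^sup>2)"

text \<open>\<open>G\<close> is a jointly measurable version of the spatial gradient of \<open>w\<close>. Such a version is unique
  up to null sets of the cylinder, and exists whenever \<open>w \<in> L\<^sub>2((0,T);H1 \<Omega>)\<close>. Joint measurability
  is what makes integrals of \<open>G\<close> in time, at fixed \<open>x\<close>, meaningful.\<close>

definition spatial_gradient ::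
    "'a::euclidean_space set \<Rightarrow> real \<Rightarrow> (real \<times> 'a \<Rightarrow> real) \<Rightarrow> (real \<times> 'a \<Rightarrow> 'a) \<Rightarrow> bool" where
  "spatial_gradient \<Omega> T w G \<longleftrightarrow>
     G \<in> borel_measurable (lebesgue_on ({0<..<T} \<times> \<Omega>)) \<and>
     (AE t in lebesgue_on {0<..<T}. weak_gradient \<Omega> (\<lambda>x. w (t, x)) (\<lambda>x. G (t, x)))"

definition continuous_L2 :: "'a::euclidean_space set \<Rightarrow> real \<Rightarrow> (real \<Rightarrow> 'a \<Rightarrow> real) \<Rightarrow> bool" where
  "continuous_L2 \<Omega> T W \<longleftrightarrow>
     (\<forall>t\<in>{0..T}. W t \<in> Lp_space 2 (lebesgue_on \<Omega>) \<and>
        ((\<lambda>s. Lp_norm 2 (lebesgue_on \<Omega>) (\<lambda>x. W s x - W t x)) \<longlongrightarrow> 0) (at t within {0..T}))"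

text \<open>Membership in \<open>C([0,T];L\<^sub>2(\<Omega>))\<close> refers to the continuous representative \<open>W\<close> of the function
  \<open>k * u\<close>, which is determined for almost all times only; the value at \<open>t = 0\<close> is that of \<open>W\<close>.\<close>

definition conv_continuous_zero_initial ::
    "'a::euclidean_space set \<Rightarrow> real \<Rightarrow> (real \<Rightarrow> real) \<Rightarrow> (real \<times> 'a \<Rightarrow> real) \<Rightarrow> bool" where
  "conv_continuous_zero_initial \<Omega> T k u \<longleftrightarrow>
     (\<exists>W. continuous_L2 \<Omega> T W \<and>
        (AE t in lebesgue_on {0<..<T}. AE x in lebesgue_on \<Omega>.
            W t x = time_conv k (\<lambda>s. u (s, x)) t) \<and>
        (AE x in lebesgue_on \<Omega>. W 0 x = 0))"

text \<open>The regularized weak inequality for all nonnegative test functions in \<open>V\<close>; here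
  \<open>k\<^sub>n = k * h\<^sub>n\<close> and \<open>G\<close> stands for the spatial gradient of \<open>a u\<^sup>m\<close>. As \<open>k\<^sub>n\<close> is locally
  absolutely continuous, \<open>k\<^sub>n * [u - u\<^sub>0]\<close> is differentiable in time almost everywhere.\<close>

definition regularized_inequality ::
    "'a::euclidean_space set \<Rightarrow> real \<Rightarrow> (real \<Rightarrow> real) \<Rightarrow> (nat \<Rightarrow> real \<Rightarrow> real) \<Rightarrow>
     (real \<times> 'a \<Rightarrow> real) \<Rightarrow> ('a \<Rightarrow> real) \<Rightarrow> (real \<times> 'a \<Rightarrow> real) \<Rightarrow> (real \<times> 'a \<Rightarrow> 'a) \<Rightarrow>
     ('a \<Rightarrow> real) set \<Rightarrow> bool" where
  "regularized_inequality \<Omega> T k h u u0 f G V \<longleftrightarrow>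
     (\<forall>\<psi>\<in>V. (AE x in lebesgue_on \<Omega>. 0 \<le> \<psi> x) \<longrightarrow> (\<forall>n\<ge>1.
        AE t in lebesgue_on {0<..<T}.
          (LINT x|lebesgue_on \<Omega>.
             \<psi> x * deriv (time_conv (time_conv k (h n)) (\<lambda>s. u (s, x) - u0 x)) t
             + time_conv (h n) (\<lambda>s. G (s, x)) t \<bullet> wgrad \<Omega> \<psi> x)
          \<le> (LINT x|lebesgue_on \<Omega>. time_conv (h n) (\<lambda>s. f (s, x)) t * \<psi> x)))"

text \<open>Bounded domain lying locally on one side of a Lipschitz graph. The value of \<open>\<gamma>\<close> only
  depends on the component of the point orthogonal to the graph direction \<open>e\<close>.\<close>

definition bounded_lipschitz_domain :: "'a::euclidean_space set \<Rightarrow> bool" where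
  "bounded_lipschitz_domain \<Omega> \<longleftrightarrow>
     open \<Omega> \<and> connected \<Omega> \<and> \<Omega> \<noteq> {} \<and> bounded \<Omega> \<and>
     (\<forall>p\<in>frontier \<Omega>. \<exists>r>0. \<exists>e L. \<exists>\<gamma> :: 'a \<Rightarrow> real.
        norm e = 1 \<and> L-lipschitz_on UNIV \<gamma> \<and>
        \<Omega> \<inter> ball p r = {x \<in> ball p r. \<gamma> (x - (x \<bullet> e) *\<^sub>R e) < x \<bullet> e})"

end

theory Submission
  imports Defs
begin

text \<open>
Write \<open>w = a u\<^sup>m\<close> and \<open>v = u - u\<^sub>0\<close>, let \<open>*\<close> be convolution in time, and let \<open>H\<^sub>n(t)\<close> be the mass of
\<open>h\<^sub>n\<close> on \<open>(0,t)\<close>.  Convolving the equation of \<open>h\<^sub>n\<close> with \<open>k\<close> gives \<open>k\<^sub>n = n (1 - H\<^sub>n)\<close>, hence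
\<open>\<partial>\<^sub>t (k\<^sub>n * v) = n (v - h\<^sub>n * v)\<close>, while the equation itself reads \<open>h\<^sub>n = n (l - h\<^sub>n * l)\<close>.
For a fixed test function \<open>\<psi>\<close>, the regularized inequality becomes a scalar inequality in \<open>t\<close>;
convolving it with the nonnegative kernel \<open>l\<close> turns it into \<open>h\<^sub>n * q \<le> 0\<close> with
\<open>q = \<integral> v \<psi> + \<integral> (l * \<nabla>w) \<bullet> \<nabla>\<psi> - \<integral> (l * f) \<psi>\<close>, and \<open>h\<^sub>n\<close> is an approximate identity, so
\<open>q \<le> 0\<close> at almost every time (\<open>remove_regularization\<close>).

The exceptional times depend on \<open>\<psi>\<close>.  Strong measurability of \<open>w\<close> makes the set of all
\<open>w(t)\<close> separable, so countably many of the functions \<open>w(c)\<close>, which are themselves admissible and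
nonnegative, are dense among them in \<open>H\<^sup>1\<close> (\<open>separable_selection\<close>).  By continuity \<open>\<psi> = w(t)\<close> may
be inserted at almost every \<open>t\<close>, and integration over \<open>t\<close> gives (\<open>tested_inequality\<close>)
\<open>\<integral>\<integral> u w + \<integral>\<integral> (l * \<nabla>w) \<bullet> \<nabla>w \<le> \<integral>\<integral> (u\<^sub>0 + l * f) w\<close>.

The quadratic term is bounded below pointwise in \<open>x\<close>.  If \<open>p = l * g\<close>, then
\<open>h\<^sub>n * g = n (p - h\<^sub>n * p)\<close>.  Expanding \<open>2 p \<bullet> (h\<^sub>n * g)\<close> and estimating
\<open>2 p(t) \<bullet> p(s) \<le> \<bar>p(t)\<bar>\<^sup>2 + \<bar>p(s)\<bar>\<^sup>2\<close> leaves the masses that \<open>h\<^sub>n\<close> still lacks at the times \<open>t\<close> and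
\<open>T - t\<close>, so that the integral of \<open>2 p \<bullet> (h\<^sub>n * g)\<close> is at least that of
\<open>(k\<^sub>n(t) + k\<^sub>n(T - t)) \<bar>p(t)\<bar>\<^sup>2\<close>.  Fatou's lemma gives the inequality for \<open>k\<close>, and time reversal
replaces \<open>l * g\<close> by the backward convolution (\<open>energy_inequality_dual\<close>).

Since \<open>a\<^sub>1 u\<^sup>m \<le> w \<le> a\<^sub>2 u\<^sup>m\<close>, it remains to absorb \<open>2 (a\<^sub>2 / a\<^sub>1) (\<bar>u\<^sub>0\<bar> + \<bar>l * f\<bar>) u\<^sup>m\<close> into one of the
two copies of \<open>u\<^sup>m\<^sup>+\<^sup>1\<close> by Young's inequality, and to use convexity of the power \<open>m + 1\<close> and
Young's convolution inequality.  The constants of absorption and of convexity multiply to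
\<open>C(m) (a\<^sub>2 / a\<^sub>1)\<^sup>m\<^sup>+\<^sup>1\<close> (\<open>constant_identity\<close>).

Nonnegativity of \<open>l\<close> is a maximum principle for the Volterra equation with kernel \<open>k\<close>
(\<open>resolvent_nonneg\<close>).  It also covers \<open>h\<^sub>n\<close>, because \<open>(k + n) * (h\<^sub>n / n) = 1\<close> and \<open>k + n\<close> is again
nonnegative and nonincreasing.

Functions are given up to null sets of completed Lebesgue measure.  For Fubini arguments they
are replaced by Borel functions that vanish outside \<open>(0,T) \<times> \<Omega>\<close>.  Three facts make the replacement
legitimate: time derivatives exist almost everywhere by Lebesgue's differentiation theorem, in a
form that is measurable in \<open>x\<close>; weak gradients are unique; and a convolution depends only on the
almost everywhere classes of its factors.
\<close>

section \<open>Differentiation of integrals on the real line\<close>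

lemma emeasure_lborel_Ioc_max: "emeasure lborel {a<..b::real} = ennreal (max 0 (b - a))"
  by (cases "a \<le> b") auto

text \<open>Half-open intervals generate the Borel sets and are closed under intersection. Dynkin's argument,
run inside a bounded window so that complements keep finite measure, reaches the indicators of
all Borel sets, whose linear combinations are dense in \<open>L\<^sub>1\<close>. The rule serves statements
that are explicit on intervals and stable under \<open>L\<^sub>1\<close> limits.\<close>

lemma integrable_induct_Ioc [consumes 1, case_names Ioc add lim]:
  fixes f :: "real \<Rightarrow> 'b::{banach, second_countable_topology}"
  assumes "integrable lborel f"
    and Ioc: "\<And>a b c. P (\<lambda>x. indicator {a<..b} x *\<^sub>R c)"
    and add: "\<And>f g. integrable lborel f \<Longrightarrow> P f \<Longrightarrow> integrable lborel g \<Longrightarrow> P g \<Longrightarrow> P (\<lambda>x. f x + g x)"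
    and lim: "\<And>f s. (\<And>i::nat. integrable lborel (s i)) \<Longrightarrow> (\<And>i. P (s i)) \<Longrightarrow> integrable lborel f \<Longrightarrow>
       (\<lambda>i. LINT x|lborel. norm (s i x - f x)) \<longlonglongrightarrow> 0 \<Longrightarrow> P f"
  shows "P f"
proof -
  have lim': "P f" if s: "\<And>i::nat. integrable lborel (s i)" "\<And>i. P (s i)"
    and pt: "\<And>x. (\<lambda>i. s i x) \<longlonglongrightarrow> f x" and bd: "\<And>i x. norm (s i x) \<le> w x"
    and w: "integrable lborel w" and f: "integrable lborel f" for s f and w :: "real \<Rightarrow> real"
  proof (rule lim[OF s f])
    have "(\<lambda>i. LINT x|lborel. norm (s i x - f x)) \<longlonglongrightarrow> (LINT x|(lborel::real measure). 0)"
    proof (rule integral_dominated_convergence[where w="\<lambda>x. w x + norm (f x)"])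
      show "AE x in lborel. (\<lambda>i. norm (s i x - f x)) \<longlonglongrightarrow> 0"
        using pt by (auto intro!: tendsto_norm_zero simp: LIM_zero)
      show "AE x in lborel. norm (norm (s i x - f x)) \<le> w x + norm (f x)" for i
        using bd[of i] by (intro AE_I2) (smt (verit) norm_triangle_ineq4 norm_ge_zero real_norm_def)
    qed (use s(1) w f in \<open>auto intro!: borel_measurable_integrable\<close>)
    then show "(\<lambda>i. LINT x|lborel. norm (s i x - f x)) \<longlonglongrightarrow> 0" by simp
  qed
  have window: "P (\<lambda>x. indicator (A \<inter> {-r<..r}) x *\<^sub>R c)" if "A \<in> sets borel" for A c and r :: real
  proof -
    have fin: "integrable lborel (\<lambda>x. indicator (A \<inter> {-r<..r}) x *\<^sub>R c)" if "A \<in> sets borel" for A and c :: 'b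
    proof -
      have "emeasure lborel (A \<inter> {-r<..r}) \<le> emeasure lborel {-r<..r}"
        by (rule emeasure_mono) auto
      then have "emeasure lborel (A \<inter> {-r<..r}) < \<infinity>"
        by (cases "-r \<le> r") (auto simp: less_top[symmetric] top_unique)
      then show ?thesis using that by (intro integrable_scaleR_left) (auto simp: integrable_indicator_iff)
    qed
    have "A \<in> sigma_sets UNIV (range (\<lambda>(a, b). {a<..b::real}))"
      using that by (simp add: borel_sigma_sets_Ioc)
    then have "\<forall>c. P (\<lambda>x. indicator (A \<inter> {-r<..r}) x *\<^sub>R c)"
    proof (induction rule: sigma_sets_induct_disjoint[rotated 2, consumes 1,
        case_names basic empty compl union Int_stable closed])
      case (basic A)
      then obtain a b where "A = {a<..b}" by auto
      then have "A \<inter> {-r<..r} = {max a (-r)<..min b r}" by auto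
      then show ?case using Ioc by auto
    next
      case empty
      show ?case using Ioc[of 0 0] by simp
    next
      case (compl A)
      then have A: "A \<in> sets borel" by (simp add: borel_sigma_sets_Ioc)
      show ?case
      proof
        fix c
        have "P (\<lambda>x. indicator (UNIV \<inter> {-r<..r}) x *\<^sub>R c + indicator (A \<inter> {-r<..r}) x *\<^sub>R (- c))"
        proof (intro add fin)
            show "P (\<lambda>x. indicator (UNIV \<inter> {-r<..r}) x *\<^sub>R c)" using Ioc by simp
            show "P (\<lambda>x. indicator (A \<inter> {-r<..r}) x *\<^sub>R (- c))" using compl.IH by blast
          qed (use A in auto)
        also have "(\<lambda>x. indicator (UNIV \<inter> {-r<..r}) x *\<^sub>R c + indicator (A \<inter> {-r<..r}) x *\<^sub>R (- c))
            = (\<lambda>x. indicator ((UNIV - A) \<inter> {-r<..r}) x *\<^sub>R c)"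
          by (auto simp: indicator_def)
        finally show "P (\<lambda>x. indicator ((UNIV - A) \<inter> {-r<..r}) x *\<^sub>R c)" .
      qed
    next
      case (union A)
      then have A: "A i \<in> sets borel" for i by (auto simp: borel_sigma_sets_Ioc)
      show ?case
      proof
        fix c
        have dis: "disjoint_family A" using union by simp
        have fs: "P (\<lambda>x. indicator ((\<Union>i<n. A i) \<inter> {-r<..r}) x *\<^sub>R c)" for n
        proof (induction n)
          case 0 then show ?case using Ioc[of 0 0] by simp
        next
          case (Suc n)
          have "P (\<lambda>x. indicator ((\<Union>i<n. A i) \<inter> {-r<..r}) x *\<^sub>R c + indicator (A n \<inter> {-r<..r}) x *\<^sub>R c)"
            by (intro add fin Suc) (use A union.IH in auto)
          also have "(\<lambda>x. indicator ((\<Union>i<n. A i) \<inter> {-r<..r}) x *\<^sub>R c + indicator (A n \<inter> {-r<..r}) x *\<^sub>R c)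
            = (\<lambda>x. indicator ((\<Union>i<Suc n. A i) \<inter> {-r<..r}) x *\<^sub>R c)"
          proof -
            have "A i \<inter> A n = {}" if "i < n" for i
              using dis that by (auto simp: disjoint_family_on_def)
            then have d: "(\<Union>i<n. A i) \<inter> A n = {}" by blast
            have u: "(\<Union>i<Suc n. A i) = (\<Union>i<n. A i) \<union> A n" by (auto simp: lessThan_Suc)
            have *: "(\<lambda>x. indicator (B \<inter> R) x *\<^sub>R c + indicator (C \<inter> R) x *\<^sub>R c) = (\<lambda>x. indicator ((B \<union> C) \<inter> R) x *\<^sub>R c)"
              if "B \<inter> C = {}" for B C R :: "real set"
              using that by (auto simp: fun_eq_iff split: split_indicator)
            show ?thesis unfolding u by (rule *[OF d])
          qed
          finally show ?case .
        qed
        show "P (\<lambda>x. indicator ((\<Union>i. A i) \<inter> {-r<..r}) x *\<^sub>R c)"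
        proof (rule lim')
          show "integrable lborel (\<lambda>x. indicator ((\<Union>i<n. A i) \<inter> {-r<..r}) x *\<^sub>R c)" for n
            by (intro fin) (use A in auto)
          show "P (\<lambda>x. indicator ((\<Union>i<n. A i) \<inter> {-r<..r}) x *\<^sub>R c)" for n by (rule fs)
          show "(\<lambda>n. indicator ((\<Union>i<n. A i) \<inter> {-r<..r}) x *\<^sub>R c) \<longlonglongrightarrow> indicator ((\<Union>i. A i) \<inter> {-r<..r}) x *\<^sub>R c" for x
            by (cases "x \<in> {-r<..r}")
              (auto simp: indicator_inter_arith intro!: tendsto_scaleR LIMSEQ_indicator_UN)
          show "norm (indicator ((\<Union>i<n. A i) \<inter> {-r<..r}) x *\<^sub>R c) \<le> norm (indicator (UNIV \<inter> {-r<..r}) x *\<^sub>R norm c)" for n x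
            by (auto simp: indicator_def)
          show "integrable lborel (\<lambda>x. norm (indicator (UNIV \<inter> {-r<..r}) x *\<^sub>R norm c))"
            by (intro integrable_norm) (auto intro!: integrable_mult_left simp: integrable_indicator_iff emeasure_lborel_Ioc_max)
          show "integrable lborel (\<lambda>x. indicator ((\<Union>i. A i) \<inter> {-r<..r}) x *\<^sub>R c)"
            by (intro fin) (use A in auto)
        qed
      qed
    qed (fastforce simp: Int_stable_def Int_greaterThanAtMost)+
    then show ?thesis by simp
  qed
  from assms(1) show ?thesis
  proof (induction rule: integrable_induct)
    case (base A c)
    have fin: "integrable lborel (\<lambda>x. indicator A x *\<^sub>R c)" using base by (auto simp: integrable_indicator_iff)
    have fin': "integrable lborel (\<lambda>x. indicator (A \<inter> {-real n<..real n}) x *\<^sub>R c)" for n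
    proof (rule Bochner_Integration.integrable_bound[OF fin])
      show "(\<lambda>x. indicator (A \<inter> {-real n<..real n}) x *\<^sub>R c) \<in> borel_measurable lborel"
        using base by (intro borel_measurable_scaleR borel_measurable_indicator) auto
    qed (auto simp: indicator_def)
    show ?case
    proof (rule lim'[OF fin' _ _ _ _ fin])
      show "P (\<lambda>x. indicator (A \<inter> {-real n<..real n}) x *\<^sub>R c)" for n using base by (intro window) auto
      show "(\<lambda>n. indicator (A \<inter> {-real n<..real n}) x *\<^sub>R c) \<longlonglongrightarrow> indicator A x *\<^sub>R c" for x
      proof (rule tendsto_eventually)
        obtain N :: nat where N: "\<bar>x\<bar> < real N" using reals_Archimedean2 by blast
        show "\<forall>\<^sub>F n in sequentially. indicator (A \<inter> {-real n<..real n}) x *\<^sub>R c = indicator A x *\<^sub>R c"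
          using eventually_ge_at_top[of N] N
          by (elim eventually_mono) (auto simp: indicator_def)
      qed
      show "norm (indicator (A \<inter> {-real n<..real n}) x *\<^sub>R c) \<le> norm (indicator A x *\<^sub>R c)" for n x
        by (auto simp: indicator_def)
      show "integrable lborel (\<lambda>x. norm (indicator A x *\<^sub>R c))" by (rule integrable_norm[OF fin])
    qed
  next
    case (add f g) then show ?case using assms(3) by blast
  next
    case (lim f s)
    show ?case
      by (rule lim'[where s=s and w="\<lambda>x. 2 * norm (f x)"]) (use lim in auto)
  qed
qed

text \<open>The weak type bound for the centred Hardy-Littlewood maximal function. Each point of the set is
the centre of a ball on which the mean of \<open>\<bar>g\<bar>\<close> is large; Vitali's covering lemma selects
disjoint balls among them whose fivefold enlargements still cover. The constant 10 compares the
length of an enlarged ball with the radius of the original one.\<close>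

lemma maximal_inequality:
  fixes g :: "real \<Rightarrow> real"
  assumes g[measurable]: "integrable lborel g" and r: "r > 0"
  obtains U where "U \<in> sets lborel"
    "{t. \<exists>d>0. ennreal (r * d) < (\<integral>\<^sup>+x. ennreal \<bar>g x\<bar> * indicator (cball t d) x \<partial>lborel)} \<subseteq> U"
    "emeasure lborel U \<le> ennreal (10 / r * (LINT x|lborel. \<bar>g x\<bar>))"
proof -
  define I where "I t d = (\<integral>\<^sup>+x. ennreal \<bar>g x\<bar> * indicator (cball t d) x \<partial>lborel)" for t d
  define M where "M = {t. \<exists>d>0. ennreal (r * d) < I t d}"
  define N where "N = (LINT x|lborel. \<bar>g x\<bar>)"
  have gm[measurable]: "g \<in> borel_measurable borel" using g by auto
  have N: "(\<integral>\<^sup>+x. ennreal \<bar>g x\<bar> \<partial>lborel) = ennreal N"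
    unfolding N_def using g by (intro nn_integral_eq_integral) auto
  have N0: "N \<ge> 0" unfolding N_def by simp
  have "\<forall>t\<in>M. \<exists>d>0. ennreal (r * d) < I t d" unfolding M_def by blast
  then obtain \<rho> where \<rho>: "\<And>t. t \<in> M \<Longrightarrow> \<rho> t > 0" "\<And>t. t \<in> M \<Longrightarrow> ennreal (r * \<rho> t) < I t (\<rho> t)"
    by metis
  have \<rho>B: "\<rho> t \<le> N / r" if "t \<in> M" for t
  proof -
    have "I t (\<rho> t) \<le> ennreal N" unfolding I_def N[symmetric]
      by (rule nn_integral_mono) (auto simp: indicator_def)
    with \<rho>(2)[OF that] have "ennreal (r * \<rho> t) < ennreal N" by (rule less_le_trans)
    then have "r * \<rho> t < N" by (simp add: N0 ennreal_less_iff \<rho>(1)[OF that] r less_imp_le)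
    then show ?thesis using r by (simp add: field_simps)
  qed
  have cov: "M \<subseteq> (\<Union>i\<in>M. cball i (\<rho> i))" using \<rho>(1) by force
  obtain C where C: "countable C" "C \<subseteq> M"
    "pairwise (\<lambda>i j. disjnt (cball i (\<rho> i)) (cball j (\<rho> j))) C"
    "M \<subseteq> (\<Union>i\<in>C. cball i (5 * \<rho> i))"
    by (rule Vitali_covering_lemma_cballs[OF cov, of "N / r"]) (use \<rho>(1) \<rho>B in auto)
  define S where "S = to_nat_on C ` C"
  define c where "c = from_nat_into C"
  have cC: "c n \<in> C" "to_nat_on C (c n) = n" if "n \<in> S" for n
    using that C(1) by (auto simp: S_def c_def)
  define V where "V n = (if n \<in> S then cball (c n) (5 * \<rho> (c n)) else {})" for n
  define D where "D n = (if n \<in> S then cball (c n) (\<rho> (c n)) else {})" for n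
  have [measurable]: "V n \<in> sets borel" "D n \<in> sets borel" for n by (auto simp: V_def D_def)
  define \<nu> where "\<nu> = density lborel (\<lambda>x. ennreal \<bar>g x\<bar>)"
  have disj: "disjoint_family D"
    unfolding disjoint_family_on_def
  proof (intro ballI impI)
    fix m n :: nat assume mn: "m \<noteq> n"
    show "D m \<inter> D n = {}"
    proof (cases "m \<in> S \<and> n \<in> S")
      case True
      then have "c m \<noteq> c n" using mn cC by metis
      then have "disjnt (cball (c m) (\<rho> (c m))) (cball (c n) (\<rho> (c n)))"
        using C(3) cC True unfolding pairwise_def by blast
      then show ?thesis using True by (simp add: D_def disjnt_def)
    qed (auto simp: D_def)
  qed
  have VD: "emeasure lborel (V n) \<le> ennreal (10 / r) * emeasure \<nu> (D n)" for n
  proof (cases "n \<in> S")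
    case True
    let ?t = "c n"
    have t: "?t \<in> M" using cC[OF True] C by auto
    have "cball ?t (5 * \<rho> ?t) = {?t - 5 * \<rho> ?t .. ?t + 5 * \<rho> ?t}" by (auto simp: dist_real_def)
    then have "emeasure lborel (V n) = ennreal (10 * \<rho> ?t)"
      using True \<rho>(1)[OF t] by (simp add: V_def)
    also have "\<dots> = ennreal (10 / r) * ennreal (r * \<rho> ?t)"
      using r \<rho>(1)[OF t] by (simp add: ennreal_mult[symmetric])
    also have "\<dots> \<le> ennreal (10 / r) * I ?t (\<rho> ?t)"
      using \<rho>(2)[OF t] by (intro mult_left_mono) auto
    also have "I ?t (\<rho> ?t) = emeasure \<nu> (D n)"
      using True by (simp add: D_def \<nu>_def emeasure_density I_def)
    finally show ?thesis .
  qed (auto simp: V_def)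
  show thesis
  proof
    show "(\<Union>n. V n) \<in> sets lborel" by simp
    have "(\<Union>i\<in>C. cball i (5 * \<rho> i)) \<subseteq> (\<Union>n. V n)"
    proof
      fix x assume "x \<in> (\<Union>i\<in>C. cball i (5 * \<rho> i))"
      then obtain i where i: "i \<in> C" "x \<in> cball i (5 * \<rho> i)" by auto
      then have "x \<in> V (to_nat_on C i)" using C(1) by (simp add: V_def S_def c_def)
      then show "x \<in> (\<Union>n. V n)" by auto
    qed
    then show "{t. \<exists>d>0. ennreal (r * d) < (\<integral>\<^sup>+x. ennreal \<bar>g x\<bar> * indicator (cball t d) x \<partial>lborel)} \<subseteq> (\<Union>n. V n)"
      using C(4) unfolding M_def I_def by simp
    have "emeasure lborel (\<Union>n. V n) \<le> (\<Sum>n. emeasure lborel (V n))"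
      by (rule emeasure_subadditive_countably) auto
    also have "\<dots> \<le> (\<Sum>n. ennreal (10 / r) * emeasure \<nu> (D n))"
      by (intro suminf_le VD) auto
    also have "\<dots> = ennreal (10 / r) * emeasure \<nu> (\<Union>n. D n)"
      by (subst ennreal_suminf_cmult, subst suminf_emeasure) (use disj in \<open>auto simp: \<nu>_def\<close>)
    also have "emeasure \<nu> (\<Union>n. D n) \<le> emeasure \<nu> UNIV"
      by (rule emeasure_mono) (auto simp: \<nu>_def)
    also have "emeasure \<nu> UNIV = ennreal N"
      by (simp add: \<nu>_def emeasure_density N)
    finally show "emeasure lborel (\<Union>n. V n) \<le> ennreal (10 / r * (LINT x|lborel. \<bar>g x\<bar>))"
      using r N0 by (simp add: ennreal_mult[symmetric] N_def mult_left_mono)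
  qed
qed

text \<open>For an interval the error of the linear approximation vanishes near every point but the
endpoints. The statement survives \<open>L\<^sub>1\<close> limits because the error for \<open>f - s i\<close> is controlled by
its maximal function and its value at \<open>t\<close>, both of which are small outside a set of small
measure.\<close>

theorem lebesgue_differentiation:
  fixes g :: "real \<Rightarrow> real"
  assumes "integrable lborel g"
  shows "AE t in lborel. ((\<lambda>t. LINT x|lborel. indicator {..t} x * g x) has_real_derivative g t) (at t)"
proof -
  define D :: "real \<Rightarrow> real \<Rightarrow> real \<Rightarrow> real" where "D t s x = indicator {..t+s} x - indicator {..t} x" for t s x
  \<comment> \<open>\<open>J g t s\<close> is the error of the linear approximation of the primitive of \<open>g\<close> at \<open>t\<close>.\<close>
  define J where "J g t s = (LINT x|lborel. D t s x * g x) - s * g t" for g t s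
  define P where "P g t \<longleftrightarrow> (\<forall>e>0. \<exists>d>0. \<forall>s. \<bar>s\<bar> < d \<longrightarrow> \<bar>J g t s\<bar> \<le> e * \<bar>s\<bar>)" for g t
  have Dm[measurable]: "D t s \<in> borel_measurable borel" for t s unfolding D_def by measurable
  have D1: "\<bar>D t s x\<bar> \<le> indicator (cball t \<bar>s\<bar>) x" for t s x
    by (auto simp: D_def indicator_def dist_real_def)
  have Dint: "integrable lborel (\<lambda>x. D t s x * g x)" if "integrable lborel g" for t s and g :: "real \<Rightarrow> real"
    by (rule Bochner_Integration.integrable_bound[OF that])
      (use that D1[of t s] in \<open>auto simp: abs_mult indicator_def D_def\<close>)
  have Ds: "(LINT x|lborel. D t s x) = s" "integrable lborel (D t s)" for t s
  proof -
    have *: "D t s = (\<lambda>x. indicator {t<..t+s} x - indicator {t+s<..t} x)"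
      by (auto simp: D_def indicator_def fun_eq_iff)
    have i: "integrable lborel (indicator {t<..t+s} :: real \<Rightarrow> real)" "integrable lborel (indicator {t+s<..t} :: real \<Rightarrow> real)"
      by (auto simp: integrable_indicator_iff emeasure_lborel_Ioc_max)
    then show "integrable lborel (D t s)" unfolding * by auto
    show "(LINT x|lborel. D t s x) = s" unfolding * using i
      by (subst Bochner_Integration.integral_diff) (auto simp: measure_def emeasure_lborel_Ioc_max)
  qed
  have "AE t in lborel. P g t" using assms
  proof (induction rule: integrable_induct_Ioc)
    case (Ioc a b c)
    have "AE t in lborel. t \<noteq> a \<and> t \<noteq> b" by (intro AE_conjI AE_lborel_singleton)
    then show ?case
    proof eventually_elim
      case (elim t)
      define g where "g = (\<lambda>x. indicator {a<..b} x *\<^sub>R c)"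
      define d where "d = min \<bar>t - a\<bar> \<bar>t - b\<bar>"
      have d: "d > 0" using elim by (auto simp: d_def)
      have "J g t s = 0" if "\<bar>s\<bar> < d" for s
      proof -
        have "(\<lambda>x. D t s x * g x) = (\<lambda>x. D t s x * g t)"
          using that by (fastforce simp: fun_eq_iff D_def g_def d_def indicator_def)
        then show ?thesis using Ds by (simp add: J_def)
      qed
      then have "P g t" using d unfolding P_def by (metis abs_ge_zero abs_zero less_imp_le mult_nonneg_nonneg)
      then show ?case by (simp add: g_def)
    qed
  next
    case (add f g)
    have J: "J (\<lambda>x. f x + g x) t s = J f t s + J g t s" for t s
      using Dint[OF add.hyps(1), of t s] Dint[OF add.hyps(2), of t s]
      by (simp add: J_def algebra_simps)
    show ?case using add.IH
    proof eventually_elim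
      case (elim t)
      show ?case unfolding P_def
      proof (intro allI impI)
        fix e :: real assume "e > 0"
        then have e: "e/2 > 0" by simp
        from elim e obtain d1 where d1: "d1 > 0" "\<And>s. \<bar>s\<bar> < d1 \<Longrightarrow> \<bar>J f t s\<bar> \<le> e/2 * \<bar>s\<bar>" unfolding P_def by meson
        from elim e obtain d2 where d2: "d2 > 0" "\<And>s. \<bar>s\<bar> < d2 \<Longrightarrow> \<bar>J g t s\<bar> \<le> e/2 * \<bar>s\<bar>" unfolding P_def by meson
        show "\<exists>d>0. \<forall>s. \<bar>s\<bar> < d \<longrightarrow> \<bar>J (\<lambda>x. f x + g x) t s\<bar> \<le> e * \<bar>s\<bar>"
        proof (intro exI[of _ "min d1 d2"] conjI allI impI)
          fix s assume "\<bar>s\<bar> < min d1 d2"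
          then show "\<bar>J (\<lambda>x. f x + g x) t s\<bar> \<le> e * \<bar>s\<bar>"
            unfolding J using d1(2)[of s] d2(2)[of s] by (smt (verit) field_sum_of_halves distrib_right min_less_iff_conj)
        qed (use d1 d2 in auto)
      qed
    qed
  next
    case (lim f s)
    have sm[measurable]: "s i \<in> borel_measurable borel" "f \<in> borel_measurable borel" for i
      using lim.hyps(1)[of i] lim.hyps(2) by auto
    define N where "N i = (LINT x|lborel. \<bar>s i x - f x\<bar>)" for i
    have Ni: "integrable lborel (\<lambda>x. s i x - f x)" for i using lim.hyps(1,2) by auto
    have N: "N \<longlonglongrightarrow> 0" using lim.hyps(3) by (simp add: N_def[abs_def])
    have "AE t in lborel. \<exists>d>0. \<forall>\<sigma>. \<bar>\<sigma>\<bar> < d \<longrightarrow> \<bar>J f t \<sigma>\<bar> \<le> e * \<bar>\<sigma>\<bar>" if e: "e > 0" for e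
    proof -
      have e3: "e/3 > 0" using e by simp
      have "\<exists>U. U \<in> sets lborel \<and> {t. \<exists>d>0. ennreal (e/3 * d) < (\<integral>\<^sup>+x. ennreal \<bar>s i x - f x\<bar> * indicator (cball t d) x \<partial>lborel)} \<subseteq> U
         \<and> emeasure lborel U \<le> ennreal (10 / (e/3) * N i)" for i
        by (rule maximal_inequality[OF Ni[of i] e3]) (auto simp: N_def)
      then have "\<forall>i. \<exists>U. U \<in> sets lborel \<and> {t. \<exists>d>0. ennreal (e/3 * d) < (\<integral>\<^sup>+x. ennreal \<bar>s i x - f x\<bar> * indicator (cball t d) x \<partial>lborel)} \<subseteq> U
         \<and> emeasure lborel U \<le> ennreal (10 / (e/3) * N i)" ..
      from choice[OF this] obtain U where U[measurable]: "\<And>i. U i \<in> sets lborel"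
        and Uc: "\<And>i. {t. \<exists>d>0. ennreal (e/3 * d) < (\<integral>\<^sup>+x. ennreal \<bar>s i x - f x\<bar> * indicator (cball t d) x \<partial>lborel)} \<subseteq> U i"
        and Ue: "\<And>i. emeasure lborel (U i) \<le> ennreal (10 / (e/3) * N i)" by blast
      have [measurable]: "U i \<in> sets borel" for i using U[of i] by simp
      define E where "E i = {t. e/3 \<le> \<bar>s i t - f t\<bar>}" for i
      have [measurable]: "E i \<in> sets borel" for i unfolding E_def by measurable
      have Ee: "emeasure lborel (E i) \<le> ennreal (1 / (e/3) * N i)" for i
      proof -
        have "emeasure lborel (E i) \<le> ennreal (1 / (e/3)) * (\<integral>\<^sup>+x. ennreal \<bar>s i x - f x\<bar> * indicator UNIV x \<partial>lborel)"
        proof -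
          have "E i = {x\<in>UNIV. 1 \<le> ennreal (1 / (e/3)) * ennreal \<bar>s i x - f x\<bar>}"
          proof -
            have "1 \<le> ennreal (1 / (e/3)) * ennreal \<bar>s i x - f x\<bar> \<longleftrightarrow> e/3 \<le> \<bar>s i x - f x\<bar>" for x
            proof -
              have "ennreal (1 / (e/3)) * ennreal \<bar>s i x - f x\<bar> = ennreal (1 / (e/3) * \<bar>s i x - f x\<bar>)"
                using e by (subst ennreal_mult) auto
              moreover have "1 \<le> ennreal (1 / (e/3) * \<bar>s i x - f x\<bar>) \<longleftrightarrow> 1 \<le> 1 / (e/3) * \<bar>s i x - f x\<bar>"
                using ennreal_le_iff2[of 1 "1 / (e/3) * \<bar>s i x - f x\<bar>"] by simp
              ultimately show ?thesis using e by (simp add: field_simps)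
            qed
            then show ?thesis by (simp add: E_def)
          qed
          then show ?thesis using nn_integral_Markov_inequality[of "\<lambda>x. ennreal \<bar>s i x - f x\<bar>" UNIV lborel "ennreal (1 / (e/3))"]
            by simp
        qed
        also have "(\<integral>\<^sup>+x. ennreal \<bar>s i x - f x\<bar> * indicator UNIV x \<partial>lborel) = ennreal (N i)"
          using Ni[of i] by (simp add: N_def nn_integral_eq_integral)
        finally show ?thesis using e by (simp add: ennreal_mult[symmetric] N_def)
      qed
      \<comment> \<open>Outside \<open>W\<close> some \<open>s i\<close> is good enough at \<open>t\<close>, and \<open>W\<close> is null since \<open>N i\<close> tends to 0.\<close>
      define W where "W = (\<Inter>i. U i \<union> E i)"
      have [measurable]: "W \<in> sets borel" unfolding W_def by measurable
      have "emeasure lborel W \<le> ennreal (33 / e * N i)" for i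
      proof -
        have "emeasure lborel W \<le> emeasure lborel (U i \<union> E i)" by (rule emeasure_mono) (auto simp: W_def)
        also have "\<dots> \<le> emeasure lborel (U i) + emeasure lborel (E i)" by (rule emeasure_subadditive) auto
        also have "\<dots> \<le> ennreal (10 / (e/3) * N i) + ennreal (1 / (e/3) * N i)" by (intro add_mono Ue Ee)
        also have "\<dots> = ennreal (33 / e * N i)" using e by (subst ennreal_plus[symmetric]) (auto simp: N_def field_simps)
        finally show ?thesis .
      qed
      moreover have "(\<lambda>i. ennreal (33 / e * N i)) \<longlonglongrightarrow> ennreal (33 / e * 0)"
        by (intro tendsto_ennrealI tendsto_mult tendsto_const N)
      ultimately have "emeasure lborel W \<le> ennreal (33 / e * 0)"
        by (intro LIMSEQ_le_const) auto
      moreover have "W \<in> sets lborel" by simp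
      ultimately have "W \<in> null_sets lborel" by (simp add: null_sets_def)
      then have W: "AE t in lborel. t \<notin> W" by (rule AE_not_in)
      have "AE t in lborel. \<forall>i. P (s i) t" using lim.IH by (simp add: AE_all_countable)
      with W show ?thesis
      proof eventually_elim
        case (elim t)
        then obtain i where i: "t \<notin> U i" "t \<notin> E i" unfolding W_def by blast
        from elim e3 obtain d where d: "d > 0" "\<And>\<sigma>. \<bar>\<sigma>\<bar> < d \<Longrightarrow> \<bar>J (s i) t \<sigma>\<bar> \<le> e/3 * \<bar>\<sigma>\<bar>" unfolding P_def by meson
        show ?case
        proof (intro exI[of _ d] conjI allI impI d(1))
          fix \<sigma> assume \<sigma>: "\<bar>\<sigma>\<bar> < d"
          show "\<bar>J f t \<sigma>\<bar> \<le> e * \<bar>\<sigma>\<bar>"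
          proof (cases "\<sigma> = 0")
            case True then show ?thesis by (simp add: J_def D_def)
          next
            case False
            let ?g = "\<lambda>x. s i x - f x"
            have "(\<integral>\<^sup>+x. ennreal \<bar>?g x\<bar> * indicator (cball t \<bar>\<sigma>\<bar>) x \<partial>lborel) \<le> ennreal (e/3 * \<bar>\<sigma>\<bar>)"
            proof (rule ccontr)
              assume "\<not> ?thesis"
              then have "\<exists>d>0. ennreal (e/3 * d) < (\<integral>\<^sup>+x. ennreal \<bar>?g x\<bar> * indicator (cball t d) x \<partial>lborel)"
                using False by (intro exI[of _ "\<bar>\<sigma>\<bar>"]) (simp add: not_le)
              then have "t \<in> U i" by (intro subsetD[OF Uc] CollectI)
              then show False using i by simp
            qed
            moreover have "ennreal \<bar>LINT x|lborel. D t \<sigma> x * ?g x\<bar> \<le> (\<integral>\<^sup>+x. ennreal \<bar>?g x\<bar> * indicator (cball t \<bar>\<sigma>\<bar>) x \<partial>lborel)"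
            proof -
              have "ennreal (norm (LINT x|lborel. D t \<sigma> x * ?g x)) \<le> (\<integral>\<^sup>+x. ennreal (norm (D t \<sigma> x * ?g x)) \<partial>lborel)"
                by (rule integral_norm_bound_ennreal[OF Dint[OF Ni]])
              also have "\<dots> \<le> (\<integral>\<^sup>+x. ennreal \<bar>?g x\<bar> * indicator (cball t \<bar>\<sigma>\<bar>) x \<partial>lborel)"
                by (rule nn_integral_mono) (auto simp: D_def indicator_def dist_real_def)
              finally show ?thesis by simp
            qed
            ultimately have "ennreal \<bar>LINT x|lborel. D t \<sigma> x * ?g x\<bar> \<le> ennreal (e/3 * \<bar>\<sigma>\<bar>)" by (rule order_trans[rotated])
            then have 1: "\<bar>LINT x|lborel. D t \<sigma> x * ?g x\<bar> \<le> e/3 * \<bar>\<sigma>\<bar>"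
              by (rule iffD1[OF ennreal_le_iff, rotated]) (use e in simp)
            have "\<bar>\<sigma> * ?g t\<bar> \<le> \<bar>\<sigma>\<bar> * (e/3)"
              unfolding abs_mult using i(2) by (intro mult_left_mono) (auto simp: E_def)
            then have 2: "\<bar>\<sigma> * ?g t\<bar> \<le> e/3 * \<bar>\<sigma>\<bar>" by (simp add: mult.commute)
            have "J f t \<sigma> = J (s i) t \<sigma> - ((LINT x|lborel. D t \<sigma> x * ?g x) - \<sigma> * ?g t)"
              using Dint[OF lim.hyps(1), of t \<sigma> i] Dint[OF lim.hyps(2), of t \<sigma>] by (simp add: J_def algebra_simps)
            with 1 2 d(2)[OF \<sigma>] show ?thesis by linarith
          qed
        qed
      qed
    qed
    then have "AE t in lborel. \<forall>n. \<exists>d>0. \<forall>\<sigma>. \<bar>\<sigma>\<bar> < d \<longrightarrow> \<bar>J f t \<sigma>\<bar> \<le> inverse (real (Suc n)) * \<bar>\<sigma>\<bar>"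
      by (simp add: AE_all_countable)
    then show ?case
    proof eventually_elim
      case (elim t)
      show ?case unfolding P_def
      proof (intro allI impI)
        fix e :: real assume "e > 0"
        then obtain n where n: "inverse (real (Suc n)) < e" using reals_Archimedean by blast
        from elim obtain d where "d > 0" and d: "\<And>\<sigma>. \<bar>\<sigma>\<bar> < d \<Longrightarrow> \<bar>J f t \<sigma>\<bar> \<le> inverse (real (Suc n)) * \<bar>\<sigma>\<bar>" by meson
        then show "\<exists>d>0. \<forall>s. \<bar>s\<bar> < d \<longrightarrow> \<bar>J f t s\<bar> \<le> e * \<bar>s\<bar>"
          using n by (intro exI[of _ d]) (smt (verit) mult_right_mono abs_ge_zero)
      qed
    qed
  qed
  then show ?thesis
  proof eventually_elim
    case (elim t)
    have I: "integrable lborel (\<lambda>x. indicator {..t} x * g x)" for t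
      using integrable_mult_indicator[OF _ assms, of "{..t}"] by simp
    have Jeq: "J g t s = (LINT x|lborel. indicator {..t + s} x * g x) - (LINT x|lborel. indicator {..t} x * g x) - s * g t" for s
      using I[of t] I[of "t+s"] by (simp add: J_def D_def left_diff_distrib)
    show ?case unfolding DERIV_def
    proof (rule LIM_I)
      fix e :: real assume e: "e > 0"
      from elim e obtain d where d: "d > 0" "\<And>s. \<bar>s\<bar> < d \<Longrightarrow> \<bar>J g t s\<bar> \<le> e/2 * \<bar>s\<bar>" unfolding P_def by (meson half_gt_zero)
      show "\<exists>d>0. \<forall>s. s \<noteq> 0 \<and> norm (s - 0) < d \<longrightarrow> norm (((LINT x|lborel. indicator {..t + s} x * g x) - (LINT x|lborel. indicator {..t} x * g x)) / s - g t) < e"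
      proof (intro exI[of _ d] conjI d(1) allI impI)
        fix s :: real assume s: "s \<noteq> 0 \<and> norm (s - 0) < d"
        have "((LINT x|lborel. indicator {..t + s} x * g x) - (LINT x|lborel. indicator {..t} x * g x)) / s - g t = J g t s / s"
          using s unfolding Jeq by (simp add: field_simps)
        moreover have "\<bar>J g t s / s\<bar> \<le> e/2" using d(2)[of s] s by (simp add: abs_divide divide_le_eq)
        ultimately show "norm (((LINT x|lborel. indicator {..t + s} x * g x) - (LINT x|lborel. indicator {..t} x * g x)) / s - g t) < e"
          using e unfolding real_norm_def by linarith
      qed
    qed
  qed
qed

section \<open>Convolution on the real line\<close>

text \<open>Kernels and functions live on the whole line and are extended by zero, which keeps endpoints out
of Fubini arguments. For functions supported in the positive half-line this is the convolution
over \<open>(0,t)\<close>.\<close>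

definition conv :: "(real \<Rightarrow> real) \<Rightarrow> (real \<Rightarrow> 'b::euclidean_space) \<Rightarrow> real \<Rightarrow> 'b" where
  "conv a b t = (LINT s|lborel. a (t - s) *\<^sub>R b s)"

text \<open>The convolution algebra of Volterra calculus: products at time \<open>t\<close> only see the factors before
\<open>t\<close>.\<close>

definition causal :: "(real \<Rightarrow> 'b::euclidean_space) \<Rightarrow> bool" where
  "causal f \<longleftrightarrow> integrable lborel f \<and> (\<forall>t\<le>0. f t = 0)"

lemma causalD: "causal f \<Longrightarrow> integrable lborel f" "causal f \<Longrightarrow> t \<le> 0 \<Longrightarrow> f t = 0"
  by (auto simp: causal_def)

lemma integrable_reflect_shift:
  fixes a :: "real \<Rightarrow> 'b::euclidean_space"
  assumes "integrable lborel a"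
  shows "integrable lborel (\<lambda>s. a (t - s))" "integrable lborel (\<lambda>s. a (s - t))"
  using lborel_integrable_real_affine[OF assms, of "-1" t] lborel_integrable_real_affine[OF assms, of 1 "-t"]
  by (simp_all add: algebra_simps)

lemma integral_reflect_shift:
  fixes a :: "real \<Rightarrow> 'b::euclidean_space"
  shows "(LINT s|lborel. a (t - s)) = (LINT s|lborel. a s)" "(LINT s|lborel. a (s - t)) = (LINT s|lborel. a s)"
  using lborel_integral_real_affine[of "-1" a t] lborel_integral_real_affine[of 1 a "-t"]
  by (simp_all add: algebra_simps)

lemma AE_reflect_shift:
  assumes "AE s in lborel. P s"
  shows "AE s in lborel. P (t - s :: real)" "AE s in lborel. P (s - t)"
proof -
  obtain N where N: "{s. \<not> P s} \<subseteq> N" "N \<in> null_sets lborel"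
    using assms by (auto elim!: AE_E simp: null_sets_def)
  have N': "AE s in lborel. s \<notin> N" "{s. s \<in> N} \<in> sets borel" using N(2) by (auto intro: AE_not_in)
  have "AE s in lborel. t + (-1) * s \<notin> N" "AE s in lborel. -t + 1 * s \<notin> N"
    using N'(2) by (intro AE_borel_affine N'(1); simp)+
  then have "AE s in lborel. t - s \<notin> N" "AE s in lborel. s - t \<notin> N" by simp_all
  note N'' = this
  show "AE s in lborel. P (t - s)" using N''(1) by eventually_elim (use N(1) in blast)
  show "AE s in lborel. P (s - t)" using N''(2) by eventually_elim (use N(1) in blast)
qed

lemma conv_commute: fixes b :: "real \<Rightarrow> real" shows "conv a b t = conv b a t"
  unfolding conv_def using integral_reflect_shift(1)[of "\<lambda>s. a (t - s) *\<^sub>R b s" t]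
  by (simp add: mult.commute)

lemma conv_scaleR_left: "conv (\<lambda>s. c * a s) b t = c *\<^sub>R conv a b t"
proof -
  have "(\<lambda>s. (c * a (t - s)) *\<^sub>R b s) = (\<lambda>s. c *\<^sub>R (a (t - s) *\<^sub>R b s))" by simp
  then show ?thesis unfolding conv_def using integral_scaleR_right[of lborel c "\<lambda>s. a (t - s) *\<^sub>R b s"] by metis
qed

lemma conv_scaleR_right: "conv a (\<lambda>s. c *\<^sub>R b s) t = c *\<^sub>R conv a b t"
proof -
  have "(\<lambda>s. a (t - s) *\<^sub>R c *\<^sub>R b s) = (\<lambda>s. c *\<^sub>R (a (t - s) *\<^sub>R b s))" by (simp add: mult.commute)
  then show ?thesis unfolding conv_def using integral_scaleR_right[of lborel c "\<lambda>s. a (t - s) *\<^sub>R b s"] by metis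
qed

lemma integrable_conv_kernel:
  fixes b :: "real \<Rightarrow> 'b::euclidean_space"
  assumes a: "integrable lborel a" and b: "integrable lborel b"
  shows "integrable (lborel \<Otimes>\<^sub>M lborel) (\<lambda>(t, s). a (t - s) *\<^sub>R b s)"
proof -
  have [measurable]: "a \<in> borel_measurable borel" "b \<in> borel_measurable borel" using a b by auto
  have "integrable (lborel \<Otimes>\<^sub>M lborel) (\<lambda>(s, t). a (t - s) *\<^sub>R b s)"
  proof (rule lborel_pair.Fubini_integrable)
    show "AE s in lborel. integrable lborel (\<lambda>t. case (s, t) of (s, t) \<Rightarrow> a (t - s) *\<^sub>R b s)"
      using integrable_reflect_shift(2)[OF a] by (auto intro!: integrable_scaleR_left)
    have "(\<lambda>s. LINT t|lborel. norm (case (s, t) of (s, t) \<Rightarrow> a (t - s) *\<^sub>R b s)) = (\<lambda>s. (LINT t|lborel. \<bar>a t\<bar>) * norm (b s))"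
      using integral_reflect_shift(2)[of "\<lambda>t. \<bar>a t\<bar>"] by (simp add: fun_eq_iff)
    then show "integrable lborel (\<lambda>s. LINT t|lborel. norm (case (s, t) of (s, t) \<Rightarrow> a (t - s) *\<^sub>R b s))"
      using b by simp
  qed measurable
  from lborel_pair.integrable_product_swap[OF this] show ?thesis by (simp add: case_prod_unfold)
qed

lemma AE_integrable_conv:
  fixes b :: "real \<Rightarrow> 'b::euclidean_space"
  assumes "integrable lborel a" "integrable lborel b"
  shows "AE t in lborel. integrable lborel (\<lambda>s. a (t - s) *\<^sub>R b s)"
  using lborel_pair.AE_integrable_fst'[OF integrable_conv_kernel[OF assms]] by simp

lemma integrable_conv:
  fixes b :: "real \<Rightarrow> 'b::euclidean_space"
  assumes "integrable lborel a" "integrable lborel b"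
  shows "integrable lborel (conv a b)"
  using lborel_pair.integrable_fst'[OF integrable_conv_kernel[OF assms]] by (simp add: conv_def[abs_def])

lemma integral_conv:
  fixes b :: "real \<Rightarrow> 'b::euclidean_space"
  assumes a: "integrable lborel a" and b: "integrable lborel b"
  shows "(LINT t|lborel. conv a b t) = (LINT t|lborel. a t) *\<^sub>R (LINT t|lborel. b t)"
proof -
  have "(LINT t|lborel. conv a b t) = (LINT s|lborel. LINT t|lborel. a (t - s) *\<^sub>R b s)"
    unfolding conv_def using lborel_pair.Fubini_integral[OF integrable_conv_kernel[OF assms]] by simp
  also have "\<dots> = (LINT s|lborel. (LINT t|lborel. a t) *\<^sub>R b s)"
    using integral_reflect_shift(2)[of a] a by (simp add: integrable_reflect_shift(2))
  finally show ?thesis by simp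
qed

lemma norm_conv_le:
  fixes b :: "real \<Rightarrow> 'b::euclidean_space"
  shows "norm (conv a b t) \<le> conv (\<lambda>s. \<bar>a s\<bar>) (\<lambda>s. norm (b s)) t"
  using integral_norm_bound[of lborel "\<lambda>s. a (t - s) *\<^sub>R b s"] by (simp add: conv_def)

lemma conv_L1_bound:
  fixes b :: "real \<Rightarrow> 'b::euclidean_space"
  assumes a: "integrable lborel a" and b: "integrable lborel b"
  shows "(LINT t|lborel. norm (conv a b t)) \<le> (LINT t|lborel. \<bar>a t\<bar>) * (LINT t|lborel. norm (b t))"
proof -
  have "(LINT t|lborel. norm (conv a b t)) \<le> (LINT t|lborel. conv (\<lambda>s. \<bar>a s\<bar>) (\<lambda>s. norm (b s)) t)"
    by (intro integral_mono norm_conv_le integrable_norm integrable_conv integrable_abs assms)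
  also have "\<dots> = (LINT t|lborel. \<bar>a t\<bar>) * (LINT t|lborel. norm (b t))"
    using integral_conv[of "\<lambda>s. \<bar>a s\<bar>" "\<lambda>s. norm (b s)"] a b by simp
  finally show ?thesis .
qed

lemma AE_conv_add_right:
  assumes "integrable lborel a" "integrable lborel b" "integrable lborel c"
  shows "AE t in lborel. conv a (\<lambda>s. b s + c s) t = conv a b t + conv a c t"
  using AE_integrable_conv[OF assms(1,2)] AE_integrable_conv[OF assms(1,3)]
  by eventually_elim (simp add: conv_def scaleR_add_right)

lemma AE_conv_diff_right:
  assumes "integrable lborel a" "integrable lborel b" "integrable lborel c"
  shows "AE t in lborel. conv a (\<lambda>s. b s - c s) t = conv a b t - conv a c t"
  using AE_integrable_conv[OF assms(1,2)] AE_integrable_conv[OF assms(1,3)]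
  by eventually_elim (simp add: conv_def scaleR_diff_right)

lemma AE_conv_diff_left:
  assumes "integrable lborel a" "integrable lborel b" "integrable lborel c"
  shows "AE t in lborel. conv (\<lambda>s. a s - b s) c t = conv a c t - conv b c t"
  using AE_integrable_conv[OF assms(1,3)] AE_integrable_conv[OF assms(2,3)]
  by eventually_elim (simp add: conv_def scaleR_diff_left)

text \<open>Fubini's theorem at a single time. Absolute convergence at that time suffices, and this
holds at every time if \<open>a\<close> is bounded, but only at almost every time if \<open>a\<close> is merely integrable;
both cases occur below.\<close>

lemma conv_assoc_at:
  fixes c :: "real \<Rightarrow> 'b::euclidean_space"
  assumes a[measurable]: "a \<in> borel_measurable borel" and b: "integrable lborel b" and c: "integrable lborel c"
    and t: "integrable lborel (\<lambda>\<sigma>. \<bar>a (t - \<sigma>)\<bar> * conv (\<lambda>s. \<bar>b s\<bar>) (\<lambda>s. norm (c s)) \<sigma>)"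
  shows "conv (conv a b) c t = conv a (conv b c) t"
proof -
  have [measurable]: "b \<in> borel_measurable borel" "c \<in> borel_measurable borel" using b c by auto
  define F where "F = (\<lambda>(\<sigma>, s). a (t - \<sigma>) *\<^sub>R (b (\<sigma> - s) *\<^sub>R c s))"
  have F: "integrable (lborel \<Otimes>\<^sub>M lborel) F"
  proof (rule lborel_pair.Fubini_integrable)
    show "F \<in> borel_measurable (lborel \<Otimes>\<^sub>M lborel)" unfolding F_def by measurable
    show "AE \<sigma> in lborel. integrable lborel (\<lambda>s. F (\<sigma>, s))"
      using AE_integrable_conv[OF b c]
      by eventually_elim (auto simp: F_def simp del: scaleR_scaleR intro!: integrable_scaleR_right)
    have "(LINT s|lborel. norm (F (\<sigma>, s))) = \<bar>a (t - \<sigma>)\<bar> * conv (\<lambda>s. \<bar>b s\<bar>) (\<lambda>s. norm (c s)) \<sigma>" for \<sigma>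
      by (simp add: F_def conv_def abs_mult mult.assoc)
    then show "integrable lborel (\<lambda>\<sigma>. LINT s|lborel. norm (F (\<sigma>, s)))" using t by simp
  qed
  have "AE s in lborel. integrable lborel (\<lambda>\<sigma>. (\<lambda>\<sigma> s. F (\<sigma>, s)) \<sigma> s)"
    by (rule lborel_pair.AE_integrable_snd) (use F in simp)
  then have F_snd: "AE s in lborel. integrable lborel (\<lambda>\<sigma>. F (\<sigma>, s))" by simp
  have "conv a (conv b c) t = (LINT \<sigma>|lborel. LINT s|lborel. F (\<sigma>, s))"
  proof -
    have "(LINT s|lborel. F (\<sigma>, s)) = a (t - \<sigma>) *\<^sub>R conv b c \<sigma>" for \<sigma>
      unfolding F_def conv_def prod.case by (rule integral_scaleR_right)
    then show ?thesis by (simp add: conv_def)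
  qed
  also have "\<dots> = (LINT s|lborel. LINT \<sigma>|lborel. F (\<sigma>, s))"
    using lborel_pair.Fubini_integral[of "\<lambda>s \<sigma>. F (\<sigma>, s)"] lborel_pair.integrable_product_swap[OF F] by (simp add: case_prod_unfold)
  also have "\<dots> = (LINT s|lborel. conv a b (t - s) *\<^sub>R c s)"
  proof (rule integral_cong_AE)
    show "AE s in lborel. (LINT \<sigma>|lborel. F (\<sigma>, s)) = conv a b (t - s) *\<^sub>R c s"
      using F_snd
    proof eventually_elim
      case (elim s)
      show ?case
      proof (cases "c s = 0")
        case False
        have "integrable lborel (\<lambda>\<sigma>. F (\<sigma>, s) \<bullet> c s / (c s \<bullet> c s))"
          using elim by (intro integrable_divide integrable_inner_left)
        then have "integrable lborel (\<lambda>\<sigma>. a (t - \<sigma>) * b (\<sigma> - s))"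
          using False by (simp add: F_def)
        then have "(LINT \<sigma>|lborel. F (\<sigma>, s)) = (LINT \<sigma>|lborel. a (t - \<sigma>) * b (\<sigma> - s)) *\<^sub>R c s"
          by (simp add: F_def)
        also have "(LINT \<sigma>|lborel. a (t - \<sigma>) * b (\<sigma> - s)) = conv a b (t - s)"
          unfolding conv_def using integral_reflect_shift(2)[of "\<lambda>r. a (t - s - r) * b r" s] by simp
        finally show ?thesis .
      qed (simp add: F_def)
    qed
    show "(\<lambda>s. LINT \<sigma>|lborel. F (\<sigma>, s)) \<in> borel_measurable lborel"
      unfolding F_def by measurable
    show "(\<lambda>s. conv a b (t - s) *\<^sub>R c s) \<in> borel_measurable lborel"
      unfolding conv_def by measurable
  qed
  finally show ?thesis by (simp add: conv_def)
qed

lemma AE_conv_assoc: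
  fixes c :: "real \<Rightarrow> 'b::euclidean_space"
  assumes a: "integrable lborel a" and b: "integrable lborel b" and c: "integrable lborel c"
  shows "AE t in lborel. conv (conv a b) c t = conv a (conv b c) t"
proof -
  have "AE t in lborel. integrable lborel (\<lambda>\<sigma>. \<bar>a (t - \<sigma>)\<bar> *\<^sub>R conv (\<lambda>s. \<bar>b s\<bar>) (\<lambda>s. norm (c s)) \<sigma>)"
    by (intro AE_integrable_conv[of "\<lambda>s. \<bar>a s\<bar>"] integrable_conv integrable_abs integrable_norm assms)
  then show ?thesis
    by eventually_elim (rule conv_assoc_at; use a b c in auto)
qed

lemma conv_eq_0: "causal a \<Longrightarrow> causal b \<Longrightarrow> t \<le> 0 \<Longrightarrow> conv a b t = 0"
proof -
  assume a: "causal a" and b: "causal b" and t: "t \<le> 0"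
  have "(\<lambda>s. a (t - s) *\<^sub>R b s) = (\<lambda>s. 0)"
  proof
    show "a (t - s) *\<^sub>R b s = 0" for s
      using causalD(2)[OF a, of "t - s"] causalD(2)[OF b, of s] t by (cases "s \<le> 0") auto
  qed
  then show ?thesis by (simp add: conv_def)
qed

lemma causal_conv: "causal a \<Longrightarrow> causal b \<Longrightarrow> causal (conv a b)"
  using conv_eq_0[of a b] integrable_conv[of a b] by (auto simp: causal_def)

text \<open>If \<open>s\<close> and \<open>t - s\<close> are both positive, then both lie below \<open>t\<close>. Hence identities that are known
before time \<open>T\<close> only may be convolved.\<close>

lemma conv_cong_AE:
  fixes b b' :: "real \<Rightarrow> 'b::euclidean_space"
  assumes a: "causal a" "causal a'" and b: "causal b" "causal b'" and t: "t \<le> T"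
    and aa: "AE s in lborel. s < T \<longrightarrow> a s = a' s" and bb: "AE s in lborel. s < T \<longrightarrow> b s = b' s"
  shows "conv a b t = conv a' b' t"
  unfolding conv_def
proof (rule integral_cong_AE)
  have [measurable]: "a \<in> borel_measurable borel" "b \<in> borel_measurable borel"
    "a' \<in> borel_measurable borel" "b' \<in> borel_measurable borel" using a b by (auto dest!: causalD(1))
  show "(\<lambda>s. a (t - s) *\<^sub>R b s) \<in> borel_measurable lborel" "(\<lambda>s. a' (t - s) *\<^sub>R b' s) \<in> borel_measurable lborel"
    by measurable
  show "AE s in lborel. a (t - s) *\<^sub>R b s = a' (t - s) *\<^sub>R b' s"
    using AE_reflect_shift(1)[OF aa, of t] bb
  proof eventually_elim
    case (elim s)
    consider "s \<le> 0" | "t - s \<le> 0" | "0 < s" "0 < t - s" by linarith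
    then show ?case
    proof cases
      case 1 then show ?thesis by (simp add: causalD(2)[OF b(1)] causalD(2)[OF b(2)])
    next
      case 2 then show ?thesis by (simp add: causalD(2)[OF a(1)] causalD(2)[OF a(2)])
    next
      case 3 then show ?thesis using elim t by simp
    qed
  qed
qed

lemma conv_nonneg:
  fixes b :: "real \<Rightarrow> real"
  assumes a: "causal a" and b: "causal b" and t: "t \<le> T"
    and aa: "AE s in lborel. s < T \<longrightarrow> 0 \<le> a s" and bb: "AE s in lborel. s < T \<longrightarrow> 0 \<le> b s"
  shows "0 \<le> conv a b t"
  unfolding conv_def
proof (rule integral_nonneg_AE)
  show "AE s in lborel. 0 \<le> a (t - s) *\<^sub>R b s"
    using AE_reflect_shift(1)[OF aa, of t] bb
  proof eventually_elim
    case (elim s)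
    consider "s \<le> 0" | "t - s \<le> 0" | "0 < s" "0 < t - s" by linarith
    then show ?case
      by cases (use elim t in \<open>auto simp: causalD(2)[OF a] causalD(2)[OF b]\<close>)
  qed
qed

text \<open>The tangent at \<open>c\<close> of the convex function \<open>x powr p\<close>, obtained from Young's inequality because
the latter handles the boundary values \<open>x = 0\<close> and \<open>c = 0\<close> separately.\<close>

lemma powr_tangent:
  fixes x c p :: real
  assumes "p \<ge> 1" "x \<ge> 0" "c \<ge> 0"
  shows "p * c powr (p - 1) * x \<le> x powr p + (p - 1) * c powr p"
proof (cases "x = 0 \<or> c = 0")
  case False
  then have xc: "x > 0" "c > 0" using assms by auto
  have "(x powr p) powr (1 / p) * (c powr p) powr (1 - 1 / p) \<le> 1 / p * x powr p + (1 - 1 / p) * c powr p"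
    by (rule Youngs_inequality_0) (use assms xc in auto)
  moreover have "(x powr p) powr (1 / p) = x" using assms xc by (simp add: powr_powr)
  moreover have "(c powr p) powr (1 - 1 / p) = c powr (p - 1)" using assms by (simp add: powr_powr algebra_simps)
  ultimately have "p * (x * c powr (p - 1)) \<le> p * (1 / p * x powr p + (1 - 1 / p) * c powr p)"
    using assms by (intro mult_left_mono) auto
  also have "\<dots> = x powr p + (p - 1) * c powr p" using assms by (simp add: algebra_simps)
  finally show ?thesis by (simp add: algebra_simps)
qed (use assms in auto)

text \<open>Integrate the tangent inequality at the weighted mean \<open>c = y / A\<close>.\<close>

lemma power_mean_integral:
  fixes \<omega> F :: "'a \<Rightarrow> real"
  assumes p: "p \<ge> 1" and l: "integrable M \<omega>" "\<And>x. 0 \<le> \<omega> x" and [measurable]: "F \<in> borel_measurable M"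
    and F: "\<And>x. 0 \<le> F x" and lF: "integrable M (\<lambda>x. \<omega> x * F x powr p)"
  shows "integrable M (\<lambda>x. \<omega> x * F x)"
    and "(LINT x|M. \<omega> x * F x) powr p \<le> (LINT x|M. \<omega> x) powr (p - 1) * (LINT x|M. \<omega> x * F x powr p)"
proof -
  have [measurable]: "\<omega> \<in> borel_measurable M" using l by auto
  show i: "integrable M (\<lambda>x. \<omega> x * F x)"
  proof (rule Bochner_Integration.integrable_bound[of _ "\<lambda>x. \<omega> x + \<omega> x * F x powr p"])
    show "AE x in M. norm (\<omega> x * F x) \<le> norm (\<omega> x + \<omega> x * F x powr p)"
    proof (rule AE_I2)
      fix x
      have "F x \<le> 1 + F x powr p"
      proof (cases "F x \<le> 1")
        case False
        then have "F x powr 1 \<le> F x powr p" using p by (intro powr_mono) auto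
        then show ?thesis using False by simp
      qed (simp add: add_increasing2)
      then have "\<omega> x * F x \<le> \<omega> x * (1 + F x powr p)" using l(2) by (intro mult_left_mono)
      moreover have "0 \<le> \<omega> x * F x" using l(2) F by simp
      ultimately show "norm (\<omega> x * F x) \<le> norm (\<omega> x + \<omega> x * F x powr p)" by (simp add: algebra_simps)
    qed
  qed (use l lF in auto)
  define y A where "y = (LINT x|M. \<omega> x * F x)" and "A = (LINT x|M. \<omega> x)"
  have y0: "y \<ge> 0" and A0: "A \<ge> 0" using l F by (auto simp: y_def A_def)
  have Q0: "0 \<le> (LINT x|M. \<omega> x * F x powr p)" using l by simp
  have "y powr p \<le> A powr (p - 1) * (LINT x|M. \<omega> x * F x powr p)"
  proof (cases "y = 0")
    case True then show ?thesis using Q0 by simp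
  next
    case False
    then have y: "y > 0" using y0 by simp
    have "A \<noteq> 0"
    proof
      assume "A = 0"
      then have "AE x in M. \<omega> x = 0" using l by (simp add: A_def integral_nonneg_eq_0_iff_AE)
      then have "y = (LINT x|M. 0)" unfolding y_def by (intro integral_cong_AE) auto
      with y show False by simp
    qed
    then have A: "A > 0" using A0 by simp
    define c where "c = y / A"
    have c: "c > 0" using y A by (simp add: c_def)
    have "(LINT x|M. p * c powr (p - 1) * (\<omega> x * F x)) \<le> (LINT x|M. \<omega> x * F x powr p + (p - 1) * c powr p * \<omega> x)"
    proof (rule integral_mono)
      fix x
      have "\<omega> x * (p * c powr (p - 1) * F x) \<le> \<omega> x * (F x powr p + (p - 1) * c powr p)"
        using l(2) F c p by (intro mult_left_mono powr_tangent) auto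
      then show "p * c powr (p - 1) * (\<omega> x * F x) \<le> \<omega> x * F x powr p + (p - 1) * c powr p * \<omega> x"
        by (simp add: algebra_simps)
    qed (use i l lF in auto)
    then have "p * c powr (p - 1) * y \<le> (LINT x|M. \<omega> x * F x powr p) + (p - 1) * c powr p * A"
      using i l lF by (simp add: y_def A_def)
    moreover have "c powr p * A = c powr (p - 1) * y"
    proof -
      have "c powr p = c powr (p - 1) * c" using c powr_add[of c "p - 1" 1] by simp
      then show ?thesis using A by (simp add: c_def)
    qed
    ultimately have "p * (c powr (p - 1) * y) \<le> (LINT x|M. \<omega> x * F x powr p) + (p - 1) * (c powr (p - 1) * y)"
      by (simp add: mult.assoc)
    then have "c powr (p - 1) * y \<le> (LINT x|M. \<omega> x * F x powr p)"
      by (simp add: left_diff_distrib)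
    then have "A powr (p - 1) * (c powr (p - 1) * y) \<le> A powr (p - 1) * (LINT x|M. \<omega> x * F x powr p)"
      by (rule mult_left_mono) simp
    moreover have "A powr (p - 1) * (c powr (p - 1) * y) = y powr p"
    proof -
      have "A powr (p - 1) * c powr (p - 1) = y powr (p - 1)"
        using A y by (simp add: powr_mult[symmetric] c_def)
      moreover have "y powr (p - 1) * y = y powr p" using y powr_add[of y "p - 1" 1] by simp
      ultimately show ?thesis by (simp add: mult.assoc[symmetric])
    qed
    ultimately show ?thesis by simp
  qed
  then show "(LINT x|M. \<omega> x * F x) powr p \<le> (LINT x|M. \<omega> x) powr (p - 1) * (LINT x|M. \<omega> x * F x powr p)"
    by (simp add: y_def A_def)
qed

section \<open>Positivity of the resolvent of a nonincreasing kernel\<close>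

lemma AE_lborel_dense:
  fixes a b :: real
  assumes "AE t in lborel. Q t" "a < b"
  shows "\<exists>t. a < t \<and> t < b \<and> Q t"
proof (rule ccontr)
  assume "\<not> ?thesis"
  with assms(1) have "AE t in lborel. t \<notin> {a<..<b}" by (auto elim!: eventually_mono)
  then have "emeasure lborel {a<..<b} = 0"
    by (subst (asm) AE_iff_measurable[of "{a<..<b}"]) auto
  then show False using \<open>a < b\<close> by simp
qed

lemma continuous_on_indefinite_integral:
  fixes g :: "real \<Rightarrow> real"
  assumes g: "integrable lborel g"
  shows "continuous_on UNIV (\<lambda>t. LINT s|lborel. indicator {..t} s * g s)"
  unfolding continuous_on_sequentially
proof (intro allI ballI impI, elim conjE)
  fix x and t :: real assume x: "x \<longlonglongrightarrow> t"
  show "((\<lambda>t. LINT s|lborel. indicator {..t} s * g s) \<circ> x) \<longlonglongrightarrow> (LINT s|lborel. indicator {..t} s * g s)"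
    unfolding comp_def
  proof (rule integral_dominated_convergence[where w="\<lambda>s. \<bar>g s\<bar>"])
    have "AE s in lborel. s \<noteq> t" by (rule AE_lborel_singleton)
    then show "AE s in lborel. (\<lambda>n. indicator {..x n} s * g s) \<longlonglongrightarrow> indicator {..t} s * g s"
    proof eventually_elim
      case (elim s)
      have "\<forall>\<^sub>F n in sequentially. indicator {..x n} s = (indicator {..t} s :: real)"
      proof (cases "s < t")
        case True
        from order_tendstoD(1)[OF x this] show ?thesis by eventually_elim (use True in auto)
      next
        case False
        then have "t < s" using elim by simp
        from order_tendstoD(2)[OF x this] show ?thesis by eventually_elim (use False elim in auto)
      qed
      then show ?case by (intro tendsto_mult tendsto_const tendsto_eventually)
    qed
  qed (use g in \<open>auto simp: indicator_def\<close>)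
qed

lemma conv_bcontfun:
  fixes z :: "real \<Rightarrow>\<^sub>C real"
  assumes "integrable lborel \<kappa>"
  shows "continuous_on UNIV (\<lambda>t. LINT s|lborel. \<kappa> s * z (t - s))"
    "integrable lborel (\<lambda>s. \<kappa> s * z (t - s))"
proof -
  have [measurable]: "\<kappa> \<in> borel_measurable borel" using assms by auto
  have zc: "continuous_on UNIV (apply_bcontfun z)" by simp
  then have [measurable]: "apply_bcontfun z \<in> borel_measurable borel" by (rule borel_measurable_continuous_onI)
  have bd: "norm (\<kappa> s * z (t - s)) \<le> norm (\<kappa> s * norm z)" for s t
    using norm_bounded[of z "t - s"] by (simp add: abs_mult mult_left_mono)
  have w: "integrable lborel (\<lambda>s. \<kappa> s * norm z)" using assms by simp
  show "integrable lborel (\<lambda>s. \<kappa> s * z (t - s))"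
    by (rule Bochner_Integration.integrable_bound[OF w]) (use bd in auto)
  show "continuous_on UNIV (\<lambda>t. LINT s|lborel. \<kappa> s * z (t - s))"
    unfolding continuous_on_sequentially
  proof (intro allI ballI impI, elim conjE)
    fix x and t :: real assume x: "x \<longlonglongrightarrow> t"
    show "((\<lambda>t. LINT s|lborel. \<kappa> s * z (t - s)) \<circ> x) \<longlonglongrightarrow> (LINT s|lborel. \<kappa> s * z (t - s))"
      unfolding comp_def
    proof (rule integral_dominated_convergence[where w="\<lambda>s. norm (\<kappa> s * norm z)"])
      show "AE s in lborel. (\<lambda>n. \<kappa> s * z (x n - s)) \<longlonglongrightarrow> \<kappa> s * z (t - s)"
      proof (intro AE_I2 tendsto_mult tendsto_const)
        fix s
        have "isCont (apply_bcontfun z) (t - s)" using zc unfolding continuous_on_eq_continuous_at[OF open_UNIV] by blast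
        then show "(\<lambda>n. z (x n - s)) \<longlonglongrightarrow> z (t - s)"
          by (rule isCont_tendsto_compose) (intro tendsto_diff x tendsto_const)
      qed
      show "integrable lborel (\<lambda>s. norm (\<kappa> s * norm z))" by (rule integrable_norm[OF w])
    qed (use bd in auto)
  qed
qed

lemma exp_weight_small:
  assumes k: "causal k" and e: "e > 0"
  shows "\<exists>n::nat. (LINT s|lborel. exp (- real n * s) * \<bar>k s\<bar>) < e"
proof -
  have [measurable]: "k \<in> borel_measurable borel" using causalD(1)[OF k] by auto
  have "(\<lambda>n. LINT s|lborel. exp (- real n * s) * \<bar>k s\<bar>) \<longlonglongrightarrow> (LINT s|(lborel::real measure). 0)"
  proof (rule integral_dominated_convergence[where w="\<lambda>s. \<bar>k s\<bar>"])
    show "AE s in lborel. (\<lambda>n. exp (- real n * s) * \<bar>k s\<bar>) \<longlonglongrightarrow> 0"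
    proof (rule AE_I2)
      fix s show "(\<lambda>n. exp (- real n * s) * \<bar>k s\<bar>) \<longlonglongrightarrow> 0"
      proof (cases "s \<le> 0")
        case True then show ?thesis using causalD(2)[OF k] by simp
      next
        case False
        then have "(\<lambda>n. exp (- s) ^ n * \<bar>k s\<bar>) \<longlonglongrightarrow> 0 * \<bar>k s\<bar>"
          by (intro tendsto_mult tendsto_const LIMSEQ_realpow_zero) auto
        then show ?thesis by (simp add: exp_of_nat_mult[symmetric])
      qed
    qed
    show "AE s in lborel. norm (exp (- real n * s) * \<bar>k s\<bar>) \<le> \<bar>k s\<bar>" for n
    proof (rule AE_I2)
      fix s show "norm (exp (- real n * s) * \<bar>k s\<bar>) \<le> \<bar>k s\<bar>"
        by (cases "s \<le> 0") (use causalD(2)[OF k] in \<open>auto simp: abs_mult mult_left_le_one_le\<close>)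
    qed
  qed (use causalD(1)[OF k] in auto)
  then have "(\<lambda>n. LINT s|lborel. exp (- real n * s) * \<bar>k s\<bar>) \<longlonglongrightarrow> 0" by simp
  from order_tendstoD(2)[OF this e] show ?thesis by (auto simp: eventually_sequentially)
qed

text \<open>Substituting \<open>y t = 1 / e - exp (\<mu> * t) * z t\<close> gives a fixed point equation for \<open>z\<close> whose kernel
\<open>\<kappa>\<close> has total mass below 1 once \<open>\<mu>\<close> is large, so that Banach's theorem applies in the space of
bounded continuous functions on the whole line. The constant \<open>1 / e\<close> is split off because it
is the value of \<open>y\<close> at 0: the remainder \<open>z\<close> extends continuously by zero to negative times.\<close>

lemma volterra_second_kind:
  assumes k: "causal k" and e: "e > 0"
  obtains y :: "real \<Rightarrow> real" where "continuous_on UNIV y"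
    "\<And>t. integrable lborel (\<lambda>s. k (t - s) * (indicator {0<..} s * y s))"
    "\<And>t. e * y t + (LINT s|lborel. k (t - s) * (indicator {0<..} s * y s)) = 1"
proof -
  have ki: "integrable lborel k" and [measurable]: "k \<in> borel_measurable borel" using causalD(1)[OF k] by auto
  obtain n :: nat where n: "(LINT s|lborel. exp (- real n * s) * \<bar>k s\<bar>) < e" using exp_weight_small[OF k e] by blast
  define \<mu> where "\<mu> = real n"
  define \<kappa> where "\<kappa> s = exp (- \<mu> * s) * k s / e" for s
  define q where "q = (LINT s|lborel. \<bar>\<kappa> s\<bar>)"
  have \<kappa>: "integrable lborel \<kappa>"
  proof (rule Bochner_Integration.integrable_bound)
    show "integrable lborel (\<lambda>s. k s / e)" using ki by simp
    show "AE s in lborel. norm (\<kappa> s) \<le> norm (k s / e)"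
    proof (rule AE_I2)
      fix s show "norm (\<kappa> s) \<le> norm (k s / e)"
        by (cases "s \<le> 0") (use causalD(2)[OF k] e in
          \<open>auto simp: \<kappa>_def abs_mult \<mu>_def intro!: divide_right_mono mult_left_le_one_le\<close>)
    qed
  qed (simp add: \<kappa>_def[abs_def])
  have [measurable]: "\<kappa> \<in> borel_measurable borel" using \<kappa> by auto
  have q0: "0 \<le> q" unfolding q_def by simp
  have q1: "q < 1"
  proof -
    have "q = (LINT s|lborel. exp (- real n * s) * \<bar>k s\<bar>) / e"
      using e by (simp add: q_def \<kappa>_def abs_mult \<mu>_def)
    then show ?thesis using n e by simp
  qed
  define K where "K t = (LINT s|lborel. k s * indicator {..<t} s)" for t
  have Kint: "integrable lborel (\<lambda>s. k s * indicator {..<t} s)" for t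
    using integrable_mult_indicator[OF _ ki, of "{..<t}"] by (simp add: mult.commute)
  have K0: "K t = 0" if "t \<le> 0" for t
  proof -
    have "(\<lambda>s. k s * indicator {..<t} s) = (\<lambda>s. 0)"
    proof
      show "k s * indicator {..<t} s = 0" for s
        using that causalD(2)[OF k, of s] by (cases "s \<le> 0") auto
    qed
    then show ?thesis by (simp add: K_def)
  qed
  have Kb: "\<bar>K t\<bar> \<le> (LINT s|lborel. \<bar>k s\<bar>)" for t
  proof -
    have "norm (K t) \<le> (LINT s|lborel. norm (k s * indicator {..<t} s))"
      unfolding K_def by (rule integral_norm_bound)
    also have "\<dots> \<le> (LINT s|lborel. \<bar>k s\<bar>)"
      by (rule integral_mono) (use Kint ki in \<open>auto simp: indicator_def\<close>)
    finally show ?thesis by simp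
  qed
  have Kc: "continuous_on UNIV K"
  proof -
    have "K t = (LINT s|lborel. indicator {..t} s * k s)" for t
      unfolding K_def
    proof (rule integral_cong_AE)
      have "AE s in lborel. s \<noteq> t" by (rule AE_lborel_singleton)
      then show "AE s in lborel. k s * indicator {..<t} s = indicator {..t} s * k s"
        by eventually_elim (auto simp: indicator_def)
    qed auto
    then show ?thesis using continuous_on_indefinite_integral[OF ki] by (simp add: K_def[abs_def])
  qed
  define g where "g t = exp (- \<mu> * t) * K t / e\<^sup>2" for t
  have gc: "continuous_on UNIV g" unfolding g_def by (intro continuous_intros Kc) (use e in auto)
  have gb: "\<bar>g t\<bar> \<le> (LINT s|lborel. \<bar>k s\<bar>) / e\<^sup>2" for t
  proof (cases "t \<le> 0")
    case True then show ?thesis using K0 by (simp add: g_def)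
  next
    case False
    then have "exp (- \<mu> * t) * \<bar>K t\<bar> \<le> 1 * (LINT s|lborel. \<bar>k s\<bar>)"
      by (intro mult_mono Kb) (auto simp: \<mu>_def)
    then show ?thesis by (auto simp: g_def abs_mult intro!: divide_right_mono)
  qed
  define \<Phi> where "\<Phi> z = Bcontfun (\<lambda>t. g t - (LINT s|lborel. \<kappa> s * apply_bcontfun z (t - s)))" for z
  have cb: "\<bar>LINT s|lborel. \<kappa> s * apply_bcontfun z (t - s)\<bar> \<le> q * norm z" for z t
  proof -
    have "norm (LINT s|lborel. \<kappa> s * z (t - s)) \<le> (LINT s|lborel. norm (\<kappa> s * z (t - s)))"
      by (rule integral_norm_bound)
    also have "\<dots> \<le> (LINT s|lborel. \<bar>\<kappa> s\<bar> * norm z)"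
    proof (rule integral_mono)
      show "integrable lborel (\<lambda>s. norm (\<kappa> s * z (t - s)))" by (intro integrable_norm conv_bcontfun \<kappa>)
      show "norm (\<kappa> s * z (t - s)) \<le> \<bar>\<kappa> s\<bar> * norm z" for s
        using norm_bounded[of z "t - s"] by (simp add: abs_mult mult_left_mono)
    qed (use \<kappa> in auto)
    finally show ?thesis by (simp add: q_def)
  qed
  have \<Phi>: "apply_bcontfun (\<Phi> z) t = g t - (LINT s|lborel. \<kappa> s * apply_bcontfun z (t - s))" for z t
    unfolding \<Phi>_def
  proof (subst Bcontfun_inverse)
    show "(\<lambda>t. g t - (LINT s|lborel. \<kappa> s * apply_bcontfun z (t - s))) \<in> bcontfun"
    proof (rule bcontfun_normI)
      show "continuous_on UNIV (\<lambda>t. g t - (LINT s|lborel. \<kappa> s * apply_bcontfun z (t - s)))"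
        by (intro continuous_on_diff gc conv_bcontfun \<kappa>)
      show "norm (g t - (LINT s|lborel. \<kappa> s * apply_bcontfun z (t - s))) \<le> (LINT s|lborel. \<bar>k s\<bar>) / e\<^sup>2 + q * norm z" for t
        using gb[of t] cb[of z t] by simp
    qed
  qed simp
  have "\<exists>!z. \<Phi> z = z"
  proof (rule banach_fix_type[OF q0 q1])
    show "\<forall>z z'. dist (\<Phi> z) (\<Phi> z') \<le> q * dist z z'"
    proof (intro allI dist_bound)
      fix z z' :: "real \<Rightarrow>\<^sub>C real" and t
      have "apply_bcontfun (\<Phi> z) t - apply_bcontfun (\<Phi> z') t = - (LINT s|lborel. \<kappa> s * apply_bcontfun (z - z') (t - s))"
        using conv_bcontfun(2)[OF \<kappa>, of z t] conv_bcontfun(2)[OF \<kappa>, of z' t]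
        by (simp add: \<Phi> minus_bcontfun.rep_eq algebra_simps)
      then show "dist (apply_bcontfun (\<Phi> z) t) (apply_bcontfun (\<Phi> z') t) \<le> q * dist z z'"
        using cb[of "z - z'" t] by (simp add: dist_norm)
    qed
  qed
  then obtain z where "\<Phi> z = z" by blast
  then have z: "apply_bcontfun z t = g t - (LINT s|lborel. \<kappa> s * apply_bcontfun z (t - s))" for t
    using \<Phi>[of z t] by simp
  have zc: "continuous_on UNIV (apply_bcontfun z)" by simp
  then have [measurable]: "apply_bcontfun z \<in> borel_measurable borel" by (rule borel_measurable_continuous_onI)
  have z0: "z t = 0" if "t \<le> 0" for t
  proof -
    define S where "S = (SUP t\<in>{..0}. \<bar>z t\<bar>)"
    have bdd: "bdd_above ((\<lambda>t. \<bar>z t\<bar>) ` {..0})"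
      using norm_bounded[of z] by (intro bdd_aboveI[of _ "norm z"]) auto
    have zS: "\<bar>z t\<bar> \<le> S" if "t \<le> 0" for t unfolding S_def using that bdd by (intro cSUP_upper) auto
    have "S \<le> q * S" unfolding S_def[symmetric]
    proof (subst S_def, rule cSUP_least)
      fix t :: real assume "t \<in> {..0}"
      then have t: "t \<le> 0" by simp
      have "\<bar>z t\<bar> = norm (LINT s|lborel. \<kappa> s * z (t - s))"
        using z[of t] K0[OF t] by (simp add: g_def)
      also have "\<dots> \<le> (LINT s|lborel. norm (\<kappa> s * z (t - s)))" by (rule integral_norm_bound)
      also have "\<dots> \<le> (LINT s|lborel. \<bar>\<kappa> s\<bar> * S)"
      proof (rule integral_mono)
        show "integrable lborel (\<lambda>s. norm (\<kappa> s * z (t - s)))" by (intro integrable_norm conv_bcontfun \<kappa>)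
        show "norm (\<kappa> s * z (t - s)) \<le> \<bar>\<kappa> s\<bar> * S" for s
        proof (cases "s \<le> 0")
          case True then show ?thesis using causalD(2)[OF k] by (simp add: \<kappa>_def)
        next
          case False then show ?thesis using zS[of "t - s"] t by (simp add: abs_mult mult_left_mono)
        qed
      qed (use \<kappa> in auto)
      finally show "\<bar>z t\<bar> \<le> q * S" by (simp add: q_def)
    qed simp
    then have "S * (1 - q) \<le> 0" by (simp add: algebra_simps)
    then have "S \<le> 0" using q1 by (simp add: mult_le_0_iff)
    then show ?thesis using zS[OF that] by simp
  qed
  define y where "y t = 1 / e - exp (\<mu> * t) * z t" for t
  have yc: "continuous_on UNIV y" unfolding y_def by (intro continuous_intros zc) (use e in auto)
  have key: "(\<lambda>s. k s * (indicator {0<..} (t - s) * y (t - s)))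
      = (\<lambda>s. (k s * indicator {..<t} s) / e - exp (\<mu> * t) * (e * (\<kappa> s * z (t - s))))" for t
  proof
    fix s
    show "k s * (indicator {0<..} (t - s) * y (t - s))
      = (k s * indicator {..<t} s) / e - exp (\<mu> * t) * (e * (\<kappa> s * z (t - s)))"
    proof (cases "s < t")
      case True
      have "exp (\<mu> * t) * exp (- \<mu> * s) = exp (\<mu> * (t - s))" by (simp add: exp_add[symmetric] algebra_simps)
      then have "exp (\<mu> * t) * (e * (\<kappa> s * z (t - s))) = k s * (exp (\<mu> * (t - s)) * z (t - s))"
        using e by (simp add: \<kappa>_def)
      then show ?thesis using True unfolding y_def by (simp only: right_diff_distrib) simp
    next
      case False then show ?thesis using z0[of "t - s"] by simp
    qed
  qed
  have int1: "integrable lborel (\<lambda>s. k s * (indicator {0<..} (t - s) * y (t - s)))" for t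
    unfolding key using Kint[of t] conv_bcontfun(2)[OF \<kappa>, of z t] by simp
  have eq1: "(LINT s|lborel. k s * (indicator {0<..} (t - s) * y (t - s))) = 1 - e * y t" for t
  proof -
    have "(LINT s|lborel. k s * (indicator {0<..} (t - s) * y (t - s)))
      = K t / e - exp (\<mu> * t) * (e * (LINT s|lborel. \<kappa> s * z (t - s)))"
      unfolding key using Kint[of t] conv_bcontfun(2)[OF \<kappa>, of z t] by (simp add: K_def)
    also have "(LINT s|lborel. \<kappa> s * z (t - s)) = g t - z t" using z[of t] by simp
    also have "exp (\<mu> * t) * (e * (g t - z t)) = K t / e - e * (exp (\<mu> * t) * z t)"
    proof -
      have "exp (\<mu> * t) * exp (- \<mu> * t) = 1" by (simp add: exp_add[symmetric])
      then have "exp (\<mu> * t) * g t = K t / e\<^sup>2" by (simp add: g_def mult.assoc[symmetric])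
      then have "e * (exp (\<mu> * t) * g t) = K t / e" using e by (simp add: power2_eq_square)
      then show ?thesis by (simp add: algebra_simps)
    qed
    also have "K t / e - (K t / e - e * (exp (\<mu> * t) * z t)) = 1 - e * y t"
      using e by (simp add: y_def algebra_simps)
    finally show ?thesis .
  qed
  show thesis
  proof (rule that[OF yc])
    fix t
    show "integrable lborel (\<lambda>s. k (t - s) * (indicator {0<..} s * y s))"
      using integrable_reflect_shift(1)[OF int1[of t], of t] by simp
    show "e * y t + (LINT s|lborel. k (t - s) * (indicator {0<..} s * y s)) = 1"
      using integral_reflect_shift(1)[of "\<lambda>s. k s * (indicator {0<..} (t - s) * y (t - s))" t] eq1[of t] by simp
  qed
qed

lemma integral_initial_segment_small:
  fixes k :: "real \<Rightarrow> real"
  assumes k: "causal k" and e: "e > 0"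
  shows "\<exists>d>0. \<forall>d'\<le>d. (LINT s|lborel. \<bar>k s\<bar> * indicator {..d'} s) < e"
proof -
  have ki: "integrable lborel k" and [measurable]: "k \<in> borel_measurable borel" using causalD(1)[OF k] by auto
  have I: "integrable lborel (\<lambda>s. \<bar>k s\<bar> * indicator {..d} s)" for d
    using integrable_mult_indicator[OF _ integrable_abs[OF ki], of "{..d}"] by (simp add: mult.commute)
  have "(\<lambda>n. LINT s|lborel. \<bar>k s\<bar> * indicator {..inverse (real (Suc n))} s) \<longlonglongrightarrow> (LINT s|(lborel::real measure). 0)"
  proof (rule integral_dominated_convergence[where w="\<lambda>s. \<bar>k s\<bar>"])
    show "AE s in lborel. (\<lambda>n. \<bar>k s\<bar> * indicator {..inverse (real (Suc n))} s) \<longlonglongrightarrow> 0"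
    proof (rule AE_I2)
      fix s show "(\<lambda>n. \<bar>k s\<bar> * indicator {..inverse (real (Suc n))} s) \<longlonglongrightarrow> 0"
      proof (cases "s \<le> 0")
        case True then show ?thesis using causalD(2)[OF k] by simp
      next
        case False
        then have "\<forall>\<^sub>F n in sequentially. inverse (real (Suc n)) < s"
          by (intro order_tendstoD(2)[OF LIMSEQ_inverse_real_of_nat]) simp
        then have "\<forall>\<^sub>F n in sequentially. \<bar>k s\<bar> * indicator {..inverse (real (Suc n))} s = 0"
          by eventually_elim (auto simp: indicator_def)
        then show ?thesis by (rule tendsto_eventually)
      qed
    qed
  qed (use ki in \<open>auto simp: indicator_def\<close>)
  then have "(\<lambda>n. LINT s|lborel. \<bar>k s\<bar> * indicator {..inverse (real (Suc n))} s) \<longlonglongrightarrow> 0" by simp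
  from order_tendstoD(2)[OF this e] obtain n where
    n: "(LINT s|lborel. \<bar>k s\<bar> * indicator {..inverse (real (Suc n))} s) < e" by (auto simp: eventually_sequentially)
  show ?thesis
  proof (intro exI[of _ "inverse (real (Suc n))"] conjI allI impI)
    fix d assume "d \<le> inverse (real (Suc n))"
    then have "(LINT s|lborel. \<bar>k s\<bar> * indicator {..d} s) \<le> (LINT s|lborel. \<bar>k s\<bar> * indicator {..inverse (real (Suc n))} s)"
      by (intro integral_mono I) (auto simp: indicator_def)
    then show "(LINT s|lborel. \<bar>k s\<bar> * indicator {..d} s) < e" using n by linarith
  qed simp
qed

text \<open>Let \<open>r\<close> be the first time with \<open>y r \<le> 0\<close> and let \<open>y\<close> attain its maximum over a short interval
\<open>[r - d, r]\<close> at \<open>\<tau>\<close>. Comparing the equation at \<open>r\<close> and at \<open>\<tau>\<close>, monotonicity of \<open>k\<close> discards the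
history before \<open>\<tau>\<close> and leaves \<open>e * y \<tau>\<close> bounded by \<open>y \<tau>\<close> times the mass of \<open>k\<close> on \<open>(0,d)\<close>, which is
less than \<open>e\<close>.\<close>

lemma volterra_second_kind_pos:
  fixes k y :: "real \<Rightarrow> real"
  assumes k: "causal k" and e: "e > 0" and k0: "\<And>s. 0 \<le> k s"
    and mono: "\<And>s t. 0 < s \<Longrightarrow> s \<le> t \<Longrightarrow> k t \<le> k s"
    and yc: "continuous_on UNIV y"
    and yi: "\<And>t. integrable lborel (\<lambda>s. k (t - s) * (indicator {0<..} s * y s))"
    and y: "\<And>t. e * y t + (LINT s|lborel. k (t - s) * (indicator {0<..} s * y s)) = 1"
  shows "y t > 0"
proof (rule ccontr)
  assume "\<not> y t > 0"
  then have t: "y t \<le> 0" by simp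
  have yneg: "y s = 1 / e" if "s \<le> 0" for s
  proof -
    have "(\<lambda>r. k (s - r) * (indicator {0<..} r * y r)) = (\<lambda>r. 0)"
    proof
      show "k (s - r) * (indicator {0<..} r * y r) = 0" for r
        using that causalD(2)[OF k, of "s - r"] by (cases "r \<le> 0") auto
    qed
    then have "(LINT r|lborel. k (s - r) * (indicator {0<..} r * y r)) = 0" by simp
    then show ?thesis using y[of s] e by (simp add: field_simps)
  qed
  have t0: "t > 0" using yneg[of t] t e by (cases "t \<le> 0") (auto simp: not_le)
  define Z where "Z = {0..t} \<inter> y -` {..0}"
  have "closed Z" unfolding Z_def
    by (intro continuous_closed_preimage continuous_on_subset[OF yc]) auto
  moreover have "t \<in> Z" using t t0 by (simp add: Z_def)
  moreover have "bounded Z" unfolding Z_def by (rule bounded_subset[of "{0..t}"]) auto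
  ultimately have "compact Z" "Z \<noteq> {}" by (auto simp: compact_eq_bounded_closed)
  from compact_attains_inf[OF this] obtain r where r: "r \<in> Z" "\<And>s. s \<in> Z \<Longrightarrow> r \<le> s" by auto
  have yr: "y r \<le> 0" "0 \<le> r" "r \<le> t" using r(1) by (auto simp: Z_def)
  have r0: "r > 0" using yneg[of r] yr e by (cases "r = 0") auto
  have ypos: "y s > 0" if "s < r" for s
  proof (cases "s \<le> 0")
    case True then show ?thesis using yneg e by simp
  next
    case False
    then have "s \<notin> Z" using r(2)[of s] that by auto
    then show ?thesis using False that yr by (auto simp: Z_def)
  qed
  obtain d0 where d0: "d0 > 0" "\<And>d'. d' \<le> d0 \<Longrightarrow> (LINT s|lborel. \<bar>k s\<bar> * indicator {..d'} s) < e"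
    using integral_initial_segment_small[OF k e] by blast
  define d where "d = min d0 r"
  have d: "d > 0" "d \<le> r" "(LINT s|lborel. k s * indicator {..d} s) < e"
    using d0(1) d0(2)[of d] r0 k0 by (auto simp: d_def)
  have "\<exists>\<tau>\<in>{r - d..r}. \<forall>s\<in>{r - d..r}. y s \<le> y \<tau>"
    by (rule continuous_attains_sup) (use d in \<open>auto intro: continuous_on_subset[OF yc]\<close>)
  then obtain \<tau> where \<tau>: "\<tau> \<in> {r - d..r}" "\<And>s. s \<in> {r - d..r} \<Longrightarrow> y s \<le> y \<tau>"
    by blast
  have y\<tau>: "y \<tau> > 0" using \<tau>(2)[of "r - d"] ypos[of "r - d"] d by auto
  then have \<tau>r: "\<tau> < r" using yr \<tau>(1) by (cases "\<tau> = r") auto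
  have ki: "integrable lborel k" by (rule causalD(1)[OF k])
  have Ir: "integrable lborel (\<lambda>s. k s * indicator {..d} s)"
    using integrable_mult_indicator[OF _ ki, of "{..d}"] by (simp add: mult.commute)
  have "e * y \<tau> = 1 - (LINT s|lborel. k (\<tau> - s) * (indicator {0<..} s * y s))" using y[of \<tau>] by simp
  also have "\<dots> \<le> (LINT s|lborel. k (r - s) * (indicator {0<..} s * y s)) - (LINT s|lborel. k (\<tau> - s) * (indicator {0<..} s * y s))"
    using y[of r] mult_nonneg_nonpos[of e "y r"] e yr by simp
  also have "\<dots> = (LINT s|lborel. k (r - s) * (indicator {0<..} s * y s) - k (\<tau> - s) * (indicator {0<..} s * y s))"
    using yi[of r] yi[of \<tau>] by simp
  also have "\<dots> \<le> (LINT s|lborel. y \<tau> * (k (r - s) * indicator {..d} (r - s)))"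
  proof (rule integral_mono)
    show "integrable lborel (\<lambda>s. k (r - s) * (indicator {0<..} s * y s) - k (\<tau> - s) * (indicator {0<..} s * y s))"
      using yi[of r] yi[of \<tau>] by simp
    show "integrable lborel (\<lambda>s. y \<tau> * (k (r - s) * indicator {..d} (r - s)))"
      using integrable_reflect_shift(1)[OF Ir, of r] by simp
    fix s
    have R: "0 \<le> y \<tau> * (k (r - s) * indicator {..d} (r - s))" using y\<tau> k0 by simp
    consider "s \<le> 0" | "0 < s" "s < \<tau>" | "0 < s" "\<tau> \<le> s" "s < r" | "0 < s" "\<tau> \<le> s" "r \<le> s" by linarith
    then show "k (r - s) * (indicator {0<..} s * y s) - k (\<tau> - s) * (indicator {0<..} s * y s)
        \<le> y \<tau> * (k (r - s) * indicator {..d} (r - s))"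
    proof cases
      case 1 then show ?thesis using R by simp
    next
      case 2
      have "k (r - s) * y s \<le> k (\<tau> - s) * y s"
        using 2 \<tau>r ypos[of s] by (intro mult_right_mono mono) auto
      then show ?thesis using R 2 by simp
    next
      case 3
      have "k (r - s) * y s \<le> k (r - s) * y \<tau>"
        using 3 \<tau> k0 by (intro mult_left_mono) auto
      moreover have "k (\<tau> - s) = 0" using 3 causalD(2)[OF k, of "\<tau> - s"] by simp
      moreover have "r - s \<le> d" using 3 \<tau>(1) by auto
      ultimately show ?thesis using 3 by (simp add: mult.commute)
    next
      case 4
      then show ?thesis using R causalD(2)[OF k, of "\<tau> - s"] causalD(2)[OF k, of "r - s"] by simp
    qed
  qed
  also have "\<dots> = y \<tau> * (LINT s|lborel. k s * indicator {..d} s)"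
    using integral_reflect_shift(1)[of "\<lambda>s. k s * indicator {..d} s" r] by simp
  also have "\<dots> < y \<tau> * e" using y\<tau> d(3) by simp
  finally show False by (simp add: mult.commute)
qed

lemma conv_unit_interval:
  fixes b :: "real \<Rightarrow> 'b::euclidean_space"
  assumes b: "causal b" and t: "t \<le> T"
  shows "conv (indicator {0<..<T}) b t = (LINT s|lborel. indicator {..t} s *\<^sub>R b s)"
  unfolding conv_def
proof (rule integral_cong_AE)
  have [measurable]: "b \<in> borel_measurable borel" using causalD(1)[OF b] by auto
  show "(\<lambda>s. indicator {0<..<T} (t - s) *\<^sub>R b s) \<in> borel_measurable lborel"
    "(\<lambda>s. indicator {..t} s *\<^sub>R b s) \<in> borel_measurable lborel" by measurable
  have "AE s in lborel. s \<noteq> t" by (rule AE_lborel_singleton)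
  then show "AE s in lborel. indicator {0<..<T} (t - s) *\<^sub>R b s = indicator {..t} s *\<^sub>R b s"
  proof eventually_elim
    case (elim s)
    show ?case
    proof (cases "s \<le> 0")
      case True then show ?thesis by (simp add: causalD(2)[OF b])
    next
      case False then show ?thesis using elim t by (auto simp: indicator_def)
    qed
  qed
qed

lemma causal_indicator: "causal (indicator {0<..<T} :: real \<Rightarrow> real)"
proof -
  have "emeasure lborel {0<..<T} < \<infinity>" by (cases "0 \<le> T") auto
  then show ?thesis by (auto simp: causal_def integrable_indicator_iff)
qed

lemma causal_truncate:
  fixes b :: "real \<Rightarrow> 'b::euclidean_space"
  assumes "causal b" shows "causal (\<lambda>s. indicator {..<T} s *\<^sub>R b s)" "causal (\<lambda>s. indicator {0<..<T} s *\<^sub>R b s)"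
  using assms integrable_mult_indicator[of "{..<T}" lborel b] integrable_mult_indicator[of "{0<..<T}" lborel b]
  by (auto simp: causal_def)

text \<open>Let \<open>y n\<close> solve \<open>e n * y n + k * y n = 1\<close> with \<open>e n\<close> tending to 0; it is positive.
Convolution with \<open>l\<close> gives \<open>e n l * y n + 1 * y n = 1 * l\<close>. The equation bounds the mass of \<open>y n\<close>
on \<open>(0,T')\<close> for \<open>T' < T\<close>, so the first term tends to 0 in \<open>L\<^sub>1\<close>, and the primitive of \<open>l\<close> is a
limit of the nondecreasing functions \<open>1 * y n\<close>. Its derivative is therefore nonnegative.\<close>

theorem resolvent_nonneg:
  fixes k l :: "real \<Rightarrow> real"
  assumes k: "causal k" and k0: "\<And>s. 0 \<le> k s" and mono: "\<And>s t. 0 < s \<Longrightarrow> s \<le> t \<Longrightarrow> k t \<le> k s"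
    and l: "causal l" and kl: "AE t in lborel. 0 < t \<and> t < T \<longrightarrow> conv k l t = 1"
  shows "AE t in lborel. t < T \<longrightarrow> 0 \<le> l t"
proof (cases "T > 0")
  case False
  then show ?thesis using causalD(2)[OF l] by (intro AE_I2) auto
next
  case T: True
  define E :: "real \<Rightarrow> real" where "E = indicator {0<..<T}"
  have E: "causal E" unfolding E_def by (rule causal_indicator)
  have ki: "integrable lborel k" and li: "integrable lborel l" and Ei: "integrable lborel E"
    using causalD(1) k l E by blast+
  have [measurable]: "k \<in> borel_measurable borel" "l \<in> borel_measurable borel" "E \<in> borel_measurable borel"
    using ki li Ei by auto
  have lkE: "AE t in lborel. t < T \<longrightarrow> conv l k t = E t"
    using kl
  proof eventually_elim
    case (elim t)
    show ?case
    proof (cases "t \<le> 0")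
      case True then show ?thesis using conv_eq_0[OF l k] by (simp add: E_def)
    next
      case False then show ?thesis using elim by (auto simp: E_def conv_commute)
    qed
  qed
  define P where "P t = (LINT s|lborel. indicator {..t} s * l s)" for t
  have Pd: "AE t in lborel. (P has_real_derivative l t) (at t)"
    unfolding P_def by (rule lebesgue_differentiation[OF li])
  have kpos: "\<exists>d>0. k d > 0"
  proof (rule ccontr)
    assume "\<not> ?thesis"
    then have "k d = 0" for d using k0[of d] causalD(2)[OF k, of d] by (cases "d \<le> 0") (auto simp: not_less)
    then have "conv k l t = 0" for t by (simp add: conv_def)
    with AE_lborel_dense[OF kl T] show False by auto
  qed
  have main: "AE t in lborel. t < T' \<longrightarrow> 0 \<le> l t" if T': "0 < T'" "T' < T" for T'
  proof -
    define d where "d = T - T'"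
    have d: "d > 0" using T' by (simp add: d_def)
    \<comment> \<open>Only the kernel before \<open>d = T - T'\<close> is used, so that \<open>kd * Y' n\<close> ends before \<open>T\<close>, where \<open>k * y n \<le> 1\<close>.\<close>
    define kd where "kd s = indicator {..<d} s *\<^sub>R k s" for s
    have kd: "causal kd" unfolding kd_def by (rule causal_truncate(1)[OF k])
    have kdi: "integrable lborel kd" by (rule causalD(1)[OF kd])
    define \<kappa> where "\<kappa> = (LINT s|lborel. kd s)"
    have \<kappa>: "\<kappa> > 0"
    proof -
      obtain r where r: "r > 0" "k r > 0" using kpos by blast
      define b where "b = min r (d/2)"
      have b: "0 < b" "b \<le> r" "b < d" using r d by (auto simp: b_def)
      have "(LINT s|lborel. indicator {0<..b} s * k r) \<le> \<kappa>" unfolding \<kappa>_def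
      proof (rule integral_mono)
        show "integrable lborel (\<lambda>s. indicator {0<..b} s * k r)"
          by (intro integrable_mult_left) (simp add: integrable_indicator_iff emeasure_lborel_Ioc_max)
        show "indicator {0<..b} s * k r \<le> kd s" for s
          using k0[of s] mono[of s r] b by (auto simp: kd_def indicator_def)
      qed (rule kdi)
      moreover have "(LINT s|lborel. indicator {0<..b} s * k r) = b * k r" using b by simp
      ultimately show ?thesis using b r by (smt (verit) mult_pos_pos)
    qed
    define e where "e n = inverse (real (Suc n))" for n
    have e: "e n > 0" for n by (simp add: e_def)
    have "\<exists>y. continuous_on UNIV y \<and> (\<forall>t. integrable lborel (\<lambda>s. k (t - s) * (indicator {0<..} s * y s)))
       \<and> (\<forall>t. e n * y t + (LINT s|lborel. k (t - s) * (indicator {0<..} s * y s)) = 1)" for n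
      by (rule volterra_second_kind[OF k e[of n]]) blast
    then have "\<forall>n. \<exists>y. continuous_on UNIV y \<and> (\<forall>t. integrable lborel (\<lambda>s. k (t - s) * (indicator {0<..} s * y s)))
       \<and> (\<forall>t. e n * y t + (LINT s|lborel. k (t - s) * (indicator {0<..} s * y s)) = 1)" ..
    from choice[OF this] obtain y where yc: "\<And>n. continuous_on UNIV (y n)"
      and yi: "\<And>n t. integrable lborel (\<lambda>s. k (t - s) * (indicator {0<..} s * y n s))"
      and y: "\<And>n t. e n * y n t + (LINT s|lborel. k (t - s) * (indicator {0<..} s * y n s)) = 1" by blast
    have ypos: "y n t > 0" for n t
      by (rule volterra_second_kind_pos[OF k e k0 mono yc yi y])
    have [measurable]: "y n \<in> borel_measurable borel" for n using yc by (rule borel_measurable_continuous_onI)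
    define Y where "Y n s = indicator {0<..<T} s * y n s" for n s
    have Yi: "integrable lborel (Y n)" for n
    proof -
      have "set_integrable lborel {0..T} (y n)"
        unfolding set_integrable_def
        by (rule borel_integrable_compact) (auto intro: continuous_on_subset[OF yc])
      then have "integrable lborel (\<lambda>s. indicator {0<..<T} s *\<^sub>R (indicator {0..T} s *\<^sub>R y n s))"
        unfolding set_integrable_def by (rule integrable_mult_indicator[rotated]) simp
      moreover have "(\<lambda>s. indicator {0<..<T} s *\<^sub>R (indicator {0..T} s *\<^sub>R y n s)) = Y n"
        by (auto simp: Y_def indicator_def fun_eq_iff)
      ultimately show ?thesis by simp
    qed
    have Y: "causal (Y n)" for n using Yi by (auto simp: causal_def Y_def)
    have Y0: "Y n s \<ge> 0" for n s using ypos[of n s] by (simp add: Y_def)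
    have kY: "conv k (Y n) t = 1 - e n * y n t" if "t \<le> T" for n t
    proof -
      have "(\<lambda>s. k (t - s) *\<^sub>R Y n s) = (\<lambda>s. k (t - s) * (indicator {0<..} s * y n s))"
      proof
        show "k (t - s) *\<^sub>R Y n s = k (t - s) * (indicator {0<..} s * y n s)" for s
          using that causalD(2)[OF k, of "t - s"] by (auto simp: Y_def indicator_def)
      qed
      then show ?thesis using y[of n t] by (simp add: conv_def)
    qed
    define Y' where "Y' n s = indicator {..<T'} s *\<^sub>R Y n s" for n s
    have Y': "causal (Y' n)" for n unfolding Y'_def by (rule causal_truncate(1)[OF Y])
    have Y'i: "integrable lborel (Y' n)" for n by (rule causalD(1)[OF Y'])
    have Y'0: "Y' n s \<ge> 0" for n s using Y0 by (simp add: Y'_def)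
    have Y'bound: "\<kappa> * (LINT s|lborel. Y' n s) \<le> T" for n
    proof -
      have "\<kappa> * (LINT s|lborel. Y' n s) = (LINT t|lborel. conv kd (Y' n) t)"
        unfolding \<kappa>_def using integral_conv[OF kdi Y'i] by simp
      also have "\<dots> \<le> (LINT t|lborel. E t)"
      proof (rule integral_mono_AE[OF integrable_conv[OF kdi Y'i] Ei])
        show "AE t in lborel. conv kd (Y' n) t \<le> E t"
          using AE_integrable_conv[OF kdi Y'i, of n] AE_integrable_conv[OF ki Yi, of n]
        proof eventually_elim
          case (elim t)
          consider "t \<le> 0" | "0 < t" "t < T" | "T \<le> t" by linarith
          then show ?case
          proof cases
            case 1 then show ?thesis using conv_eq_0[OF kd Y', of t n] by (simp add: E_def)
          next
            case 2
            have "conv kd (Y' n) t \<le> conv k (Y n) t"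
              unfolding conv_def
              by (rule integral_mono[OF elim]) (use k0 Y0 in \<open>auto simp: kd_def Y'_def indicator_def\<close>)
            also have "\<dots> \<le> 1" using kY[of t n] 2 e[of n] ypos[of n t] by simp
            finally show ?thesis using 2 by (simp add: E_def)
          next
            case 3
            have "kd (t - s) *\<^sub>R Y' n s = 0" for s
              using 3 by (auto simp: kd_def Y'_def indicator_def d_def)
            then have "conv kd (Y' n) t = 0" unfolding conv_def by (simp del: scaleR_eq_0_iff real_scaleR_def)
            then show ?thesis by (simp add: E_def)
          qed
        qed
      qed
      also have "\<dots> = T" using T by (simp add: E_def)
      finally show ?thesis .
    qed
    define r where "r n t = e n * conv l (Y' n) t" for n t
    have ri: "integrable lborel (r n)" for n
      unfolding r_def using integrable_conv[OF li Y'i, of n] by simp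
    have "(\<lambda>n. LINT t|lborel. norm (r n t)) \<longlonglongrightarrow> 0"
    proof (rule tendsto_sandwich[OF always_eventually always_eventually tendsto_const])
      show "\<forall>n. 0 \<le> (LINT t|lborel. norm (r n t))" by simp
      show "\<forall>n. (LINT t|lborel. norm (r n t)) \<le> e n * ((LINT t|lborel. \<bar>l t\<bar>) * (T / \<kappa>))"
      proof
        fix n
        have "(LINT t|lborel. norm (r n t)) = e n * (LINT t|lborel. norm (conv l (Y' n) t))"
          using e[of n] by (simp add: r_def abs_mult)
        also have "\<dots> \<le> e n * ((LINT t|lborel. \<bar>l t\<bar>) * (LINT t|lborel. norm (Y' n t)))"
          using e[of n] by (intro mult_left_mono conv_L1_bound li Y'i) auto
        also have "(LINT t|lborel. norm (Y' n t)) \<le> T / \<kappa>"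
          using Y'bound[of n] \<kappa> Y'0 by (simp add: field_simps)
        finally show "(LINT t|lborel. norm (r n t)) \<le> e n * ((LINT t|lborel. \<bar>l t\<bar>) * (T / \<kappa>))"
          using e[of n] by (simp add: mult_left_mono)
      qed
      have "e \<longlonglongrightarrow> 0" unfolding e_def by (rule LIMSEQ_inverse_real_of_nat)
      then show "(\<lambda>n. e n * ((LINT t|lborel. \<bar>l t\<bar>) * (T / \<kappa>))) \<longlonglongrightarrow> 0"
        by (rule tendsto_mult_left_zero)
    qed
    from tendsto_L1_AE_subseq[OF ri this] obtain \<phi> :: "nat \<Rightarrow> nat" where \<phi>: "strict_mono \<phi>"
      "AE t in lborel. (\<lambda>n. r (\<phi> n) t) \<longlonglongrightarrow> 0" by blast
    define Q where "Q n t = (LINT s|lborel. indicator {..t} s * Y n s)" for n t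
    have Qmono: "Q n s \<le> Q n t" if "s \<le> t" for n s t
    proof -
      have I: "integrable lborel (\<lambda>x. indicator {..r} x * Y n x)" for r
        using integrable_mult_indicator[OF _ Yi, of "{..r}" n] by simp
      show ?thesis unfolding Q_def
        by (rule integral_mono[OF I I]) (use that Y0 in \<open>auto simp: indicator_def\<close>)
    qed
    have id: "AE t in lborel. t < T' \<longrightarrow> Q n t + r n t = P t" for n
    proof -
      have eYi: "integrable lborel (\<lambda>s. e n *\<^sub>R Y n s)" using Yi by simp
      have eY: "causal (\<lambda>s. e n *\<^sub>R Y n s)" using Y by (auto simp: causal_def)
      have kYc: "causal (conv k (Y n))" by (rule causal_conv[OF k Y])
      have sum: "AE s in lborel. s < T \<longrightarrow> conv k (Y n) s + e n *\<^sub>R Y n s = E s"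
      proof (rule AE_I2)
        fix s show "s < T \<longrightarrow> conv k (Y n) s + e n *\<^sub>R Y n s = E s"
          using conv_eq_0[OF k Y, of s n] kY[of s n] by (cases "s \<le> 0") (auto simp: E_def Y_def)
      qed
      have c: "causal (\<lambda>s. conv k (Y n) s + e n *\<^sub>R Y n s)"
        using kYc eY by (auto simp: causal_def)
      show ?thesis
        using AE_conv_assoc[OF li ki Yi, of n] AE_conv_add_right[OF li causalD(1)[OF kYc] eYi]
      proof eventually_elim
        case (elim t)
        show ?case
        proof
          assume t: "t < T'"
          then have tT: "t \<le> T" using T' by simp
          have "P t = conv E l t" unfolding P_def E_def using conv_unit_interval[OF l tT] by simp
          also have "\<dots> = conv l E t" by (rule conv_commute)
          also have "\<dots> = conv l (\<lambda>s. conv k (Y n) s + e n *\<^sub>R Y n s) t"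
            by (rule conv_cong_AE[OF l l E c tT]) (use sum in \<open>auto elim: eventually_mono\<close>)
          also have "\<dots> = conv (conv l k) (Y n) t + e n * conv l (Y n) t"
            using elim conv_scaleR_right[of l "e n" "Y n" t] by simp
          also have "conv (conv l k) (Y n) t = conv E (Y n) t"
            by (rule conv_cong_AE[OF causal_conv[OF l k] E Y Y tT lkE]) simp
          also have "\<dots> = Q n t" unfolding Q_def E_def using conv_unit_interval[OF Y tT] by simp
          also have "conv l (Y n) t = conv l (Y' n) t"
            by (rule conv_cong_AE[OF l l Y Y', where T=T']) (use t in \<open>auto simp: Y'_def\<close>)
          finally show "Q n t + r n t = P t" by (simp add: r_def)
        qed
      qed
    qed
    define G where "G t \<longleftrightarrow> (\<lambda>n. Q (\<phi> n) t) \<longlonglongrightarrow> P t" for t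
    have G: "AE t in lborel. t < T' \<longrightarrow> G t"
    proof -
      have "AE t in lborel. \<forall>n. t < T' \<longrightarrow> Q (\<phi> n) t + r (\<phi> n) t = P t"
        unfolding AE_all_countable using id by (auto elim: eventually_mono)
      with \<phi>(2) show ?thesis
      proof eventually_elim
        case (elim t)
        show ?case
        proof
          assume t: "t < T'"
          have "(\<lambda>n. P t - r (\<phi> n) t) \<longlonglongrightarrow> P t - 0" by (intro tendsto_intros elim(1))
          moreover have "(\<lambda>n. P t - r (\<phi> n) t) = (\<lambda>n. Q (\<phi> n) t)"
            using elim(2) t by (auto simp: fun_eq_iff algebra_simps)
          ultimately show "G t" by (simp add: G_def)
        qed
      qed
    qed
    have Pmono: "P s \<le> P t" if "G s" "G t" "s \<le> t" for s t
      using that Qmono unfolding G_def by (intro LIMSEQ_le) auto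
    show ?thesis using G Pd
    proof eventually_elim
      case (elim t)
      show ?case
      proof (rule impI, rule ccontr)
        assume t: "t < T'" and "\<not> 0 \<le> l t"
        then have neg: "l t < 0" by simp
        from DERIV_neg_dec_right[OF elim(2) neg] obtain \<delta> where \<delta>: "\<delta> > 0"
          "\<And>h. 0 < h \<Longrightarrow> h < \<delta> \<Longrightarrow> P (t + h) < P t" by blast
        have "t < min (t + \<delta>) T'" using \<delta> t by simp
        from AE_lborel_dense[OF G this] obtain s where s: "t < s" "s < t + \<delta>" "s < T'" "G s" by auto
        have "P s < P t" using \<delta>(2)[of "s - t"] s by simp
        moreover have "P t \<le> P s" using Pmono[of t s] elim(1) t s by simp
        ultimately show False by simp
      qed
    qed
  qed
  have "AE t in lborel. \<forall>n. t < T - T / real (n + 2) \<longrightarrow> 0 \<le> l t"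
    unfolding AE_all_countable
  proof
    fix n show "AE t in lborel. t < T - T / real (n + 2) \<longrightarrow> 0 \<le> l t"
    proof (rule main)
      have "T / real (n + 2) < T" using T by (simp add: divide_less_eq)
      then show "0 < T - T / real (n + 2)" by simp
    qed (use T in simp)
  qed
  then show ?thesis
  proof eventually_elim
    case (elim t)
    show ?case
    proof
      assume t: "t < T"
      have "(\<lambda>n. T / real (n + 2)) \<longlonglongrightarrow> 0"
        using LIMSEQ_ignore_initial_segment[OF lim_const_over_n[of T], of 2] by simp
      then have "\<forall>\<^sub>F n in sequentially. T / real (n + 2) < T - t" using t by (intro order_tendstoD(2)) auto
      then obtain n where "T / real (n + 2) < T - t" by (auto simp: eventually_sequentially)
      then show "0 \<le> l t" using elim by (auto simp: less_diff_eq algebra_simps)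
    qed
  qed
qed

section \<open>Regularized kernels\<close>

text \<open>The truncation of a pair \<open>(k,l)\<close> to \<open>(0,T)\<close>. Truncation keeps \<open>k\<close> nonincreasing on the positive
half-line and leaves convolutions unchanged before time \<open>T\<close>.\<close>

locale PC_pair =
  fixes k l :: "real \<Rightarrow> real" and T :: real
  assumes T: "T > 0"
    and k: "causal k" and k_nonneg: "\<And>s. 0 \<le> k s"
    and k_antimono: "\<And>s t. 0 < s \<Longrightarrow> s \<le> t \<Longrightarrow> k t \<le> k s"
    and l: "causal l"
    and kl: "AE t in lborel. 0 < t \<and> t < T \<longrightarrow> conv k l t = 1"
begin

abbreviation E :: "real \<Rightarrow> real" where "E \<equiv> indicator {0<..<T}"

lemma E: "causal E" by (rule causal_indicator)

lemma integrable_kernels: "integrable lborel k" "integrable lborel l" "integrable lborel E"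
  using k l E causalD(1) by blast+

lemma measurable_kernels [measurable]: "k \<in> borel_measurable borel" "l \<in> borel_measurable borel"
  using integrable_kernels by auto

lemma kl_E: "AE t in lborel. t < T \<longrightarrow> conv k l t = E t"
  using kl
proof eventually_elim
  case (elim t)
  show ?case
    by (cases "t \<le> 0") (use elim conv_eq_0[OF k l] in auto)
qed

lemma l_nonneg: "AE t in lborel. t < T \<longrightarrow> 0 \<le> l t"
  by (rule resolvent_nonneg[OF k k_nonneg k_antimono l kl])

text \<open>Convolve the equation for \<open>h\<close> with \<open>k\<close>, and use that \<open>k * l\<close> is the unit step. Thus \<open>k * h\<close> is \<open>\<nu>\<close>
times the mass that \<open>h\<close> lacks at time \<open>t\<close>.\<close>

lemma regularizer_mass:
  assumes h: "causal h" and eq: "AE t in lborel. t < T \<longrightarrow> h t + \<nu> * conv h l t = \<nu> * l t"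
  shows "AE t in lborel. t < T \<longrightarrow> conv k h t + \<nu> * conv E h t = \<nu> * E t"
proof -
  have integrable_h: "integrable lborel h" by (rule causalD(1)[OF h])
  note ki = integrable_kernels(1) and li = integrable_kernels(2)
  have hl: "integrable lborel (conv h l)" "causal (conv h l)" by (intro integrable_conv integrable_h li causal_conv h l)+
  have \<nu>i: "integrable lborel (\<lambda>s. \<nu> * conv h l s)" "causal (\<lambda>s. \<nu> * conv h l s)" "causal (\<lambda>s. \<nu> * l s)"
    using hl l by (auto simp: causal_def)
  have c: "causal (\<lambda>s. h s + \<nu> * conv h l s)" using h \<nu>i(2) by (auto simp: causal_def)
  show ?thesis
    using AE_conv_add_right[OF ki integrable_h \<nu>i(1)] AE_conv_assoc[OF ki li integrable_h] kl_E
  proof eventually_elim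
    case (elim t)
    show ?case
    proof
      assume t: "t < T"
      have "conv k (\<lambda>s. h s + \<nu> * conv h l s) t = conv k (\<lambda>s. \<nu> * l s) t"
        by (rule conv_cong_AE[OF k k c \<nu>i(3), where T=T]) (use t eq in auto)
      moreover have "conv k (\<lambda>s. \<nu> * l s) t = \<nu> * E t"
        using conv_scaleR_right[of k \<nu> l t] elim(3) t by simp
      moreover have "conv k (\<lambda>s. \<nu> * conv h l s) t = \<nu> * conv k (conv h l) t"
        using conv_scaleR_right[of k \<nu> "conv h l" t] by simp
      moreover have "conv k (conv h l) t = conv E h t"
      proof -
        have "conv k (conv h l) t = conv k (conv l h) t"
          unfolding conv_def[of k] by (simp add: conv_commute[of h l])
        also have "\<dots> = conv (conv k l) h t" using elim(2) by simp
        also have "\<dots> = conv E h t"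
          by (rule conv_cong_AE[OF causal_conv[OF k l] E h h, where T=T]) (use t kl_E in auto)
        finally show ?thesis .
      qed
      ultimately show "conv k h t + \<nu> * conv E h t = \<nu> * E t" using elim(1) by simp
    qed
  qed
qed

text \<open>The mass identity says \<open>(k + \<nu>) * (h / \<nu>) = 1\<close>, so \<open>h / \<nu>\<close> is itself the resolvent of a
nonnegative nonincreasing kernel.\<close>

lemma regularizer_nonneg:
  assumes h: "causal h" and \<nu>: "\<nu> > 0" and eq: "AE t in lborel. t < T \<longrightarrow> h t + \<nu> * conv h l t = \<nu> * l t"
  shows "AE t in lborel. t < T \<longrightarrow> 0 \<le> h t"
proof -
  define K where "K s = indicator {0<..<T} s *\<^sub>R (k s + \<nu> * E s)" for s
  define kE where "kE s = k s + \<nu> * E s" for s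
  have integrable_h: "integrable lborel h" by (rule causalD(1)[OF h])
  have \<nu>E: "integrable lborel (\<lambda>s. \<nu> * E s)" using integrable_kernels(3) by (intro integrable_mult_right)
  have kE: "causal kE" using k Bochner_Integration.integrable_add[OF integrable_kernels(1) \<nu>E]
    by (auto simp: causal_def kE_def[abs_def])
  have K: "causal K" unfolding K_def using causal_truncate(2)[OF kE] by (simp add: kE_def)
  have h': "causal (\<lambda>s. h s / \<nu>)" using h by (auto simp: causal_def)
  have "AE t in lborel. 0 < t \<and> t < T \<longrightarrow> conv K (\<lambda>s. h s / \<nu>) t = 1"
    using regularizer_mass[OF h eq] AE_integrable_conv[OF integrable_kernels(1) integrable_h] AE_integrable_conv[OF \<nu>E integrable_h]
  proof eventually_elim
    case (elim t)
    show ?case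
    proof
      assume t: "0 < t \<and> t < T"
      have "conv K (\<lambda>s. h s / \<nu>) t = conv K h t / \<nu>"
        using conv_scaleR_right[of K "1/\<nu>" h t] by simp
      also have "conv K h t = conv kE h t"
        by (rule conv_cong_AE[OF K kE h h, where T=T])
          (use t causalD(2)[OF kE] in \<open>auto simp: K_def kE_def indicator_def\<close>)
      also have "\<dots> = conv k h t + conv (\<lambda>s. \<nu> * E s) h t"
        using elim(2,3) unfolding conv_def kE_def by (simp add: scaleR_add_left distrib_right)
      also have "conv (\<lambda>s. \<nu> * E s) h t = \<nu> * conv E h t" using conv_scaleR_left[of \<nu> E h t] by simp
      finally show "conv K (\<lambda>s. h s / \<nu>) t = 1" using elim(1) t \<nu> by simp
    qed
  qed
  then have "AE t in lborel. t < T \<longrightarrow> 0 \<le> h t / \<nu>"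
    by (intro resolvent_nonneg[OF K _ _ h']) (use k_nonneg k_antimono \<nu> in \<open>auto simp: K_def indicator_def\<close>)
  then show ?thesis using \<nu> by (auto elim!: eventually_mono simp: zero_le_divide_iff)
qed

end

text \<open>The index is shifted: \<open>h n\<close> belongs to the parameter \<open>Suc n\<close>. Pointwise nonnegativity and vanishing after
\<open>T\<close> are normalizations of the representative.\<close>

locale PC_regularized = PC_pair +
  fixes h :: "nat \<Rightarrow> real \<Rightarrow> real"
  assumes h: "\<And>n. causal (h n)" and h_nonneg: "\<And>n s. 0 \<le> h n s" and h_zero: "\<And>n s. T \<le> s \<Longrightarrow> h n s = 0"
    and h_eq: "\<And>n. AE t in lborel. t < T \<longrightarrow> h n t + real (Suc n) * conv (h n) l t = real (Suc n) * l t"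
begin

lemma integrable_h: "integrable lborel (h n)" by (rule causalD(1)[OF h])

lemma measurable_h [measurable]: "h n \<in> borel_measurable borel" using integrable_h by auto

definition H :: "nat \<Rightarrow> real \<Rightarrow> real" where "H n t = (LINT s|lborel. indicator {..t} s * h n s)"

lemma H_int: "integrable lborel (\<lambda>s. indicator {..t} s * h n s)"
  using integrable_mult_indicator[OF _ integrable_h, of "{..t}"] by simp

lemma H_conv: "t \<le> T \<Longrightarrow> conv E (h n) t = H n t"
  using conv_unit_interval[OF h] by (simp add: H_def)

lemma measurable_H [measurable]: "H n \<in> borel_measurable borel"
proof -
  have "(\<lambda>t. LINT s|lborel. indicator {s..} t * h n s) \<in> borel_measurable borel" 
    unfolding indicator_def of_bool_def atLeast_iff by measurable
  moreover have "(\<lambda>t. LINT s|lborel. indicator {s..} t * h n s) = H n"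
    by (auto simp: H_def fun_eq_iff indicator_def)
  ultimately show ?thesis by simp
qed

lemma H_nonneg: "0 \<le> H n t" using h_nonneg by (simp add: H_def)

lemma H_mass: "AE t in lborel. t < T \<longrightarrow> conv k (h n) t = real (Suc n) * (E t - H n t)"
  using regularizer_mass[OF h h_eq, of n] by eventually_elim (auto simp: H_conv algebra_simps)

text \<open>Where \<open>k * h n\<close> is nonnegative, \<open>H n \<le> 1\<close>. This is known at almost every time only, hence
along some sequence of times increasing to \<open>T\<close>.\<close>

lemma h_mass_le_1: "(LINT s|lborel. h n s) \<le> 1"
proof -
  have ae: "AE t in lborel. t < T \<longrightarrow> H n t \<le> 1"
    using H_mass[of n]
  proof eventually_elim
    case (elim t)
    have "0 \<le> conv k (h n) t" using k_nonneg h_nonneg by (simp add: conv_def)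
    then have "t < T \<longrightarrow> H n t \<le> E t" using elim by (auto simp: zero_le_mult_iff)
    moreover have "E t \<le> 1" by (simp add: indicator_def)
    ultimately show ?case by linarith
  qed
  define t where "t m = T - inverse (real (Suc m))" for m
  have "\<exists>s. t m < s \<and> s < T \<and> (s < T \<longrightarrow> H n s \<le> 1)" for m
    using AE_lborel_dense[OF ae, of "t m" T] by (simp add: t_def)
  then have "\<forall>m. \<exists>s. t m < s \<and> s < T \<and> H n s \<le> 1" by blast
  from choice[OF this] obtain s where s: "\<And>m. t m < s m" "\<And>m. s m < T" "\<And>m. H n (s m) \<le> 1" by blast
  have "t \<longlonglongrightarrow> T - 0" unfolding t_def by (intro tendsto_diff tendsto_const LIMSEQ_inverse_real_of_nat)
  then have st: "s \<longlonglongrightarrow> T"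
    by (intro tendsto_sandwich[of t s sequentially "\<lambda>_. T"]) (use s in \<open>auto intro!: always_eventually less_imp_le\<close>)
  have "(\<lambda>m. LINT x|lborel. indicator {..s m} x * h n x) \<longlonglongrightarrow> (LINT x|lborel. h n x)"
  proof (rule integral_dominated_convergence[where w="h n"])
    show "AE x in lborel. (\<lambda>m. indicator {..s m} x * h n x) \<longlonglongrightarrow> h n x"
    proof (rule AE_I2)
      fix x show "(\<lambda>m. indicator {..s m} x * h n x) \<longlonglongrightarrow> h n x"
      proof (cases "x < T")
        case True
        from order_tendstoD(1)[OF st this] have "\<forall>\<^sub>F m in sequentially. indicator {..s m} x * h n x = h n x"
          by eventually_elim auto
        then show ?thesis by (rule tendsto_eventually)
      next
        case False then show ?thesis using h_zero by simp
      qed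
    qed
  qed (use integrable_h h_nonneg in \<open>auto simp: indicator_def\<close>)
  then have "(\<lambda>m. H n (s m)) \<longlonglongrightarrow> (LINT x|lborel. h n x)" by (simp add: H_def)
  then show ?thesis by (rule LIMSEQ_le_const2) (use s in auto)
qed

lemma H_le_1: "H n t \<le> 1"
proof -
  have "H n t \<le> (LINT s|lborel. h n s)" unfolding H_def
    by (rule integral_mono[OF H_int integrable_h]) (use h_nonneg in \<open>auto simp: indicator_def\<close>)
  then show ?thesis using h_mass_le_1[of n] by linarith
qed

lemma conv_h_L1_le:
  fixes g :: "real \<Rightarrow> 'b::euclidean_space"
  assumes "integrable lborel g"
  shows "(LINT t|lborel. norm (conv (h n) g t)) \<le> (LINT t|lborel. norm (g t))"
proof -
  have "(LINT t|lborel. norm (conv (h n) g t)) \<le> (LINT t|lborel. \<bar>h n t\<bar>) * (LINT t|lborel. norm (g t))"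
    by (rule conv_L1_bound[OF integrable_h assms])
  also have "(LINT t|lborel. \<bar>h n t\<bar>) = (LINT t|lborel. h n t)" using h_nonneg by simp
  also have "(LINT t|lborel. h n t) * (LINT t|lborel. norm (g t)) \<le> 1 * (LINT t|lborel. norm (g t))"
    by (intro mult_right_mono h_mass_le_1) simp
  finally show ?thesis by simp
qed

text \<open>The missing mass is \<open>k * h n\<close> divided by \<open>Suc n\<close>, and the norms of \<open>k * h n\<close> are bounded by that
of \<open>k\<close>.\<close>

lemma H_tendsto_L1: "(\<lambda>n. LINT t|lborel. indicator {..<T} t * \<bar>H n t - E t\<bar>) \<longlonglongrightarrow> 0"
proof (rule tendsto_sandwich[OF always_eventually always_eventually tendsto_const])
  show "\<forall>n. 0 \<le> (LINT t|lborel. indicator {..<T} t * \<bar>H n t - E t\<bar>)" by simp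
  show "\<forall>n. (LINT t|lborel. indicator {..<T} t * \<bar>H n t - E t\<bar>) \<le> inverse (real (Suc n)) * (LINT t|lborel. \<bar>k t\<bar>)"
  proof
    fix n
    have kh: "integrable lborel (conv k (h n))" by (intro integrable_conv integrable_kernels integrable_h)
    have "(LINT t|lborel. indicator {..<T} t * \<bar>H n t - E t\<bar>) = (LINT t|lborel. inverse (real (Suc n)) * (indicator {..<T} t * \<bar>conv k (h n) t\<bar>))"
    proof (rule integral_cong_AE)
      show "AE t in lborel. indicator {..<T} t * \<bar>H n t - E t\<bar> = inverse (real (Suc n)) * (indicator {..<T} t * \<bar>conv k (h n) t\<bar>)"
        using H_mass[of n]
      proof eventually_elim
        case (elim t)
        have "inverse (real (Suc n)) * \<bar>real (Suc n) * (E t - H n t)\<bar> = \<bar>H n t - E t\<bar>"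
          by (simp add: abs_mult abs_minus_commute del: of_nat_Suc)
        then show ?case using elim by (auto simp: indicator_def simp del: of_nat_Suc)
      qed
    qed (use kh in auto)
    also have "\<dots> \<le> (LINT t|lborel. inverse (real (Suc n)) * norm (conv k (h n) t))"
    proof (rule integral_mono)
      show "integrable lborel (\<lambda>t. inverse (real (Suc n)) * (indicator {..<T} t * \<bar>conv k (h n) t\<bar>))"
        using integrable_mult_indicator[OF _ integrable_abs[OF kh], of "{..<T}"]
        by (intro integrable_mult_right) simp
    qed (use kh in \<open>auto simp: indicator_def\<close>)
    also have "\<dots> = inverse (real (Suc n)) * (LINT t|lborel. norm (conv k (h n) t))" by simp
    also have "\<dots> \<le> inverse (real (Suc n)) * ((LINT t|lborel. \<bar>k t\<bar>) * (LINT t|lborel. norm (h n t)))"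
      by (intro mult_left_mono conv_L1_bound integrable_kernels integrable_h) simp
    also have "(LINT t|lborel. norm (h n t)) \<le> 1" using h_mass_le_1[of n] h_nonneg by simp
    finally show "(LINT t|lborel. indicator {..<T} t * \<bar>H n t - E t\<bar>) \<le> inverse (real (Suc n)) * (LINT t|lborel. \<bar>k t\<bar>)"
      by (simp add: mult_left_mono del: of_nat_Suc)
  qed
  show "(\<lambda>n. inverse (real (Suc n)) * (LINT t|lborel. \<bar>k t\<bar>)) \<longlonglongrightarrow> 0"
    by (intro tendsto_mult_left_zero LIMSEQ_inverse_real_of_nat)
qed

lemma conv_shift: "conv a (\<lambda>s. b (s - \<alpha>)) t = conv a b (t - \<alpha>)"
  unfolding conv_def using integral_reflect_shift(2)[of "\<lambda>r. a (t - \<alpha> - r) *\<^sub>R b r" \<alpha>] by simp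

text \<open>For an interval, the convolution with \<open>h n\<close> is a difference of two translates of \<open>H n\<close>. Since all
\<open>h n\<close> have mass at most 1, the convergence passes to \<open>L\<^sub>1\<close> limits.\<close>

lemma conv_h_cut_tendsto_L1:
  fixes g :: "real \<Rightarrow> 'b::euclidean_space"
  assumes "integrable lborel g"
  defines "D \<equiv> \<lambda>n g. LINT t|lborel. indicator {..<T} t * norm (conv (h n) (\<lambda>s. E s *\<^sub>R g s) t - E t *\<^sub>R g t)"
  shows "(\<lambda>n. D n g) \<longlonglongrightarrow> 0"
proof -
  have cut: "integrable lborel (\<lambda>s. E s *\<^sub>R g s)" "causal (\<lambda>s. E s *\<^sub>R g s)" if "integrable lborel g" for g :: "real \<Rightarrow> 'b"
    using integrable_mult_indicator[OF _ that, of "{0<..<T}"] by (auto simp: causal_def)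
  have Dint: "integrable lborel (\<lambda>t. indicator {..<T} t * norm (conv (h n) (\<lambda>s. E s *\<^sub>R g s) t - E t *\<^sub>R g t))"
    if "integrable lborel g" for n and g :: "real \<Rightarrow> 'b"
    using integrable_mult_indicator[of "{..<T}" lborel "\<lambda>t. norm (conv (h n) (\<lambda>s. E s *\<^sub>R g s) t - E t *\<^sub>R g t)"]
      cut[OF that] integrable_conv[OF integrable_h cut(1)[OF that], of n] by simp
  have Dadd: "D n (\<lambda>x. f x + g x) \<le> D n f + D n g" if f: "integrable lborel f" and g: "integrable lborel g" for f g n
  proof -
    have "D n (\<lambda>x. f x + g x) \<le> (LINT t|lborel. indicator {..<T} t * norm (conv (h n) (\<lambda>s. E s *\<^sub>R f s) t - E t *\<^sub>R f t)
      + indicator {..<T} t * norm (conv (h n) (\<lambda>s. E s *\<^sub>R g s) t - E t *\<^sub>R g t))" unfolding D_def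
    proof (rule integral_mono_AE)
      show "AE t in lborel. indicator {..<T} t * norm (conv (h n) (\<lambda>s. E s *\<^sub>R (f s + g s)) t - E t *\<^sub>R (f t + g t))
        \<le> indicator {..<T} t * norm (conv (h n) (\<lambda>s. E s *\<^sub>R f s) t - E t *\<^sub>R f t)
        + indicator {..<T} t * norm (conv (h n) (\<lambda>s. E s *\<^sub>R g s) t - E t *\<^sub>R g t)"
        using AE_conv_add_right[OF integrable_h cut(1)[OF f] cut(1)[OF g], of n]
      proof eventually_elim
        case (elim t)
        have "conv (h n) (\<lambda>s. E s *\<^sub>R (f s + g s)) t - E t *\<^sub>R (f t + g t)
          = (conv (h n) (\<lambda>s. E s *\<^sub>R f s) t - E t *\<^sub>R f t) + (conv (h n) (\<lambda>s. E s *\<^sub>R g s) t - E t *\<^sub>R g t)"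
          using elim by (simp add: scaleR_add_right)
        then show ?case by (simp add: norm_triangle_ineq distrib_left[symmetric] mult_left_mono del: distrib_left)
      qed
    qed (use f g in \<open>auto intro!: Dint Bochner_Integration.integrable_add\<close>)
    also have "\<dots> = D n f + D n g" unfolding D_def using Dint[OF f] Dint[OF g] by simp
    finally show ?thesis .
  qed
  have Dle: "D n g \<le> 2 * (LINT t|lborel. norm (g t))" if g: "integrable lborel g" for g n
  proof -
    have "D n g \<le> (LINT t|lborel. norm (conv (h n) (\<lambda>s. E s *\<^sub>R g s) t) + norm (E t *\<^sub>R g t))" unfolding D_def
    proof (rule integral_mono)
      fix t show "indicator {..<T} t * norm (conv (h n) (\<lambda>s. E s *\<^sub>R g s) t - E t *\<^sub>R g t) \<le> norm (conv (h n) (\<lambda>s. E s *\<^sub>R g s) t) + norm (E t *\<^sub>R g t)"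
        using norm_triangle_ineq4[of "conv (h n) (\<lambda>s. E s *\<^sub>R g s) t" "E t *\<^sub>R g t"]
        by (auto simp: indicator_def)
      show "integrable lborel (\<lambda>t. norm (conv (h n) (\<lambda>s. E s *\<^sub>R g s) t) + norm (E t *\<^sub>R g t))"
        by (intro Bochner_Integration.integrable_add integrable_norm integrable_conv integrable_h cut(1)[OF g])
    qed (rule Dint[OF g])
    also have "\<dots> = (LINT t|lborel. norm (conv (h n) (\<lambda>s. E s *\<^sub>R g s) t)) + (LINT t|lborel. norm (E t *\<^sub>R g t))"
      using cut(1)[OF g] integrable_conv[OF integrable_h cut(1)[OF g], of n] by (intro Bochner_Integration.integral_add integrable_norm)
    also have "\<dots> \<le> 2 * (LINT t|lborel. norm (E t *\<^sub>R g t))" using conv_h_L1_le[OF cut(1)[OF g], of n] by simp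
    also have "(LINT t|lborel. norm (E t *\<^sub>R g t)) \<le> (LINT t|lborel. norm (g t))"
      by (rule integral_mono[OF integrable_norm[OF cut(1)[OF g]] integrable_norm[OF g]]) (auto simp: indicator_def)
    finally show ?thesis by simp
  qed
  have D0: "0 \<le> D n g" for n g unfolding D_def by simp
  from assms(1) show ?thesis
  proof (induction rule: integrable_induct_Ioc)
    case (Ioc a b c)
    define \<alpha> \<beta> where "\<alpha> = max a 0" and "\<beta> = max \<alpha> b"
    define d where "d n = (LINT t|lborel. indicator {..<T} t * \<bar>H n t - E t\<bar>)" for n
    have di: "integrable lborel (\<lambda>t. indicator {..<T} t * \<bar>H n t - E t\<bar>)" for n
    proof (rule Bochner_Integration.integrable_bound[OF integrable_kernels(3)])
      show "AE t in lborel. norm (indicator {..<T} t * \<bar>H n t - E t\<bar>) \<le> norm (E t)"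
      proof (rule AE_I2)
        fix t
        have "H n t = 0" if "t \<le> 0" using H_conv[of t n] conv_eq_0[OF E h that] T that by simp
        then show "norm (indicator {..<T} t * \<bar>H n t - E t\<bar>) \<le> norm (E t)"
          using H_nonneg[of n t] H_le_1[of n t] by (cases "t \<le> 0") (auto simp: indicator_def)
      qed
    qed simp
    have shift: "integrable lborel (\<lambda>t. indicator {..<T} (t - \<gamma>) * \<bar>H n (t - \<gamma>) - E (t - \<gamma>)\<bar>)"
      "(LINT t|lborel. indicator {..<T} (t - \<gamma>) * \<bar>H n (t - \<gamma>) - E (t - \<gamma>)\<bar>) = d n" for \<gamma> n
      using integrable_reflect_shift(2)[OF di, of \<gamma>] integral_reflect_shift(2)[of "\<lambda>t. indicator {..<T} t * \<bar>H n t - E t\<bar>" \<gamma>]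
      by (auto simp: d_def)
    have bound: "D n (\<lambda>x. indicator {a<..b} x *\<^sub>R c) \<le> 2 * norm c * d n" for n
    proof -
      define e where "e \<gamma> s = E (s - \<gamma>)" for \<gamma> s
      have ei: "integrable lborel (e \<gamma>)" for \<gamma> unfolding e_def by (rule integrable_reflect_shift(2)[OF integrable_kernels(3)])
      have ec: "causal (e \<gamma>)" if "0 \<le> \<gamma>" for \<gamma> using ei[of \<gamma>] that by (auto simp: causal_def e_def)
      have \<alpha>\<beta>: "0 \<le> \<alpha>" "0 \<le> \<beta>" by (auto simp: \<alpha>_def \<beta>_def)
      define b' where "b' = (\<lambda>s. (e \<alpha> s - e \<beta> s) *\<^sub>R c)"
      have b'c: "causal b'" using ec[OF \<alpha>\<beta>(1)] ec[OF \<alpha>\<beta>(2)] by (auto simp: causal_def b'_def)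
      have base_i: "integrable lborel (\<lambda>x. indicator {a<..b} x *\<^sub>R c)"
        by (intro integrable_scaleR_left) (simp add: integrable_indicator_iff emeasure_lborel_Ioc_max)
      have pt: "E s *\<^sub>R indicator {a<..b} s *\<^sub>R c = b' s" if "s < T" for s
        using that by (auto simp: b'_def e_def \<alpha>_def \<beta>_def indicator_def)
      have "D n (\<lambda>x. indicator {a<..b} x *\<^sub>R c) \<le> (LINT t|lborel. norm c * (indicator {..<T} (t - \<alpha>) * \<bar>H n (t - \<alpha>) - E (t - \<alpha>)\<bar>)
         + norm c * (indicator {..<T} (t - \<beta>) * \<bar>H n (t - \<beta>) - E (t - \<beta>)\<bar>))"
        unfolding D_def
      proof (rule integral_mono_AE)
        show "AE t in lborel. indicator {..<T} t * norm (conv (h n) (\<lambda>s. E s *\<^sub>R indicator {a<..b} s *\<^sub>R c) t - E t *\<^sub>R indicator {a<..b} t *\<^sub>R c)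
          \<le> norm c * (indicator {..<T} (t - \<alpha>) * \<bar>H n (t - \<alpha>) - E (t - \<alpha>)\<bar>)
         + norm c * (indicator {..<T} (t - \<beta>) * \<bar>H n (t - \<beta>) - E (t - \<beta>)\<bar>)"
          using AE_conv_diff_right[OF integrable_h ei[of \<alpha>] ei[of \<beta>], of n]
        proof eventually_elim
          case (elim t)
          show ?case
          proof (cases "t < T")
            case True
            have "conv (h n) (\<lambda>s. E s *\<^sub>R indicator {a<..b} s *\<^sub>R c) t = conv (h n) b' t"
              by (rule conv_cong_AE[OF h h cut(2)[OF base_i] b'c, where T=T]) (use True pt in auto)
            also have "\<dots> = conv (h n) (\<lambda>s. e \<alpha> s - e \<beta> s) t *\<^sub>R c"
              using integral_scaleR_left[of c lborel "\<lambda>s. h n (t - s) * (e \<alpha> s - e \<beta> s)"]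
                Bochner_Integration.integrable_bound[OF integrable_reflect_shift(1)[OF integrable_h[of n], of t], of "\<lambda>s. h n (t - s) * (e \<alpha> s - e \<beta> s)"] 
              by (auto simp: conv_def b'_def e_def abs_mult mult_left_le indicator_def)
            also have "conv (h n) (\<lambda>s. e \<alpha> s - e \<beta> s) t = H n (t - \<alpha>) - H n (t - \<beta>)"
            proof -
              have "conv (h n) (e \<gamma>) t = conv E (h n) (t - \<gamma>)" for \<gamma>
                using conv_shift[of "h n" E \<gamma> t] conv_commute[of "h n" E "t - \<gamma>"] by (simp add: e_def[abs_def])
              then show ?thesis using elim True \<alpha>\<beta> H_conv[of "t - \<alpha>" n] H_conv[of "t - \<beta>" n] by simp
            qed
            finally have "conv (h n) (\<lambda>s. E s *\<^sub>R indicator {a<..b} s *\<^sub>R c) t - E t *\<^sub>R indicator {a<..b} t *\<^sub>R c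
              = ((H n (t - \<alpha>) - E (t - \<alpha>)) - (H n (t - \<beta>) - E (t - \<beta>))) *\<^sub>R c"
              using pt[OF True] by (simp add: b'_def e_def algebra_simps)
            then have "norm (conv (h n) (\<lambda>s. E s *\<^sub>R indicator {a<..b} s *\<^sub>R c) t - E t *\<^sub>R indicator {a<..b} t *\<^sub>R c)
              = \<bar>(H n (t - \<alpha>) - E (t - \<alpha>)) - (H n (t - \<beta>) - E (t - \<beta>))\<bar> * norm c" by simp
            also have "\<dots> \<le> (\<bar>H n (t - \<alpha>) - E (t - \<alpha>)\<bar> + \<bar>H n (t - \<beta>) - E (t - \<beta>)\<bar>) * norm c"
              by (intro mult_right_mono abs_triangle_ineq4) simp
            finally show ?thesis using True \<alpha>\<beta> by (simp add: algebra_simps)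
          next
            case False then show ?thesis by simp
          qed
        qed
      qed (use Dint[OF base_i] shift(1) in auto)
      also have "\<dots> = 2 * norm c * d n" using shift by simp
      finally show ?thesis .
    qed
    have "d \<longlonglongrightarrow> 0" unfolding d_def by (rule H_tendsto_L1)
    then have "(\<lambda>n. 2 * norm c * d n) \<longlonglongrightarrow> 0" by (rule tendsto_mult_right_zero)
    then show ?case
      by (rule tendsto_sandwich[OF always_eventually always_eventually tendsto_const, rotated 2]) (use D0 bound in auto)
  next
    case (add f g)
    have "(\<lambda>n. D n f + D n g) \<longlonglongrightarrow> 0" using tendsto_add[OF add.IH] by simp
    then show ?case
      by (rule tendsto_sandwich[OF always_eventually always_eventually tendsto_const, rotated 2])
        (use D0 Dadd[OF add.hyps] in auto)
  next
    case (lim f s)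
    show ?case
    proof (rule LIMSEQ_I)
      fix r :: real assume r: "r > 0"
      then have "\<forall>\<^sub>F i in sequentially. (LINT x|lborel. norm (s i x - f x)) < r / 4"
        by (intro order_tendstoD(2)[OF lim.hyps(3)]) simp
      then obtain i where i: "(LINT x|lborel. norm (s i x - f x)) < r / 4" by (auto simp: eventually_sequentially)
      have fs: "integrable lborel (\<lambda>x. f x - s i x)" using lim.hyps by auto
      from LIMSEQ_D[OF lim.IH[of i], of "r/2"] r obtain N where N: "\<And>n. n \<ge> N \<Longrightarrow> \<bar>D n (s i)\<bar> < r/2" by auto
      show "\<exists>N. \<forall>n\<ge>N. norm (D n f - 0) < r"
      proof (intro exI allI impI)
        fix n assume n: "n \<ge> N"
        have "D n f = D n (\<lambda>x. s i x + (f x - s i x))" by simp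
        also have "\<dots> \<le> D n (s i) + D n (\<lambda>x. f x - s i x)" by (rule Dadd[OF lim.hyps(1) fs])
        also have "D n (\<lambda>x. f x - s i x) \<le> 2 * (LINT x|lborel. norm (f x - s i x))" by (rule Dle[OF fs])
        also have "(LINT x|lborel. norm (f x - s i x)) = (LINT x|lborel. norm (s i x - f x))" by (simp add: norm_minus_commute)
        finally have "D n f < r" using N[OF n] i by simp
        then show "norm (D n f - 0) < r" using D0[of n f] by simp
      qed
    qed
  qed
qed

lemma conv_h_tendsto_L1:
  fixes g :: "real \<Rightarrow> 'b::euclidean_space"
  assumes g: "causal g"
  shows "(\<lambda>n. LINT t|lborel. indicator {..<T} t * norm (conv (h n) g t - g t)) \<longlonglongrightarrow> 0"
proof -
  have gi: "integrable lborel g" by (rule causalD(1)[OF g])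
  have c: "causal (\<lambda>s. E s *\<^sub>R g s)" by (rule causal_truncate(2)[OF g])
  have Eg: "E s *\<^sub>R g s = g s" if "s < T" for s
    using that causalD(2)[OF g, of s] by (cases "s \<le> 0") auto
  have "indicator {..<T} t * norm (conv (h n) (\<lambda>s. E s *\<^sub>R g s) t - E t *\<^sub>R g t) = indicator {..<T} t * norm (conv (h n) g t - g t)" for n t
  proof (cases "t < T")
    case True
    have "conv (h n) (\<lambda>s. E s *\<^sub>R g s) t = conv (h n) g t"
      by (rule conv_cong_AE[OF h h c g, where T=T]) (use True Eg in auto)
    then show ?thesis using Eg[OF True] by simp
  qed simp
  then show ?thesis using conv_h_cut_tendsto_L1[OF gi] by presburger
qed

lemma nonpos_if_conv_h_nonpos:
  assumes q: "causal q" and n: "\<And>n. AE t in lborel. t < T \<longrightarrow> conv (h n) q t \<le> 0"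
  shows "AE t in lborel. t < T \<longrightarrow> q t \<le> (0::real)"
proof -
  have qi: "integrable lborel q" by (rule causalD(1)[OF q])
  define u where "u n t = indicator {..<T} t * (conv (h n) q t - q t)" for n t
  have ui: "integrable lborel (u n)" for n
    using integrable_mult_indicator[of "{..<T}" lborel "\<lambda>t. conv (h n) q t - q t"] integrable_conv[OF integrable_h qi, of n] qi
    by (simp add: u_def[abs_def])
  have "(\<lambda>n. LINT t|lborel. norm (u n t)) \<longlonglongrightarrow> 0"
    using conv_h_tendsto_L1[OF q] by (simp add: u_def abs_mult)
  from tendsto_L1_AE_subseq[OF ui this] obtain r :: "nat \<Rightarrow> nat"
    where "AE t in lborel. (\<lambda>n. u (r n) t) \<longlonglongrightarrow> 0" by blast
  moreover have "AE t in lborel. \<forall>n. t < T \<longrightarrow> conv (h (r n)) q t \<le> 0"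
    unfolding AE_all_countable using n by blast
  ultimately show ?thesis
  proof eventually_elim
    case (elim t)
    show ?case
    proof
      assume t: "t < T"
      have "(\<lambda>n. conv (h (r n)) q t - q t) \<longlonglongrightarrow> 0" using elim(1) t by (simp add: u_def)
      then have "0 \<le> - q t" by (rule LIMSEQ_le_const2) (use elim(2) t in auto)
      then show "q t \<le> 0" by simp
    qed
  qed
qed

end

section \<open>The energy inequality for convolution quadratic forms\<close>

text \<open>Jensen's inequality for the measure with density \<open>\<bar>a (t - s)\<bar>\<close>.\<close>

lemma norm_conv_powr_le:
  fixes b :: "real \<Rightarrow> 'b::euclidean_space"
  assumes p: "p \<ge> 1" and a: "integrable lborel a" and b[measurable]: "b \<in> borel_measurable borel"
    and t: "integrable lborel (\<lambda>s. \<bar>a (t - s)\<bar> * norm (b s) powr p)"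
  shows "norm (conv a b t) powr p \<le> (LINT s|lborel. \<bar>a s\<bar>) powr (p - 1) * conv (\<lambda>s. \<bar>a s\<bar>) (\<lambda>s. norm (b s) powr p) t"
proof -
  have "norm (conv a b t) powr p \<le> conv (\<lambda>s. \<bar>a s\<bar>) (\<lambda>s. norm (b s)) t powr p"
    using p by (intro powr_mono2 norm_conv_le) auto
  also have "\<dots> \<le> (LINT s|lborel. \<bar>a (t - s)\<bar>) powr (p - 1) * (LINT s|lborel. \<bar>a (t - s)\<bar> * norm (b s) powr p)"
    unfolding conv_def real_scaleR_def
    by (rule power_mean_integral(2)[OF p _ _ _ _ t]) (use integrable_reflect_shift(1)[OF a, of t] in auto)
  also have "(LINT s|lborel. \<bar>a (t - s)\<bar>) = (LINT s|lborel. \<bar>a s\<bar>)"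
    by (rule integral_reflect_shift(1))
  finally show ?thesis by (simp add: conv_def)
qed

lemma young_convolution:
  fixes b :: "real \<Rightarrow> 'b::euclidean_space"
  assumes p: "p \<ge> 1" and a: "integrable lborel a" and b: "integrable lborel b"
    and bp: "integrable lborel (\<lambda>s. norm (b s) powr p)"
  shows "AE t in lborel. norm (conv a b t) powr p \<le> (LINT s|lborel. \<bar>a s\<bar>) powr (p - 1) * conv (\<lambda>s. \<bar>a s\<bar>) (\<lambda>s. norm (b s) powr p) t"
    and "integrable lborel (\<lambda>t. norm (conv a b t) powr p)"
    and "(LINT t|lborel. norm (conv a b t) powr p) \<le> (LINT s|lborel. \<bar>a s\<bar>) powr p * (LINT s|lborel. norm (b s) powr p)"
proof -
  have [measurable]: "b \<in> borel_measurable borel" using b by auto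
  have aa: "integrable lborel (\<lambda>s. \<bar>a s\<bar>)" using a by simp
  define A where "A = (LINT s|lborel. \<bar>a s\<bar>)"
  have A0: "A \<ge> 0" by (simp add: A_def)
  have bd: "integrable lborel (\<lambda>t. A powr (p - 1) * conv (\<lambda>s. \<bar>a s\<bar>) (\<lambda>s. norm (b s) powr p) t)"
    by (intro integrable_mult_right integrable_conv aa bp)
  show ae: "AE t in lborel. norm (conv a b t) powr p \<le> (LINT s|lborel. \<bar>a s\<bar>) powr (p - 1) * conv (\<lambda>s. \<bar>a s\<bar>) (\<lambda>s. norm (b s) powr p) t"
    using AE_integrable_conv[OF aa bp]
    by eventually_elim (rule norm_conv_powr_le[OF p a], use b in auto)
  have cm: "conv a b \<in> borel_measurable lborel" using integrable_conv[OF a b] by auto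
  show int: "integrable lborel (\<lambda>t. norm (conv a b t) powr p)"
    by (rule Bochner_Integration.integrable_bound[OF bd]) (use ae cm A0 in \<open>auto simp: A_def elim!: eventually_mono\<close>)
  have "(LINT t|lborel. norm (conv a b t) powr p) \<le> (LINT t|lborel. A powr (p - 1) * conv (\<lambda>s. \<bar>a s\<bar>) (\<lambda>s. norm (b s) powr p) t)"
    by (rule integral_mono_AE[OF int bd]) (use ae in \<open>simp add: A_def\<close>)
  also have "\<dots> = A powr (p - 1) * (A * (LINT s|lborel. norm (b s) powr p))"
    using integral_conv[OF aa bp] by (simp add: A_def)
  also have "\<dots> = A powr p * (LINT s|lborel. norm (b s) powr p)"
    using A0 powr_add[of A "p - 1" 1] by (cases "A = 0") auto
  finally show "(LINT t|lborel. norm (conv a b t) powr p) \<le> (LINT s|lborel. \<bar>a s\<bar>) powr p * (LINT s|lborel. norm (b s) powr p)"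
    by (simp add: A_def)
qed

lemma conv_square_integrable:
  fixes b :: "real \<Rightarrow> 'b::euclidean_space"
  assumes "integrable lborel a" "integrable lborel b" "integrable lborel (\<lambda>s. (norm (b s))\<^sup>2)"
  shows "integrable lborel (\<lambda>t. (norm (conv a b t))\<^sup>2)"
  using young_convolution(2)[of 2 a b] assms by simp

lemma integrable_inner_L2:
  fixes f g :: "'a \<Rightarrow> 'b::euclidean_space"
  assumes [measurable]: "f \<in> borel_measurable M" "g \<in> borel_measurable M"
    and f: "integrable M (\<lambda>x. (norm (f x))\<^sup>2)" and g: "integrable M (\<lambda>x. (norm (g x))\<^sup>2)"
  shows "integrable M (\<lambda>x. f x \<bullet> g x)" "integrable M (\<lambda>x. norm (f x) * norm (g x))"
proof -
  have i: "integrable M (\<lambda>x. ((norm (f x))\<^sup>2 + (norm (g x))\<^sup>2) / 2)" using f g by simp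
  have ineq: "norm (f x) * norm (g x) \<le> ((norm (f x))\<^sup>2 + (norm (g x))\<^sup>2) / 2" for x
    using sum_squares_bound[of "norm (f x)" "norm (g x)"] by simp
  show "integrable M (\<lambda>x. norm (f x) * norm (g x))"
    by (rule Bochner_Integration.integrable_bound[OF i]) (use ineq in auto)
  show "integrable M (\<lambda>x. f x \<bullet> g x)"
  proof (rule Bochner_Integration.integrable_bound[OF i])
    show "AE x in M. norm (f x \<bullet> g x) \<le> norm (((norm (f x))\<^sup>2 + (norm (g x))\<^sup>2) / 2)"
    proof (rule AE_I2)
      fix x show "norm (f x \<bullet> g x) \<le> norm (((norm (f x))\<^sup>2 + (norm (g x))\<^sup>2) / 2)"
        using order_trans[OF Cauchy_Schwarz_ineq2[of "f x" "g x"] ineq[of x]] by simp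
    qed
  qed simp
qed

context PC_regularized
begin

text \<open>Since \<open>h n = \<nu> (l - h n * l)\<close> with \<open>\<nu> = Suc n\<close>, the regularization of \<open>g\<close> is the Yosida
approximation, at the point \<open>l * g\<close>, of the operator that inverts convolution with \<open>l\<close>.\<close>

lemma conv_h_resolvent:
  fixes g :: "real \<Rightarrow> 'b::euclidean_space"
  assumes g: "causal g"
  shows "AE t in lborel. t < T \<longrightarrow> conv (h n) g t = real (Suc n) *\<^sub>R (conv l g t - conv (h n) (conv l g) t)"
proof -
  have gi: "integrable lborel g" by (rule causalD(1)[OF g])
  define \<nu> where "\<nu> = real (Suc n)"
  note li = integrable_kernels(2)
  define a where "a s = \<nu> * l s - \<nu> * conv (h n) l s" for s
  have hl: "integrable lborel (conv (h n) l)" "causal (conv (h n) l)" by (intro integrable_conv integrable_h li causal_conv h l)+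
  have i1: "integrable lborel (\<lambda>s. \<nu> * l s)" "integrable lborel (\<lambda>s. \<nu> * conv (h n) l s)" using hl li by auto
  have a: "causal a" using hl l Bochner_Integration.integrable_diff[OF i1] by (auto simp: causal_def a_def[abs_def])
  show ?thesis
    using AE_conv_diff_left[OF i1 gi] AE_conv_assoc[OF integrable_h li gi, of n]
  proof eventually_elim
    case (elim t)
    show ?case
    proof
      assume t: "t < T"
      have "conv (h n) g t = conv a g t"
        by (rule conv_cong_AE[OF h a g g, where T=T])
          (use t h_eq[of n] in \<open>auto simp: a_def \<nu>_def elim!: eventually_mono\<close>)
      also have "\<dots> = \<nu> *\<^sub>R conv l g t - \<nu> *\<^sub>R conv (conv (h n) l) g t"
        using elim(1) by (simp add: a_def[abs_def] conv_scaleR_left)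
      finally show "conv (h n) g t = real (Suc n) *\<^sub>R (conv l g t - conv (h n) (conv l g) t)"
        using elim(2) by (simp add: scaleR_diff_right \<nu>_def)
    qed
  qed
qed

text \<open>Integration up to \<open>T\<close> is convolution with the unit step, evaluated at \<open>T\<close>; associativity moves the
step onto \<open>h n\<close>.\<close>

lemma integral_conv_h_upto_T:
  fixes q :: "real \<Rightarrow> real"
  assumes q: "causal q"
  shows "(LINT t|lborel. E t * conv (h n) q t) = (LINT s|lborel. E s * H n (T - s) * q s)"
proof -
  have qi: "integrable lborel q" by (rule causalD(1)[OF q])
  have [measurable]: "q \<in> borel_measurable borel" using qi by auto
  have hq: "causal (conv (h n) q)" by (rule causal_conv[OF h q])
  have hqi: "integrable lborel (conv (h n) q)" by (rule causalD(1)[OF hq])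
  have abs: "integrable lborel (conv (\<lambda>s. \<bar>h n s\<bar>) (\<lambda>s. norm (q s)))"
    using integrable_h[of n] qi by (intro integrable_conv) auto
  have neT: "AE s in lborel. s \<noteq> T" by (rule AE_lborel_singleton)
  have "(LINT t|lborel. E t * conv (h n) q t) = (LINT t|lborel. indicator {..T} t * conv (h n) q t)"
  proof (rule integral_cong_AE)
    show "AE t in lborel. E t * conv (h n) q t = indicator {..T} t * conv (h n) q t"
      using neT
    proof eventually_elim
      case (elim t)
      show ?case by (cases "t \<le> 0") (use elim causalD(2)[OF hq] in \<open>auto simp: indicator_def\<close>)
    qed
  qed (use hqi in auto)
  also have "\<dots> = conv E (conv (h n) q) T" using conv_unit_interval[OF hq, of T T] by simp
  also have "\<dots> = conv (conv E (h n)) q T"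
  proof (rule conv_assoc_at[symmetric, OF _ integrable_h qi])
    show "integrable lborel (\<lambda>\<sigma>. \<bar>E (T - \<sigma>)\<bar> * conv (\<lambda>s. \<bar>h n s\<bar>) (\<lambda>s. norm (q s)) \<sigma>)"
    proof (rule Bochner_Integration.integrable_bound[OF abs])
      show "(\<lambda>\<sigma>. \<bar>E (T - \<sigma>)\<bar> * conv (\<lambda>s. \<bar>h n s\<bar>) (\<lambda>s. norm (q s)) \<sigma>) \<in> borel_measurable lborel"
        using abs by measurable
    qed (auto simp: indicator_def)
  qed simp
  also have "\<dots> = (LINT s|lborel. E s * H n (T - s) * q s)" unfolding conv_def[of "conv E (h n)"]
  proof (rule integral_cong_AE)
    have "conv E (h n) \<in> borel_measurable borel" using integrable_conv[OF integrable_kernels(3) integrable_h, of n] by auto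
    then show "(\<lambda>s. conv E (h n) (T - s) *\<^sub>R q s) \<in> borel_measurable lborel" by measurable
    show "AE s in lborel. conv E (h n) (T - s) *\<^sub>R q s = E s * H n (T - s) * q s"
      using neT
    proof eventually_elim
      case (elim s)
      consider "s \<le> 0" | "0 < s" "s < T" | "T < s" using elim by linarith
      then show ?case
      proof cases
        case 1 then show ?thesis using causalD(2)[OF q] by simp
      next
        case 2 then show ?thesis using H_conv[of "T - s" n] by simp
      next
        case 3 then show ?thesis using conv_eq_0[OF E h, of "T - s" n] by simp
      qed
    qed
  qed measurable
  finally show ?thesis .
qed

lemma conv_h_square_le:
  fixes g :: "real \<Rightarrow> 'b::euclidean_space"
  assumes g: "integrable lborel g" and g2: "integrable lborel (\<lambda>s. (norm (g s))\<^sup>2)"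
  shows "AE t in lborel. (norm (conv (h n) g t))\<^sup>2 \<le> conv (h n) (\<lambda>s. (norm (g s))\<^sup>2) t"
proof -
  have "AE t in lborel. norm (conv (h n) g t) powr 2 \<le> (LINT s|lborel. \<bar>h n s\<bar>) powr (2 - 1) * conv (\<lambda>s. \<bar>h n s\<bar>) (\<lambda>s. norm (g s) powr 2) t"
    by (rule young_convolution(1)[OF _ integrable_h g]) (use g2 in auto)
  then show ?thesis
  proof eventually_elim
    case (elim t)
    have "(norm (conv (h n) g t))\<^sup>2 \<le> (LINT s|lborel. h n s) * conv (h n) (\<lambda>s. (norm (g s))\<^sup>2) t"
      using elim h_nonneg by simp
    also have "\<dots> \<le> 1 * conv (h n) (\<lambda>s. (norm (g s))\<^sup>2) t"
      by (intro mult_right_mono h_mass_le_1) (simp add: conv_def h_nonneg)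
    finally show ?case by simp
  qed
qed

text \<open>With \<open>p = l * g\<close> and \<open>\<nu> = Suc n\<close>, the integrand on the right is \<open>\<nu> (\<bar>p\<bar>\<^sup>2 - p \<bullet> (h n * p))\<close>. By
\<open>2 p(t) \<bullet> p(s) \<le> \<bar>p(t)\<bar>\<^sup>2 + \<bar>p(s)\<bar>\<^sup>2\<close>, twice the mixed term is at most
\<open>H n t \<bar>p(t)\<bar>\<^sup>2 + (h n * \<bar>p\<bar>\<^sup>2)(t)\<close>, and after integration over \<open>(0,T)\<close> the second summand carries
the weight \<open>H n (T - t)\<close>.\<close>

lemma energy_regularized:
  fixes g :: "real \<Rightarrow> 'b::euclidean_space"
  assumes g: "causal g" and g2: "integrable lborel (\<lambda>s. (norm (g s))\<^sup>2)"
  shows "(LINT t|lborel. E t * (real (Suc n) * ((1 - H n t) + (1 - H n (T - t))) * (norm (conv l g t))\<^sup>2))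
     \<le> 2 * (LINT t|lborel. E t * (conv l g t \<bullet> conv (h n) g t))"
proof -
  define \<nu> where "\<nu> = real (Suc n)"
  have \<nu>: "\<nu> > 0" by (simp add: \<nu>_def)
  have gi: "integrable lborel g" by (rule causalD(1)[OF g])
  define p where "p = conv l g"
  have p: "causal p" unfolding p_def by (rule causal_conv[OF l g])
  have pi: "integrable lborel p" by (rule causalD(1)[OF p])
  have [measurable]: "p \<in> borel_measurable borel" "g \<in> borel_measurable borel" using pi gi by auto
  have p2: "integrable lborel (\<lambda>s. (norm (p s))\<^sup>2)" unfolding p_def
    by (rule conv_square_integrable[OF integrable_kernels(2) gi g2])
  have p2c: "causal (\<lambda>s. (norm (p s))\<^sup>2)" using p p2 by (auto simp: causal_def)
  have hp: "integrable lborel (conv (h n) p)" "integrable lborel (\<lambda>t. (norm (conv (h n) p t))\<^sup>2)"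
    by (intro integrable_conv conv_square_integrable integrable_h pi p2)+
  have hg: "integrable lborel (conv (h n) g)" "integrable lborel (\<lambda>t. (norm (conv (h n) g t))\<^sup>2)"
    by (intro integrable_conv conv_square_integrable integrable_h gi g2)+
  have hp2: "integrable lborel (conv (h n) (\<lambda>s. (norm (p s))\<^sup>2))" by (intro integrable_conv integrable_h p2)
  have [measurable]: "conv (h n) p \<in> borel_measurable borel" "conv (h n) g \<in> borel_measurable borel"
    "conv (h n) (\<lambda>s. (norm (p s))\<^sup>2) \<in> borel_measurable borel" using hp hg hp2 by auto
  have Ei: "integrable lborel (\<lambda>t. E t * f t)" if "integrable lborel f" for f :: "real \<Rightarrow> real"
    using integrable_mult_indicator[OF _ that, of "{0<..<T}"] by simp
  have bdd: "integrable lborel (\<lambda>t. E t * (w t * (norm (p t))\<^sup>2))"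
    if [measurable]: "w \<in> borel_measurable borel" and "\<And>t. \<bar>w t\<bar> \<le> c" for w c
  proof (rule Bochner_Integration.integrable_bound)
    show "integrable lborel (\<lambda>t. c * (norm (p t))\<^sup>2)" using p2 by simp
    show "AE t in lborel. norm (E t * (w t * (norm (p t))\<^sup>2)) \<le> norm (c * (norm (p t))\<^sup>2)"
    proof (rule AE_I2)
      fix t
      have "\<bar>w t\<bar> * (norm (p t))\<^sup>2 \<le> \<bar>c\<bar> * (norm (p t))\<^sup>2" using that(2)[of t] by (intro mult_right_mono) auto
      then show "norm (E t * (w t * (norm (p t))\<^sup>2)) \<le> norm (c * (norm (p t))\<^sup>2)"
        by (auto simp: indicator_def abs_mult)
    qed
  qed simp
  have Habs: "\<bar>H n t\<bar> \<le> 1" for t using H_nonneg[of n t] H_le_1[of n t] by simp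
  have iH: "integrable lborel (\<lambda>t. E t * (H n t * (norm (p t))\<^sup>2))" by (rule bdd[OF _ Habs]) simp
  have iH': "integrable lborel (\<lambda>t. E t * (H n (T - t) * (norm (p t))\<^sup>2))" by (rule bdd[OF _ Habs]) simp
  have i1: "integrable lborel (\<lambda>t. E t * (norm (p t))\<^sup>2)" by (rule Ei[OF p2])
  have i2: "integrable lborel (\<lambda>t. E t * conv (h n) (\<lambda>s. (norm (p s))\<^sup>2) t)" by (rule Ei[OF hp2])
  have ip: "integrable lborel (\<lambda>t. E t * (p t \<bullet> conv (h n) g t))"
    by (intro Ei integrable_inner_L2) (use p2 hg in auto)
  have young: "AE t in lborel. 2 * (p t \<bullet> conv (h n) p t) \<le> H n t * (norm (p t))\<^sup>2 + conv (h n) (\<lambda>s. (norm (p s))\<^sup>2) t"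
    using AE_integrable_conv[OF integrable_h pi, of n] AE_integrable_conv[OF integrable_h p2, of n]
  proof eventually_elim
    case (elim t)
    have posi: "integrable lborel (\<lambda>s. indicator {..t} (t - s) * h n (t - s))"
      using integrable_reflect_shift(1)[OF H_int[of t n], of t] by simp
    have "2 * (p t \<bullet> conv (h n) p t) = (LINT s|lborel. 2 * (p t \<bullet> (h n (t - s) *\<^sub>R p s)))"
    proof -
      have "(LINT s|lborel. p t \<bullet> (h n (t - s) *\<^sub>R p s)) = p t \<bullet> conv (h n) p t"
        unfolding conv_def by (rule integral_inner_right) (rule elim(1))
      then show ?thesis by (simp only: integral_mult_right_zero)
    qed
    also have "\<dots> \<le> (LINT s|lborel. (indicator {..t} (t - s) * h n (t - s)) * (norm (p t))\<^sup>2 + h n (t - s) *\<^sub>R (norm (p s))\<^sup>2)"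
    proof (rule integral_mono)
      show "integrable lborel (\<lambda>s. 2 * (p t \<bullet> (h n (t - s) *\<^sub>R p s)))"
        using elim(1) by (intro integrable_mult_right integrable_inner_right)
      show "integrable lborel (\<lambda>s. (indicator {..t} (t - s) * h n (t - s)) * (norm (p t))\<^sup>2 + h n (t - s) *\<^sub>R (norm (p s))\<^sup>2)"
        using elim(2) posi by (intro Bochner_Integration.integrable_add integrable_mult_left)
      fix s
      have "2 * (p t \<bullet> p s) \<le> (norm (p t))\<^sup>2 + (norm (p s))\<^sup>2"
        using norm_cauchy_schwarz[of "p t" "p s"] sum_squares_bound[of "norm (p t)" "norm (p s)"] by linarith
      then have *: "h n (t - s) * (2 * (p t \<bullet> p s)) \<le> h n (t - s) * ((norm (p t))\<^sup>2 + (norm (p s))\<^sup>2)"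
        by (rule mult_left_mono[OF _ h_nonneg])
      show "2 * (p t \<bullet> (h n (t - s) *\<^sub>R p s)) \<le> (indicator {..t} (t - s) * h n (t - s)) * (norm (p t))\<^sup>2 + h n (t - s) *\<^sub>R (norm (p s))\<^sup>2"
      proof (cases "s < 0")
        case True then show ?thesis using causalD(2)[OF p, of s] by simp
      next
        case False then show ?thesis using * by (simp add: algebra_simps)
      qed
    qed
    also have "\<dots> = (LINT s|lborel. indicator {..t} (t - s) * h n (t - s)) * (norm (p t))\<^sup>2 + conv (h n) (\<lambda>s. (norm (p s))\<^sup>2) t"
      unfolding conv_def using elim(2) posi by simp
    also have "(LINT s|lborel. indicator {..t} (t - s) * h n (t - s)) = H n t"
      unfolding H_def by (rule integral_reflect_shift(1))
    finally show ?case .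
  qed
  have "(LINT t|lborel. E t * (\<nu> * ((1 - H n t) + (1 - H n (T - t))) * (norm (p t))\<^sup>2))
      = (LINT t|lborel. \<nu> * (2 * (E t * (norm (p t))\<^sup>2) - E t * (H n t * (norm (p t))\<^sup>2)) - \<nu> * (E t * (H n (T - t) * (norm (p t))\<^sup>2)))"
    by (rule Bochner_Integration.integral_cong) (auto simp: algebra_simps)
  also have "\<dots> = \<nu> * (LINT t|lborel. 2 * (E t * (norm (p t))\<^sup>2) - E t * (H n t * (norm (p t))\<^sup>2)) - \<nu> * (LINT t|lborel. E t * (H n (T - t) * (norm (p t))\<^sup>2))"
    using i1 iH iH' by simp
  also have "(LINT t|lborel. E t * (H n (T - t) * (norm (p t))\<^sup>2)) = (LINT t|lborel. E t * conv (h n) (\<lambda>s. (norm (p s))\<^sup>2) t)"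
    using integral_conv_h_upto_T[OF p2c, of n] by (simp add: mult.assoc)
  also have "\<nu> * (LINT t|lborel. 2 * (E t * (norm (p t))\<^sup>2) - E t * (H n t * (norm (p t))\<^sup>2)) - \<nu> * (LINT t|lborel. E t * conv (h n) (\<lambda>s. (norm (p s))\<^sup>2) t)
    = (LINT t|lborel. \<nu> * (2 * (E t * (norm (p t))\<^sup>2) - E t * (H n t * (norm (p t))\<^sup>2)) - \<nu> * (E t * conv (h n) (\<lambda>s. (norm (p s))\<^sup>2) t))"
    using i1 iH i2 by simp
  also have "\<dots> \<le> (LINT t|lborel. 2 * (E t * (p t \<bullet> conv (h n) g t)))"
  proof (rule integral_mono_AE)
    show "AE t in lborel. \<nu> * (2 * (E t * (norm (p t))\<^sup>2) - E t * (H n t * (norm (p t))\<^sup>2)) - \<nu> * (E t * conv (h n) (\<lambda>s. (norm (p s))\<^sup>2) t)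
       \<le> 2 * (E t * (p t \<bullet> conv (h n) g t))"
      using young conv_h_resolvent[OF g, of n]
    proof eventually_elim
      case (elim t)
      show ?case
      proof (cases "0 < t \<and> t < T")
        case True
        then have "p t \<bullet> conv (h n) g t = \<nu> * ((norm (p t))\<^sup>2 - p t \<bullet> conv (h n) p t)"
          using elim(2) by (simp add: p_def \<nu>_def inner_diff_right power2_norm_eq_inner del: of_nat_Suc)
        moreover have "\<nu> * (2 * (norm (p t))\<^sup>2 - H n t * (norm (p t))\<^sup>2 - conv (h n) (\<lambda>s. (norm (p s))\<^sup>2) t)
          \<le> \<nu> * (2 * (norm (p t))\<^sup>2 - 2 * (p t \<bullet> conv (h n) p t))"
          using elim(1) \<nu> by (intro mult_left_mono) auto
        ultimately show ?thesis using True by (simp add: algebra_simps)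
      next
        case False then show ?thesis by auto
      qed
    qed
  qed (use i1 iH i2 ip in auto)
  also have "\<dots> = 2 * (LINT t|lborel. E t * (p t \<bullet> conv (h n) g t))" by simp
  finally show ?thesis by (simp add: p_def \<nu>_def)
qed

text \<open>Fatou's lemma in the regularized inequality, whose weights are \<open>k\<^sub>n(t) + k\<^sub>n(T - t)\<close>. The
functions \<open>h n * g\<close> converge to \<open>g\<close> in \<open>L\<^sub>1\<close>, which says nothing about the products with \<open>p\<close>.
Therefore the square is completed: \<open>\<bar>p\<bar>\<^sup>2 + h n * \<bar>g\<bar>\<^sup>2 - 2 p \<bullet> (h n * g)\<close> is nonnegative by Jensen's
inequality, and the integral of \<open>h n * \<bar>g\<bar>\<^sup>2\<close> does not exceed that of \<open>\<bar>g\<bar>\<^sup>2\<close>.\<close>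

theorem energy_inequality:
  fixes g :: "real \<Rightarrow> 'b::euclidean_space"
  assumes g: "causal g" and g2: "integrable lborel (\<lambda>s. (norm (g s))\<^sup>2)"
  shows "(\<integral>\<^sup>+t. ennreal (E t * ((k t + k (T - t)) * (norm (conv l g t))\<^sup>2)) \<partial>lborel)
     \<le> ennreal (2 * (LINT t|lborel. E t * (conv l g t \<bullet> g t)))"
    and "0 \<le> (LINT t|lborel. E t * (conv l g t \<bullet> g t))"
proof -
  have gi: "integrable lborel g" by (rule causalD(1)[OF g])
  define p where "p = conv l g"
  have p: "causal p" unfolding p_def by (rule causal_conv[OF l g])
  have pi: "integrable lborel p" by (rule causalD(1)[OF p])
  have [measurable]: "p \<in> borel_measurable borel" "g \<in> borel_measurable borel" using pi gi by auto
  have p2: "integrable lborel (\<lambda>s. (norm (p s))\<^sup>2)" unfolding p_def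
    by (rule conv_square_integrable[OF integrable_kernels(2) gi g2])
  have g2c: "causal (\<lambda>s. (norm (g s))\<^sup>2)" using g g2 by (auto simp: causal_def)
  have kh: "integrable lborel (conv (h n) k)" for n by (intro integrable_conv integrable_h integrable_kernels)
  have hg: "integrable lborel (conv (h n) g)" "integrable lborel (\<lambda>t. (norm (conv (h n) g t))\<^sup>2)" for n
    by (intro integrable_conv conv_square_integrable integrable_h gi g2)+
  have hg2: "integrable lborel (conv (h n) (\<lambda>s. (norm (g s))\<^sup>2))" for n by (intro integrable_conv integrable_h g2)
  have [measurable]: "conv (h n) k \<in> borel_measurable borel" "conv (h n) g \<in> borel_measurable borel"
    "conv (h n) (\<lambda>s. (norm (g s))\<^sup>2) \<in> borel_measurable borel" for n using kh[of n] hg(1)[of n] hg2[of n] by auto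
  have cut: "integrable lborel (\<lambda>t. indicator {..<T} t * f t)" if "integrable lborel f" for f :: "real \<Rightarrow> real"
    using integrable_mult_indicator[OF _ that, of "{..<T}"] by simp
  have Ei: "integrable lborel (\<lambda>t. E t * f t)" if "integrable lborel f" for f :: "real \<Rightarrow> real"
    using integrable_mult_indicator[OF _ that, of "{0<..<T}"] by simp
  \<comment> \<open>One subsequence for the three convergences \<open>h n * k\<close>, \<open>h n * g\<close> and \<open>h n * \<bar>g\<bar>\<^sup>2\<close>.\<close>
  define u where "u n t = indicator {..<T} t * norm (conv (h n) k t - k t) + indicator {..<T} t * norm (conv (h n) g t - g t)
     + indicator {..<T} t * norm (conv (h n) (\<lambda>s. (norm (g s))\<^sup>2) t - (norm (g t))\<^sup>2)" for n t
  have ui3: "integrable lborel (\<lambda>t. indicator {..<T} t * norm (conv (h n) k t - k t))"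
    "integrable lborel (\<lambda>t. indicator {..<T} t * norm (conv (h n) g t - g t))"
    "integrable lborel (\<lambda>t. indicator {..<T} t * norm (conv (h n) (\<lambda>s. (norm (g s))\<^sup>2) t - (norm (g t))\<^sup>2))" for n
    by (intro cut integrable_norm Bochner_Integration.integrable_diff kh integrable_kernels hg gi hg2 g2)+
  have ui: "integrable lborel (u n)" for n unfolding u_def by (intro Bochner_Integration.integrable_add ui3)
  have u0: "0 \<le> u n t" for n t by (simp add: u_def)
  have "(\<lambda>n. LINT t|lborel. norm (u n t)) \<longlonglongrightarrow> 0 + 0 + 0"
  proof -
    have "(LINT t|lborel. norm (u n t)) = (LINT t|lborel. indicator {..<T} t * norm (conv (h n) k t - k t))
      + (LINT t|lborel. indicator {..<T} t * norm (conv (h n) g t - g t))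
      + (LINT t|lborel. indicator {..<T} t * norm (conv (h n) (\<lambda>s. (norm (g s))\<^sup>2) t - (norm (g t))\<^sup>2))" for n
    proof -
      have "(LINT t|lborel. norm (u n t)) = (LINT t|lborel. u n t)" using u0 by simp
      then show ?thesis unfolding u_def using ui3[of n] by (simp only: Bochner_Integration.integral_add Bochner_Integration.integrable_add)
    qed
    then show ?thesis
      by (simp only:) (intro tendsto_add conv_h_tendsto_L1 k g g2c)
  qed
  then have "(\<lambda>n. LINT t|lborel. norm (u n t)) \<longlonglongrightarrow> 0" by simp
  from tendsto_L1_AE_subseq[OF ui this] obtain r :: "nat \<Rightarrow> nat"
    where r: "AE t in lborel. (\<lambda>n. u (r n) t) \<longlonglongrightarrow> 0" by blast
  define \<Phi> where "\<Phi> n t = E t * (real (Suc n) * ((1 - H n t) + (1 - H n (T - t))) * (norm (p t))\<^sup>2)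
      + (E t * (norm (p t))\<^sup>2 + E t * conv (h n) (\<lambda>s. (norm (g s))\<^sup>2) t - 2 * (E t * (p t \<bullet> conv (h n) g t)))" for n t
  define R where "R t = E t * (norm (p t))\<^sup>2 + E t * (norm (g t))\<^sup>2 - 2 * (E t * (p t \<bullet> g t))" for t
  define X where "X t = E t * ((k t + k (T - t)) * (norm (p t))\<^sup>2)" for t
  have [measurable]: "\<Phi> n \<in> borel_measurable borel" "R \<in> borel_measurable borel" "X \<in> borel_measurable borel" for n
    unfolding \<Phi>_def R_def X_def by measurable
  have igp: "integrable lborel (\<lambda>t. E t * (p t \<bullet> g t))"
    by (intro Ei integrable_inner_L2) (use p2 g2 in auto)
  have Ri: "integrable lborel R" unfolding R_def using Ei[OF p2] Ei[OF g2] igp by simp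
  have R0: "0 \<le> R t" for t
  proof -
    have "R t = E t * (norm (p t - g t))\<^sup>2"
      by (simp add: R_def power2_norm_eq_inner inner_diff_left inner_diff_right inner_commute algebra_simps)
    then show ?thesis by simp
  qed
  have X0: "0 \<le> X t" for t using k_nonneg by (simp add: X_def)
  have \<Phi>0: "AE t in lborel. 0 \<le> \<Phi> n t" for n
    using conv_h_square_le[OF gi g2, of n]
  proof eventually_elim
    case (elim t)
    have "0 \<le> (norm (p t - conv (h n) g t))\<^sup>2" by simp
    also have "\<dots> = (norm (p t))\<^sup>2 + (norm (conv (h n) g t))\<^sup>2 - 2 * (p t \<bullet> conv (h n) g t)"
      by (simp add: power2_norm_eq_inner inner_diff_left inner_diff_right inner_commute)
    also have "\<dots> \<le> (norm (p t))\<^sup>2 + conv (h n) (\<lambda>s. (norm (g s))\<^sup>2) t - 2 * (p t \<bullet> conv (h n) g t)" using elim by simp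
    finally have "0 \<le> E t * ((norm (p t))\<^sup>2 + conv (h n) (\<lambda>s. (norm (g s))\<^sup>2) t - 2 * (p t \<bullet> conv (h n) g t))" by simp
    moreover have "0 \<le> E t * (real (Suc n) * ((1 - H n t) + (1 - H n (T - t))) * (norm (p t))\<^sup>2)"
      using H_le_1[of n t] H_le_1[of n "T - t"] by simp
    ultimately show ?case by (simp add: \<Phi>_def algebra_simps)
  qed
  have \<Phi>i: "integrable lborel (\<Phi> n)" "(LINT t|lborel. \<Phi> n t) \<le> (LINT t|lborel. E t * (norm (p t))\<^sup>2) + (LINT t|lborel. E t * (norm (g t))\<^sup>2)" for n
  proof -
    have iH: "integrable lborel (\<lambda>t. E t * (real (Suc n) * ((1 - H n t) + (1 - H n (T - t))) * (norm (p t))\<^sup>2))"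
    proof (rule Bochner_Integration.integrable_bound)
      show "integrable lborel (\<lambda>t. real (Suc n) * 2 * (norm (p t))\<^sup>2)" using p2 by simp
      show "AE t in lborel. norm (E t * (real (Suc n) * ((1 - H n t) + (1 - H n (T - t))) * (norm (p t))\<^sup>2)) \<le> norm (real (Suc n) * 2 * (norm (p t))\<^sup>2)"
      proof (rule AE_I2)
        fix t
        have "real (Suc n) * ((1 - H n t) + (1 - H n (T - t))) * (norm (p t))\<^sup>2 \<le> real (Suc n) * 2 * (norm (p t))\<^sup>2"
          using H_nonneg[of n t] H_nonneg[of n "T - t"] by (intro mult_right_mono mult_left_mono) auto
        moreover have "0 \<le> real (Suc n) * ((1 - H n t) + (1 - H n (T - t))) * (norm (p t))\<^sup>2"
          using H_le_1[of n t] H_le_1[of n "T - t"] by simp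
        ultimately show "norm (E t * (real (Suc n) * ((1 - H n t) + (1 - H n (T - t))) * (norm (p t))\<^sup>2)) \<le> norm (real (Suc n) * 2 * (norm (p t))\<^sup>2)"
          unfolding real_norm_def by (cases "0 < t \<and> t < T") auto
      qed
    qed measurable
    have ip: "integrable lborel (\<lambda>t. E t * (p t \<bullet> conv (h n) g t))"
      by (intro Ei integrable_inner_L2) (use p2 hg[of n] in auto)
    note i2 = Ei[OF p2] Ei[OF hg2[of n]]
    show "integrable lborel (\<Phi> n)" unfolding \<Phi>_def using iH ip i2
      by (intro Bochner_Integration.integrable_add Bochner_Integration.integrable_diff integrable_mult_right)
    have "(LINT t|lborel. \<Phi> n t) = (LINT t|lborel. E t * (real (Suc n) * ((1 - H n t) + (1 - H n (T - t))) * (norm (p t))\<^sup>2))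
      + ((LINT t|lborel. E t * (norm (p t))\<^sup>2) + (LINT t|lborel. E t * conv (h n) (\<lambda>s. (norm (g s))\<^sup>2) t) - 2 * (LINT t|lborel. E t * (p t \<bullet> conv (h n) g t)))"
    proof -
      have "integrable lborel (\<lambda>t. 2 * (E t * (p t \<bullet> conv (h n) g t)))" using ip by (rule integrable_mult_right)
      then show ?thesis unfolding \<Phi>_def using iH i2
        by (simp only: Bochner_Integration.integral_add Bochner_Integration.integral_diff
          Bochner_Integration.integrable_add Bochner_Integration.integrable_diff integral_mult_right_zero)
    qed
    also have "\<dots> \<le> (LINT t|lborel. E t * (norm (p t))\<^sup>2) + (LINT t|lborel. E t * conv (h n) (\<lambda>s. (norm (g s))\<^sup>2) t)"
      using energy_regularized[OF g g2, of n] by (simp add: p_def)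
    also have "(LINT t|lborel. E t * conv (h n) (\<lambda>s. (norm (g s))\<^sup>2) t) = (LINT s|lborel. E s * H n (T - s) * (norm (g s))\<^sup>2)"
      by (rule integral_conv_h_upto_T[OF g2c])
    also have "\<dots> \<le> (LINT s|lborel. E s * (norm (g s))\<^sup>2)"
    proof (rule integral_mono_AE')
      show "AE s in lborel. E s * H n (T - s) * (norm (g s))\<^sup>2 \<le> E s * (norm (g s))\<^sup>2"
        using H_le_1 H_nonneg by (auto simp: indicator_def intro!: mult_left_le_one_le)
      show "AE s in lborel. 0 \<le> E s * (norm (g s))\<^sup>2" by simp
    qed (rule Ei[OF g2])
    finally show "(LINT t|lborel. \<Phi> n t) \<le> (LINT t|lborel. E t * (norm (p t))\<^sup>2) + (LINT t|lborel. E t * (norm (g t))\<^sup>2)" by simp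
  qed
  define C where "C = (LINT t|lborel. E t * (norm (p t))\<^sup>2) + (LINT t|lborel. E t * (norm (g t))\<^sup>2)"
  have lim: "AE t in lborel. (\<lambda>n. \<Phi> (r n) t) \<longlonglongrightarrow> X t + R t"
  proof -
    have "AE t in lborel. \<forall>n. t < T \<longrightarrow> conv k (h (r n)) t = real (Suc (r n)) * (E t - H (r n) t)"
      unfolding AE_all_countable using H_mass by blast
    note m = this AE_reflect_shift(1)[OF this, of T]
    show ?thesis using m r AE_reflect_shift(1)[OF r, of T]
    proof eventually_elim
      case (elim t)
      show ?case
      proof (cases "0 < t \<and> t < T")
        case False
        then have "E t = 0" by auto
        then show ?thesis by (simp add: \<Phi>_def X_def R_def)
      next
        case True
        have conv0: "(\<lambda>n. conv (h (r n)) k s) \<longlonglongrightarrow> k s" if "s < T" "(\<lambda>n. u (r n) s) \<longlonglongrightarrow> 0" for s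
        proof (rule LIM_zero_cancel, rule Lim_null_comparison[OF always_eventually that(2)])
          show "\<forall>n. norm (conv (h (r n)) k s - k s) \<le> u (r n) s" using that(1) by (simp add: u_def)
        qed
        have conv1: "(\<lambda>n. conv (h (r n)) g t) \<longlonglongrightarrow> g t"
        proof (rule LIM_zero_cancel, rule Lim_null_comparison[OF always_eventually elim(3)])
          show "\<forall>n. norm (conv (h (r n)) g t - g t) \<le> u (r n) t" using True by (simp add: u_def)
        qed
        have conv2: "(\<lambda>n. conv (h (r n)) (\<lambda>s. (norm (g s))\<^sup>2) t) \<longlonglongrightarrow> (norm (g t))\<^sup>2"
        proof (rule LIM_zero_cancel, rule Lim_null_comparison[OF always_eventually elim(3)])
          show "\<forall>n. norm (conv (h (r n)) (\<lambda>s. (norm (g s))\<^sup>2) t - (norm (g t))\<^sup>2) \<le> u (r n) t" using True by (simp add: u_def)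
        qed
        have H1: "real (Suc (r n)) * ((1 - H (r n) t) + (1 - H (r n) (T - t))) = conv (h (r n)) k t + conv (h (r n)) k (T - t)" for n
        proof -
          have "conv (h (r n)) k t = real (Suc (r n)) * (1 - H (r n) t)"
            using elim(1) True conv_commute[of "h (r n)" k t] by (auto simp del: of_nat_Suc)
          moreover have "conv (h (r n)) k (T - t) = real (Suc (r n)) * (1 - H (r n) (T - t))"
            using elim(2) True conv_commute[of "h (r n)" k "T - t"] by (auto simp del: of_nat_Suc)
          ultimately show ?thesis by (simp only: distrib_left)
        qed
        have "(\<lambda>n. (conv (h (r n)) k t + conv (h (r n)) k (T - t)) * (norm (p t))\<^sup>2
            + ((norm (p t))\<^sup>2 + conv (h (r n)) (\<lambda>s. (norm (g s))\<^sup>2) t - 2 * (p t \<bullet> conv (h (r n)) g t)))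
          \<longlonglongrightarrow> (k t + k (T - t)) * (norm (p t))\<^sup>2 + ((norm (p t))\<^sup>2 + (norm (g t))\<^sup>2 - 2 * (p t \<bullet> g t))"
          by (intro tendsto_intros conv0 conv1 conv2 elim) (use True in auto)
        then show ?thesis using True unfolding \<Phi>_def X_def R_def H1 by simp
      qed
    qed
  qed
  have "(\<integral>\<^sup>+t. ennreal (X t + R t) \<partial>lborel) = (\<integral>\<^sup>+t. liminf (\<lambda>n. ennreal (\<Phi> (r n) t)) \<partial>lborel)"
  proof (rule nn_integral_cong_AE)
    show "AE t in lborel. ennreal (X t + R t) = liminf (\<lambda>n. ennreal (\<Phi> (r n) t))"
      using lim
    proof eventually_elim
      case (elim t)
      then have "(\<lambda>n. ennreal (\<Phi> (r n) t)) \<longlonglongrightarrow> ennreal (X t + R t)" by (rule tendsto_ennrealI)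
      then show ?case by (simp add: lim_imp_Liminf)
    qed
  qed
  also have "\<dots> \<le> liminf (\<lambda>n. \<integral>\<^sup>+t. ennreal (\<Phi> (r n) t) \<partial>lborel)"
    by (rule nn_integral_liminf) measurable
  also have "\<dots> \<le> ennreal C"
  proof (rule Liminf_le)
    show "\<forall>\<^sub>F n in sequentially. (\<integral>\<^sup>+t. ennreal (\<Phi> (r n) t) \<partial>lborel) \<le> ennreal C"
    proof (rule always_eventually, rule allI)
      fix n
      have "(\<integral>\<^sup>+t. ennreal (\<Phi> (r n) t) \<partial>lborel) = ennreal (LINT t|lborel. \<Phi> (r n) t)"
        by (rule nn_integral_eq_integral[OF \<Phi>i(1) \<Phi>0])
      also have "\<dots> \<le> ennreal C" unfolding C_def by (intro ennreal_leI \<Phi>i(2))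
      finally show "(\<integral>\<^sup>+t. ennreal (\<Phi> (r n) t) \<partial>lborel) \<le> ennreal C" .
    qed
  qed simp
  finally have fatou: "(\<integral>\<^sup>+t. ennreal (X t + R t) \<partial>lborel) \<le> ennreal C" .
  have "(\<integral>\<^sup>+t. ennreal (X t + R t) \<partial>lborel) = (\<integral>\<^sup>+t. ennreal (X t) \<partial>lborel) + (\<integral>\<^sup>+t. ennreal (R t) \<partial>lborel)"
    using X0 R0 by (subst nn_integral_add[symmetric]) auto
  also have "(\<integral>\<^sup>+t. ennreal (R t) \<partial>lborel) = ennreal (LINT t|lborel. R t)"
    by (rule nn_integral_eq_integral[OF Ri]) (use R0 in auto)
  also have "(LINT t|lborel. R t) = C - 2 * (LINT t|lborel. E t * (p t \<bullet> g t))"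
    unfolding R_def C_def using Ei[OF p2] Ei[OF g2] igp by simp
  finally have *: "(\<integral>\<^sup>+t. ennreal (X t) \<partial>lborel) + ennreal (C - 2 * (LINT t|lborel. E t * (p t \<bullet> g t))) \<le> ennreal C"
    using fatou by simp
  have nn: "0 \<le> C - 2 * (LINT t|lborel. E t * (p t \<bullet> g t))"
  proof -
    have "0 \<le> (LINT t|lborel. R t)" using R0 by simp
    then show ?thesis unfolding R_def C_def using Ei[OF p2] Ei[OF g2] igp by simp
  qed
  have C0: "0 \<le> C" unfolding C_def by simp
  have "(\<integral>\<^sup>+t. ennreal (X t) \<partial>lborel) \<noteq> top"
    using * by (auto simp: top_unique)
  then obtain x where x: "0 \<le> x" "(\<integral>\<^sup>+t. ennreal (X t) \<partial>lborel) = ennreal x"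
    by (cases "(\<integral>\<^sup>+t. ennreal (X t) \<partial>lborel)") auto
  have "ennreal (x + (C - 2 * (LINT t|lborel. E t * (p t \<bullet> g t)))) \<le> ennreal C"
    using * x nn by (simp add: ennreal_plus)
  then have "x \<le> 2 * (LINT t|lborel. E t * (p t \<bullet> g t))" using C0 by (simp add: ennreal_le_iff)
  then show "(\<integral>\<^sup>+t. ennreal (E t * ((k t + k (T - t)) * (norm (conv l g t))\<^sup>2)) \<partial>lborel)
     \<le> ennreal (2 * (LINT t|lborel. E t * (conv l g t \<bullet> g t)))"
    and "0 \<le> (LINT t|lborel. E t * (conv l g t \<bullet> g t))"
    using x by (simp_all add: X_def p_def ennreal_leI)
qed

end

text \<open>The transpose of \<open>conv\<close>: convolution backwards in time.\<close>

definition dconv :: "(real \<Rightarrow> real) \<Rightarrow> (real \<Rightarrow> 'b::euclidean_space) \<Rightarrow> real \<Rightarrow> 'b" where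
  "dconv a g t = (LINT s|lborel. a (s - t) *\<^sub>R g s)"

lemma conv_reflect: "conv a (\<lambda>s. g (T - s)) t = dconv a g (T - t)"
  unfolding conv_def dconv_def
  using integral_reflect_shift(1)[of "\<lambda>s. a (s - (T - t)) *\<^sub>R g s" T] by (simp add: algebra_simps)

lemma integral_conv_inner_dconv:
  fixes g :: "real \<Rightarrow> 'b::euclidean_space"
  assumes a: "integrable lborel a" and g: "integrable lborel g" and g2: "integrable lborel (\<lambda>s. (norm (g s))\<^sup>2)"
  shows "(LINT t|lborel. dconv a g t \<bullet> g t) = (LINT t|lborel. conv a g t \<bullet> g t)"
proof -
  have [measurable]: "a \<in> borel_measurable borel" "g \<in> borel_measurable borel" using a g by auto
  have aa: "integrable lborel (\<lambda>s. \<bar>a s\<bar>)" and gg: "integrable lborel (\<lambda>s. norm (g s))" using a g by auto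
  define F where "F = (\<lambda>(r, t). a (r - t) * (g r \<bullet> g t))"
  have F: "integrable (lborel \<Otimes>\<^sub>M lborel) F"
  proof (rule lborel_pair.Fubini_integrable)
    show "F \<in> borel_measurable (lborel \<Otimes>\<^sub>M lborel)" unfolding F_def by measurable
    have i2: "integrable lborel (\<lambda>r. norm (conv (\<lambda>s. \<bar>a s\<bar>) (\<lambda>s. norm (g s)) r) * norm (norm (g r)))"
    proof (rule integrable_inner_L2(2))
      show "integrable lborel (\<lambda>r. (norm (conv (\<lambda>s. \<bar>a s\<bar>) (\<lambda>s. norm (g s)) r))\<^sup>2)"
        by (rule conv_square_integrable[OF aa gg]) (use g2 in simp)
    qed (use g2 integrable_conv[OF aa gg] in auto)
    have le: "norm (F (r, t)) \<le> \<bar>a (r - t)\<bar> * norm (g t) * norm (g r)" for r t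
      using mult_left_mono[OF Cauchy_Schwarz_ineq2[of "g r" "g t"], of "\<bar>a (r - t)\<bar>"] by (simp add: F_def abs_mult algebra_simps)
    have iF: "AE r in lborel. integrable lborel (\<lambda>t. F (r, t)) \<and> (LINT t|lborel. norm (F (r, t))) \<le> norm (conv (\<lambda>s. \<bar>a s\<bar>) (\<lambda>s. norm (g s)) r) * norm (norm (g r))"
      using AE_integrable_conv[OF aa gg]
    proof eventually_elim
      case (elim r)
      then have i: "integrable lborel (\<lambda>t. \<bar>a (r - t)\<bar> * norm (g t) * norm (g r))" by simp
      have iF: "integrable lborel (\<lambda>t. F (r, t))"
      proof (rule Bochner_Integration.integrable_bound[OF i])
        show "(\<lambda>t. F (r, t)) \<in> borel_measurable lborel" unfolding F_def prod.case by measurable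
      qed (use le in \<open>auto intro: order_trans\<close>)
      have "(LINT t|lborel. norm (F (r, t))) \<le> (LINT t|lborel. \<bar>a (r - t)\<bar> * norm (g t) * norm (g r))"
        by (rule integral_mono[OF integrable_norm[OF iF] i le])
      also have "\<dots> = conv (\<lambda>s. \<bar>a s\<bar>) (\<lambda>s. norm (g s)) r * norm (g r)" by (simp add: conv_def)
      finally have "(LINT t|lborel. norm (F (r, t))) \<le> norm (conv (\<lambda>s. \<bar>a s\<bar>) (\<lambda>s. norm (g s)) r) * norm (norm (g r))"
        by (rule order_trans) (auto intro!: mult_right_mono)
      with iF show ?case by blast
    qed
    then show "AE r in lborel. integrable lborel (\<lambda>t. F (r, t))" by eventually_elim simp
    show "integrable lborel (\<lambda>r. LINT t|lborel. norm (F (r, t)))"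
    proof (rule Bochner_Integration.integrable_bound[OF i2])
      show "(\<lambda>r. LINT t|lborel. norm (F (r, t))) \<in> borel_measurable lborel" unfolding F_def by measurable
      show "AE r in lborel. norm (LINT t|lborel. norm (F (r, t))) \<le> norm (norm (conv (\<lambda>s. \<bar>a s\<bar>) (\<lambda>s. norm (g s)) r) * norm (norm (g r)))"
        using iF by eventually_elim simp
    qed
  qed
  have "(LINT t|lborel. conv a g t \<bullet> g t) = (LINT r|lborel. LINT t|lborel. F (r, t))"
  proof (rule integral_cong_AE)
    show "(\<lambda>r. LINT t|lborel. F (r, t)) \<in> borel_measurable lborel" unfolding F_def by measurable
    show "AE r in lborel. conv a g r \<bullet> g r = (LINT t|lborel. F (r, t))"
      using AE_integrable_conv[OF a g]
    proof eventually_elim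
      case (elim r)
      have "(LINT t|lborel. (a (r - t) *\<^sub>R g t) \<bullet> g r) = conv a g r \<bullet> g r"
        unfolding conv_def by (rule integral_inner_left) (rule elim)
      then show ?case by (simp add: F_def inner_commute)
    qed
  qed (use integrable_conv[OF a g] in measurable)
  also have "\<dots> = (LINT t|lborel. LINT r|lborel. F (r, t))"
    using lborel_pair.Fubini_integral[of "\<lambda>t r. F (r, t)"] lborel_pair.integrable_product_swap[OF F] by (simp add: case_prod_unfold)
  also have "\<dots> = (LINT t|lborel. dconv a g t \<bullet> g t)"
  proof (rule integral_cong_AE)
    show "(\<lambda>t. LINT r|lborel. F (r, t)) \<in> borel_measurable lborel" unfolding F_def by measurable
    show "(\<lambda>t. dconv a g t \<bullet> g t) \<in> borel_measurable lborel" unfolding dconv_def by measurable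
    have "integrable lborel (\<lambda>t. a (0 - t))" by (rule integrable_reflect_shift(1)[OF a])
    then have "AE t in lborel. integrable lborel (\<lambda>r. a (0 - (t - r)) *\<^sub>R g r)" by (rule AE_integrable_conv[OF _ g])
    then show "AE t in lborel. (LINT r|lborel. F (r, t)) = dconv a g t \<bullet> g t"
    proof eventually_elim
      case (elim t)
      then have i: "integrable lborel (\<lambda>r. a (r - t) *\<^sub>R g r)" by simp
      have "(LINT r|lborel. (a (r - t) *\<^sub>R g r) \<bullet> g t) = dconv a g t \<bullet> g t"
        unfolding dconv_def by (rule integral_inner_left) (rule i)
      then show ?case by (simp add: F_def)
    qed
  qed
  finally show ?thesis by simp
qed

context PC_regularized
begin

text \<open>The reflection \<open>t \<mapsto> T - t\<close> exchanges the two convolutions and preserves the weight. The right-hand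
side is unchanged because the two convolutions are adjoint to each other.\<close>

theorem energy_inequality_dual:
  fixes g :: "real \<Rightarrow> 'b::euclidean_space"
  assumes gi: "integrable lborel g" and g2: "integrable lborel (\<lambda>s. (norm (g s))\<^sup>2)"
    and g0: "\<And>s. s \<notin> {0<..<T} \<Longrightarrow> g s = 0"
  shows "(\<integral>\<^sup>+t. ennreal (E t * ((k (T - t) + k t) * (norm (dconv l g t))\<^sup>2)) \<partial>lborel)
     \<le> ennreal (2 * (LINT t|lborel. conv l g t \<bullet> g t))"
    and "0 \<le> (LINT t|lborel. conv l g t \<bullet> g t)"
proof -
  define g' where "g' s = g (T - s)" for s
  have g': "causal g'" unfolding causal_def g'_def using g0 integrable_reflect_shift(1)[OF gi] by auto
  have g'2: "integrable lborel (\<lambda>s. (norm (g' s))\<^sup>2)" unfolding g'_def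
    using integrable_reflect_shift(1)[OF g2] .
  have cg: "conv l g' t = dconv l g (T - t)" for t
    using conv_reflect[of l g T t] by (simp add: g'_def[abs_def])
  have Er: "E (T - t) = E t" for t by (auto simp: indicator_def)
  have [measurable]: "g \<in> borel_measurable borel" using gi by auto
  have "(\<integral>\<^sup>+t. ennreal (E t * ((k (T - t) + k t) * (norm (dconv l g t))\<^sup>2)) \<partial>lborel)
      = (\<integral>\<^sup>+t. ennreal (E (T + (-1) * t) * ((k (T - (T + (-1) * t)) + k (T + (-1) * t)) * (norm (dconv l g (T + (-1) * t)))\<^sup>2)) \<partial>lborel)"
    unfolding dconv_def
    by (subst nn_integral_real_affine[where c="-1" and t=T]) auto
  also have "\<dots> = (\<integral>\<^sup>+t. ennreal (E t * ((k t + k (T - t)) * (norm (conv l g' t))\<^sup>2)) \<partial>lborel)"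
    using Er by (simp add: cg)
  also have "\<dots> \<le> ennreal (2 * (LINT t|lborel. E t * (conv l g' t \<bullet> g' t)))"
    by (rule energy_inequality(1)[OF g' g'2])
  also have eq: "(LINT t|lborel. E t * (conv l g' t \<bullet> g' t)) = (LINT t|lborel. conv l g t \<bullet> g t)"
  proof -
  have "(LINT t|lborel. E t * (conv l g' t \<bullet> g' t)) = (LINT t|lborel. conv l g' t \<bullet> g' t)"
  proof (rule Bochner_Integration.integral_cong)
    show "E t * (conv l g' t \<bullet> g' t) = conv l g' t \<bullet> g' t" for t
      by (cases "t \<in> {0<..<T}") (auto simp: g'_def g0)
  qed simp
  also have "\<dots> = (LINT t|lborel. dconv l g t \<bullet> g t)"
    using integral_reflect_shift(1)[of "\<lambda>t. dconv l g t \<bullet> g t" T] by (simp add: cg g'_def)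
  also have "\<dots> = (LINT t|lborel. conv l g t \<bullet> g t)"
    by (rule integral_conv_inner_dconv[OF integrable_kernels(2) gi g2])
  finally show ?thesis .
  qed
  finally show "(\<integral>\<^sup>+t. ennreal (E t * ((k (T - t) + k t) * (norm (dconv l g t))\<^sup>2)) \<partial>lborel)
     \<le> ennreal (2 * (LINT t|lborel. conv l g t \<bullet> g t))" .
  show "0 \<le> (LINT t|lborel. conv l g t \<bullet> g t)" using energy_inequality(2)[OF g' g'2] unfolding eq .
qed

text \<open>The difference \<open>r\<close> of the two sides is nonnegative before \<open>T\<close>, and so is \<open>l * r\<close>. By the resolvent identity for
\<open>\<alpha>\<close>, the latter equals \<open>- h n * q\<close> with \<open>q = \<alpha> + l * \<beta> - l * \<gamma>\<close>; it remains to let \<open>n\<close> tend to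
infinity.\<close>

theorem remove_regularization:
  fixes \<alpha> \<beta> \<gamma> :: "real \<Rightarrow> real"
  assumes \<alpha>: "causal \<alpha>" and \<beta>: "causal \<beta>" and \<gamma>: "causal \<gamma>"
    and ineq: "\<And>n. AE t in lborel. 0 < t \<and> t < T \<longrightarrow>
       real (Suc n) * (\<alpha> t - conv (h n) \<alpha> t) + conv (h n) \<beta> t \<le> conv (h n) \<gamma> t"
  shows "AE t in lborel. t < T \<longrightarrow> \<alpha> t + conv l \<beta> t \<le> conv l \<gamma> t"
proof -
  define q where "q t = \<alpha> t + (conv l \<beta> t - conv l \<gamma> t)" for t
  have l\<beta>: "causal (conv l \<beta>)" and l\<gamma>: "causal (conv l \<gamma>)" by (intro causal_conv l \<beta> \<gamma>)+
  have d: "causal (\<lambda>t. conv l \<beta> t - conv l \<gamma> t)" using l\<beta> l\<gamma> by (auto simp: causal_def)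
  have q: "causal q" using \<alpha> d by (auto simp: causal_def q_def[abs_def])
  have "AE t in lborel. t < T \<longrightarrow> q t \<le> 0"
  proof (rule nonpos_if_conv_h_nonpos[OF q])
    fix n
    define \<nu> where "\<nu> = real (Suc n)"
    note li = integrable_kernels(2)
    have h\<alpha>: "causal (conv (h n) \<alpha>)" and h\<beta>: "causal (conv (h n) \<beta>)" and h\<gamma>: "causal (conv (h n) \<gamma>)"
      by (intro causal_conv h \<alpha> \<beta> \<gamma>)+
    define r1 r2 r where "r1 t = \<nu> * (\<alpha> t - conv (h n) \<alpha> t)" and "r2 t = conv (h n) \<gamma> t - conv (h n) \<beta> t"
      and "r t = r2 t - r1 t" for t
    have r1: "causal r1" using \<alpha> h\<alpha> by (auto simp: causal_def r1_def[abs_def])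
    have r2: "causal r2" using h\<beta> h\<gamma> by (auto simp: causal_def r2_def[abs_def])
    have r: "causal r" using r1 r2 by (auto simp: causal_def r_def[abs_def])
    have r0: "AE t in lborel. t < T \<longrightarrow> 0 \<le> r t"
      using ineq[of n]
    proof eventually_elim
      case (elim t)
      show ?case
        by (cases "t \<le> 0") (use elim causalD(2)[OF r] in \<open>auto simp: r_def r1_def r2_def \<nu>_def\<close>)
    qed
    have comm: "AE t in lborel. conv l (conv (h n) x) t = conv (h n) (conv l x) t" if "causal x" for x :: "real \<Rightarrow> real"
      using AE_conv_assoc[OF li integrable_h causalD(1)[OF that], of n] AE_conv_assoc[OF integrable_h li causalD(1)[OF that], of n]
    proof eventually_elim
      case (elim t)
      have "conv (conv l (h n)) x t = conv (conv (h n) l) x t"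
        unfolding conv_def[of _ x] by (simp add: conv_commute[of l])
      then show ?case using elim by simp
    qed
    show "AE t in lborel. t < T \<longrightarrow> conv (h n) q t \<le> 0"
      using AE_conv_diff_right[OF li causalD(1)[OF r2] causalD(1)[OF r1]]
        AE_conv_diff_right[OF li causalD(1)[OF h\<gamma>] causalD(1)[OF h\<beta>]]
        AE_conv_diff_right[OF li causalD(1)[OF \<alpha>] causalD(1)[OF h\<alpha>]]
        comm[OF \<alpha>] comm[OF \<beta>] comm[OF \<gamma>] conv_h_resolvent[OF \<alpha>, of n]
        AE_conv_add_right[OF integrable_h causalD(1)[OF \<alpha>] causalD(1)[OF d], of n]
        AE_conv_diff_right[OF integrable_h causalD(1)[OF l\<beta>] causalD(1)[OF l\<gamma>], of n]
    proof eventually_elim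
      case (elim t)
      show ?case
      proof
        assume t: "t < T"
        have "0 \<le> conv l r t"
          by (rule conv_nonneg[OF l r _ l_nonneg r0]) (use t in simp)
        also have "conv l r t = conv l r2 t - conv l r1 t" using elim(1) by (simp add: r_def[abs_def])
        also have "conv l r1 t = \<nu> * conv l (\<lambda>s. \<alpha> s - conv (h n) \<alpha> s) t"
          using conv_scaleR_right[of l \<nu> "\<lambda>s. \<alpha> s - conv (h n) \<alpha> s" t] by (simp add: r1_def[abs_def])
        also have "\<dots> = \<nu> * (conv l \<alpha> t - conv (h n) (conv l \<alpha>) t)" using elim(3,4) by simp
        also have "\<dots> = conv (h n) \<alpha> t" using elim(7) t by (simp add: \<nu>_def)
        also have "conv l r2 t = conv (h n) (conv l \<gamma>) t - conv (h n) (conv l \<beta>) t"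
          using elim(2,5,6) by (simp add: r2_def[abs_def])
        finally show "conv (h n) q t \<le> 0" using elim(8,9) by (simp add: q_def[abs_def])
      qed
    qed
  qed
  then show ?thesis by eventually_elim (auto simp: q_def)
qed

text \<open>The kernel is \<open>\<nu>\<close> times the unit step minus its convolution with \<open>h n\<close>. Convolution with it is
therefore integration of \<open>v - h n * v\<close>, and this holds at every time since the step is bounded.\<close>

lemma conv_regularized_kernel:
  fixes v \<kappa> :: "real \<Rightarrow> real"
  assumes v: "causal v" and \<kappa>: "causal \<kappa>" and \<kappa>eq: "AE t in lborel. t < T \<longrightarrow> \<kappa> t = real (Suc n) * (E t - H n t)"
    and t: "t \<le> T"
  shows "conv \<kappa> v t = real (Suc n) * (LINT s|lborel. indicator {..t} s * (v s - conv (h n) v s))"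
proof -
  define \<nu> where "\<nu> = real (Suc n)"
  have vi: "integrable lborel v" by (rule causalD(1)[OF v])
  have hv: "causal (conv (h n) v)" by (rule causal_conv[OF h v])
  have Eh: "causal (conv E (h n))" by (rule causal_conv[OF E h])
  define a where "a s = \<nu> * (E s - conv E (h n) s)" for s
  have a: "causal a" using E Eh by (auto simp: causal_def a_def[abs_def])
  have [measurable]: "v \<in> borel_measurable borel" using vi by auto
  have bnd: "integrable lborel (\<lambda>s. b s * f s)" if "integrable lborel f" "b \<in> borel_measurable borel" "\<And>s. \<bar>b s\<bar> \<le> 1" for b f :: "real \<Rightarrow> real"
    by (rule Bochner_Integration.integrable_bound[OF that(1)])
      (use that in \<open>auto simp: abs_mult intro!: AE_I2 mult_left_le_one_le\<close>)
  have Ehb: "\<bar>conv E (h n) s\<bar> \<le> 1" for s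
  proof -
    have "norm (conv E (h n) s) \<le> (LINT r|lborel. norm (E (s - r) *\<^sub>R h n r))" unfolding conv_def by (rule integral_norm_bound)
    also have "\<dots> \<le> (LINT r|lborel. h n r)"
    proof (rule integral_mono_AE')
      show "AE r in lborel. norm (E (s - r) *\<^sub>R h n r) \<le> h n r" using h_nonneg by (auto simp: indicator_def)
    qed (use integrable_h h_nonneg in auto)
    finally show ?thesis using h_mass_le_1[of n] by simp
  qed
  have [measurable]: "conv E (h n) \<in> borel_measurable borel" using causalD(1)[OF Eh] by auto
  have i1: "integrable lborel (\<lambda>s. E (t - s) * v s)" by (rule bnd[OF vi]) (auto simp: indicator_def)
  have i2: "integrable lborel (\<lambda>s. conv E (h n) (t - s) * v s)" by (rule bnd[OF vi _ Ehb]) measurable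
  have "conv \<kappa> v t = conv a v t"
    by (rule conv_cong_AE[OF \<kappa> a v v t]) (use \<kappa>eq H_conv[of _ n] in \<open>auto simp: a_def \<nu>_def elim!: eventually_mono\<close>)
  also have "\<dots> = \<nu> * (conv E v t - conv (conv E (h n)) v t)"
  proof -
    have "conv a v t = (LINT s|lborel. \<nu> * (E (t - s) * v s - conv E (h n) (t - s) * v s))"
      unfolding conv_def[of a] a_def by (simp add: algebra_simps)
    also have "\<dots> = \<nu> * (conv E v t - conv (conv E (h n)) v t)"
      using i1 i2 by (simp add: conv_def[of _ v])
    finally show ?thesis .
  qed
  also have "conv (conv E (h n)) v t = conv E (conv (h n) v) t"
  proof (rule conv_assoc_at[OF _ integrable_h vi])
    have "integrable lborel (conv (\<lambda>s. \<bar>h n s\<bar>) (\<lambda>s. norm (v s)))" using integrable_h[of n] vi by (intro integrable_conv) auto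
    then show "integrable lborel (\<lambda>\<sigma>. \<bar>E (t - \<sigma>)\<bar> * conv (\<lambda>s. \<bar>h n s\<bar>) (\<lambda>s. norm (v s)) \<sigma>)"
      by (rule bnd) (auto simp: indicator_def)
  qed simp
  also have "conv E v t - conv E (conv (h n) v) t = (LINT s|lborel. indicator {..t} s * (v s - conv (h n) v s))"
  proof -
    have I: "integrable lborel (\<lambda>s. indicator {..t} s * f s)" if "integrable lborel f" for f :: "real \<Rightarrow> real"
      using integrable_mult_indicator[OF _ that, of "{..t}"] by simp
    show ?thesis using conv_unit_interval[OF v t] conv_unit_interval[OF hv t] I[OF vi] I[OF causalD(1)[OF hv]]
      by (simp add: right_diff_distrib)
  qed
  finally show ?thesis by (simp add: \<nu>_def)
qed

end

section \<open>Differentiability almost everywhere with a parameter\<close>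

text \<open>By continuity, rational increments suffice. With countably many conditions, differentiability
becomes measurable in parameters.\<close>

lemma has_real_derivative_iff_rational:
  fixes W :: "real \<Rightarrow> real"
  assumes W: "continuous_on UNIV W"
  shows "(W has_real_derivative D) (at t) \<longleftrightarrow>
    (\<forall>m::nat. \<exists>j::nat. \<forall>q::rat. \<bar>real_of_rat q\<bar> < inverse (real (Suc j)) \<longrightarrow>
      \<bar>W (t + of_rat q) - W t - of_rat q * D\<bar> \<le> inverse (real (Suc m)) * \<bar>of_rat q\<bar>)" (is "_ \<longleftrightarrow> ?R")
proof
  assume "(W has_real_derivative D) (at t)"
  then have L: "(\<lambda>s. (W (t + s) - W t) / s) \<midarrow>0\<rightarrow> D" by (simp add: DERIV_def)
  show ?R
  proof
    fix m :: nat
    from LIM_D[OF L, of "inverse (real (Suc m))"] obtain d where d: "d > 0"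
      "\<And>s. s \<noteq> 0 \<Longrightarrow> \<bar>s\<bar> < d \<Longrightarrow> \<bar>(W (t + s) - W t) / s - D\<bar> < inverse (real (Suc m))" by auto
    obtain j where j: "inverse (real (Suc j)) < d" using reals_Archimedean[OF d(1)] by blast
    have "\<bar>W (t + s) - W t - s * D\<bar> \<le> inverse (real (Suc m)) * \<bar>s\<bar>" if "\<bar>s\<bar> < inverse (real (Suc j))" for s
    proof (cases "s = 0")
      case False
      have "\<bar>W (t + s) - W t - s * D\<bar> = \<bar>(W (t + s) - W t) / s - D\<bar> * \<bar>s\<bar>"
      proof -
        have "W (t + s) - W t - s * D = ((W (t + s) - W t) / s - D) * s" using False by (simp add: field_simps)
        then show ?thesis by (simp only: abs_mult)
      qed
      also have "\<dots> \<le> inverse (real (Suc m)) * \<bar>s\<bar>"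
        using d(2)[of s] False that j by (intro mult_right_mono) auto
      finally show ?thesis .
    qed simp
    then show "\<exists>j::nat. \<forall>q::rat. \<bar>real_of_rat q\<bar> < inverse (real (Suc j)) \<longrightarrow>
      \<bar>W (t + of_rat q) - W t - of_rat q * D\<bar> \<le> inverse (real (Suc m)) * \<bar>of_rat q\<bar>" by blast
  qed
next
  assume R: ?R
  show "(W has_real_derivative D) (at t)" unfolding DERIV_def
  proof (rule LIM_I)
    fix r :: real assume "r > 0"
    then obtain m where m: "inverse (real (Suc m)) < r" using reals_Archimedean by blast
    from R obtain j where j: "\<And>q. \<bar>real_of_rat q\<bar> < inverse (real (Suc j)) \<Longrightarrow>
      \<bar>W (t + of_rat q) - W t - of_rat q * D\<bar> \<le> inverse (real (Suc m)) * \<bar>of_rat q\<bar>" by blast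
    have *: "\<bar>W (t + s) - W t - s * D\<bar> \<le> inverse (real (Suc m)) * \<bar>s\<bar>" if s: "\<bar>s\<bar> < inverse (real (Suc j))" for s
    proof -
      have "\<exists>q. \<forall>n. \<bar>real_of_rat (q n) - s\<bar> < inverse (real (Suc n))"
      proof -
        have "\<exists>q. \<bar>real_of_rat q - s\<bar> < inverse (real (Suc n))" for n
        proof -
          obtain q where "s < real_of_rat q" "real_of_rat q < s + inverse (real (Suc n))"
            using of_rat_dense[of s "s + inverse (real (Suc n))"] by auto
          then show ?thesis by (intro exI[of _ q]) auto
        qed
        then show ?thesis by metis
      qed
      then obtain q where q: "\<And>n. \<bar>real_of_rat (q n) - s\<bar> < inverse (real (Suc n))" by blast
      have qs: "(\<lambda>n. real_of_rat (q n)) \<longlonglongrightarrow> s"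
        by (rule LIM_zero_cancel, rule Lim_null_comparison[OF always_eventually LIMSEQ_inverse_real_of_nat])
          (use q in \<open>auto intro: less_imp_le\<close>)
      have "(\<lambda>n. \<bar>real_of_rat (q n)\<bar>) \<longlonglongrightarrow> \<bar>s\<bar>" by (intro tendsto_rabs qs)
      from order_tendstoD(2)[OF this s] have ev: "\<forall>\<^sub>F n in sequentially. \<bar>W (t + of_rat (q n)) - W t - of_rat (q n) * D\<bar> \<le> inverse (real (Suc m)) * \<bar>of_rat (q n)\<bar>"
        by eventually_elim (rule j)
      have Wt: "(\<lambda>n. W (t + of_rat (q n))) \<longlonglongrightarrow> W (t + s)"
      proof (rule isCont_tendsto_compose[of "t + s" W])
        show "isCont W (t + s)" using W by (simp add: continuous_on_eq_continuous_at)
      qed (intro tendsto_intros qs)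
      show ?thesis
        by (rule tendsto_le[OF sequentially_bot _ _ ev]) (intro tendsto_intros Wt qs)+
    qed
    show "\<exists>d>0. \<forall>s. s \<noteq> 0 \<and> norm (s - 0) < d \<longrightarrow> norm ((W (t + s) - W t) / s - D) < r"
    proof (intro exI conjI allI impI)
      show "0 < inverse (real (Suc j))" by simp
      fix s :: real assume s: "s \<noteq> 0 \<and> norm (s - 0) < inverse (real (Suc j))"
      have "\<bar>(W (t + s) - W t) / s - D\<bar> = \<bar>W (t + s) - W t - s * D\<bar> / \<bar>s\<bar>"
        using s by (simp add: abs_divide[symmetric] diff_divide_distrib)
      also have "\<dots> \<le> inverse (real (Suc m))" using *[of s] s by (simp add: divide_le_eq)
      finally show "norm ((W (t + s) - W t) / s - D) < r" using m by simp
    qed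
  qed
qed

text \<open>For each \<open>x\<close> the exceptional times form a null set that depends on \<open>x\<close>. The quantifiers may be exchanged
because the points of differentiability form a measurable subset of the product.\<close>

lemma AE_lebesgue_differentiation_param:
  fixes w :: "real \<times> 'a::euclidean_space \<Rightarrow> real"
  assumes w[measurable]: "w \<in> borel_measurable borel"
    and wi: "AE x in lborel. integrable lborel (\<lambda>s. w (s, x))"
  shows "AE t in lborel. AE x in lborel.
    ((\<lambda>t. LINT s|lborel. indicator {..t} s * w (s, x)) has_real_derivative w (t, x)) (at t)"
proof -
  have w'[measurable]: "w \<in> borel_measurable (lborel \<Otimes>\<^sub>M lborel)"
    using w by (simp add: lborel_prod)
  define A where "A = {x. integrable lborel (\<lambda>s. w (s, x))}"
  have A[measurable]: "A \<in> sets borel"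
  proof -
    have "A = {x \<in> space lborel. (\<integral>\<^sup>+s. ennreal (norm (w (s, x))) \<partial>lborel) < \<infinity>}"
      unfolding A_def integrable_iff_bounded by auto
    also have "\<dots> \<in> sets lborel" by measurable
    finally show ?thesis by simp
  qed
  \<comment> \<open>Where the section is not integrable it is replaced by 0, to have a continuous primitive for every \<open>x\<close>.\<close>
  define w0 where "w0 p = indicator A (snd p) * w p" for p
  have w0m[measurable]: "w0 \<in> borel_measurable (lborel \<Otimes>\<^sub>M lborel)" unfolding w0_def by measurable
  have w0i: "integrable lborel (\<lambda>s. w0 (s, x))" for x
    by (cases "x \<in> A") (auto simp: w0_def A_def)
  define W where "W t x = (LINT s|lborel. indicator {..t} s * w0 (s, x))" for t x
  have Wm[measurable]: "(\<lambda>p. W (fst p) (snd p)) \<in> borel_measurable (lborel \<Otimes>\<^sub>M lborel)"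
  proof -
    have "(\<lambda>p. W (fst p) (snd p)) = (\<lambda>p. LINT s|lborel. indicator {s..} (fst p) * w0 (s, snd p))"
      by (auto simp: W_def fun_eq_iff indicator_def)
    also have "\<dots> \<in> borel_measurable (lborel \<Otimes>\<^sub>M lborel)"
      unfolding indicator_def of_bool_def atLeast_iff by measurable
    finally show ?thesis .
  qed
  have Wc: "continuous_on UNIV (\<lambda>t. W t x)" for x unfolding W_def by (rule continuous_on_indefinite_integral[OF w0i])
  define P where "P t x \<longleftrightarrow> ((\<lambda>t. W t x) has_real_derivative w0 (t, x)) (at t)" for t x
  have Pm: "{p \<in> space (lborel \<Otimes>\<^sub>M lborel). P (fst p) (snd p)} \<in> sets (lborel \<Otimes>\<^sub>M lborel)"
  proof -
    have [measurable]: "(\<lambda>p. W (fst p + c) (snd p)) \<in> borel_measurable (lborel \<Otimes>\<^sub>M lborel)" for c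
    proof -
      have "(\<lambda>p. (fst p + c, snd p)) \<in> (lborel \<Otimes>\<^sub>M lborel) \<rightarrow>\<^sub>M (lborel \<Otimes>\<^sub>M lborel)" by measurable
      from measurable_compose[OF this Wm] show ?thesis by simp
    qed
    show ?thesis unfolding P_def has_real_derivative_iff_rational[OF Wc] by measurable
  qed
  have "AE x in lborel. AE t in lborel. P t x"
    unfolding P_def W_def using lebesgue_differentiation[OF w0i] by auto
  then have "AE t in lborel. AE x in lborel. P t x"
    using lborel_pair.AE_commute[OF Pm] by simp
  then show ?thesis
  proof eventually_elim
    case (elim t)
    have "AE x in lborel. x \<in> A" using wi by (simp add: A_def)
    with elim show ?case by eventually_elim (simp add: P_def W_def w0_def)
  qed
qed

section \<open>Uniqueness of weak gradients\<close>

lemma C_k_imp_continuous: "C_k j f \<Longrightarrow> continuous_on UNIV f"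
  by (cases j) (simp_all add: differentiable_imp_continuous_on)

lemma C_k_Suc_imp: "C_k (Suc j) f \<Longrightarrow> C_k j f"
proof (induction j arbitrary: f)
  case 0 from C_k_imp_continuous[OF 0] show ?case by simp
next
  case (Suc j)
  then have "f differentiable_on UNIV" "\<And>e. e \<in> Basis \<Longrightarrow> C_k (Suc j) (\<lambda>x. frechet_derivative f (at x) e)" by auto
  then show ?case using Suc.IH by simp
qed

lemma C_k_SucI:
  assumes "\<And>x. (f has_derivative f' x) (at x)" and "\<And>e. e \<in> Basis \<Longrightarrow> C_k j (\<lambda>x. f' x e)"
  shows "C_k (Suc j) f"
proof -
  have "f differentiable_on UNIV" using assms(1) by (auto simp: differentiable_on_def differentiable_def)
  moreover have "frechet_derivative f (at x) = f' x" for x using frechet_derivative_at[OF assms(1)[of x]] by simp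
  ultimately show ?thesis using assms(2) by simp
qed

lemma C_k_SucD:
  assumes "C_k (Suc j) f"
  shows "(f has_derivative frechet_derivative f (at x)) (at x)" "e \<in> Basis \<Longrightarrow> C_k j (\<lambda>x. frechet_derivative f (at x) e)"
  using assms by (auto simp: differentiable_on_def frechet_derivative_works[symmetric])

lemma C_k_const: "C_k j (\<lambda>x. c)"
proof (induction j arbitrary: c)
  case (Suc j)
  show ?case by (rule C_k_SucI[where f'="\<lambda>x h. 0"]) (auto intro: Suc)
qed simp

lemma C_k_add: "C_k j f \<Longrightarrow> C_k j g \<Longrightarrow> C_k j (\<lambda>x. f x + g x)"
proof (induction j arbitrary: f g)
  case (Suc j)
  show ?case
    by (rule C_k_SucI[OF has_derivative_add[OF C_k_SucD(1)[OF Suc.prems(1)] C_k_SucD(1)[OF Suc.prems(2)]]])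
      (intro Suc.IH C_k_SucD(2) Suc.prems)
qed (auto intro: continuous_intros)

lemma C_k_mult: "C_k j f \<Longrightarrow> C_k j g \<Longrightarrow> C_k j (\<lambda>x. f x * g x)"
proof (induction j arbitrary: f g)
  case (Suc j)
  show ?case
    by (rule C_k_SucI[OF has_derivative_mult[OF C_k_SucD(1)[OF Suc.prems(1)] C_k_SucD(1)[OF Suc.prems(2)]]])
      (intro C_k_add Suc.IH C_k_SucD(2) C_k_Suc_imp[OF Suc.prems(1)] C_k_Suc_imp[OF Suc.prems(2)] Suc.prems)
qed (auto intro: continuous_intros)

lemma C_k_prod: "finite I \<Longrightarrow> (\<And>i. i \<in> I \<Longrightarrow> C_k j (f i)) \<Longrightarrow> C_k j (\<lambda>x. \<Prod>i\<in>I. f i x)"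
  by (induction I rule: finite_induct) (auto intro: C_k_const C_k_mult)

text \<open>Inverse powers of \<open>t\<close> times \<open>exp (- 1 / t)\<close>, extended by 0. Derivatives of members of this family
are combinations of members, which makes smoothness an induction over the order.\<close>

definition flat :: "nat \<Rightarrow> real \<Rightarrow> real" where
  "flat k t = (if t > 0 then inverse t ^ k * exp (- inverse t) else 0)"

lemma flat_over_t_tendsto: "((\<lambda>t. flat k t / t) \<longlongrightarrow> 0) (at 0)"
proof -
  have "((\<lambda>t. inverse t ^ Suc k / exp (inverse t)) \<longlongrightarrow> 0) (at_right (0::real))"
    by (rule filterlim_compose[OF tendsto_power_div_exp_0 filterlim_inverse_at_top_right])
  then have "((\<lambda>t. flat k t / t) \<longlongrightarrow> 0) (at_right 0)"
  proof (rule Lim_transform_eventually)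
    show "\<forall>\<^sub>F t in at_right 0. inverse t ^ Suc k / exp (inverse t) = flat k t / t"
      by (auto simp: eventually_at_filter flat_def exp_minus divide_inverse)
  qed
  moreover have "((\<lambda>t. flat k t / t) \<longlongrightarrow> 0) (at_left 0)"
    by (rule tendsto_eventually) (auto simp: eventually_at_filter flat_def)
  ultimately show ?thesis using filterlim_split_at by blast
qed

lemma flat_deriv: "(flat k has_real_derivative (flat (Suc (Suc k)) t - real k * flat (Suc k) t)) (at t)"
proof -
  consider "t > 0" | "t = 0" | "t < 0" by linarith
  then show ?thesis
  proof cases
    case 1
    have "((\<lambda>t. inverse t ^ k * exp (- inverse t)) has_real_derivative (flat (Suc (Suc k)) t - real k * flat (Suc k) t)) (at t)"
    proof -
      have i: "(inverse has_real_derivative - (inverse t)\<^sup>2) (at t)"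
        using DERIV_inverse[of t UNIV] 1 by (simp add: power2_eq_square)
      have "((\<lambda>t. inverse t ^ k) has_real_derivative - real k * inverse t ^ Suc k) (at t)"
        using DERIV_power[OF i, of k] by (cases k) (simp_all add: power2_eq_square algebra_simps)
      moreover have "((\<lambda>t. exp (- inverse t)) has_real_derivative exp (- inverse t) * (inverse t)\<^sup>2) (at t)"
        using DERIV_chain2[OF DERIV_exp DERIV_minus[OF i]] by simp
      ultimately have "((\<lambda>t. inverse t ^ k * exp (- inverse t)) has_real_derivative
        - real k * inverse t ^ Suc k * exp (- inverse t) + exp (- inverse t) * (inverse t)\<^sup>2 * inverse t ^ k) (at t)"
        by (rule DERIV_mult)
      then show ?thesis using 1 by (simp add: flat_def power2_eq_square algebra_simps)
    qed
    then show ?thesis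
      by (rule has_field_derivative_transform_within_open[where S="{0<..}"]) (use 1 in \<open>auto simp: flat_def\<close>)
  next
    case 2
    then show ?thesis using flat_over_t_tendsto[of k] by (simp add: DERIV_def flat_def[of _ 0])
  next
    case 3
    have "((\<lambda>t. 0) has_real_derivative 0) (at t)" by simp
    then have "(flat k has_real_derivative 0) (at t)"
      by (rule has_field_derivative_transform_within_open[where S="{..<0}"]) (use 3 in \<open>auto simp: flat_def\<close>)
    then show ?thesis using 3 by (simp add: flat_def)
  qed
qed

lemma C_k_flat: "C_k j (\<lambda>x::'a::euclidean_space. flat k (a \<bullet> x + b))"
proof (induction j arbitrary: k)
  case 0
  have "continuous_on UNIV (flat k)"
    using flat_deriv[of k] by (intro continuous_at_imp_continuous_on ballI DERIV_isCont)
  then have "continuous_on UNIV (\<lambda>x. flat k (a \<bullet> x + b))"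
    by (rule continuous_on_compose2) (auto intro!: continuous_intros)
  then show ?case by simp
next
  case (Suc j)
  show ?case
  proof (rule C_k_SucI)
    fix x :: 'a
    have "((\<lambda>x. a \<bullet> x + b) has_derivative (\<lambda>e. a \<bullet> e)) (at x)"
      by (auto intro!: derivative_eq_intros)
    from has_derivative_compose[OF this flat_deriv[of k "a \<bullet> x + b", unfolded has_field_derivative_def]]
    show "((\<lambda>x. flat k (a \<bullet> x + b)) has_derivative
      (\<lambda>e. (flat (Suc (Suc k)) (a \<bullet> x + b) + - real k * flat (Suc k) (a \<bullet> x + b)) * (a \<bullet> e))) (at x)" by simp
  next
    fix e :: 'a
    show "C_k j (\<lambda>x. (flat (Suc (Suc k)) (a \<bullet> x + b) + - real k * flat (Suc k) (a \<bullet> x + b)) * (a \<bullet> e))"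
      by (intro C_k_mult C_k_add C_k_const Suc.IH)
  qed
qed

text \<open>A product of one-dimensional smooth steps, two for each coordinate. As \<open>j\<close> grows, the steps
steepen and the product tends to the indicator of the open box.\<close>

definition box_bump :: "'a::euclidean_space \<Rightarrow> 'a \<Rightarrow> nat \<Rightarrow> 'a \<Rightarrow> real" where
  "box_bump a b j x = (\<Prod>e\<in>Basis. flat 0 (real (Suc j) * ((x - a) \<bullet> e)) * flat 0 (real (Suc j) * ((b - x) \<bullet> e)))"

lemma box_bump_nonzero: "box_bump a b j x \<noteq> 0 \<Longrightarrow> x \<in> box a b"
proof -
  assume "box_bump a b j x \<noteq> 0"
  then have "\<forall>e\<in>Basis. flat 0 (real (Suc j) * ((x - a) \<bullet> e)) * flat 0 (real (Suc j) * ((b - x) \<bullet> e)) \<noteq> 0"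
    by (simp add: box_bump_def)
  then have "\<forall>e\<in>Basis. 0 < (x - a) \<bullet> e \<and> 0 < (b - x) \<bullet> e"
    by (auto simp: flat_def zero_less_mult_iff split: if_splits)
  then show ?thesis by (auto simp: mem_box inner_diff_left)
qed

lemma flat_0_bounds: "0 \<le> flat 0 t" "flat 0 t \<le> 1"
  by (auto simp: flat_def)

lemma box_bump_bounds: "0 \<le> box_bump a b j x" "box_bump a b j x \<le> 1"
  unfolding box_bump_def
  by (intro prod_nonneg prod_le_1 conjI mult_nonneg_nonneg mult_le_one flat_0_bounds ballI; simp add: flat_0_bounds)+

lemma C_k_box_bump: "C_k i (box_bump a b j)"
proof -
  have "C_k i (\<lambda>x. flat 0 (real (Suc j) * ((x - a) \<bullet> e)) * flat 0 (real (Suc j) * ((b - x) \<bullet> e)))" for e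
  proof -
    have "(\<lambda>x. flat 0 (real (Suc j) * ((x - a) \<bullet> e)) * flat 0 (real (Suc j) * ((b - x) \<bullet> e)))
      = (\<lambda>x. flat 0 ((real (Suc j) *\<^sub>R e) \<bullet> x + - (real (Suc j) * (a \<bullet> e))) * flat 0 ((- real (Suc j) *\<^sub>R e) \<bullet> x + real (Suc j) * (b \<bullet> e)))"
      by (simp add: inner_diff_left inner_diff_right right_diff_distrib inner_commute[of e] del: of_nat_Suc)
    then show ?thesis by (simp only:) (intro C_k_mult C_k_flat)
  qed
  then show ?thesis unfolding box_bump_def[abs_def] by (intro C_k_prod) auto
qed

lemma box_bump_test_function:
  assumes "cbox a b \<subseteq> \<Omega>"
  shows "box_bump a b j \<in> test_functions \<Omega>"
proof -
  have "{x. box_bump a b j x \<noteq> 0} \<subseteq> cbox a b"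
    using box_bump_nonzero box_subset_cbox by blast
  then have c: "closure {x. box_bump a b j x \<noteq> 0} \<subseteq> cbox a b" by (rule closure_minimal) (rule closed_cbox)
  moreover have "compact (closure {x. box_bump a b j x \<noteq> 0})"
    using c by (meson closed_closure compact_cbox compact_Int_closed inf.absorb_iff2 compact_eq_bounded_closed bounded_subset)
  ultimately show ?thesis using assms C_k_box_bump by (auto simp: test_functions_def)
qed

lemma box_bump_tendsto: "(\<lambda>j. box_bump a b j x) \<longlonglongrightarrow> indicator (box a b) x"
proof (cases "x \<in> box a b")
  case False
  then have "(\<lambda>j. box_bump a b j x) = (\<lambda>j. 0)" using box_bump_nonzero by fastforce
  then show ?thesis using False by simp
next
  case True
  have fl: "(\<lambda>j. flat 0 (real (Suc j) * y)) \<longlonglongrightarrow> 1" if y: "y > 0" for y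
  proof -
    have "(\<lambda>j. exp (- (inverse (real (Suc j)) * inverse y))) \<longlonglongrightarrow> exp (- (0 * inverse y))"
      by (intro tendsto_intros LIMSEQ_inverse_real_of_nat)
    moreover have "flat 0 (real (Suc j) * y) = exp (- (inverse (real (Suc j)) * inverse y))" for j
      using y by (simp add: flat_def inverse_mult_distrib del: of_nat_Suc)
    ultimately show ?thesis by simp
  qed
  have "(\<lambda>j. box_bump a b j x) \<longlonglongrightarrow> (\<Prod>e\<in>(Basis::'a set). 1 * 1)"
    unfolding box_bump_def
    by (intro tendsto_prod tendsto_mult fl) (use True in \<open>auto simp: mem_box inner_diff_left\<close>)
  then show ?thesis using True by simp
qed

lemma AE_zero_if_box_integrals_zero:
  fixes g :: "'a::euclidean_space \<Rightarrow> real"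
  assumes g: "integrable lborel g" and z: "\<And>a b. (LINT x|lborel. indicator (box a b) x * g x) = 0"
    and tot: "(LINT x|lborel. g x) = 0"
  shows "AE x in lborel. g x = 0"
proof -
  have gm[measurable]: "g \<in> borel_measurable borel" using g by auto
  have I: "integrable lborel (\<lambda>x. indicator A x * g x)" if "A \<in> sets borel" for A
    using integrable_mult_indicator[OF _ g, of A] that by simp
  have zero: "(LINT x|lborel. indicator A x * g x) = 0" if "A \<in> sets borel" for A
  proof -
  have "A \<in> sigma_sets UNIV (range (\<lambda>(a, b). box a b))" using that by (simp add: borel_eq_box)
  then show "(LINT x|lborel. indicator A x * g x) = 0"
  proof (induction rule: sigma_sets_induct_disjoint[rotated 2, consumes 1,
        case_names basic empty compl union Int_stable closed])
    case (basic A) then show ?case using z by auto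
  next
    case empty show ?case by simp
  next
    case (compl A)
    then have A: "A \<in> sets borel" by (simp add: borel_eq_box)
    have "(LINT x|lborel. indicator (UNIV - A) x * g x) = (LINT x|lborel. g x - indicator A x * g x)"
      by (rule Bochner_Integration.integral_cong) (auto simp: indicator_def)
    then show ?case using compl.IH tot g I[OF A] by simp
  next
    case (union A)
    then have A: "A i \<in> sets borel" for i by (auto simp: borel_eq_box)
    have "(LINT x:(\<Union>i. A i)|lborel. g x) = (\<Sum>i. LINT x:(A i)|lborel. g x)"
    proof (rule lebesgue_integral_countable_add)
      show "A i \<in> sets lborel" for i using A by simp
      show "i \<noteq> j \<Longrightarrow> A i \<inter> A j = {}" for i j using union(1) by (auto simp: disjoint_family_on_def)
      show "set_integrable lborel (\<Union>i. A i) g" using I[of "\<Union>i. A i"] A by (simp add: set_integrable_def)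
    qed
    then show ?case using union.IH by (simp add: set_lebesgue_integral_def)
  next
    case Int_stable
    show ?case by (auto simp: Int_stable_def box_Int_box)
  qed auto
  qed
  show ?thesis
    by (rule density_unique_real[OF g]) (use zero in \<open>auto simp: set_lebesgue_integral_def\<close>)
qed

lemma test_function_derivative_bounds:
  assumes \<phi>: "\<phi> \<in> test_functions \<Omega>" and e: "e \<in> Basis"
  defines "K \<equiv> closure {x. \<phi> x \<noteq> 0}"
  shows "compact K" "K \<subseteq> \<Omega>" "\<And>x. x \<notin> K \<Longrightarrow> \<phi> x = 0" "\<And>x. x \<notin> K \<Longrightarrow> frechet_derivative \<phi> (at x) e = 0"
    "continuous_on UNIV \<phi>" "continuous_on UNIV (\<lambda>x. frechet_derivative \<phi> (at x) e)"
proof -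
  show K: "compact K" "K \<subseteq> \<Omega>" using \<phi> by (auto simp: test_functions_def K_def)
  show z: "\<phi> x = 0" if "x \<notin> K" for x using that closure_subset[of "{x. \<phi> x \<noteq> 0}"] by (auto simp: K_def)
  have C: "C_k j \<phi>" for j using \<phi> by (auto simp: test_functions_def)
  show "continuous_on UNIV \<phi>" by (rule C_k_imp_continuous[OF C[of 0]])
  show "continuous_on UNIV (\<lambda>x. frechet_derivative \<phi> (at x) e)"
    by (rule C_k_imp_continuous[OF C_k_SucD(2)[OF C[of "Suc 0"] e]])
  show "frechet_derivative \<phi> (at x) e = 0" if x: "x \<notin> K" for x
  proof -
    have "((\<lambda>x. 0) has_derivative (\<lambda>h. 0)) (at x)" by simp
    then have "(\<phi> has_derivative (\<lambda>h. 0)) (at x)"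
    proof (rule has_derivative_transform_within_open)
      show "open (- K)" unfolding K_def by (intro open_Compl closed_closure)
    qed (use x z in auto)
    from frechet_derivative_at[OF this] show ?thesis by (metis (full_types))
  qed
qed

lemma integrable_on_mult_compact_support:
  fixes v \<psi> :: "'a::euclidean_space \<Rightarrow> real"
  assumes \<Omega>: "\<Omega> \<in> sets lebesgue" and K: "compact K" "K \<subseteq> \<Omega>" and v: "set_integrable lebesgue K v"
    and \<psi>: "continuous_on UNIV \<psi>" and z: "\<And>x. x \<notin> K \<Longrightarrow> \<psi> x = 0"
  shows "integrable (lebesgue_on \<Omega>) (\<lambda>x. v x * \<psi> x)"
proof -
  have "bounded (\<psi> ` K)" by (intro compact_imp_bounded compact_continuous_image continuous_on_subset[OF \<psi>] K) simp
  then obtain B where B: "\<And>x. x \<in> K \<Longrightarrow> \<bar>\<psi> x\<bar> \<le> B" by (auto simp: bounded_iff)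
  have [measurable]: "\<psi> \<in> borel_measurable lebesgue"
    using borel_measurable_continuous_onI[OF \<psi>] by (intro measurable_completion) simp
  have v': "integrable lebesgue (\<lambda>x. indicator K x * v x)" using v by (simp add: set_integrable_def)
  have eq: "indicator \<Omega> x * (v x * \<psi> x) = indicator K x * v x * \<psi> x" for x
    using K(2) z[of x] by (auto simp: indicator_def)
  have "integrable lebesgue (\<lambda>x. indicator K x * v x * \<psi> x)"
  proof (rule Bochner_Integration.integrable_bound)
    show "integrable lebesgue (\<lambda>x. B * (indicator K x * v x))" using v' by simp
    show "AE x in lebesgue. norm (indicator K x * v x * \<psi> x) \<le> norm (B * (indicator K x * v x))"
    proof (rule AE_I2)
      fix x show "norm (indicator K x * v x * \<psi> x) \<le> norm (B * (indicator K x * v x))"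
      proof (cases "x \<in> K")
        case True
        have "\<bar>v x\<bar> * \<bar>\<psi> x\<bar> \<le> \<bar>v x\<bar> * \<bar>B\<bar>" using B[OF True] by (intro mult_left_mono) auto
        then show ?thesis using True by (simp add: abs_mult mult.commute)
      qed simp
    qed
  qed (use v' in \<open>auto intro!: borel_measurable_times\<close>)
  then have "integrable lebesgue (\<lambda>x. indicator \<Omega> x * (v x * \<psi> x))" by (simp only: eq)
  then show ?thesis using \<Omega> by (subst integrable_restrict_space) auto
qed

lemma weak_gradient_diff:
  assumes \<Omega>: "\<Omega> \<in> sets lebesgue" and v: "weak_gradient \<Omega> v g" and v': "weak_gradient \<Omega> v' g'"
  shows "weak_gradient \<Omega> (\<lambda>x. v x - v' x) (\<lambda>x. g x - g' x)"
  unfolding weak_gradient_def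
proof (intro conjI allI impI ballI)
  fix K assume "compact K \<and> K \<subseteq> \<Omega>"
  then have "set_integrable lebesgue K v" "set_integrable lebesgue K v'" "set_integrable lebesgue K g" "set_integrable lebesgue K g'"
    using v v' by (auto simp: weak_gradient_def)
  then show "set_integrable lebesgue K (\<lambda>x. v x - v' x)" "set_integrable lebesgue K (\<lambda>x. g x - g' x)"
    by (auto intro!: set_integral_diff)
next
  fix \<phi> :: "'a \<Rightarrow> real" and e :: 'a assume \<phi>: "\<phi> \<in> test_functions \<Omega>" and e: "e \<in> Basis"
  define K where "K = closure {x. \<phi> x \<noteq> 0}"
  note b = test_function_derivative_bounds[OF \<phi> e, folded K_def]
  have I: "set_integrable lebesgue K v" "set_integrable lebesgue K v'" "set_integrable lebesgue K g" "set_integrable lebesgue K g'"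
    using v v' b(1,2) by (auto simp: weak_gradient_def)
  have Ie: "set_integrable lebesgue K (\<lambda>x. g x \<bullet> e)" "set_integrable lebesgue K (\<lambda>x. g' x \<bullet> e)"
    using integrable_inner_left[of e lebesgue "\<lambda>x. indicator K x *\<^sub>R g x"]
      integrable_inner_left[of e lebesgue "\<lambda>x. indicator K x *\<^sub>R g' x"] I(3,4)
    by (auto simp: set_integrable_def)
  note i = integrable_on_mult_compact_support[OF \<Omega> b(1,2)]
  have "(LINT x|lebesgue_on \<Omega>. (v x - v' x) * frechet_derivative \<phi> (at x) e)
    = (LINT x|lebesgue_on \<Omega>. v x * frechet_derivative \<phi> (at x) e) - (LINT x|lebesgue_on \<Omega>. v' x * frechet_derivative \<phi> (at x) e)"
    using i[OF I(1) b(6) b(4)] i[OF I(2) b(6) b(4)] by (simp add: left_diff_distrib)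
  also have "\<dots> = - (LINT x|lebesgue_on \<Omega>. (g x \<bullet> e) * \<phi> x) + (LINT x|lebesgue_on \<Omega>. (g' x \<bullet> e) * \<phi> x)"
    using v v' \<phi> e by (simp add: weak_gradient_def)
  also have "\<dots> = - (LINT x|lebesgue_on \<Omega>. ((g x - g' x) \<bullet> e) * \<phi> x)"
    using i[OF Ie(1) b(5) b(3)] i[OF Ie(2) b(5) b(3)] by (simp add: left_diff_distrib inner_diff_left)
  finally show "(LINT x|lebesgue_on \<Omega>. (v x - v' x) * frechet_derivative \<phi> (at x) e)
    = - (LINT x|lebesgue_on \<Omega>. ((g x - g' x) \<bullet> e) * \<phi> x)" .
qed

text \<open>Coordinatewise, from the same fact for real functions.\<close>

lemma AE_lebesgue_ex_borel:
  fixes g :: "'a::euclidean_space \<Rightarrow> 'b::euclidean_space"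
  assumes g: "g \<in> borel_measurable lebesgue"
  obtains g' where "g' \<in> borel_measurable borel" "AE x in lborel. g x = g' x"
proof -
  have "\<exists>g'. g' \<in> borel_measurable lborel \<and> (AE x in lborel. g x \<bullet> e = g' x)" for e
    using completion_ex_borel_measurable_real[of "\<lambda>x. g x \<bullet> e" lborel] g by auto
  then have "\<forall>e. \<exists>g'. g' \<in> borel_measurable lborel \<and> (AE x in lborel. g x \<bullet> e = g' x)" by blast
  from choice[OF this] obtain c where c: "\<And>e. c e \<in> borel_measurable lborel"
    "\<And>e. AE x in lborel. g x \<bullet> e = c e x" by blast
  show thesis
  proof
    show "(\<lambda>x. \<Sum>e\<in>Basis. c e x *\<^sub>R e) \<in> borel_measurable borel" using c(1) by (intro borel_measurable_sum) auto
    have "AE x in lborel. \<forall>e\<in>Basis. g x \<bullet> e = c e x" using c(2) by (intro AE_finite_allI) auto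
    then show "AE x in lborel. g x = (\<Sum>e\<in>Basis. c e x *\<^sub>R e)"
    proof eventually_elim
      case (elim x)
      then show ?case by (subst euclidean_representation[symmetric, of "g x"]) (auto intro!: sum.cong)
    qed
  qed
qed

text \<open>The fundamental lemma of the calculus of variations. The bumps converge boundedly to the
indicator of a box, so every component of \<open>g\<close> has integral 0 over every small box; countably many closed
boxes exhaust \<open>\<Omega>\<close>, and their boundaries are null sets.\<close>

lemma weak_gradient_zero:
  assumes \<Omega>: "open \<Omega>" and v: "weak_gradient \<Omega> (\<lambda>x. 0) g"
  shows "AE x in lborel. x \<in> \<Omega> \<longrightarrow> g x = 0"
proof -
  have \<Omega>s: "\<Omega> \<in> sets lebesgue" using \<Omega> by auto
  have boxes: "AE x in lborel. x \<in> box c d \<longrightarrow> g x = 0" if cd: "cbox c d \<subseteq> \<Omega>" for c d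
  proof -
    have gi: "set_integrable lebesgue (cbox c d) g" using v cd by (auto simp: weak_gradient_def)
    have comp: "AE x in lborel. x \<in> box c d \<longrightarrow> g x \<bullet> e = 0" if e: "e \<in> Basis" for e
    proof -
      define \<gamma> where "\<gamma> x = indicator (box c d) x * (g x \<bullet> e)" for x
      have "integrable lebesgue (\<lambda>x. (indicator (cbox c d) x *\<^sub>R g x) \<bullet> e)"
        using gi unfolding set_integrable_def by (rule integrable_inner_left)
      from integrable_mult_indicator[OF _ this, of "box c d"]
      have "integrable lebesgue (\<lambda>x. indicator (box c d) x *\<^sub>R ((indicator (cbox c d) x *\<^sub>R g x) \<bullet> e))" by simp
      moreover have "(\<lambda>x. indicator (box c d) x *\<^sub>R ((indicator (cbox c d) x *\<^sub>R g x) \<bullet> e)) = \<gamma>"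
        using box_subset_cbox by (force simp: \<gamma>_def indicator_def fun_eq_iff)
      ultimately have \<gamma>i: "integrable lebesgue \<gamma>" by simp
      then obtain \<gamma>' where \<gamma>': "\<gamma>' \<in> borel_measurable borel" "AE x in lborel. \<gamma> x = \<gamma>' x"
        using AE_lebesgue_ex_borel[of \<gamma>] by blast
      have \<gamma>'c: "\<gamma>' \<in> borel_measurable lebesgue" using \<gamma>'(1) by (intro measurable_completion) simp
      have \<gamma>'i: "integrable lborel \<gamma>'"
      proof -
        have "integrable lebesgue \<gamma>'"
          by (rule integrable_cong_AE_imp[OF \<gamma>i \<gamma>'c]) (use \<gamma>'(2) in \<open>auto intro: AE_completion elim: eventually_mono\<close>)
        then show ?thesis using \<gamma>'(1) by (simp add: integrable_completion)
      qed
      have zero: "(LINT x|lborel. indicator (box a b) x * \<gamma>' x) = 0" for a b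
      proof -
        obtain a' b' where ab: "box a b \<inter> box c d = box a' b'" using box_Int_box by blast
        have "(LINT x|lborel. indicator (box a b) x * \<gamma>' x) = (LINT x|lebesgue. indicator (box a b) x * \<gamma>' x)"
          using \<gamma>'(1) by (subst integral_completion) auto
        also have "\<dots> = (LINT x|lebesgue. indicator (box a' b') x * \<gamma> x)"
        proof (rule integral_cong_AE)
          show "AE x in lebesgue. indicator (box a b) x * \<gamma>' x = indicator (box a' b') x * \<gamma> x"
            using AE_completion[OF \<gamma>'(2)]
          proof eventually_elim
            case (elim x)
            have "x \<in> box a' b' \<longleftrightarrow> x \<in> box a b \<and> x \<in> box c d" unfolding ab[symmetric] by simp
            then have "indicator (box a' b') x = indicator (box a b) x * (indicator (box c d) x :: real)"
              by (simp split: split_indicator)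
            then show ?case unfolding elim[symmetric] \<gamma>_def by (simp split: split_indicator)
          qed
        qed (use \<gamma>'c \<gamma>i in \<open>auto intro!: borel_measurable_times borel_measurable_indicator\<close>)
        also have "\<dots> = 0"
        proof (rule LIMSEQ_unique)
          show "(\<lambda>j. LINT x|lebesgue. box_bump a' b' j x * \<gamma> x) \<longlonglongrightarrow> (LINT x|lebesgue. indicator (box a' b') x * \<gamma> x)"
          proof (rule integral_dominated_convergence[where w="\<lambda>x. norm (\<gamma> x)"])
            have "box_bump a' b' j \<in> borel_measurable borel" for j
              by (rule borel_measurable_continuous_onI[OF C_k_imp_continuous[OF C_k_box_bump]])
            then have [measurable]: "box_bump a' b' j \<in> borel_measurable lebesgue" for j
              by (intro measurable_completion) simp
            show "(\<lambda>x. box_bump a' b' j x * \<gamma> x) \<in> borel_measurable lebesgue" for j using \<gamma>i by measurable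
            show "AE x in lebesgue. norm (box_bump a' b' j x * \<gamma> x) \<le> norm (\<gamma> x)" for j
              using box_bump_bounds[of a' b' j] by (auto simp: abs_mult intro!: AE_I2 mult_left_le_one_le)
            show "AE x in lebesgue. (\<lambda>j. box_bump a' b' j x * \<gamma> x) \<longlonglongrightarrow> indicator (box a' b') x * \<gamma> x"
              by (intro AE_I2 tendsto_mult box_bump_tendsto tendsto_const)
          qed (use \<gamma>i in \<open>auto intro!: borel_measurable_times borel_measurable_indicator\<close>)
          have "(LINT x|lebesgue. box_bump a' b' j x * \<gamma> x) = 0" for j
          proof (cases "box a' b' = {}")
            case True
            then have "box_bump a' b' j x = 0" for x using box_bump_nonzero[of a' b' j x] by auto
            then show ?thesis by simp
          next
            case False
            have "box a' b' \<subseteq> box c d" using ab by blast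
            then have "cbox a' b' \<subseteq> cbox c d"
              using False closure_mono[of "box a' b'" "box c d"] by (metis closure_box closure_empty subset_empty)
            then have "cbox a' b' \<subseteq> \<Omega>" using cd by blast
            then have t: "box_bump a' b' j \<in> test_functions \<Omega>" by (rule box_bump_test_function)
            have "(LINT x|lebesgue. box_bump a' b' j x * \<gamma> x) = (LINT x|lebesgue_on \<Omega>. (g x \<bullet> e) * box_bump a' b' j x)"
            proof (subst integral_restrict_space)
              show "(LINT x|lebesgue. box_bump a' b' j x * \<gamma> x) = (LINT x|lebesgue. indicator \<Omega> x *\<^sub>R ((g x \<bullet> e) * box_bump a' b' j x))"
              proof (rule Bochner_Integration.integral_cong)
                fix x
                show "box_bump a' b' j x * \<gamma> x = indicator \<Omega> x *\<^sub>R ((g x \<bullet> e) * box_bump a' b' j x)"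
                proof (cases "box_bump a' b' j x = 0")
                  case False
                  then have "x \<in> box c d" "x \<in> \<Omega>"
                    using box_bump_nonzero[of a' b' j x] ab cd box_subset_cbox[of c d] by blast+
                  then show ?thesis by (simp add: \<gamma>_def)
                qed simp
              qed simp
            qed (use \<Omega>s in simp)
            also have "\<dots> = - (LINT x|lebesgue_on \<Omega>. 0 * frechet_derivative (box_bump a' b' j) (at x) e)"
            proof -
              have "(LINT x|lebesgue_on \<Omega>. 0 * frechet_derivative (box_bump a' b' j) (at x) e)
                = - (LINT x|lebesgue_on \<Omega>. (g x \<bullet> e) * box_bump a' b' j x)"
                using v t e unfolding weak_gradient_def by blast
              then show ?thesis by linarith
            qed
            finally show ?thesis by simp
          qed
          then show "(\<lambda>j. LINT x|lebesgue. box_bump a' b' j x * \<gamma> x) \<longlonglongrightarrow> 0" by simp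
        qed
        finally show ?thesis .
      qed
      have "(LINT x|lborel. \<gamma>' x) = (LINT x|lborel. indicator (box c d) x * \<gamma>' x)"
      proof (rule integral_cong_AE)
        show "AE x in lborel. \<gamma>' x = indicator (box c d) x * \<gamma>' x"
          using \<gamma>'(2) by eventually_elim (auto simp: \<gamma>_def indicator_def split: if_splits)
      qed (use \<gamma>'(1) in auto)
      then have "AE x in lborel. \<gamma>' x = 0"
        by (intro AE_zero_if_box_integrals_zero[OF \<gamma>'i zero]) (simp add: zero)
      with \<gamma>'(2) show ?thesis by eventually_elim (auto simp: \<gamma>_def)
    qed
    have "AE x in lborel. \<forall>e\<in>Basis. x \<in> box c d \<longrightarrow> g x \<bullet> e = 0" using comp by (intro AE_finite_allI) auto
    then show ?thesis by eventually_elim (auto intro: euclidean_eqI)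
  qed
  have cboxes: "AE x in lborel. x \<in> cbox c d \<longrightarrow> g x = 0" if "cbox c d \<subseteq> \<Omega>" for c d
  proof -
    have "cbox c d - box c d \<in> null_sets lebesgue"
      using negligible_frontier_interval[of c d] by (simp add: negligible_iff_null_sets)
    then have "AE x in lebesgue. x \<notin> cbox c d - box c d" by (rule AE_not_in)
    then have "AE x in lborel. x \<notin> cbox c d - box c d" by (simp add: AE_completion_iff)
    with boxes[OF that] show ?thesis by eventually_elim auto
  qed
  obtain D where D: "countable D" "D \<subseteq> Pow \<Omega>" "\<And>X. X \<in> D \<Longrightarrow> \<exists>a b. X = cbox a b" "\<Union>D = \<Omega>"
    using open_countable_Union_open_cbox[OF \<Omega>] by blast
  have "AE x in lborel. x \<in> X \<longrightarrow> g x = 0" if "X \<in> D" for X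
    using D(2) D(3)[OF that] that cboxes by blast
  then have "AE x in lborel. \<forall>X\<in>D. x \<in> X \<longrightarrow> g x = 0"
    by (subst AE_ball_countable[OF D(1)]) blast
  then show ?thesis by eventually_elim (use D(4) in blast)
qed

lemma weak_gradient_unique:
  assumes \<Omega>: "open \<Omega>" and "weak_gradient \<Omega> v g" "weak_gradient \<Omega> v g'"
  shows "AE x in lborel. x \<in> \<Omega> \<longrightarrow> g x = g' x"
proof -
  have "\<Omega> \<in> sets lebesgue" using \<Omega> by auto
  from weak_gradient_diff[OF this assms(2,3)] have "weak_gradient \<Omega> (\<lambda>x. 0) (\<lambda>x. g x - g' x)" by simp
  from weak_gradient_zero[OF \<Omega> this] show ?thesis by eventually_elim auto
qed

section \<open>Testing in space and time\<close>

lemma borel_lborel_pair: "borel_measurable (lborel \<Otimes>\<^sub>M lborel) = borel_measurable (borel :: ('a::euclidean_space \<times> 'b::euclidean_space) measure)"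
  by (simp add: lborel_prod)

lemma measurable_conv_param [measurable]:
  fixes F :: "real \<times> 'a::euclidean_space \<Rightarrow> 'b::euclidean_space"
  assumes a[measurable]: "a \<in> borel_measurable borel" and F: "F \<in> borel_measurable borel"
  shows "(\<lambda>p. conv a (\<lambda>s. F (s, snd p)) (fst p)) \<in> borel_measurable borel"
proof -
  have [measurable]: "F \<in> borel_measurable (lborel \<Otimes>\<^sub>M lborel)" using F by (simp add: borel_lborel_pair)
  have "(\<lambda>p. conv a (\<lambda>s. F (s, snd p)) (fst p)) \<in> borel_measurable (lborel \<Otimes>\<^sub>M lborel)"
    unfolding conv_def by measurable
  then show ?thesis by (simp add: borel_lborel_pair)
qed

lemma fubini_sections_x:
  fixes F :: "real \<times> 'a::euclidean_space \<Rightarrow> 'b::euclidean_space"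
  assumes "integrable lborel F"
  shows "AE x in lborel. integrable lborel (\<lambda>s. F (s, x))" "integrable lborel (\<lambda>x. LINT s|lborel. F (s, x))"
    "(LINT x|lborel. LINT s|lborel. F (s, x)) = (LINT p|lborel. F p)"
proof -
  have F: "integrable (lborel \<Otimes>\<^sub>M lborel) (\<lambda>(s, x). F (s, x))" using assms by (simp add: lborel_prod)
  show "AE x in lborel. integrable lborel (\<lambda>s. F (s, x))"
    by (rule lborel_pair.AE_integrable_snd[of "\<lambda>s x. F (s, x)"]) (use F in simp)
  show "integrable lborel (\<lambda>x. LINT s|lborel. F (s, x))"
    by (rule lborel_pair.integrable_snd[of "\<lambda>s x. F (s, x)"]) (use F in simp)
  show "(LINT x|lborel. LINT s|lborel. F (s, x)) = (LINT p|lborel. F p)"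
    using lborel_pair.integral_snd[of "\<lambda>s x. F (s, x)"] F by (simp add: lborel_prod)
qed

lemma fubini_sections_t:
  fixes F :: "real \<times> 'a::euclidean_space \<Rightarrow> 'b::euclidean_space"
  assumes "integrable lborel F"
  shows "AE s in lborel. integrable lborel (\<lambda>x. F (s, x))" "integrable lborel (\<lambda>s. LINT x|lborel. F (s, x))"
    "(LINT s|lborel. LINT x|lborel. F (s, x)) = (LINT p|lborel. F p)"
proof -
  have F: "integrable (lborel \<Otimes>\<^sub>M lborel) F" using assms by (simp add: lborel_prod)
  show "AE s in lborel. integrable lborel (\<lambda>x. F (s, x))" by (rule lborel_pair.AE_integrable_fst'[OF F])
  show "integrable lborel (\<lambda>s. LINT x|lborel. F (s, x))" by (rule lborel_pair.integrable_fst'[OF F])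
  show "(LINT s|lborel. LINT x|lborel. F (s, x)) = (LINT p|lborel. F p)"
    using lborel_pair.integral_fst'[OF F] by (simp add: lborel_prod)
qed

lemma AE_integrable_conv_param:
  fixes F :: "real \<times> 'a::euclidean_space \<Rightarrow> 'b::euclidean_space"
  assumes a: "integrable lborel a" and F: "integrable lborel F"
  shows "AE t in lborel. integrable lborel (\<lambda>(s, x). a (t - s) *\<^sub>R F (s, x))"
proof -
  have [measurable]: "a \<in> borel_measurable borel" "F \<in> borel_measurable (lborel \<Otimes>\<^sub>M lborel)"
    using a F by (auto simp: lborel_prod)
  have Fn: "integrable lborel (\<lambda>p. norm (F p))" using F by simp
  have aa: "integrable lborel (\<lambda>s. \<bar>a s\<bar>)" using a by simp
  show ?thesis
    using AE_integrable_conv[OF aa fubini_sections_t(2)[OF Fn]]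
  proof eventually_elim
    case (elim t)
    have "integrable (lborel \<Otimes>\<^sub>M lborel) (\<lambda>(s, x). a (t - s) *\<^sub>R F (s, x))"
    proof (rule lborel_pair.Fubini_integrable)
      show "AE s in lborel. integrable lborel (\<lambda>x. case (s, x) of (s, x) \<Rightarrow> a (t - s) *\<^sub>R F (s, x))"
        using fubini_sections_t(1)[OF F] by eventually_elim auto
      show "integrable lborel (\<lambda>s. LINT x|lborel. norm (case (s, x) of (s, x) \<Rightarrow> a (t - s) *\<^sub>R F (s, x)))"
        using elim by simp
    qed measurable
    then show ?case by (simp add: lborel_prod)
  qed
qed

text \<open>Fubini's theorem: testing with a function of \<open>x\<close> commutes with convolution in time.\<close>

lemma integral_conv_inner:
  fixes F :: "real \<times> 'a::euclidean_space \<Rightarrow> 'b::euclidean_space"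
  assumes a: "integrable lborel a" and F: "integrable lborel F" and \<eta>[measurable]: "\<eta> \<in> borel_measurable borel"
    and F\<eta>: "integrable lborel (\<lambda>(s, x). norm (F (s, x)) * norm (\<eta> x))"
  shows "AE t in lborel. integrable lborel (\<lambda>x. conv a (\<lambda>s. F (s, x)) t \<bullet> \<eta> x) \<and>
    (LINT x|lborel. conv a (\<lambda>s. F (s, x)) t \<bullet> \<eta> x) = conv a (\<lambda>s. LINT x|lborel. F (s, x) \<bullet> \<eta> x) t"
proof -
  have [measurable]: "a \<in> borel_measurable borel" "F \<in> borel_measurable borel" using a F by auto
  have in\<eta>: "integrable lborel (\<lambda>p. F p \<bullet> \<eta> (snd p))"
  proof (rule Bochner_Integration.integrable_bound[OF F\<eta>])
    have "F \<in> borel_measurable (lborel \<Otimes>\<^sub>M lborel)" by (simp add: borel_lborel_pair)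
    then have "(\<lambda>p. F p \<bullet> \<eta> (snd p)) \<in> borel_measurable (lborel \<Otimes>\<^sub>M lborel)" by measurable
    then show "(\<lambda>p. F p \<bullet> \<eta> (snd p)) \<in> borel_measurable lborel" by (simp add: lborel_prod)
  qed (auto simp: Cauchy_Schwarz_ineq2)
  show ?thesis
    using AE_integrable_conv_param[OF a F] AE_integrable_conv_param[OF a in\<eta>]
  proof eventually_elim
    case (elim t)
    have AEx: "AE x in lborel. (LINT s|lborel. a (t - s) *\<^sub>R (F (s, x) \<bullet> \<eta> x)) = conv a (\<lambda>s. F (s, x)) t \<bullet> \<eta> x"
      using fubini_sections_x(1)[OF elim(1)]
    proof eventually_elim
      case (elim x)
      then have i: "integrable lborel (\<lambda>s. a (t - s) *\<^sub>R F (s, x))" by simp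
      have "(LINT s|lborel. (a (t - s) *\<^sub>R F (s, x)) \<bullet> \<eta> x) = conv a (\<lambda>s. F (s, x)) t \<bullet> \<eta> x"
        unfolding conv_def by (rule integral_inner_left) (rule i)
      then show ?case by simp
    qed
    have m1: "(\<lambda>x. conv a (\<lambda>s. F (s, x)) t \<bullet> \<eta> x) \<in> borel_measurable lborel"
    proof -
      have "(\<lambda>x. conv a (\<lambda>s. F (s, snd (t, x))) (fst (t, x))) \<in> borel_measurable borel"
        by (rule measurable_compose[OF _ measurable_conv_param]) measurable
      then show ?thesis by simp
    qed
    have i1: "integrable lborel (\<lambda>x. LINT s|lborel. a (t - s) *\<^sub>R (F (s, x) \<bullet> \<eta> x))"
      using fubini_sections_x(2)[OF elim(2)] by simp
    have i2: "integrable lborel (\<lambda>x. conv a (\<lambda>s. F (s, x)) t \<bullet> \<eta> x)"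
      by (rule integrable_cong_AE_imp[OF i1 m1]) (use AEx in \<open>auto elim: eventually_mono\<close>)
    have "(LINT x|lborel. conv a (\<lambda>s. F (s, x)) t \<bullet> \<eta> x) = (LINT x|lborel. LINT s|lborel. a (t - s) *\<^sub>R (F (s, x) \<bullet> \<eta> x))"
      by (rule integral_cong_AE) (use m1 i1 AEx in \<open>auto elim: eventually_mono\<close>)
    also have "\<dots> = (LINT s|lborel. LINT x|lborel. a (t - s) *\<^sub>R (F (s, x) \<bullet> \<eta> x))"
      using fubini_sections_x(3)[OF elim(2)] fubini_sections_t(3)[OF elim(2)] by simp
    also have "\<dots> = conv a (\<lambda>s. LINT x|lborel. F (s, x) \<bullet> \<eta> x) t"
      unfolding conv_def by simp
    finally show ?case using i2 by simp
  qed
qed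

lemma young_convolution_param:
  fixes F :: "real \<times> 'a::euclidean_space \<Rightarrow> 'b::euclidean_space"
  assumes p: "p \<ge> 1" and a: "integrable lborel a" and F: "integrable lborel F"
    and Fp: "integrable lborel (\<lambda>q. norm (F q) powr p)"
  shows "integrable lborel (\<lambda>q. norm (conv a (\<lambda>s. F (s, snd q)) (fst q)) powr p)" (is "integrable lborel ?C")
    and "(LINT q|lborel. norm (conv a (\<lambda>s. F (s, snd q)) (fst q)) powr p) \<le> (LINT s|lborel. \<bar>a s\<bar>) powr p * (LINT q|lborel. norm (F q) powr p)"
proof -
  have [measurable]: "a \<in> borel_measurable borel" "F \<in> borel_measurable borel" using a F by auto
  have Cm: "?C \<in> borel_measurable (lborel \<Otimes>\<^sub>M lborel)"
    unfolding borel_lborel_pair by measurable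
  have sec: "AE x in lborel. integrable lborel (\<lambda>s. F (s, x)) \<and> integrable lborel (\<lambda>s. norm (F (s, x)) powr p)"
    using fubini_sections_x(1)[OF F] fubini_sections_x(1)[OF Fp] by eventually_elim simp
  have y: "AE x in lborel. integrable lborel (\<lambda>t. ?C (t, x)) \<and>
     (LINT t|lborel. ?C (t, x)) \<le> (LINT s|lborel. \<bar>a s\<bar>) powr p * (LINT s|lborel. norm (F (s, x)) powr p)"
    using sec
  proof eventually_elim
    case (elim x)
    then show ?case using young_convolution(2,3)[OF p a, of "\<lambda>s. F (s, x)"] by simp
  qed
  have bi: "integrable lborel (\<lambda>x. (LINT s|lborel. \<bar>a s\<bar>) powr p * (LINT s|lborel. norm (F (s, x)) powr p))"
    using fubini_sections_x(2)[OF Fp] by simp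
  have "integrable (lborel \<Otimes>\<^sub>M lborel) (\<lambda>(x, t). ?C (t, x))"
  proof (rule lborel_pair.Fubini_integrable)
    show m: "(\<lambda>(x, t). ?C (t, x)) \<in> borel_measurable (lborel \<Otimes>\<^sub>M lborel)"
      using measurable_compose[OF measurable_pair_swap' Cm] by (simp add: case_prod_unfold)
    show "AE x in lborel. integrable lborel (\<lambda>t. case (x, t) of (x, t) \<Rightarrow> ?C (t, x))"
      using y by eventually_elim simp
    show "integrable lborel (\<lambda>x. LINT t|lborel. norm (case (x, t) of (x, t) \<Rightarrow> ?C (t, x)))"
    proof (rule Bochner_Integration.integrable_bound[OF bi])
      show "(\<lambda>x. LINT t|lborel. norm (case (x, t) of (x, t) \<Rightarrow> ?C (t, x))) \<in> borel_measurable lborel"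
        using m by (intro lborel.borel_measurable_lebesgue_integral) (auto simp: case_prod_unfold)
      show "AE x in lborel. norm (LINT t|lborel. norm (case (x, t) of (x, t) \<Rightarrow> ?C (t, x)))
        \<le> norm ((LINT s|lborel. \<bar>a s\<bar>) powr p * (LINT s|lborel. norm (F (s, x)) powr p))"
        using y by eventually_elim auto
    qed
  qed
  from lborel_pair.integrable_product_swap[OF this] have C: "integrable lborel ?C"
    by (simp add: lborel_prod case_prod_unfold)
  then show "integrable lborel ?C" .
  have "(LINT q|lborel. ?C q) = (LINT x|lborel. LINT t|lborel. ?C (t, x))" using fubini_sections_x(3)[OF C] by simp
  also have "\<dots> \<le> (LINT x|lborel. (LINT s|lborel. \<bar>a s\<bar>) powr p * (LINT s|lborel. norm (F (s, x)) powr p))"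
    by (rule integral_mono_AE[OF fubini_sections_x(2)[OF C] bi]) (use y in \<open>auto elim: eventually_mono\<close>)
  also have "\<dots> = (LINT s|lborel. \<bar>a s\<bar>) powr p * (LINT q|lborel. norm (F q) powr p)"
    using fubini_sections_x(3)[OF Fp] by simp
  finally show "(LINT q|lborel. ?C q) \<le> (LINT s|lborel. \<bar>a s\<bar>) powr p * (LINT q|lborel. norm (F q) powr p)" .
qed

lemma integrable_norm_mult_L2:
  fixes F :: "real \<times> 'a::euclidean_space \<Rightarrow> 'b::euclidean_space" and \<eta> :: "'a \<Rightarrow> 'c::euclidean_space"
  assumes F: "F \<in> borel_measurable borel" and F2: "integrable lborel (\<lambda>q. (norm (F q))\<^sup>2)"
    and F0: "\<And>s x. s \<notin> {0<..<T} \<Longrightarrow> F (s, x) = 0"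
    and \<eta>: "\<eta> \<in> borel_measurable borel" and \<eta>2: "integrable lborel (\<lambda>x. (norm (\<eta> x))\<^sup>2)"
  shows "integrable lborel (\<lambda>(s, x). norm (F (s, x)) * norm (\<eta> x))"
proof -
  note [measurable] = \<eta>
  define e where "e = (indicator {0<..<T} :: real \<Rightarrow> real)"
  have [measurable]: "e \<in> borel_measurable borel" by (simp add: e_def)
  have ei: "integrable lborel e" unfolding e_def by (rule causalD(1)[OF causal_indicator])
  define \<eta>' where "\<eta>' = (\<lambda>(s, x). e s *\<^sub>R \<eta> x)"
  have m': "\<eta>' \<in> borel_measurable (lborel \<Otimes>\<^sub>M lborel)" unfolding \<eta>'_def case_prod_unfold
  proof (rule borel_measurable_scaleR)
    show "(\<lambda>p. e (fst p)) \<in> borel_measurable (lborel \<Otimes>\<^sub>M lborel)"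
      by (rule measurable_compose[OF measurable_fst]) simp
    show "(\<lambda>p. \<eta> (snd p)) \<in> borel_measurable (lborel \<Otimes>\<^sub>M lborel)"
      by (rule measurable_compose[OF measurable_snd]) (use \<eta> in simp)
  qed
  have "integrable (lborel \<Otimes>\<^sub>M lborel) (\<lambda>q. (norm (\<eta>' q))\<^sup>2)"
  proof (rule lborel_pair.Fubini_integrable)
    show "(\<lambda>q. (norm (\<eta>' q))\<^sup>2) \<in> borel_measurable (lborel \<Otimes>\<^sub>M lborel)" using m' by measurable
    have *: "(\<lambda>x. (norm (\<eta>' (s, x)))\<^sup>2) = (\<lambda>x. e s * (norm (\<eta> x))\<^sup>2)" for s
      by (auto simp: \<eta>'_def e_def indicator_def)
    show "AE s in lborel. integrable lborel (\<lambda>x. (norm (\<eta>' (s, x)))\<^sup>2)" using \<eta>2 by (simp add: *)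
    have "(LINT x|lborel. norm ((norm (\<eta>' (s, x)))\<^sup>2)) = e s * (LINT x|lborel. (norm (\<eta> x))\<^sup>2)" for s
      using * by simp
    then show "integrable lborel (\<lambda>s. LINT x|lborel. norm ((norm (\<eta>' (s, x)))\<^sup>2))" using ei by simp
  qed
  then have e2: "integrable lborel (\<lambda>q. (norm (\<eta>' q))\<^sup>2)" by (simp add: lborel_prod)
  have "integrable lborel (\<lambda>q. norm (F q) * norm (\<eta>' q))"
    using integrable_inner_L2(1)[of "\<lambda>q. norm (F q)" lborel "\<lambda>q. norm (\<eta>' q)"] F m' F2 e2
    by (simp add: borel_lborel_pair)
  moreover have "(\<lambda>q. norm (F q) * norm (\<eta>' q)) = (\<lambda>(s, x). norm (F (s, x)) * norm (\<eta> x))"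
    using F0 by (force simp: fun_eq_iff \<eta>'_def e_def indicator_def)
  ultimately show ?thesis by simp
qed

lemma integrable_norm_diff_L2:
  fixes F F' :: "'a \<Rightarrow> 'b::euclidean_space"
  assumes F: "F \<in> borel_measurable M" "F' \<in> borel_measurable M"
    and i: "integrable M (\<lambda>x. (norm (F x))\<^sup>2)" "integrable M (\<lambda>x. (norm (F' x))\<^sup>2)"
  shows "integrable M (\<lambda>x. (norm (F x - F' x))\<^sup>2)"
proof (rule Bochner_Integration.integrable_bound)
  show "integrable M (\<lambda>x. 2 * (norm (F x))\<^sup>2 + 2 * (norm (F' x))\<^sup>2)" using i by simp
  show "AE x in M. norm ((norm (F x - F' x))\<^sup>2) \<le> norm (2 * (norm (F x))\<^sup>2 + 2 * (norm (F' x))\<^sup>2)"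
  proof (rule AE_I2)
    fix x
    have "0 \<le> (norm (F x + F' x))\<^sup>2" by simp
    then have "(norm (F x - F' x))\<^sup>2 \<le> 2 * (norm (F x))\<^sup>2 + 2 * (norm (F' x))\<^sup>2"
      by (simp add: power2_norm_eq_inner inner_diff_left inner_diff_right inner_add_left inner_add_right inner_commute)
    then show "norm ((norm (F x - F' x))\<^sup>2) \<le> norm (2 * (norm (F x))\<^sup>2 + 2 * (norm (F' x))\<^sup>2)" by simp
  qed
qed (use F in auto)

text \<open>The inequality of Cauchy and Schwarz in a form with a free parameter, which avoids square roots in
density arguments.\<close>

lemma integral_inner_le_weighted:
  fixes A B :: "'a \<Rightarrow> 'b::euclidean_space"
  assumes A: "A \<in> borel_measurable M" and B: "B \<in> borel_measurable M"
    and A2: "integrable M (\<lambda>x. (norm (A x))\<^sup>2)" and B2: "integrable M (\<lambda>x. (norm (B x))\<^sup>2)" and d: "d > 0"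
  shows "(LINT x|M. A x \<bullet> B x) \<le> (d * (LINT x|M. (norm (A x))\<^sup>2) + (LINT x|M. (norm (B x))\<^sup>2) / d) / 2"
proof -
  have "(LINT x|M. A x \<bullet> B x) \<le> (LINT x|M. (d * (norm (A x))\<^sup>2 + (norm (B x))\<^sup>2 / d) / 2)"
  proof (rule integral_mono)
    show "integrable M (\<lambda>x. A x \<bullet> B x)" by (rule integrable_inner_L2[OF A B A2 B2])
    fix x
    have "0 \<le> (d * norm (A x) - norm (B x))\<^sup>2" by simp
    then have "2 * (norm (A x) * norm (B x)) * d \<le> (d * (norm (A x))\<^sup>2 + (norm (B x))\<^sup>2 / d) * d"
      using d by (simp add: power2_diff power2_eq_square algebra_simps)
    then have "2 * (norm (A x) * norm (B x)) \<le> d * (norm (A x))\<^sup>2 + (norm (B x))\<^sup>2 / d" using d by simp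
    then show "A x \<bullet> B x \<le> (d * (norm (A x))\<^sup>2 + (norm (B x))\<^sup>2 / d) / 2"
      using norm_cauchy_schwarz[of "A x" "B x"] by simp
  qed (use A2 B2 in auto)
  then show ?thesis using A2 B2 by simp
qed

context PC_regularized
begin

text \<open>For each \<open>c\<close> the scalar functions \<open>\<alpha>\<close>, \<open>\<beta>\<close>, \<open>\<gamma>\<close> obtained by testing with \<open>\<psi> c\<close> satisfy the hypothesis
for removing the regularization. As \<open>C\<close> is countable, the resulting inequalities hold simultaneously at
almost every time, and there they extend by \<open>L\<^sub>2\<close> continuity from the pairs \<open>(\<psi> c, g c)\<close> to the
pair \<open>(w(t), G(t))\<close>. The conclusion is their integral over \<open>t\<close>.\<close>

theorem tested_inequality:
  fixes v f w :: "real \<times> 'a::euclidean_space \<Rightarrow> real" and G :: "real \<times> 'a \<Rightarrow> 'b::euclidean_space"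
    and \<psi> :: "'c \<Rightarrow> 'a \<Rightarrow> real" and g :: "'c \<Rightarrow> 'a \<Rightarrow> 'b"
  assumes v: "integrable lborel v" "integrable lborel (\<lambda>q. (norm (v q))\<^sup>2)" "\<And>s x. s \<notin> {0<..<T} \<Longrightarrow> v (s, x) = 0"
    and f: "integrable lborel f" "integrable lborel (\<lambda>q. (norm (f q))\<^sup>2)" "\<And>s x. s \<notin> {0<..<T} \<Longrightarrow> f (s, x) = 0"
    and G: "integrable lborel G" "integrable lborel (\<lambda>q. (norm (G q))\<^sup>2)" "\<And>s x. s \<notin> {0<..<T} \<Longrightarrow> G (s, x) = 0"
    and w: "w \<in> borel_measurable borel" "integrable lborel (\<lambda>q. (norm (w q))\<^sup>2)" "\<And>s x. s \<notin> {0<..<T} \<Longrightarrow> w (s, x) = 0"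
    and C: "countable C"
    and \<psi>: "\<And>c. c \<in> C \<Longrightarrow> \<psi> c \<in> borel_measurable borel" "\<And>c. c \<in> C \<Longrightarrow> integrable lborel (\<lambda>x. (norm (\<psi> c x))\<^sup>2)"
    and g: "\<And>c. c \<in> C \<Longrightarrow> g c \<in> borel_measurable borel" "\<And>c. c \<in> C \<Longrightarrow> integrable lborel (\<lambda>x. (norm (g c x))\<^sup>2)"
    and weak: "\<And>c n. c \<in> C \<Longrightarrow> AE t in lborel. 0 < t \<and> t < T \<longrightarrow>
       (LINT x|lborel. \<psi> c x * (real (Suc n) * (v (t, x) - conv (h n) (\<lambda>s. v (s, x)) t)) + conv (h n) (\<lambda>s. G (s, x)) t \<bullet> g c x)
         \<le> (LINT x|lborel. conv (h n) (\<lambda>s. f (s, x)) t * \<psi> c x)"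
    and dense: "AE t in lborel. 0 < t \<and> t < T \<longrightarrow> (\<forall>e>0. \<exists>c\<in>C.
       (LINT x|lborel. (norm (w (t, x) - \<psi> c x))\<^sup>2) + (LINT x|lborel. (norm (G (t, x) - g c x))\<^sup>2) \<le> e)"
  shows "integrable lborel (\<lambda>q. v q * w q)"
    and "integrable lborel (\<lambda>q. conv l (\<lambda>s. f (s, snd q)) (fst q) * w q)"
    and "integrable lborel (\<lambda>q. conv l (\<lambda>s. G (s, snd q)) (fst q) \<bullet> G q)"
    and "(LINT q|lborel. v q * w q) + (LINT q|lborel. conv l (\<lambda>s. G (s, snd q)) (fst q) \<bullet> G q)
       \<le> (LINT q|lborel. conv l (\<lambda>s. f (s, snd q)) (fst q) * w q)"
proof -
  note li = integrable_kernels(2)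
  have [measurable]: "v \<in> borel_measurable borel" "f \<in> borel_measurable borel" "G \<in> borel_measurable borel"
    "w \<in> borel_measurable borel" using v f G w by auto
  define lf where "lf q = conv l (\<lambda>s. f (s, snd q)) (fst q)" for q
  define lG where "lG q = conv l (\<lambda>s. G (s, snd q)) (fst q)" for q
  have [measurable]: "lf \<in> borel_measurable borel" "lG \<in> borel_measurable borel"
    unfolding lf_def[abs_def] lG_def[abs_def] by measurable
  have lf2: "integrable lborel (\<lambda>q. (norm (lf q))\<^sup>2)"
    using young_convolution_param(1)[OF _ li f(1), of 2] f(2) by (simp add: lf_def)
  have lG2: "integrable lborel (\<lambda>q. (norm (lG q))\<^sup>2)"
    using young_convolution_param(1)[OF _ li G(1), of 2] G(2) by (simp add: lG_def)
  have ivw: "integrable lborel (\<lambda>q. v q * w q)"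
    using integrable_inner_L2(1)[OF _ _ v(2) w(2)] by simp
  have ifw: "integrable lborel (\<lambda>q. lf q * w q)"
    using integrable_inner_L2(1)[OF _ _ lf2 w(2)] by simp
  have iGG: "integrable lborel (\<lambda>q. lG q \<bullet> G q)"
    by (rule integrable_inner_L2(1)[OF _ _ lG2 G(2)]) measurable
  show "integrable lborel (\<lambda>q. v q * w q)" "integrable lborel (\<lambda>q. conv l (\<lambda>s. f (s, snd q)) (fst q) * w q)"
    "integrable lborel (\<lambda>q. conv l (\<lambda>s. G (s, snd q)) (fst q) \<bullet> G q)"
    using ivw ifw iGG by (simp_all add: lf_def lG_def)

  have limit: "AE t in lborel. 0 < t \<and> t < T \<longrightarrow>
     (LINT x|lborel. v (t, x) * \<psi> c x) + (LINT x|lborel. lG (t, x) \<bullet> g c x) \<le> (LINT x|lborel. lf (t, x) * \<psi> c x)"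
    if c: "c \<in> C" for c
  proof -
    have \<psi>m[measurable]: "\<psi> c \<in> borel_measurable borel" and gm[measurable]: "g c \<in> borel_measurable borel"
      using \<psi>(1)[OF c] g(1)[OF c] .
    have v\<psi>: "integrable lborel (\<lambda>(s, x). norm (v (s, x)) * norm (\<psi> c x))"
      by (rule integrable_norm_mult_L2[OF _ v(2,3) \<psi>(1)[OF c] \<psi>(2)[OF c]]) auto
    have f\<psi>: "integrable lborel (\<lambda>(s, x). norm (f (s, x)) * norm (\<psi> c x))"
      by (rule integrable_norm_mult_L2[OF _ f(2,3) \<psi>(1)[OF c] \<psi>(2)[OF c]]) auto
    have Gg: "integrable lborel (\<lambda>(s, x). norm (G (s, x)) * norm (g c x))"
      by (rule integrable_norm_mult_L2[OF _ G(2,3) g(1)[OF c] g(2)[OF c]]) auto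
    define \<alpha> \<beta> \<gamma> where "\<alpha> s = (LINT x|lborel. v (s, x) \<bullet> \<psi> c x)"
      and "\<beta> s = (LINT x|lborel. G (s, x) \<bullet> g c x)" and "\<gamma> s = (LINT x|lborel. f (s, x) \<bullet> \<psi> c x)" for s
    have inn: "integrable lborel (\<lambda>q. F q \<bullet> \<eta> (snd q))"
      if "F \<in> borel_measurable borel" "\<eta> \<in> borel_measurable borel" "integrable lborel (\<lambda>(s, x). norm (F (s, x)) * norm (\<eta> x))"
      for F :: "real \<times> 'a \<Rightarrow> 'd::euclidean_space" and \<eta>
    proof (rule Bochner_Integration.integrable_bound[OF that(3)])
      have "F \<in> borel_measurable (lborel \<Otimes>\<^sub>M lborel)" "\<eta> \<in> borel_measurable lborel" using that by (simp_all add: borel_lborel_pair)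
      then have "(\<lambda>p. F p \<bullet> \<eta> (snd p)) \<in> borel_measurable (lborel \<Otimes>\<^sub>M lborel)" by measurable
      then show "(\<lambda>p. F p \<bullet> \<eta> (snd p)) \<in> borel_measurable lborel" by (simp add: lborel_prod)
    qed (auto simp: Cauchy_Schwarz_ineq2)
    have iv: "integrable lborel (\<lambda>q. v q \<bullet> \<psi> c (snd q))" by (rule inn[OF _ _ v\<psi>]) auto
    have if': "integrable lborel (\<lambda>q. f q \<bullet> \<psi> c (snd q))" by (rule inn[OF _ _ f\<psi>]) auto
    have iG: "integrable lborel (\<lambda>q. G q \<bullet> g c (snd q))" by (rule inn[OF _ _ Gg]) auto
    have \<alpha>: "causal \<alpha>" using fubini_sections_t(2)[OF iv] v(3) by (auto simp: causal_def \<alpha>_def[abs_def])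
    have \<beta>: "causal \<beta>" using fubini_sections_t(2)[OF iG] G(3) by (auto simp: causal_def \<beta>_def[abs_def])
    have \<gamma>: "causal \<gamma>" using fubini_sections_t(2)[OF if'] f(3) by (auto simp: causal_def \<gamma>_def[abs_def])
    have "AE t in lborel. t < T \<longrightarrow> \<alpha> t + conv l \<beta> t \<le> conv l \<gamma> t"
    proof (rule remove_regularization[OF \<alpha> \<beta> \<gamma>])
      fix n
      show "AE t in lborel. 0 < t \<and> t < T \<longrightarrow> real (Suc n) * (\<alpha> t - conv (h n) \<alpha> t) + conv (h n) \<beta> t \<le> conv (h n) \<gamma> t"
        using weak[OF c, of n] integral_conv_inner[OF integrable_h v(1) \<psi>m v\<psi>, of n] integral_conv_inner[OF integrable_h f(1) \<psi>m f\<psi>, of n]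
          integral_conv_inner[OF integrable_h G(1) gm Gg, of n] fubini_sections_t(1)[OF iv]
      proof eventually_elim
        case (elim t)
        show ?case
        proof
          assume t: "0 < t \<and> t < T"
          have "(LINT x|lborel. \<psi> c x * (real (Suc n) * (v (t, x) - conv (h n) (\<lambda>s. v (s, x)) t)) + conv (h n) (\<lambda>s. G (s, x)) t \<bullet> g c x)
            = (LINT x|lborel. real (Suc n) * (v (t, x) \<bullet> \<psi> c x - conv (h n) (\<lambda>s. v (s, x)) t \<bullet> \<psi> c x) + conv (h n) (\<lambda>s. G (s, x)) t \<bullet> g c x)"
            by (rule Bochner_Integration.integral_cong) (auto simp: algebra_simps)
          also have "\<dots> = real (Suc n) * ((LINT x|lborel. v (t, x) \<bullet> \<psi> c x) - (LINT x|lborel. conv (h n) (\<lambda>s. v (s, x)) t \<bullet> \<psi> c x))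
             + (LINT x|lborel. conv (h n) (\<lambda>s. G (s, x)) t \<bullet> g c x)"
          proof -
            have "integrable lborel (\<lambda>x. v (t, x) \<bullet> \<psi> c x)" using elim(5) by simp
            moreover have "integrable lborel (\<lambda>x. conv (h n) (\<lambda>s. v (s, x)) t \<bullet> \<psi> c x)" using elim(2) by blast
            moreover have "integrable lborel (\<lambda>x. conv (h n) (\<lambda>s. G (s, x)) t \<bullet> g c x)" using elim(4) by blast
            ultimately show ?thesis
              by (simp only: Bochner_Integration.integral_add Bochner_Integration.integral_diff
                Bochner_Integration.integrable_diff integrable_mult_right integral_mult_right_zero)
          qed
          also have "\<dots> = real (Suc n) * (\<alpha> t - conv (h n) \<alpha> t) + conv (h n) \<beta> t"
            using elim(2,4) by (simp add: \<alpha>_def[abs_def] \<beta>_def[abs_def] del: of_nat_Suc inner_real_def)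
          finally have 1: "real (Suc n) * (\<alpha> t - conv (h n) \<alpha> t) + conv (h n) \<beta> t
            \<le> (LINT x|lborel. conv (h n) (\<lambda>s. f (s, x)) t * \<psi> c x)" using elim(1) t by simp
          have "(LINT x|lborel. conv (h n) (\<lambda>s. f (s, x)) t * \<psi> c x) = conv (h n) \<gamma> t"
            using elim(3) by (simp add: \<gamma>_def[abs_def])
          with 1 show "real (Suc n) * (\<alpha> t - conv (h n) \<alpha> t) + conv (h n) \<beta> t \<le> conv (h n) \<gamma> t" by simp
        qed
      qed
    qed
    then show ?thesis
      using integral_conv_inner[OF li f(1) \<psi>m f\<psi>] integral_conv_inner[OF li G(1) gm Gg]
      by eventually_elim (simp add: \<alpha>_def[abs_def] \<beta>_def[abs_def] \<gamma>_def[abs_def] lf_def lG_def)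
  qed
  have all: "AE t in lborel. \<forall>c\<in>C. 0 < t \<and> t < T \<longrightarrow>
     (LINT x|lborel. v (t, x) * \<psi> c x) + (LINT x|lborel. lG (t, x) \<bullet> g c x) \<le> (LINT x|lborel. lf (t, x) * \<psi> c x)"
    using limit by (subst AE_ball_countable[OF C]) blast
  have sect: "(\<lambda>x. F (t, x)) \<in> borel_measurable lborel" if "F \<in> borel_measurable borel" for F :: "real \<times> 'a \<Rightarrow> 'd::euclidean_space" and t
  proof -
    have "F \<in> borel_measurable (lborel \<Otimes>\<^sub>M lborel)" using that by (simp add: borel_lborel_pair)
    then show ?thesis by measurable
  qed
  have pointwise: "AE t in lborel. (LINT x|lborel. v (t, x) * w (t, x) + lG (t, x) \<bullet> G (t, x) - lf (t, x) * w (t, x)) \<le> 0"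
    using all dense fubini_sections_t(1)[OF v(2)] fubini_sections_t(1)[OF w(2)] fubini_sections_t(1)[OF G(2)]
      fubini_sections_t(1)[OF lf2] fubini_sections_t(1)[OF lG2]
  proof eventually_elim
    case (elim t)
    note L2 = elim(3-7)
    show ?case
    proof (cases "0 < t \<and> t < T")
      case False
      then show ?thesis using v(3)[of t] w(3)[of t] G(3)[of t] by simp
    next
      case True
      define A where "A x = v (t, x) - lf (t, x)" for x
      define B where "B x = lG (t, x)" for x
      have Am: "A \<in> borel_measurable lborel" and Bm: "B \<in> borel_measurable lborel"
        unfolding A_def[abs_def] B_def[abs_def] by (intro borel_measurable_diff sect; measurable)+
      have B2: "integrable lborel (\<lambda>x. (norm (B x))\<^sup>2)" using L2 by (simp add: B_def)
      have A2: "integrable lborel (\<lambda>x. (norm (A x))\<^sup>2)"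
        unfolding A_def[abs_def] by (intro integrable_norm_diff_L2 sect L2; measurable)
      define M where "M = (LINT x|lborel. (norm (A x))\<^sup>2) + (LINT x|lborel. (norm (B x))\<^sup>2)"
      have wm: "(\<lambda>x. w (t, x)) \<in> borel_measurable lborel" "(\<lambda>x. G (t, x)) \<in> borel_measurable lborel" by (intro sect; measurable)+
      have wi: "integrable lborel (\<lambda>x. A x \<bullet> w (t, x))" "integrable lborel (\<lambda>x. B x \<bullet> G (t, x))"
        by (intro integrable_inner_L2 Am Bm wm A2 B2; use L2 in simp)+
      define Q where "Q = (LINT x|lborel. A x \<bullet> w (t, x)) + (LINT x|lborel. B x \<bullet> G (t, x))"
      have Qd: "Q \<le> d * (M + 1) / 2" if d: "d > 0" for d
      proof -
        have "d\<^sup>2 > 0" using d by simp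
        with elim(2) True obtain c where c: "c \<in> C"
          "(LINT x|lborel. (norm (w (t, x) - \<psi> c x))\<^sup>2) + (LINT x|lborel. (norm (G (t, x) - g c x))\<^sup>2) \<le> d\<^sup>2" by blast
        have cm: "\<psi> c \<in> borel_measurable lborel" "g c \<in> borel_measurable lborel" using \<psi>(1)[OF c(1)] g(1)[OF c(1)] by auto
        note c2 = \<psi>(2)[OF c(1)] g(2)[OF c(1)]
        have ci: "integrable lborel (\<lambda>x. A x \<bullet> \<psi> c x)" "integrable lborel (\<lambda>x. B x \<bullet> g c x)"
          by (intro integrable_inner_L2 Am Bm cm A2 B2 c2)+
        have d2: "integrable lborel (\<lambda>x. (norm (w (t, x) - \<psi> c x))\<^sup>2)" "integrable lborel (\<lambda>x. (norm (G (t, x) - g c x))\<^sup>2)"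
          by (intro integrable_norm_diff_L2 wm cm c2; use L2 in simp)+
        have le0: "(LINT x|lborel. A x \<bullet> \<psi> c x) + (LINT x|lborel. B x \<bullet> g c x) \<le> 0"
        proof -
          have "integrable lborel (\<lambda>x. v (t, x) * \<psi> c x)" "integrable lborel (\<lambda>x. lf (t, x) * \<psi> c x)"
            using integrable_inner_L2(1)[OF sect cm(1) L2(1) c2(1)] integrable_inner_L2(1)[OF sect cm(1) L2(4) c2(1)] by simp_all
          moreover have "(LINT x|lborel. v (t, x) * \<psi> c x) + (LINT x|lborel. lG (t, x) \<bullet> g c x) \<le> (LINT x|lborel. lf (t, x) * \<psi> c x)"
            using elim(1) c(1) True by blast
          ultimately show ?thesis by (simp add: A_def B_def left_diff_distrib)
        qed
        have "Q = ((LINT x|lborel. A x \<bullet> \<psi> c x) + (LINT x|lborel. B x \<bullet> g c x))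
          + (LINT x|lborel. A x \<bullet> (w (t, x) - \<psi> c x)) + (LINT x|lborel. B x \<bullet> (G (t, x) - g c x))"
          using wi ci by (simp add: Q_def inner_diff_right right_diff_distrib)
        also have "\<dots> \<le> 0 + (d * (LINT x|lborel. (norm (A x))\<^sup>2) + (LINT x|lborel. (norm (w (t, x) - \<psi> c x))\<^sup>2) / d) / 2
           + (d * (LINT x|lborel. (norm (B x))\<^sup>2) + (LINT x|lborel. (norm (G (t, x) - g c x))\<^sup>2) / d) / 2"
          by (intro add_mono le0 integral_inner_le_weighted Am Bm A2 B2 d2 d borel_measurable_diff wm cm)
        also have "\<dots> = (d * M + ((LINT x|lborel. (norm (w (t, x) - \<psi> c x))\<^sup>2) + (LINT x|lborel. (norm (G (t, x) - g c x))\<^sup>2)) / d) / 2"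
          by (simp add: M_def add_divide_distrib algebra_simps)
        also have "\<dots> \<le> (d * M + d\<^sup>2 / d) / 2"
          using c(2) d by (intro divide_right_mono add_left_mono) auto
        also have "\<dots> = d * (M + 1) / 2" using d by (simp add: power2_eq_square algebra_simps)
        finally show ?thesis .
      qed
      have M0: "M \<ge> 0" by (simp add: M_def)
      have "Q \<le> 0"
      proof (rule field_le_epsilon)
        fix e :: real assume e: "e > 0"
        have "Q \<le> (2 * e / (M + 1)) * (M + 1) / 2" by (rule Qd) (use e M0 in simp)
        then show "Q \<le> 0 + e" using M0 by simp
      qed
      moreover have "(LINT x|lborel. v (t, x) * w (t, x) + lG (t, x) \<bullet> G (t, x) - lf (t, x) * w (t, x))
        = (LINT x|lborel. A x \<bullet> w (t, x) + B x \<bullet> G (t, x))"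
        by (rule Bochner_Integration.integral_cong) (auto simp: A_def B_def algebra_simps)
      ultimately show ?thesis using wi by (simp add: Q_def)
    qed
  qed
  define R where "R q = v q * w q + lG q \<bullet> G q - lf q * w q" for q
  have Ri: "integrable lborel R" unfolding R_def[abs_def] using ivw iGG ifw by simp
  have "(LINT q|lborel. R q) = (LINT t|lborel. LINT x|lborel. R (t, x))" using fubini_sections_t(3)[OF Ri] by simp
  also have "\<dots> \<le> (LINT t|(lborel::real measure). 0)"
    by (rule integral_mono_AE[OF fubini_sections_t(2)[OF Ri]]) (use pointwise in \<open>auto simp: R_def\<close>)
  finally have "(LINT q|lborel. R q) \<le> 0" by simp
  moreover have "(LINT q|lborel. R q) = (LINT q|lborel. v q * w q) + (LINT q|lborel. lG q \<bullet> G q) - (LINT q|lborel. lf q * w q)"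
    unfolding R_def[abs_def] using ivw iGG ifw by simp
  ultimately show "(LINT q|lborel. v q * w q) + (LINT q|lborel. conv l (\<lambda>s. G (s, snd q)) (fst q) \<bullet> G q)
       \<le> (LINT q|lborel. conv l (\<lambda>s. f (s, snd q)) (fst q) * w q)"
    by (simp add: lf_def lG_def)
qed

end

section \<open>The integral estimate for Borel functions\<close>

lemma indicator_tensor:
  fixes \<phi> :: "'a::euclidean_space \<Rightarrow> real"
  assumes T: "T > 0" and \<phi>: "integrable lborel \<phi>"
  shows "integrable lborel (\<lambda>q. indicator {0<..<T} (fst q) * \<phi> (snd q))"
    "(LINT q|lborel. indicator {0<..<T} (fst q) * \<phi> (snd q)) = T * (LINT x|lborel. \<phi> x)"
proof -
  define E where "E = (indicator {0<..<T} :: real \<Rightarrow> real)"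
  have E: "integrable lborel E" "E \<in> borel_measurable borel" unfolding E_def using causalD(1)[OF causal_indicator] by auto
  have "integrable (lborel \<Otimes>\<^sub>M lborel) (\<lambda>q. E (fst q) * \<phi> (snd q))"
  proof (rule lborel_pair.Fubini_integrable)
    show "(\<lambda>q. E (fst q) * \<phi> (snd q)) \<in> borel_measurable (lborel \<Otimes>\<^sub>M lborel)"
    proof (rule borel_measurable_times)
      show "(\<lambda>p. E (fst p)) \<in> borel_measurable (lborel \<Otimes>\<^sub>M lborel)"
        by (rule measurable_compose[OF measurable_fst]) (use E in simp)
      show "(\<lambda>p. \<phi> (snd p)) \<in> borel_measurable (lborel \<Otimes>\<^sub>M lborel)"
        by (rule measurable_compose[OF measurable_snd]) (use \<phi> in auto)
    qed
    show "AE s in lborel. integrable lborel (\<lambda>x. E (fst (s, x)) * \<phi> (snd (s, x)))" using \<phi> by simp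
    have "(LINT x|lborel. norm (E (fst (s, x)) * \<phi> (snd (s, x)))) = E s * (LINT x|lborel. \<bar>\<phi> x\<bar>)" for s
      by (simp add: abs_mult E_def)
    then show "integrable lborel (\<lambda>s. LINT x|lborel. norm (E (fst (s, x)) * \<phi> (snd (s, x))))" using E by simp
  qed
  then have i: "integrable lborel (\<lambda>q. E (fst q) * \<phi> (snd q))" by (simp add: lborel_prod)
  have "(LINT q|lborel. E (fst q) * \<phi> (snd q)) = (LINT s|lborel. E s * (LINT x|lborel. \<phi> x))"
    using fubini_sections_t(3)[OF i] by simp
  also have "\<dots> = T * (LINT x|lborel. \<phi> x)" using T by (simp add: E_def)
  finally show "(LINT q|lborel. indicator {0<..<T} (fst q) * \<phi> (snd q)) = T * (LINT x|lborel. \<phi> x)" by (simp add: E_def)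
  show "integrable lborel (\<lambda>q. indicator {0<..<T} (fst q) * \<phi> (snd q))" using i by (simp add: E_def)
qed

text \<open>Young's inequality with the exponents \<open>m + 1\<close> and \<open>(m + 1) / m\<close>. The weight \<open>c\<close> is chosen so that
\<open>s powr (m + 1)\<close> gets the coefficient 1.\<close>

lemma young_absorption:
  fixes A s m :: real
  assumes m: "m \<ge> 1" and A: "A \<ge> 0" and s: "s \<ge> 0"
  shows "A * s powr m \<le> s powr (m + 1) + m powr m / (m + 1) powr (m + 1) * A powr (m + 1)"
proof -
  define p q where "p = m + 1" and "q = (m + 1) / m"
  define c where "c = q powr (1 / q)"
  have pq: "p > 1" "q > 1" "1 / p + 1 / q = 1" using m by (auto simp: p_def q_def field_simps)
  have c0: "c > 0" using pq by (simp add: c_def)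
  have cq: "c powr q = q" using pq by (simp add: c_def powr_powr)
  have "(A / c) * (c * s powr m) \<le> (A / c) powr p / p + (c * s powr m) powr q / q"
    by (rule Youngs_inequality[OF pq]) (use A c0 in auto)
  moreover have "(A / c) * (c * s powr m) = A * s powr m" using c0 by simp
  moreover have "(c * s powr m) powr q / q = s powr (m + 1)"
  proof -
    have "m * q = m + 1" using m by (simp add: q_def)
    then have "(c * s powr m) powr q = q * s powr (m + 1)" using c0 cq by (simp add: powr_mult powr_powr)
    then show ?thesis using pq by simp
  qed
  moreover have "(A / c) powr p / p = m powr m / (m + 1) powr (m + 1) * A powr (m + 1)"
  proof -
    have "1 / q * p = m" using m by (simp add: q_def p_def)
    then have "c powr p = q powr m" by (simp add: c_def powr_powr)
    also have "\<dots> = (m + 1) powr m / m powr m" using m by (simp add: q_def powr_divide)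
    finally have "(A / c) powr p = A powr p * (m powr m / (m + 1) powr m)"
      using A c0 by (simp add: powr_divide)
    moreover have "(m + 1) powr (m + 1) = (m + 1) powr m * (m + 1)" using m by (simp add: powr_add)
    ultimately show ?thesis using m by (simp add: p_def)
  qed
  ultimately show ?thesis by simp
qed

lemma powr_sum_le:
  fixes x y p :: real
  assumes p: "p \<ge> 1" and x: "x \<ge> 0" and y: "y \<ge> 0"
  shows "(x + y) powr p \<le> 2 powr (p - 1) * (x powr p + y powr p)"
proof (cases "x + y = 0")
  case False
  define c where "c = (x + y) / 2"
  have c: "c > 0" using False x y by (simp add: c_def)
  have "p * c powr (p - 1) * x + p * c powr (p - 1) * y \<le> (x powr p + (p - 1) * c powr p) + (y powr p + (p - 1) * c powr p)"
    using c by (intro add_mono powr_tangent p x y) auto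
  moreover have cp: "c powr p = c powr (p - 1) * c" using c powr_add[of c "p - 1" 1] by simp
  moreover have "p * c powr (p - 1) * x + p * c powr (p - 1) * y = 2 * p * (c powr (p - 1) * c)"
    by (simp add: c_def algebra_simps)
  ultimately have "2 * c powr p \<le> x powr p + y powr p" by (simp add: algebra_simps)
  then have "2 powr (p - 1) * (2 * c powr p) \<le> 2 powr (p - 1) * (x powr p + y powr p)" by (intro mult_left_mono) auto
  moreover have "2 powr (p - 1) * (2 * c powr p) = (x + y) powr p"
  proof -
    have "2 powr p = 2 powr (p - 1) * 2" using powr_add[of 2 "p - 1" 1] by simp
    moreover have "(x + y) powr p = 2 powr p * c powr p"
    proof -
      have "x + y = 2 * c" by (simp add: c_def)
      then show ?thesis using c by (simp add: powr_mult)
    qed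
    ultimately show ?thesis by simp
  qed
  ultimately show ?thesis by simp
qed (use x y in auto)

text \<open>The product of the constants of absorption and of convexity, with \<open>r = a2 / a1\<close>.\<close>

lemma constant_identity:
  fixes m r :: real
  assumes m: "m \<ge> 1" and r: "r > 0"
  shows "m powr m / (m + 1) powr (m + 1) * (2 * r) powr (m + 1) * 2 powr m
    = 2 * (4 * m) powr m / (m + 1) powr (m + 1) * r powr (m + 1)"
proof -
  have "(2 * r) powr (m + 1) = 2 * 2 powr m * r powr (m + 1)" using r by (simp add: powr_mult powr_add)
  moreover have "(4 * m) powr m = 2 powr m * 2 powr m * m powr m"
    using m by (simp add: powr_mult[symmetric])
  ultimately show ?thesis by simp
qed

context PC_regularized
begin

text \<open>Twice the tested inequality divided by \<open>a1\<close> contains \<open>2 u powr (m + 1)\<close> on the left; one copy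
absorbs the right-hand side, the other stays. This is legitimate because \<open>u powr (m + 1)\<close> is integrable.
The functions \<open>\<psi> c\<close> and \<open>g c\<close> stand for a dense family of values of \<open>w\<close> and of its gradient.\<close>

theorem borel_estimate:
  fixes u f w :: "real \<times> 'a::euclidean_space \<Rightarrow> real" and G :: "real \<times> 'a \<Rightarrow> 'b::euclidean_space" and u0 :: "'a \<Rightarrow> real"
    and \<psi> :: "'c \<Rightarrow> 'a \<Rightarrow> real" and g :: "'c \<Rightarrow> 'a \<Rightarrow> 'b" and m a1 a2 :: real
  assumes m: "m \<ge> 1" and a: "a1 > 0" "a2 > 0"
    and u: "integrable lborel u" "integrable lborel (\<lambda>q. (norm (u q))\<^sup>2)" "\<And>s x. s \<notin> {0<..<T} \<Longrightarrow> u (s, x) = 0"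
      "\<And>q. 0 \<le> u q" "integrable lborel (\<lambda>q. u q powr (m + 1))"
    and u0: "integrable lborel u0" "integrable lborel (\<lambda>x. (norm (u0 x))\<^sup>2)" "integrable lborel (\<lambda>x. \<bar>u0 x\<bar> powr (m + 1))"
    and f: "integrable lborel f" "integrable lborel (\<lambda>q. (norm (f q))\<^sup>2)" "\<And>s x. s \<notin> {0<..<T} \<Longrightarrow> f (s, x) = 0"
      "integrable lborel (\<lambda>q. \<bar>f q\<bar> powr (m + 1))"
    and G: "integrable lborel G" "integrable lborel (\<lambda>q. (norm (G q))\<^sup>2)" "\<And>s x. s \<notin> {0<..<T} \<Longrightarrow> G (s, x) = 0"
    and w: "w \<in> borel_measurable borel" "integrable lborel (\<lambda>q. (norm (w q))\<^sup>2)" "\<And>s x. s \<notin> {0<..<T} \<Longrightarrow> w (s, x) = 0"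
    and uw: "AE q in lborel. a1 * u q powr m \<le> w q \<and> w q \<le> a2 * u q powr m"
    and C: "countable C"
    and \<psi>: "\<And>c. c \<in> C \<Longrightarrow> \<psi> c \<in> borel_measurable borel" "\<And>c. c \<in> C \<Longrightarrow> integrable lborel (\<lambda>x. (norm (\<psi> c x))\<^sup>2)"
    and g: "\<And>c. c \<in> C \<Longrightarrow> g c \<in> borel_measurable borel" "\<And>c. c \<in> C \<Longrightarrow> integrable lborel (\<lambda>x. (norm (g c x))\<^sup>2)"
    and weak: "\<And>c n. c \<in> C \<Longrightarrow> AE t in lborel. 0 < t \<and> t < T \<longrightarrow>
       (LINT x|lborel. \<psi> c x * (real (Suc n) * ((u (t, x) - E t * u0 x) - conv (h n) (\<lambda>s. u (s, x) - E s * u0 x) t))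
          + conv (h n) (\<lambda>s. G (s, x)) t \<bullet> g c x)
         \<le> (LINT x|lborel. conv (h n) (\<lambda>s. f (s, x)) t * \<psi> c x)"
    and dense: "AE t in lborel. 0 < t \<and> t < T \<longrightarrow> (\<forall>e>0. \<exists>c\<in>C.
       (LINT x|lborel. (norm (w (t, x) - \<psi> c x))\<^sup>2) + (LINT x|lborel. (norm (G (t, x) - g c x))\<^sup>2) \<le> e)"
  shows "(\<integral>\<^sup>+q. ennreal (u q powr (m + 1)) \<partial>lborel)
      + ennreal (1 / a1) * (\<integral>\<^sup>+x. (\<integral>\<^sup>+t. ennreal (E t * ((k (T - t) + k t) * (norm (dconv l (\<lambda>s. G (s, x)) t))\<^sup>2)) \<partial>lborel) \<partial>lborel)
     \<le> ennreal (2 * (4 * m) powr m / (m + 1) powr (m + 1) * (a2 / a1) powr (m + 1) *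
         (T * (LINT x|lborel. \<bar>u0 x\<bar> powr (m + 1)) + (LINT s|lborel. \<bar>l s\<bar>) powr (m + 1) * (LINT q|lborel. \<bar>f q\<bar> powr (m + 1))))"
proof -
  note li = integrable_kernels(2)
  have [measurable]: "u \<in> borel_measurable borel" "f \<in> borel_measurable borel" "G \<in> borel_measurable borel"
    "w \<in> borel_measurable borel" "u0 \<in> borel_measurable borel" using u f G w u0 by auto
  define lf where "lf q = conv l (\<lambda>s. f (s, snd q)) (fst q)" for q
  define lG where "lG q = conv l (\<lambda>s. G (s, snd q)) (fst q)" for q
  have [measurable]: "lf \<in> borel_measurable borel" "lG \<in> borel_measurable borel"
    unfolding lf_def[abs_def] lG_def[abs_def] by measurable
  define U0 where "U0 q = E (fst q) * u0 (snd q)" for q :: "real \<times> 'a"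
  have U0: "integrable lborel U0" unfolding U0_def[abs_def] by (rule indicator_tensor(1)[OF T u0(1)])
  have U0m[measurable]: "U0 \<in> borel_measurable borel" using U0 by auto
  have U02: "integrable lborel (\<lambda>q. (norm (U0 q))\<^sup>2)"
  proof -
    have "(\<lambda>q. (norm (U0 q))\<^sup>2) = (\<lambda>q. E (fst q) * (norm (u0 (snd q)))\<^sup>2)"
      by (auto simp: U0_def power_mult_distrib fun_eq_iff indicator_def)
    then show ?thesis using indicator_tensor(1)[OF T u0(2)] by simp
  qed
  have U0p_eq: "(\<lambda>q. \<bar>U0 q\<bar> powr (m + 1)) = (\<lambda>q. E (fst q) * \<bar>u0 (snd q)\<bar> powr (m + 1))"
    by (auto simp: U0_def fun_eq_iff indicator_def)
  have U0p: "integrable lborel (\<lambda>q. \<bar>U0 q\<bar> powr (m + 1))" "(LINT q|lborel. \<bar>U0 q\<bar> powr (m + 1)) = T * (LINT x|lborel. \<bar>u0 x\<bar> powr (m + 1))"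
    unfolding U0p_eq using indicator_tensor[OF T u0(3)] by auto
  have lfp: "integrable lborel (\<lambda>q. \<bar>lf q\<bar> powr (m + 1))"
    "(LINT q|lborel. \<bar>lf q\<bar> powr (m + 1)) \<le> (LINT s|lborel. \<bar>l s\<bar>) powr (m + 1) * (LINT q|lborel. \<bar>f q\<bar> powr (m + 1))"
    using young_convolution_param[of "m + 1" l f] m li f by (simp_all add: lf_def)
  define v where "v q = u q - U0 q" for q
  have v: "integrable lborel v" "integrable lborel (\<lambda>q. (norm (v q))\<^sup>2)" "\<And>s x. s \<notin> {0<..<T} \<Longrightarrow> v (s, x) = 0"
  proof -
    show "integrable lborel v" unfolding v_def[abs_def] using u(1) U0 by simp
    show "integrable lborel (\<lambda>q. (norm (v q))\<^sup>2)" unfolding v_def by (intro integrable_norm_diff_L2 u(2) U02) simp_all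
    show "\<And>s x. s \<notin> {0<..<T} \<Longrightarrow> v (s, x) = 0" using u(3) by (simp add: v_def U0_def)
  qed
  have weak': "AE t in lborel. 0 < t \<and> t < T \<longrightarrow>
       (LINT x|lborel. \<psi> c x * (real (Suc n) * (v (t, x) - conv (h n) (\<lambda>s. v (s, x)) t)) + conv (h n) (\<lambda>s. G (s, x)) t \<bullet> g c x)
         \<le> (LINT x|lborel. conv (h n) (\<lambda>s. f (s, x)) t * \<psi> c x)" if "c \<in> C" for c n
    using weak[OF that, of n] by (simp add: v_def U0_def)
  note tested = tested_inequality[OF v f(1-3) G w C \<psi> g weak' dense]
  have lG: "(LINT q|lborel. v q * w q) + (LINT q|lborel. lG q \<bullet> G q) \<le> (LINT q|lborel. lf q * w q)"
    "integrable lborel (\<lambda>q. v q * w q)" "integrable lborel (\<lambda>q. lf q * w q)" "integrable lborel (\<lambda>q. lG q \<bullet> G q)"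
    using tested by (simp_all add: lf_def lG_def)

  define Z where "Z = (\<integral>\<^sup>+x. (\<integral>\<^sup>+t. ennreal (E t * ((k (T - t) + k t) * (norm (dconv l (\<lambda>s. G (s, x)) t))\<^sup>2)) \<partial>lborel) \<partial>lborel)"
  have en: "AE x in lborel. (\<integral>\<^sup>+t. ennreal (E t * ((k (T - t) + k t) * (norm (dconv l (\<lambda>s. G (s, x)) t))\<^sup>2)) \<partial>lborel)
      \<le> ennreal (2 * (LINT t|lborel. lG (t, x) \<bullet> G (t, x))) \<and> 0 \<le> (LINT t|lborel. lG (t, x) \<bullet> G (t, x))"
    using fubini_sections_x(1)[OF G(1)] fubini_sections_x(1)[OF G(2)]
  proof eventually_elim
    case (elim x)
    show ?case using energy_inequality_dual[OF elim] G(3) by (simp add: lG_def)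
  qed
  have "Z \<le> (\<integral>\<^sup>+x. ennreal (2 * (LINT t|lborel. lG (t, x) \<bullet> G (t, x))) \<partial>lborel)"
    unfolding Z_def by (rule nn_integral_mono_AE) (use en in \<open>auto elim: eventually_mono\<close>)
  also have "\<dots> = ennreal (LINT x|lborel. 2 * (LINT t|lborel. lG (t, x) \<bullet> G (t, x)))"
    by (rule nn_integral_eq_integral) (use fubini_sections_x(2)[OF lG(4)] en in \<open>auto elim: eventually_mono\<close>)
  also have "(LINT x|lborel. 2 * (LINT t|lborel. lG (t, x) \<bullet> G (t, x))) = 2 * (LINT q|lborel. lG q \<bullet> G q)"
    using fubini_sections_x(3)[OF lG(4)] by simp
  finally have Z: "Z \<le> ennreal (2 * (LINT q|lborel. lG q \<bullet> G q))" .
  define X where "X = (LINT q|lborel. u q powr (m + 1))"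
  define F where "F q = \<bar>U0 q\<bar> + \<bar>lf q\<bar>" for q
  \<comment> \<open>The absorption constant for the factor \<open>2 (a2 / a1)\<close>.\<close>
  define K where "K = m powr m / (m + 1) powr (m + 1) * (2 * (a2 / a1)) powr (m + 1)"
  have K0: "K \<ge> 0" by (simp add: K_def)
  have main: "2 / a1 * (LINT q|lborel. lG q \<bullet> G q) + X \<le> K * 2 powr m * ((LINT q|lborel. \<bar>U0 q\<bar> powr (m + 1)) + (LINT q|lborel. \<bar>lf q\<bar> powr (m + 1)))"
  proof -
    have "2 / a1 * (LINT q|lborel. lG q \<bullet> G q) \<le> 2 / a1 * ((LINT q|lborel. lf q * w q) - (LINT q|lborel. v q * w q))"
      using lG(1) a by (intro mult_left_mono) auto
    also have "\<dots> = (LINT q|lborel. 2 / a1 * (lf q * w q - v q * w q))" using lG(2,3) by simp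
    also have "\<dots> \<le> (LINT q|lborel. K * 2 powr m * (\<bar>U0 q\<bar> powr (m + 1) + \<bar>lf q\<bar> powr (m + 1)) - u q powr (m + 1))"
    proof (rule integral_mono_AE)
      show "AE q in lborel. 2 / a1 * (lf q * w q - v q * w q) \<le> K * 2 powr m * (\<bar>U0 q\<bar> powr (m + 1) + \<bar>lf q\<bar> powr (m + 1)) - u q powr (m + 1)"
        using uw
      proof eventually_elim
        case (elim q)
        have up: "u q powr (m + 1) = u q * u q powr m" using u(4)[of q] m by (cases "u q = 0") (auto simp: powr_add)
        have w0: "0 \<le> w q" using elim a order_trans[of 0 "a1 * u q powr m" "w q"] by simp
        have F0: "0 \<le> F q" by (simp add: F_def)
        have "lf q * w q - v q * w q = (lf q + U0 q) * w q - u q * w q" by (simp add: v_def algebra_simps)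
        moreover have "(lf q + U0 q) * w q \<le> F q * w q" using w0 by (intro mult_right_mono) (auto simp: F_def)
        moreover have "F q * w q \<le> F q * (a2 * u q powr m)" using elim F0 by (intro mult_left_mono) auto
        moreover have "u q * (a1 * u q powr m) \<le> u q * w q" using elim u(4) by (intro mult_left_mono) auto
        moreover have "u q * (a1 * u q powr m) = a1 * u q powr (m + 1)" unfolding up by simp
        ultimately have "lf q * w q - v q * w q \<le> F q * (a2 * u q powr m) - a1 * u q powr (m + 1)" by linarith
        then have "2 / a1 * (lf q * w q - v q * w q) \<le> 2 / a1 * (F q * (a2 * u q powr m) - a1 * u q powr (m + 1))"
          using a by (intro mult_left_mono) auto
        also have "\<dots> = (2 * (a2 / a1) * F q) * u q powr m - 2 * u q powr (m + 1)" using a by (simp add: algebra_simps)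
        also have "(2 * (a2 / a1) * F q) * u q powr m \<le> u q powr (m + 1) + m powr m / (m + 1) powr (m + 1) * (2 * (a2 / a1) * F q) powr (m + 1)"
          by (rule young_absorption[OF m]) (use F0 a u(4) in auto)
        also have "m powr m / (m + 1) powr (m + 1) * (2 * (a2 / a1) * F q) powr (m + 1) = K * F q powr (m + 1)"
        proof -
          have "(2 * (a2 / a1) * F q) powr (m + 1) = (2 * (a2 / a1)) powr (m + 1) * F q powr (m + 1)"
            by (rule powr_mult)
          then show ?thesis unfolding K_def by (simp only: mult.assoc)
        qed
        also have "F q powr (m + 1) \<le> 2 powr (m + 1 - 1) * (\<bar>U0 q\<bar> powr (m + 1) + \<bar>lf q\<bar> powr (m + 1))"
          unfolding F_def by (rule powr_sum_le) (use m in auto)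
        finally show ?case using K0 by (simp add: mult_left_mono mult.assoc)
      qed
    qed (use lG(2,3) U0p(1) lfp(1) u(5) in auto)
    also have "\<dots> = K * 2 powr m * ((LINT q|lborel. \<bar>U0 q\<bar> powr (m + 1)) + (LINT q|lborel. \<bar>lf q\<bar> powr (m + 1))) - X"
      using U0p(1) lfp(1) u(5) by (simp add: X_def)
    finally show ?thesis by simp
  qed
  have GG0: "0 \<le> (LINT q|lborel. lG q \<bullet> G q)"
  proof -
    have "0 \<le> (LINT x|lborel. LINT t|lborel. lG (t, x) \<bullet> G (t, x))"
      by (rule integral_nonneg_AE) (use en in \<open>auto elim: eventually_mono\<close>)
    then show ?thesis using fubini_sections_x(3)[OF lG(4)] by simp
  qed
  have X0: "X \<ge> 0" by (simp add: X_def)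
  have "(\<integral>\<^sup>+q. ennreal (u q powr (m + 1)) \<partial>lborel) = ennreal X"
    unfolding X_def by (rule nn_integral_eq_integral[OF u(5)]) simp
  then have "(\<integral>\<^sup>+q. ennreal (u q powr (m + 1)) \<partial>lborel) + ennreal (1 / a1) * Z
     \<le> ennreal X + ennreal (1 / a1) * ennreal (2 * (LINT q|lborel. lG q \<bullet> G q))"
    using Z by (intro add_mono mult_left_mono) auto
  also have "\<dots> = ennreal (X + 2 / a1 * (LINT q|lborel. lG q \<bullet> G q))"
    using X0 GG0 a by (simp add: ennreal_mult[symmetric] ennreal_plus[symmetric] del: ennreal_plus)
  also have "\<dots> \<le> ennreal (2 * (4 * m) powr m / (m + 1) powr (m + 1) * (a2 / a1) powr (m + 1) *
         (T * (LINT x|lborel. \<bar>u0 x\<bar> powr (m + 1)) + (LINT s|lborel. \<bar>l s\<bar>) powr (m + 1) * (LINT q|lborel. \<bar>f q\<bar> powr (m + 1))))"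
  proof (rule ennreal_leI)
    have "X + 2 / a1 * (LINT q|lborel. lG q \<bullet> G q) \<le> K * 2 powr m * ((LINT q|lborel. \<bar>U0 q\<bar> powr (m + 1)) + (LINT q|lborel. \<bar>lf q\<bar> powr (m + 1)))"
      using main by simp
    also have "\<dots> \<le> K * 2 powr m * (T * (LINT x|lborel. \<bar>u0 x\<bar> powr (m + 1)) + (LINT s|lborel. \<bar>l s\<bar>) powr (m + 1) * (LINT q|lborel. \<bar>f q\<bar> powr (m + 1)))"
      using U0p(2) lfp(2) K0 by (intro mult_left_mono) auto
    also have "K * 2 powr m = 2 * (4 * m) powr m / (m + 1) powr (m + 1) * (a2 / a1) powr (m + 1)"
      unfolding K_def by (rule constant_identity[OF m]) (use a in simp)
    finally show "X + 2 / a1 * (LINT q|lborel. lG q \<bullet> G q) \<le> 2 * (4 * m) powr m / (m + 1) powr (m + 1) * (a2 / a1) powr (m + 1) *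
         (T * (LINT x|lborel. \<bar>u0 x\<bar> powr (m + 1)) + (LINT s|lborel. \<bar>l s\<bar>) powr (m + 1) * (LINT q|lborel. \<bar>f q\<bar> powr (m + 1)))" .
  qed
  finally show ?thesis by (simp add: Z_def)
qed

end

section \<open>Borel representatives of kernels and convolutions\<close>

lemma AE_lebesgue_on_iff:
  "A \<in> sets lebesgue \<Longrightarrow> (AE x in lebesgue_on A. P x) \<longleftrightarrow> (AE x in lborel. x \<in> A \<longrightarrow> P x)"
  by (subst AE_restrict_space_iff) (auto simp: AE_completion_iff)

text \<open>Lebesgue measure is complete, so arbitrary values on the null set are harmless.\<close>

lemma borel_measurable_lebesgue_cong_AE:
  fixes f g :: "'a::euclidean_space \<Rightarrow> 'b::euclidean_space"
  assumes g: "g \<in> borel_measurable borel" and fg: "AE x in lborel. f x = g x"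
  shows "f \<in> borel_measurable lebesgue"
proof -
  obtain N where N: "{x. f x \<noteq> g x} \<subseteq> N" "N \<in> null_sets lborel"
    using fg by (auto elim!: AE_E simp: null_sets_def)
  have g': "g \<in> borel_measurable lebesgue" using g by (intro measurable_completion) simp
  show ?thesis
  proof (rule measurableI)
    fix S :: "'b set" assume S: "S \<in> sets borel"
    have D1: "{x. f x \<noteq> g x \<and> f x \<in> S} \<in> sets lebesgue" and D2: "{x. f x \<noteq> g x \<and> g x \<in> S} \<in> sets lebesgue"
      by (rule null_setsD2, rule null_sets_completion_subset[OF _ null_sets_completionI[OF N(2)]], use N(1) in auto)+
    have "f -` S = (g -` S - {x. f x \<noteq> g x \<and> g x \<in> S}) \<union> {x. f x \<noteq> g x \<and> f x \<in> S}" by auto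
    also have "\<dots> \<in> sets lebesgue" using D1 D2 measurable_sets[OF g' S] by auto
    finally show "f -` S \<inter> space lebesgue \<in> sets lebesgue" by simp
  qed simp
qed

lemma lebesgue_integral_eq_borel:
  fixes f g :: "'a::euclidean_space \<Rightarrow> 'b::euclidean_space"
  assumes g: "g \<in> borel_measurable borel" and fg: "AE x in lborel. f x = g x"
  shows "(LINT x|lebesgue. f x) = (LINT x|lborel. g x)" "integrable lebesgue f \<longleftrightarrow> integrable lborel g"
proof -
  have f: "f \<in> borel_measurable lebesgue" by (rule borel_measurable_lebesgue_cong_AE[OF assms])
  have g': "g \<in> borel_measurable lebesgue" using g by (intro measurable_completion) simp
  have ae: "AE x in lebesgue. f x = g x" using fg by (rule AE_completion)
  show "(LINT x|lebesgue. f x) = (LINT x|lborel. g x)"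
    using integral_cong_AE[OF f g' ae] integral_completion[of g lborel] g by simp
  show "integrable lebesgue f \<longleftrightarrow> integrable lborel g"
    using integrable_cong_AE[OF f g' ae] integrable_completion[of g lborel] g by simp
qed

lemma borel_version_on:
  fixes f :: "'a::euclidean_space \<Rightarrow> 'b::euclidean_space"
  assumes A: "A \<in> sets borel" and f: "f \<in> borel_measurable (lebesgue_on A)"
  obtains g where "g \<in> borel_measurable borel" "AE x in lborel. x \<in> A \<longrightarrow> f x = g x" "\<And>x. x \<notin> A \<Longrightarrow> g x = 0"
proof -
  have "(\<lambda>x. indicator A x *\<^sub>R f x) \<in> borel_measurable lebesgue"
    using f A by (subst (asm) borel_measurable_restrict_space_iff) auto
  then obtain g where g: "g \<in> borel_measurable borel" "AE x in lborel. indicator A x *\<^sub>R f x = g x"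
    using AE_lebesgue_ex_borel by blast
  show thesis
  proof
    show "(\<lambda>x. indicator A x *\<^sub>R g x) \<in> borel_measurable borel" using g(1) A by simp
    show "AE x in lborel. x \<in> A \<longrightarrow> f x = indicator A x *\<^sub>R g x" using g(2) by eventually_elim auto
  qed simp
qed

lemma causal_version:
  fixes b :: "real \<Rightarrow> 'b::euclidean_space"
  assumes b: "set_integrable lebesgue {0..T} b"
  obtains b' where "causal b'" "AE s in lborel. 0 < s \<and> s < T \<longrightarrow> b s = b' s" "\<And>s. s \<notin> {0<..<T} \<Longrightarrow> b' s = 0"
proof -
  have "integrable lebesgue (\<lambda>s. indicator {0<..<T} s *\<^sub>R (indicator {0..T} s *\<^sub>R b s))"
    using b unfolding set_integrable_def by (rule integrable_mult_indicator[rotated]) simp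
  moreover have "(\<lambda>s. indicator {0<..<T} s *\<^sub>R (indicator {0..T} s *\<^sub>R b s)) = (\<lambda>s. indicator {0<..<T} s *\<^sub>R b s)"
    by (auto simp: indicator_def fun_eq_iff)
  ultimately have bi: "integrable lebesgue (\<lambda>s. indicator {0<..<T} s *\<^sub>R b s)" by simp
  then have "b \<in> borel_measurable (lebesgue_on {0<..<T})"
    by (subst borel_measurable_restrict_space_iff) auto
  then obtain b' where b': "b' \<in> borel_measurable borel" "AE x in lborel. x \<in> {0<..<T} \<longrightarrow> b x = b' x"
    "\<And>x. x \<notin> {0<..<T} \<Longrightarrow> b' x = 0" by (rule borel_version_on[rotated]) auto
  have "AE x in lborel. indicator {0<..<T} x *\<^sub>R b x = b' x"
    using b'(2)
  proof eventually_elim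
    case (elim x) then show ?case using b'(3)[of x] by (cases "x \<in> {0<..<T}") auto
  qed
  from lebesgue_integral_eq_borel(2)[OF b'(1) this] have "integrable lborel b'" using bi by simp
  then have c: "causal b'" using b'(3) by (auto simp: causal_def)
  show thesis by (rule that[OF c]) (use b'(2,3) in auto)
qed

text \<open>The integral over \<open>[0,t]\<close> sees both factors on \<open>(0,t)\<close> only, up to the two endpoints.\<close>

lemma time_conv_eq_conv:
  fixes v v' :: "real \<Rightarrow> 'b::euclidean_space"
  assumes a: "causal a'" "AE s in lborel. 0 < s \<and> s < T \<longrightarrow> a s = a' s"
    and v: "causal v'" "AE s in lborel. 0 < s \<and> s < T \<longrightarrow> v s = v' s" and t: "t \<le> T"
  shows "time_conv a v t = conv a' v' t"
proof -
  have [measurable]: "a' \<in> borel_measurable borel" "v' \<in> borel_measurable borel" using causalD(1)[OF a(1)] causalD(1)[OF v(1)] by auto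
  have ae: "AE s in lborel. indicator {0..t} s *\<^sub>R (a (t - s) *\<^sub>R v s) = a' (t - s) *\<^sub>R v' s"
  proof -
    have "AE s in lborel. s \<noteq> t" "AE s in lborel. s \<noteq> 0" by (rule AE_lborel_singleton)+
    then show ?thesis using AE_reflect_shift(1)[OF a(2), of t] v(2)
    proof eventually_elim
      case (elim s)
      consider "s < 0" | "0 < s" "s < t" | "t < s" using elim by linarith
      then show ?case
      proof cases
        case 1 then show ?thesis using causalD(2)[OF v(1), of s] by simp
      next
        case 2 then show ?thesis using elim t by simp
      next
        case 3 then show ?thesis using causalD(2)[OF a(1), of "t - s"] by simp
      qed
    qed
  qed
  have "(\<lambda>s. a' (t - s) *\<^sub>R v' s) \<in> borel_measurable borel" by measurable
  then show ?thesis unfolding time_conv_def set_lebesgue_integral_def conv_def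
    by (rule lebesgue_integral_eq_borel(1)[OF _ ae])
qed

lemma dual_conv_eq_dconv:
  fixes v v' :: "real \<Rightarrow> 'b::euclidean_space"
  assumes a: "causal a'" "AE s in lborel. 0 < s \<and> s < T \<longrightarrow> a s = a' s"
    and v: "v' \<in> borel_measurable borel" "\<And>s. s \<notin> {0<..<T} \<Longrightarrow> v' s = 0" "AE s in lborel. 0 < s \<and> s < T \<longrightarrow> v s = v' s" and t: "0 \<le> t"
  shows "dual_conv T a v t = dconv a' v' t"
proof -
  have [measurable]: "a' \<in> borel_measurable borel" using causalD(1)[OF a(1)] by auto
  note [measurable] = v(1)
  have ae: "AE s in lborel. indicator {t..T} s *\<^sub>R (a (s - t) *\<^sub>R v s) = a' (s - t) *\<^sub>R v' s"
  proof -
    have "AE s in lborel. s \<noteq> t" "AE s in lborel. s \<noteq> T" by (rule AE_lborel_singleton)+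
    then show ?thesis using AE_reflect_shift(2)[OF a(2), of t] v(3)
    proof eventually_elim
      case (elim s)
      consider "s < t" | "t < s" "s < T" | "T < s" using elim by linarith
      then show ?case
      proof cases
        case 1 then show ?thesis using causalD(2)[OF a(1), of "s - t"] by simp
      next
        case 2 then show ?thesis using elim t by simp
      next
        case 3 then show ?thesis using v(2)[of s] by simp
      qed
    qed
  qed
  have "(\<lambda>s. a' (s - t) *\<^sub>R v' s) \<in> borel_measurable borel" by measurable
  then show ?thesis unfolding dual_conv_def set_lebesgue_integral_def dconv_def
    by (rule lebesgue_integral_eq_borel(1)[OF _ ae])
qed

lemma L1loc_set_integrable: "L1loc_halfline b \<Longrightarrow> T > 0 \<Longrightarrow> set_integrable lebesgue {0..T} b"
  by (auto simp: L1loc_halfline_def)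

lemma antimono_kernel_causal:
  fixes k :: "real \<Rightarrow> real"
  assumes k: "set_integrable lebesgue {0..T} k" and mono: "\<And>s t. 0 < s \<Longrightarrow> s \<le> t \<Longrightarrow> k t \<le> k s"
  shows "causal (\<lambda>s. indicator {0<..<T} s * k s)"
proof -
  have "mono_on {0<..<T} (\<lambda>s. - k s)" using mono by (auto simp: mono_on_def)
  then have "(\<lambda>s. - k s) \<in> borel_measurable (restrict_space borel {0<..<T})" by (rule borel_measurable_mono_on_fnc)
  then have "(\<lambda>s. indicator {0<..<T} s *\<^sub>R (- k s)) \<in> borel_measurable borel"
    by (subst (asm) borel_measurable_restrict_space_iff) auto
  then have m: "(\<lambda>s. - (indicator {0<..<T} s *\<^sub>R (- k s))) \<in> borel_measurable borel" by (rule borel_measurable_uminus)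
  then have m': "(\<lambda>s. indicator {0<..<T} s * k s) \<in> borel_measurable borel" by simp
  have "integrable lebesgue (\<lambda>s. indicator {0<..<T} s *\<^sub>R (indicator {0..T} s *\<^sub>R k s))"
    using k unfolding set_integrable_def by (rule integrable_mult_indicator[rotated]) simp
  moreover have "(\<lambda>s. indicator {0<..<T} s *\<^sub>R (indicator {0..T} s *\<^sub>R k s)) = (\<lambda>s. indicator {0<..<T} s * k s)"
    by (auto simp: indicator_def fun_eq_iff)
  ultimately have "integrable lebesgue (\<lambda>s. indicator {0<..<T} s * k s)" by simp
  then have "integrable lborel (\<lambda>s. indicator {0<..<T} s * k s)"
    using lebesgue_integral_eq_borel(2)[OF m', of "\<lambda>s. indicator {0<..<T} s * k s"] by simp
  then show ?thesis by (simp add: causal_def)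
qed

text \<open>The kernel \<open>k\<close> is monotone, hence Borel measurable after truncation, and it is used as it stands since
monotonicity is a pointwise condition. The functions \<open>l\<close> and \<open>h\<close> are replaced by Borel
representatives, and the one of \<open>h\<close> by its positive part.\<close>

lemma cond_PC_regularized:
  assumes T: "T > 0" and kl: "cond_PC k l" and h: "\<And>n. n \<ge> 1 \<Longrightarrow> is_regularizer l n (h n)"
  obtains k' l' h' where "PC_regularized k' l' T h'"
    "\<And>s. 0 < s \<Longrightarrow> s < T \<Longrightarrow> k s = k' s"
    "AE s in lborel. 0 < s \<and> s < T \<longrightarrow> l s = l' s" "\<And>s. s \<notin> {0<..<T} \<Longrightarrow> l' s = 0"
    "\<And>n. AE s in lborel. 0 < s \<and> s < T \<longrightarrow> h (Suc n) s = h' n s"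
proof -
  have k_nonneg: "\<And>t. t > 0 \<Longrightarrow> 0 \<le> k t" and k_mono: "\<And>s t. 0 < s \<Longrightarrow> s \<le> t \<Longrightarrow> k t \<le> k s"
    and kL: "L1loc_halfline k" and lL: "L1loc_halfline l"
    and conv1: "AE t in lebesgue_on {0<..}. time_conv k l t = 1"
    using kl unfolding cond_PC_def by auto
  define k' where "k' s = indicator {0<..<T} s * k s" for s
  have k': "causal k'" unfolding k'_def using antimono_kernel_causal[OF L1loc_set_integrable[OF kL T] k_mono] .
  have kk': "AE s in lborel. 0 < s \<and> s < T \<longrightarrow> k s = k' s" by (auto simp: k'_def)
  obtain l' where l': "causal l'" "AE s in lborel. 0 < s \<and> s < T \<longrightarrow> l s = l' s" "\<And>s. s \<notin> {0<..<T} \<Longrightarrow> l' s = 0"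
    by (rule causal_version[OF L1loc_set_integrable[OF lL T]]) blast
  interpret PC_pair k' l' T
  proof
    show "T > 0" by (rule T)
    show "causal k'" "causal l'" by (rule k' l')+
    show "0 \<le> k' s" for s using k_nonneg by (auto simp: k'_def indicator_def)
    show "k' t \<le> k' s" if "0 < s" "s \<le> t" for s t
      using that k_mono[OF that] k_nonneg[of s] by (auto simp: k'_def indicator_def)
    have "AE t in lborel. t \<in> {0<..} \<longrightarrow> time_conv k l t = 1"
      using conv1 by (subst (asm) AE_lebesgue_on_iff) auto
    then show "AE t in lborel. 0 < t \<and> t < T \<longrightarrow> conv k' l' t = 1"
    proof eventually_elim
      case (elim t)
      then show ?case using time_conv_eq_conv[OF k' kk' l'(1,2), of t] by auto
    qed
  qed
  have "\<exists>b. causal b \<and> (\<forall>s. 0 \<le> b s) \<and> (\<forall>s. T \<le> s \<longrightarrow> b s = 0)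
    \<and> (AE t in lborel. t < T \<longrightarrow> b t + real (Suc n) * conv b l' t = real (Suc n) * l' t)
    \<and> (AE s in lborel. 0 < s \<and> s < T \<longrightarrow> h (Suc n) s = b s)" for n
  proof -
    define \<nu> where "\<nu> = real (Suc n)"
    have reg: "is_regularizer l (Suc n) (h (Suc n))" by (rule h) simp
    have hL: "L1loc_halfline (h (Suc n))" and heq: "AE t in lebesgue_on {0<..}. h (Suc n) t + \<nu> * time_conv (h (Suc n)) l t = \<nu> * l t"
      using reg by (auto simp: is_regularizer_def \<nu>_def)
    obtain b where b: "causal b" "AE s in lborel. 0 < s \<and> s < T \<longrightarrow> h (Suc n) s = b s" "\<And>s. s \<notin> {0<..<T} \<Longrightarrow> b s = 0"
      by (rule causal_version[OF L1loc_set_integrable[OF hL T]]) blast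
    have "AE t in lborel. t \<in> {0<..} \<longrightarrow> h (Suc n) t + \<nu> * time_conv (h (Suc n)) l t = \<nu> * l t"
      using heq by (subst (asm) AE_lebesgue_on_iff) auto
    with b(2) l'(2) have beq: "AE t in lborel. t < T \<longrightarrow> b t + \<nu> * conv b l' t = \<nu> * l' t"
    proof eventually_elim
      case (elim t)
      show ?case
      proof
        assume t: "t < T"
        show "b t + \<nu> * conv b l' t = \<nu> * l' t"
        proof (cases "t \<le> 0")
          case True
          then show ?thesis using causalD(2)[OF b(1)] causalD(2)[OF l'(1)] conv_eq_0[OF b(1) l'(1)] by simp
        next
          case False
          then show ?thesis using elim t time_conv_eq_conv[OF b(1,2) l'(1,2), of t] by simp
        qed
      qed
    qed
    have b0: "AE t in lborel. t < T \<longrightarrow> 0 \<le> b t"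
      by (rule regularizer_nonneg[OF b(1) _ beq]) (simp add: \<nu>_def)
    define b' where "b' s = max 0 (b s)" for s
    have bb': "AE s in lborel. s < T \<longrightarrow> b s = b' s" using b0 by eventually_elim (auto simp: b'_def)
    have b'c: "causal b'" using b(1) integrable_max[OF integrable_zero, of lborel b] by (auto simp: causal_def b'_def[abs_def])
    have "AE t in lborel. t < T \<longrightarrow> b' t + \<nu> * conv b' l' t = \<nu> * l' t"
      using beq bb'
    proof eventually_elim
      case (elim t)
      show ?case
      proof
        assume t: "t < T"
        have "conv b l' t = conv b' l' t"
          by (rule conv_cong_AE[OF b(1) b'c l'(1) l'(1) less_imp_le[OF t] bb']) simp
        then show "b' t + \<nu> * conv b' l' t = \<nu> * l' t" using elim t by simp
      qed
    qed
    moreover have "AE s in lborel. 0 < s \<and> s < T \<longrightarrow> h (Suc n) s = b' s"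
      using b(2) bb' by eventually_elim auto
    ultimately show ?thesis using b'c b(3) by (intro exI[of _ b']) (auto simp: b'_def \<nu>_def)
  qed
  then have "\<forall>n. \<exists>b. causal b \<and> (\<forall>s. 0 \<le> b s) \<and> (\<forall>s. T \<le> s \<longrightarrow> b s = 0)
    \<and> (AE t in lborel. t < T \<longrightarrow> b t + real (Suc n) * conv b l' t = real (Suc n) * l' t)
    \<and> (AE s in lborel. 0 < s \<and> s < T \<longrightarrow> h (Suc n) s = b s)" ..
  from choice[OF this] obtain h' where h': "\<And>n. causal (h' n)" "\<And>n s. 0 \<le> h' n s" "\<And>n s. T \<le> s \<Longrightarrow> h' n s = 0"
    "\<And>n. AE t in lborel. t < T \<longrightarrow> h' n t + real (Suc n) * conv (h' n) l' t = real (Suc n) * l' t"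
    "\<And>n. AE s in lborel. 0 < s \<and> s < T \<longrightarrow> h (Suc n) s = h' n s" by blast
  have "PC_regularized k' l' T h'" by unfold_locales (rule h'; assumption)+
  then show thesis using that[of k' l' h'] l' h'(5) by (simp add: k'_def)
qed

context PC_regularized
begin

text \<open>For almost every \<open>x\<close>, the function to be differentiated is, before \<open>T\<close>, the primitive of a Borel
function, no matter which representatives enter the convolution.\<close>

lemma AE_deriv_regularized:
  fixes v :: "real \<times> 'a::euclidean_space \<Rightarrow> real" and v_raw :: "real \<Rightarrow> 'a \<Rightarrow> real"
  assumes v: "integrable lborel v" "\<And>s x. s \<notin> {0<..<T} \<Longrightarrow> v (s, x) = 0"
    and kr: "AE s in lborel. 0 < s \<and> s < T \<longrightarrow> k_raw s = k s"
    and hr: "AE s in lborel. 0 < s \<and> s < T \<longrightarrow> h_raw s = h n s"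
    and vr: "AE x in lborel. x \<in> \<Omega> \<longrightarrow> (AE s in lborel. 0 < s \<and> s < T \<longrightarrow> v_raw s x = v (s, x))"
  shows "AE t in lborel. 0 < t \<and> t < T \<longrightarrow> (AE x in lborel. x \<in> \<Omega> \<longrightarrow>
     deriv (time_conv (time_conv k_raw h_raw) (\<lambda>s. v_raw s x)) t = real (Suc n) * (v (t, x) - conv (h n) (\<lambda>s. v (s, x)) t))"
proof -
  have [measurable]: "v \<in> borel_measurable borel" using v(1) by auto
  define w where "w q = v q - conv (h n) (\<lambda>s. v (s, snd q)) (fst q)" for q
  have wm: "w \<in> borel_measurable borel" unfolding w_def[abs_def] by measurable
  have secv: "AE x in lborel. causal (\<lambda>s. v (s, x))"
    using fubini_sections_x(1)[OF v(1)] by eventually_elim (auto simp: causal_def v(2))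
  have wi: "AE x in lborel. integrable lborel (\<lambda>s. w (s, x))"
    using secv
  proof eventually_elim
    case (elim x)
    show ?case
      using Bochner_Integration.integrable_diff[OF causalD(1)[OF elim] causalD(1)[OF causal_conv[OF h elim]]]
      by (simp add: w_def)
  qed
  define \<kappa> where "\<kappa> s = E s *\<^sub>R conv k (h n) s" for s
  have \<kappa>: "causal \<kappa>" unfolding \<kappa>_def by (intro causal_truncate(2) causal_conv k h)
  have \<kappa>H: "AE t in lborel. t < T \<longrightarrow> \<kappa> t = real (Suc n) * (E t - H n t)"
    using H_mass[of n]
  proof eventually_elim
    case (elim t)
    show ?case
    proof
      assume t: "t < T"
      have "H n t = 0" if "t \<le> 0" using H_conv[of t n] conv_eq_0[OF E h that] t by simp
      then show "\<kappa> t = real (Suc n) * (E t - H n t)" using elim t by (cases "t \<le> 0") (auto simp: \<kappa>_def)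
    qed
  qed
  have \<kappa>r: "AE s in lborel. 0 < s \<and> s < T \<longrightarrow> time_conv k_raw h_raw s = \<kappa> s"
    using time_conv_eq_conv[OF k kr h hr] by (auto simp: \<kappa>_def)
  have F: "AE x in lborel. x \<in> \<Omega> \<longrightarrow> (\<forall>t. t < T \<longrightarrow> time_conv (time_conv k_raw h_raw) (\<lambda>s. v_raw s x) t
     = real (Suc n) * (LINT s|lborel. indicator {..t} s * w (s, x)))"
    using secv vr
  proof eventually_elim
    case (elim x)
    show ?case
    proof (intro impI allI)
      fix t assume x: "x \<in> \<Omega>" and t: "t < T"
      have "time_conv (time_conv k_raw h_raw) (\<lambda>s. v_raw s x) t = conv \<kappa> (\<lambda>s. v (s, x)) t"
        by (rule time_conv_eq_conv[OF \<kappa> \<kappa>r elim(1)]) (use elim(2) x t in auto)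
      also have "\<dots> = real (Suc n) * (LINT s|lborel. indicator {..t} s * (v (s, x) - conv (h n) (\<lambda>s. v (s, x)) s))"
        by (rule conv_regularized_kernel[OF elim(1) \<kappa> \<kappa>H]) (use t in simp)
      finally show "time_conv (time_conv k_raw h_raw) (\<lambda>s. v_raw s x) t = real (Suc n) * (LINT s|lborel. indicator {..t} s * w (s, x))"
        by (simp add: w_def)
    qed
  qed
  show ?thesis using AE_lebesgue_differentiation_param[OF wm wi]
  proof eventually_elim
    case (elim t)
    show ?case
    proof
      assume t: "0 < t \<and> t < T"
      show "AE x in lborel. x \<in> \<Omega> \<longrightarrow>
        deriv (time_conv (time_conv k_raw h_raw) (\<lambda>s. v_raw s x)) t = real (Suc n) * (v (t, x) - conv (h n) (\<lambda>s. v (s, x)) t)"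
        using elim F
      proof eventually_elim
        case (elim x)
        show ?case
        proof
          assume x: "x \<in> \<Omega>"
          have "((\<lambda>t. real (Suc n) * (LINT s|lborel. indicator {..t} s * w (s, x))) has_real_derivative real (Suc n) * w (t, x)) (at t)"
            by (rule DERIV_cmult[OF elim(1)])
          then have "(time_conv (time_conv k_raw h_raw) (\<lambda>s. v_raw s x) has_real_derivative real (Suc n) * w (t, x)) (at t)"
            by (rule has_field_derivative_transform_within_open[where S="{..<T}"]) (use t x elim(2) in auto)
          from DERIV_imp_deriv[OF this]
          show "deriv (time_conv (time_conv k_raw h_raw) (\<lambda>s. v_raw s x)) t = real (Suc n) * (v (t, x) - conv (h n) (\<lambda>s. v (s, x)) t)"
            by (simp add: w_def)
        qed
      qed
    qed
  qed
qed

end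

section \<open>Separability of the range of a Bochner measurable function\<close>

text \<open>A subset of a separable space is separable: for each \<open>z\<close> in \<open>D\<close> and each radius, one point of \<open>A\<close>
within this radius of \<open>z\<close> is kept, if there is any. The approximating values \<open>S j t\<close> need not
be nonnegative test functions, whereas the values at the selected points are.\<close>

lemma separable_selection:
  fixes \<delta> :: "'z \<Rightarrow> 't \<Rightarrow> real" and S :: "nat \<Rightarrow> 't \<Rightarrow> 'z"
  assumes D: "countable D" "\<And>j t. t \<in> A \<Longrightarrow> S j t \<in> D" and lim: "\<And>t. t \<in> A \<Longrightarrow> (\<lambda>j. \<delta> (S j t) t) \<longlonglongrightarrow> 0"
  obtains C where "countable C" "C \<subseteq> A" "\<And>t e. t \<in> A \<Longrightarrow> e > 0 \<Longrightarrow> \<exists>c\<in>C. \<exists>z\<in>D. \<bar>\<delta> z c\<bar> < e \<and> \<bar>\<delta> z t\<bar> < e"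
proof -
  define near where "near z i c \<longleftrightarrow> c \<in> A \<and> \<bar>\<delta> z c\<bar> < inverse (real (Suc i))" for z i c
  define pick where "pick z i = (SOME c. near z i c)" for z i
  define I where "I = {(z, i). z \<in> D \<and> (\<exists>c. near z i c)}"
  define C where "C = (\<lambda>(z, i). pick z i) ` I"
  have pick: "near z i (pick z i)" if "near z i c" for z i c
    unfolding pick_def using that by (rule someI)
  show thesis
  proof
    have "countable I" by (rule countable_subset[of _ "D \<times> UNIV"]) (use D in \<open>auto simp: I_def\<close>)
    then show "countable C" unfolding C_def by (rule countable_image)
    show "C \<subseteq> A" using pick by (auto simp: C_def I_def near_def)
    fix t and e :: real assume t: "t \<in> A" and e: "e > 0"
    obtain i where i: "inverse (real (Suc i)) < e" using reals_Archimedean[OF e] by blast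
    have "(\<lambda>j. \<bar>\<delta> (S j t) t\<bar>) \<longlonglongrightarrow> \<bar>0\<bar>" by (intro tendsto_rabs lim t)
    then have "\<forall>\<^sub>F j in sequentially. \<bar>\<delta> (S j t) t\<bar> < inverse (real (Suc i))" by (rule order_tendstoD) simp
    then obtain j where "\<bar>\<delta> (S j t) t\<bar> < inverse (real (Suc i))" by (auto simp: eventually_sequentially)
    then have near: "near (S j t) i t" using t by (simp add: near_def)
    have "pick (S j t) i \<in> C" using near D(2)[OF t] by (force simp: C_def I_def)
    moreover have "\<bar>\<delta> (S j t) (pick (S j t) i)\<bar> < e" "\<bar>\<delta> (S j t) t\<bar> < e"
      using pick[OF near] near i by (auto simp: near_def)
    ultimately show "\<exists>c\<in>C. \<exists>z\<in>D. \<bar>\<delta> z c\<bar> < e \<and> \<bar>\<delta> z t\<bar> < e" using D(2)[OF t] by blast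
  qed
qed

lemma lebesgue_on_integral_eq_borel:
  fixes f g :: "'a::euclidean_space \<Rightarrow> 'b::euclidean_space"
  assumes A: "A \<in> sets borel" and g: "g \<in> borel_measurable borel" "\<And>x. x \<notin> A \<Longrightarrow> g x = 0"
    and fg: "AE x in lborel. x \<in> A \<longrightarrow> f x = g x"
  shows "(LINT x|lebesgue_on A. f x) = (LINT x|lborel. g x)" "integrable (lebesgue_on A) f \<longleftrightarrow> integrable lborel g"
proof -
  have ae: "AE x in lborel. indicator A x *\<^sub>R f x = g x"
    using fg by eventually_elim (use g(2) in \<open>auto simp: indicator_def\<close>)
  show "(LINT x|lebesgue_on A. f x) = (LINT x|lborel. g x)"
    using lebesgue_integral_eq_borel(1)[OF g(1) ae] A by (subst integral_restrict_space) auto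
  show "integrable (lebesgue_on A) f \<longleftrightarrow> integrable lborel g"
    using lebesgue_integral_eq_borel(2)[OF g(1) ae] A by (subst integrable_restrict_space) auto
qed

lemma Lp_norm_powr_eq_borel:
  fixes f g :: "'a::euclidean_space \<Rightarrow> 'b::euclidean_space"
  assumes A: "A \<in> sets borel" and g: "g \<in> borel_measurable borel" "\<And>x. x \<notin> A \<Longrightarrow> g x = 0"
    and fg: "AE x in lborel. x \<in> A \<longrightarrow> f x = g x" and p: "p > 0"
  shows "Lp_norm p (lebesgue_on A) f powr p = (LINT x|lborel. norm (g x) powr p)"
    "f \<in> Lp_space p (lebesgue_on A) \<Longrightarrow> integrable lborel (\<lambda>x. norm (g x) powr p)"
proof -
  have gp: "(\<lambda>x. norm (g x) powr p) \<in> borel_measurable borel" using g(1) by measurable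
  have ae: "AE x in lborel. x \<in> A \<longrightarrow> norm (f x) powr p = norm (g x) powr p" using fg by eventually_elim auto
  note eq = lebesgue_on_integral_eq_borel[OF A gp _ ae]
  have "0 \<le> (LINT x|lborel. norm (g x) powr p)" by simp
  then show "Lp_norm p (lebesgue_on A) f powr p = (LINT x|lborel. norm (g x) powr p)"
    using eq(1) g(2) p by (simp add: Lp_norm_def powr_powr)
  show "integrable lborel (\<lambda>x. norm (g x) powr p)" if "f \<in> Lp_space p (lebesgue_on A)"
    using that eq(2) g(2) by (simp add: Lp_space_def)
qed

lemma integrable_powr_mono:
  fixes F :: "'a::euclidean_space \<Rightarrow> 'b::euclidean_space"
  assumes F: "F \<in> borel_measurable borel" and A: "A \<in> sets borel" "emeasure lborel A < \<infinity>" and F0: "\<And>x. x \<notin> A \<Longrightarrow> F x = 0"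
    and r: "integrable lborel (\<lambda>x. norm (F x) powr r)" and q: "0 < q" "q \<le> r"
  shows "integrable lborel (\<lambda>x. norm (F x) powr q)"
proof (rule Bochner_Integration.integrable_bound)
  show "integrable lborel (\<lambda>x. indicator A x + norm (F x) powr r)"
    using A r by (intro Bochner_Integration.integrable_add) (auto simp: integrable_indicator_iff)
  show "(\<lambda>x. norm (F x) powr q) \<in> borel_measurable lborel" using F by measurable
  show "AE x in lborel. norm (norm (F x) powr q) \<le> norm (indicator A x + norm (F x) powr r)"
  proof (rule AE_I2)
    fix x
    show "norm (norm (F x) powr q) \<le> norm (indicator A x + norm (F x) powr r)"
    proof (cases "x \<in> A")
      case False then show ?thesis using F0 q by simp
    next
      case True
      have "norm (F x) powr q \<le> 1 + norm (F x) powr r"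
      proof (cases "norm (F x) \<le> 1")
        case True
        then have "norm (F x) powr q \<le> 1 powr q" using q by (intro powr_mono2) auto
        then show ?thesis by (simp add: add_increasing2)
      next
        case False
        then have "norm (F x) powr q \<le> norm (F x) powr r" using q by (intro powr_mono) auto
        then show ?thesis by simp
      qed
      then show ?thesis using True by simp
    qed
  qed
qed

lemma AE_lborel_pair:
  fixes P :: "real \<times> 'a::euclidean_space \<Rightarrow> bool"
  assumes "AE q in lborel. P q"
  shows "AE s in lborel. AE x in lborel. P (s, x)" "AE x in lborel. AE s in lborel. P (s, x)"
proof -
  obtain N where N: "{q. \<not> P q} \<subseteq> N" "N \<in> null_sets lborel"
    using assms by (auto elim!: AE_E simp: null_sets_def)
  have ae: "AE q in lborel \<Otimes>\<^sub>M lborel. q \<notin> N" unfolding lborel_prod by (rule AE_not_in[OF N(2)])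
  have 1: "AE s in lborel. AE x in lborel. (s, x) \<notin> N" using lborel_pair.AE_pair[OF ae] by simp
  have "N \<in> sets (lborel \<Otimes>\<^sub>M lborel)" unfolding lborel_prod using N(2) by (rule null_setsD2)
  moreover have "{q \<in> space (lborel \<Otimes>\<^sub>M lborel). (fst q, snd q) \<notin> N} = space (lborel \<Otimes>\<^sub>M lborel) - N" by auto
  ultimately have m: "{q \<in> space (lborel \<Otimes>\<^sub>M lborel). (fst q, snd q) \<notin> N} \<in> sets (lborel \<Otimes>\<^sub>M lborel)"
    by (metis sets.Diff sets.top)
  have 2: "AE x in lborel. AE s in lborel. (s, x) \<notin> N"
    using 1 by (subst lborel_pair.AE_commute[OF m, symmetric]) simp
  have imp: "P q" if "q \<notin> N" for q using that N(1) by blast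
  show "AE s in lborel. AE x in lborel. P (s, x)" using 1 by (auto elim!: eventually_mono intro: imp)
  show "AE x in lborel. AE s in lborel. P (s, x)" using 2 by (auto elim!: eventually_mono intro: imp)
qed

text \<open>By uniqueness of weak gradients, the choice made in the definition of the norm does not matter.\<close>

lemma H1_norm_sq:
  fixes \<Omega> :: "'a::euclidean_space set"
  assumes \<Omega>: "open \<Omega>" and wg: "weak_gradient \<Omega> v g"
    and v': "v' \<in> borel_measurable borel" "AE x in lborel. x \<in> \<Omega> \<longrightarrow> v x = v' x" "\<And>x. x \<notin> \<Omega> \<Longrightarrow> v' x = 0"
    and g': "g' \<in> borel_measurable borel" "AE x in lborel. x \<in> \<Omega> \<longrightarrow> g x = g' x" "\<And>x. x \<notin> \<Omega> \<Longrightarrow> g' x = 0"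
  shows "(H1_norm \<Omega> v)\<^sup>2 = (LINT x|lborel. (norm (v' x))\<^sup>2) + (LINT x|lborel. (norm (g' x))\<^sup>2)"
    "AE x in lborel. x \<in> \<Omega> \<longrightarrow> wgrad \<Omega> v x = g' x"
    "v \<in> H1 \<Omega> \<Longrightarrow> integrable lborel (\<lambda>x. (norm (v' x))\<^sup>2)"
    "v \<in> H1 \<Omega> \<Longrightarrow> integrable lborel (\<lambda>x. (norm (g' x))\<^sup>2)"
proof -
  have \<Omega>b: "\<Omega> \<in> sets borel" using \<Omega> by simp
  have "weak_gradient \<Omega> v (wgrad \<Omega> v)" unfolding wgrad_def
    by (rule someI[of "weak_gradient \<Omega> v" g, OF wg])
  from weak_gradient_unique[OF \<Omega> this wg] g'(2)
  show wae: "AE x in lborel. x \<in> \<Omega> \<longrightarrow> wgrad \<Omega> v x = g' x" by eventually_elim auto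
  have sq: "(Lp_norm 2 (lebesgue_on \<Omega>) f)\<^sup>2 = (LINT x|lborel. (norm (f' x))\<^sup>2)"
    if "f' \<in> borel_measurable borel" "AE x in lborel. x \<in> \<Omega> \<longrightarrow> f x = f' x" "\<And>x. x \<notin> \<Omega> \<Longrightarrow> f' x = 0"
    for f f' :: "'a \<Rightarrow> 'c::euclidean_space"
    using Lp_norm_powr_eq_borel(1)[OF \<Omega>b that(1) that(3) that(2), of 2] by (simp add: Lp_norm_def)
  show "(H1_norm \<Omega> v)\<^sup>2 = (LINT x|lborel. (norm (v' x))\<^sup>2) + (LINT x|lborel. (norm (g' x))\<^sup>2)"
    unfolding H1_norm_def using sq[OF v'] sq[OF g'(1) wae g'(3)] by simp
  show "integrable lborel (\<lambda>x. (norm (v' x))\<^sup>2)" if "v \<in> H1 \<Omega>"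
    using that Lp_norm_powr_eq_borel(2)[OF \<Omega>b v'(1) v'(3) v'(2), of 2] by (simp add: H1_def)
  show "integrable lborel (\<lambda>x. (norm (g' x))\<^sup>2)" if vH: "v \<in> H1 \<Omega>"
  proof -
    obtain g2 where g2: "g2 \<in> Lp_space 2 (lebesgue_on \<Omega>)" "weak_gradient \<Omega> v g2" using vH by (auto simp: H1_def)
    have "AE x in lborel. x \<in> \<Omega> \<longrightarrow> g2 x = g' x"
      using weak_gradient_unique[OF \<Omega> g2(2) wg] g'(2) by eventually_elim auto
    from Lp_norm_powr_eq_borel(2)[OF \<Omega>b g'(1) g'(3) this, of 2] g2(1) show ?thesis by simp
  qed
qed

lemma H1_borel_version:
  fixes \<Omega> :: "'a::euclidean_space set"
  assumes \<Omega>: "open \<Omega>" and v: "v \<in> H1 \<Omega>"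
  obtains g v' g' where "weak_gradient \<Omega> v g"
    "v' \<in> borel_measurable borel" "AE x in lborel. x \<in> \<Omega> \<longrightarrow> v x = v' x" "\<And>x. x \<notin> \<Omega> \<Longrightarrow> v' x = 0"
    "g' \<in> borel_measurable borel" "AE x in lborel. x \<in> \<Omega> \<longrightarrow> g x = g' x" "\<And>x. x \<notin> \<Omega> \<Longrightarrow> g' x = 0"
    "integrable lborel (\<lambda>x. (norm (v' x))\<^sup>2)" "integrable lborel (\<lambda>x. (norm (g' x))\<^sup>2)"
proof -
  have \<Omega>b: "\<Omega> \<in> sets borel" using \<Omega> by simp
  obtain g where g: "g \<in> Lp_space 2 (lebesgue_on \<Omega>)" "weak_gradient \<Omega> v g" and vL: "v \<in> Lp_space 2 (lebesgue_on \<Omega>)"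
    using v by (auto simp: H1_def)
  obtain v' where v': "v' \<in> borel_measurable borel" "AE x in lborel. x \<in> \<Omega> \<longrightarrow> v x = v' x" "\<And>x. x \<notin> \<Omega> \<Longrightarrow> v' x = 0"
    by (rule borel_version_on[OF \<Omega>b, of v]) (use vL in \<open>auto simp: Lp_space_def\<close>)
  obtain g' where g': "g' \<in> borel_measurable borel" "AE x in lborel. x \<in> \<Omega> \<longrightarrow> g x = g' x" "\<And>x. x \<notin> \<Omega> \<Longrightarrow> g' x = 0"
    by (rule borel_version_on[OF \<Omega>b, of g]) (use g in \<open>auto simp: Lp_space_def\<close>)
  show thesis
    by (rule that[OF g(2) v' g' H1_norm_sq(3,4)[OF \<Omega> g(2) v' g' v]])
qed

lemma L2_distance_triangle:
  fixes f g z :: "'a \<Rightarrow> 'b::euclidean_space"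
  assumes m: "f \<in> borel_measurable M" "g \<in> borel_measurable M" "z \<in> borel_measurable M"
    and i: "integrable M (\<lambda>x. (norm (f x))\<^sup>2)" "integrable M (\<lambda>x. (norm (g x))\<^sup>2)" "integrable M (\<lambda>x. (norm (z x))\<^sup>2)"
  shows "(LINT x|M. (norm (f x - g x))\<^sup>2) \<le> 2 * (LINT x|M. (norm (z x - f x))\<^sup>2) + 2 * (LINT x|M. (norm (z x - g x))\<^sup>2)"
proof -
  have d: "integrable M (\<lambda>x. (norm (f x - g x))\<^sup>2)" "integrable M (\<lambda>x. (norm (z x - f x))\<^sup>2)" "integrable M (\<lambda>x. (norm (z x - g x))\<^sup>2)"
    by (intro integrable_norm_diff_L2 m i)+
  have "(LINT x|M. (norm (f x - g x))\<^sup>2) \<le> (LINT x|M. 2 * (norm (z x - f x))\<^sup>2 + 2 * (norm (z x - g x))\<^sup>2)"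
  proof (rule integral_mono)
    fix x
    have "0 \<le> (norm ((z x - f x) + (z x - g x)))\<^sup>2" by simp
    moreover have "f x - g x = (z x - g x) - (z x - f x)" by simp
    ultimately show "(norm (f x - g x))\<^sup>2 \<le> 2 * (norm (z x - f x))\<^sup>2 + 2 * (norm (z x - g x))\<^sup>2"
      by (simp only: power2_norm_eq_inner inner_add_left inner_add_right inner_diff_left inner_diff_right) (simp add: inner_commute)
  qed (use d in auto)
  then show ?thesis using d by simp
qed

text \<open>Two functions close to a common \<open>z\<close> are close to each other, measured on Borel representatives.\<close>

lemma H1_distance_L2:
  fixes \<Omega> :: "'a::euclidean_space set"
  assumes \<Omega>: "open \<Omega>" and z: "z \<in> H1 \<Omega>"
    and v1: "weak_gradient \<Omega> v1 g1" "v1' \<in> borel_measurable borel" "AE x in lborel. x \<in> \<Omega> \<longrightarrow> v1 x = v1' x" "\<And>x. x \<notin> \<Omega> \<Longrightarrow> v1' x = 0"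
      "g1' \<in> borel_measurable borel" "AE x in lborel. x \<in> \<Omega> \<longrightarrow> g1 x = g1' x" "\<And>x. x \<notin> \<Omega> \<Longrightarrow> g1' x = 0" "v1 \<in> H1 \<Omega>"
    and v2: "weak_gradient \<Omega> v2 g2" "v2' \<in> borel_measurable borel" "AE x in lborel. x \<in> \<Omega> \<longrightarrow> v2 x = v2' x" "\<And>x. x \<notin> \<Omega> \<Longrightarrow> v2' x = 0"
      "g2' \<in> borel_measurable borel" "AE x in lborel. x \<in> \<Omega> \<longrightarrow> g2 x = g2' x" "\<And>x. x \<notin> \<Omega> \<Longrightarrow> g2' x = 0" "v2 \<in> H1 \<Omega>"
  shows "(LINT x|lborel. (norm (v1' x - v2' x))\<^sup>2) + (LINT x|lborel. (norm (g1' x - g2' x))\<^sup>2)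
    \<le> 2 * (H1_norm \<Omega> (\<lambda>x. z x - v1 x))\<^sup>2 + 2 * (H1_norm \<Omega> (\<lambda>x. z x - v2 x))\<^sup>2"
proof -
  have \<Omega>l: "\<Omega> \<in> sets lebesgue" using \<Omega> by auto
  obtain gz z' gz' where gz: "weak_gradient \<Omega> z gz"
    "z' \<in> borel_measurable borel" "AE x in lborel. x \<in> \<Omega> \<longrightarrow> z x = z' x" "\<And>x. x \<notin> \<Omega> \<Longrightarrow> z' x = 0"
    "gz' \<in> borel_measurable borel" "AE x in lborel. x \<in> \<Omega> \<longrightarrow> gz x = gz' x" "\<And>x. x \<notin> \<Omega> \<Longrightarrow> gz' x = 0"
    "integrable lborel (\<lambda>x. (norm (z' x))\<^sup>2)" "integrable lborel (\<lambda>x. (norm (gz' x))\<^sup>2)"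
    by (rule H1_borel_version[OF \<Omega> z]) blast
  have dist: "(H1_norm \<Omega> (\<lambda>x. z x - v x))\<^sup>2 = (LINT x|lborel. (norm (z' x - v' x))\<^sup>2) + (LINT x|lborel. (norm (gz' x - g' x))\<^sup>2)"
    if "weak_gradient \<Omega> v g" "v' \<in> borel_measurable borel" "AE x in lborel. x \<in> \<Omega> \<longrightarrow> v x = v' x" "\<And>x. x \<notin> \<Omega> \<Longrightarrow> v' x = 0"
      "g' \<in> borel_measurable borel" "AE x in lborel. x \<in> \<Omega> \<longrightarrow> g x = g' x" "\<And>x. x \<notin> \<Omega> \<Longrightarrow> g' x = 0" for v v' g g'
  proof (rule H1_norm_sq(1)[OF \<Omega> weak_gradient_diff[OF \<Omega>l gz(1) that(1)]])
    show "(\<lambda>x. z' x - v' x) \<in> borel_measurable borel" "(\<lambda>x. gz' x - g' x) \<in> borel_measurable borel"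
      using gz that by auto
    show "AE x in lborel. x \<in> \<Omega> \<longrightarrow> z x - v x = z' x - v' x" using gz(3) that(3) by eventually_elim auto
    show "AE x in lborel. x \<in> \<Omega> \<longrightarrow> gz x - g x = gz' x - g' x" using gz(6) that(6) by eventually_elim auto
  qed (use gz that in auto)
  note i1 = H1_norm_sq(3,4)[OF \<Omega> v1(1-7) v1(8)]
  note i2 = H1_norm_sq(3,4)[OF \<Omega> v2(1-7) v2(8)]
  have "(LINT x|lborel. (norm (v1' x - v2' x))\<^sup>2) \<le> 2 * (LINT x|lborel. (norm (z' x - v1' x))\<^sup>2) + 2 * (LINT x|lborel. (norm (z' x - v2' x))\<^sup>2)"
    by (rule L2_distance_triangle) (use v1(2) v2(2) gz(2,8) i1 i2 in auto)
  moreover have "(LINT x|lborel. (norm (g1' x - g2' x))\<^sup>2) \<le> 2 * (LINT x|lborel. (norm (gz' x - g1' x))\<^sup>2) + 2 * (LINT x|lborel. (norm (gz' x - g2' x))\<^sup>2)"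
    by (rule L2_distance_triangle) (use v1(5) v2(5) gz(5,9) i1 i2 in auto)
  ultimately show ?thesis using dist[OF v1(1-7)] dist[OF v2(1-7)] by simp
qed

section \<open>The integral estimate\<close>

lemma borel_section:
  fixes F :: "real \<times> 'a::euclidean_space \<Rightarrow> 'b::euclidean_space"
  assumes "F \<in> borel_measurable borel"
  shows "(\<lambda>x. F (t, x)) \<in> borel_measurable borel"
proof -
  have "F \<in> borel_measurable (lborel \<Otimes>\<^sub>M lborel)" using assms by (simp add: borel_lborel_pair)
  then have "(\<lambda>x. F (t, x)) \<in> borel_measurable lborel" by measurable
  then show ?thesis by simp
qed

theorem theorem4p1:
  fixes \<Omega> :: "(real ^ 'n) set" and T m a1 a2 :: real
    and k l :: "real \<Rightarrow> real" and h :: "nat \<Rightarrow> real \<Rightarrow> real"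
    and u0 :: "real ^ 'n \<Rightarrow> real" and f a u :: "real \<times> (real ^ 'n) \<Rightarrow> real"
    and G :: "real \<times> (real ^ 'n) \<Rightarrow> real ^ 'n"
  assumes "T > 0"
    and "bounded_lipschitz_domain \<Omega>"
    and "cond_PC k l"
    and "\<And>n. n \<ge> 1 \<Longrightarrow> is_regularizer l n (h n)"
    and "m \<ge> 1"
    and "u0 \<in> Lp_space (m + 1) (lebesgue_on \<Omega>)"
    and "f \<in> Lp_space (m + 1) (lebesgue_on ({0<..<T} \<times> \<Omega>))"
    and "a \<in> Linf_space (lebesgue_on ({0<..<T} \<times> \<Omega>))"
    and "a1 > 0" and "a2 > 0"
    and "AE p in lebesgue_on ({0<..<T} \<times> \<Omega>). a1 \<le> a p \<and> a p \<le> a2"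
    and "u \<in> borel_measurable (lebesgue_on ({0<..<T} \<times> \<Omega>))"
    and "AE p in lebesgue_on ({0<..<T} \<times> \<Omega>). 0 \<le> u p"
    and "spatial_gradient \<Omega> T (\<lambda>p. a p * u p powr m) G"
    and "(L2_bochner \<Omega> T (H1_zero \<Omega>) (\<lambda>t x. a (t, x) * u (t, x) powr m) \<and>
            regularized_inequality \<Omega> T k h u u0 f G (H1_zero \<Omega>)) \<or>
         (L2_bochner \<Omega> T (H1 \<Omega>) (\<lambda>t x. a (t, x) * u (t, x) powr m) \<and>
            regularized_inequality \<Omega> T k h u u0 f G (H1 \<Omega>))"
    and "conv_continuous_zero_initial \<Omega> T k u"
  shows "(\<integral>\<^sup>+t\<in>{0<..<T}. (\<integral>\<^sup>+x\<in>\<Omega>. ennreal (u (t, x) powr (m + 1)) \<partial>lebesgue) \<partial>lebesgue)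
       + ennreal (1 / a1) *
         (\<integral>\<^sup>+t\<in>{0<..<T}. (\<integral>\<^sup>+x\<in>\<Omega>.
            ennreal ((k (T - t) + k t) * (norm (dual_conv T l (\<lambda>s. G (s, x)) t))\<^sup>2)
          \<partial>lebesgue) \<partial>lebesgue)
       \<le> ennreal
           (2 * (4 * m) powr m / (m + 1) powr (m + 1) * (a2 / a1) powr (m + 1) *
            (T * Lp_norm (m + 1) (lebesgue_on \<Omega>) u0 powr (m + 1)
             + Lp_norm 1 (lebesgue_on {0<..<T}) l powr (m + 1)
               * Lp_norm (m + 1) (lebesgue_on ({0<..<T} \<times> \<Omega>)) f powr (m + 1)))"
proof -
  note T = assms(1) and m = assms(5) and a_pos = assms(9,10)
  define S where "S = {0<..<T} \<times> \<Omega>"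
  define w where "w q = a q * u q powr m" for q
  have \<Omega>: "open \<Omega>" "bounded \<Omega>" using assms(2) by (auto simp: bounded_lipschitz_domain_def)
  have \<Omega>b: "\<Omega> \<in> sets borel" using \<Omega> by simp
  have "open S" unfolding S_def by (intro open_Times \<Omega>) simp
  then have Sb: "S \<in> sets borel" by simp
  have Sl: "S \<in> sets lebesgue" using Sb by simp
  have fin\<Omega>: "emeasure lborel \<Omega> < \<infinity>" by (rule emeasure_bounded_finite[OF \<Omega>(2)])
  have finS: "emeasure lborel S < \<infinity>"
    unfolding S_def by (intro emeasure_bounded_finite bounded_Times \<Omega>) simp

  \<comment> \<open>The two boundary conditions differ only in the space \<open>V\<close> of test functions and are treated at once.\<close>
  obtain V where V: "V \<subseteq> H1 \<Omega>" and boch: "L2_bochner \<Omega> T V (\<lambda>t x. w (t, x))"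
    and ineq: "regularized_inequality \<Omega> T k h u u0 f G V"
  proof -
    have "H1_zero \<Omega> \<subseteq> H1 \<Omega>" by (auto simp: H1_zero_def)
    then show thesis using assms(15) that[of "H1_zero \<Omega>"] that[of "H1 \<Omega>"] unfolding w_def by blast
  qed

  obtain k' l' h' where reg: "PC_regularized k' l' T h'"
    and kk': "\<And>s. 0 < s \<Longrightarrow> s < T \<Longrightarrow> k s = k' s"
    and ll': "AE s in lborel. 0 < s \<and> s < T \<longrightarrow> l s = l' s" and l'0: "\<And>s. s \<notin> {0<..<T} \<Longrightarrow> l' s = 0"
    and hh': "\<And>n. AE s in lborel. 0 < s \<and> s < T \<longrightarrow> h (Suc n) s = h' n s"
    by (rule cond_PC_regularized[OF T assms(3,4)]) blast+
  interpret PC_regularized k' l' T h' by (rule reg)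
  have kk'_AE: "AE s in lborel. 0 < s \<and> s < T \<longrightarrow> k s = k' s" using kk' by auto

  \<comment> \<open>Primed letters denote Borel representatives, extended by zero; \<open>u'\<close> is moreover nonnegative.\<close>
  obtain u1 where u1: "u1 \<in> borel_measurable borel" "AE q in lborel. q \<in> S \<longrightarrow> u q = u1 q" "\<And>q. q \<notin> S \<Longrightarrow> u1 q = 0"
    using borel_version_on[OF Sb, of u] assms(12) unfolding S_def by blast
  define u' where "u' q = max 0 (u1 q)" for q
  have upos: "AE q in lborel. q \<in> S \<longrightarrow> 0 \<le> u q"
    using assms(13) Sl unfolding S_def by (subst (asm) AE_lebesgue_on_iff) auto
  have u'm: "u' \<in> borel_measurable borel" unfolding u'_def[abs_def] using u1(1) by measurable
  have uu': "AE q in lborel. q \<in> S \<longrightarrow> u q = u' q" using u1(2) upos by eventually_elim (auto simp: u'_def)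
  have u'0: "u' q = 0" if "q \<notin> S" for q using u1(3)[OF that] by (simp add: u'_def)
  have u'nn: "0 \<le> u' q" for q by (simp add: u'_def)
  have abd: "AE q in lborel. q \<in> S \<longrightarrow> a1 \<le> a q \<and> a q \<le> a2"
    using assms(11) Sl unfolding S_def by (subst (asm) AE_lebesgue_on_iff) auto
  have "w \<in> borel_measurable (lebesgue_on S)"
    using assms(8,12) unfolding w_def[abs_def] S_def Linf_space_def by (intro borel_measurable_times) auto
  then obtain w' where w': "w' \<in> borel_measurable borel" "AE q in lborel. q \<in> S \<longrightarrow> w q = w' q" "\<And>q. q \<notin> S \<Longrightarrow> w' q = 0"
    using borel_version_on[OF Sb, of w] by blast
  have "G \<in> borel_measurable (lebesgue_on S)" and Gwg0: "AE t in lebesgue_on {0<..<T}. weak_gradient \<Omega> (\<lambda>x. w (t, x)) (\<lambda>x. G (t, x))"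
    using assms(14) unfolding spatial_gradient_def S_def w_def by auto
  then obtain G' where G': "G' \<in> borel_measurable borel" "AE q in lborel. q \<in> S \<longrightarrow> G q = G' q" "\<And>q. q \<notin> S \<Longrightarrow> G' q = 0"
    using borel_version_on[OF Sb, of G] by blast
  have "f \<in> borel_measurable (lebesgue_on S)" using assms(7) unfolding Lp_space_def S_def by blast
  then obtain f' where f': "f' \<in> borel_measurable borel" "AE q in lborel. q \<in> S \<longrightarrow> f q = f' q" "\<And>q. q \<notin> S \<Longrightarrow> f' q = 0"
    using borel_version_on[OF Sb, of f] by blast
  have "u0 \<in> borel_measurable (lebesgue_on \<Omega>)" using assms(6) unfolding Lp_space_def by blast
  then obtain u0' where u0': "u0' \<in> borel_measurable borel" "AE x in lborel. x \<in> \<Omega> \<longrightarrow> u0 x = u0' x" "\<And>x. x \<notin> \<Omega> \<Longrightarrow> u0' x = 0"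
    using borel_version_on[OF \<Omega>b, of u0] by blast
  have outS: "(s, x) \<notin> S" if "s \<notin> {0<..<T} \<or> x \<notin> \<Omega>" for s x using that by (auto simp: S_def)

  have ww': "AE q in lborel. a1 * u' q powr m \<le> w' q \<and> w' q \<le> a2 * u' q powr m"
    using abd uu' w'(2)
  proof eventually_elim
    case (elim q)
    show ?case
    proof (cases "q \<in> S")
      case True
      then have "w' q = a q * u' q powr m" using elim by (simp add: w_def)
      moreover have "a1 * u' q powr m \<le> a q * u' q powr m" "a q * u' q powr m \<le> a2 * u' q powr m"
        using elim True by (auto intro!: mult_right_mono)
      ultimately show ?thesis by simp
    next
      case False then show ?thesis using u'0 w'(3) by simp
    qed
  qed

  obtain Sim where Sim: "\<And>j. Sim j ` {0<..<T} \<subseteq> V" "\<And>j. finite (Sim j ` {0<..<T})"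
    and Sim_lim: "AE t in lebesgue_on {0<..<T}. (\<lambda>j. H1_norm \<Omega> (\<lambda>x. Sim j t x - w (t, x))) \<longlonglongrightarrow> 0"
    and wV: "AE t in lebesgue_on {0<..<T}. (\<lambda>x. w (t, x)) \<in> V"
    and normi: "integrable (lebesgue_on {0<..<T}) (\<lambda>t. (H1_norm \<Omega> (\<lambda>x. w (t, x)))\<^sup>2)"
    using boch unfolding L2_bochner_def by blast
  \<comment> \<open>The times at which all almost everywhere hypotheses on \<open>w(t)\<close> and \<open>G(t)\<close> hold; test functions are taken from these.\<close>
  define good where "good t \<longleftrightarrow> 0 < t \<and> t < T \<and> (\<lambda>x. w (t, x)) \<in> V \<and> (\<lambda>j. H1_norm \<Omega> (\<lambda>x. Sim j t x - w (t, x))) \<longlonglongrightarrow> 0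
     \<and> weak_gradient \<Omega> (\<lambda>x. w (t, x)) (\<lambda>x. G (t, x)) \<and> (AE x in lborel. x \<in> \<Omega> \<longrightarrow> w (t, x) = w' (t, x))
     \<and> (AE x in lborel. x \<in> \<Omega> \<longrightarrow> G (t, x) = G' (t, x)) \<and> (AE x in lborel. x \<in> \<Omega> \<longrightarrow> 0 \<le> w (t, x))" for t
  have intT: "{0<..<T} \<in> sets lebesgue" by simp
  have good: "AE t in lborel. 0 < t \<and> t < T \<longrightarrow> good t"
  proof -
    have ae1: "AE t in lborel. t \<in> {0<..<T} \<longrightarrow> (\<lambda>x. w (t, x)) \<in> V"
      using wV by (subst (asm) AE_lebesgue_on_iff[OF intT])
    have ae2: "AE t in lborel. t \<in> {0<..<T} \<longrightarrow> (\<lambda>j. H1_norm \<Omega> (\<lambda>x. Sim j t x - w (t, x))) \<longlonglongrightarrow> 0"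
      using Sim_lim by (subst (asm) AE_lebesgue_on_iff[OF intT])
    have ae3: "AE t in lborel. t \<in> {0<..<T} \<longrightarrow> weak_gradient \<Omega> (\<lambda>x. w (t, x)) (\<lambda>x. G (t, x))"
      using Gwg0 by (subst (asm) AE_lebesgue_on_iff[OF intT])
    have "AE q in lborel. q \<in> S \<longrightarrow> 0 \<le> w q"
      using abd by eventually_elim (use a_pos in \<open>auto simp: w_def\<close>)
    note secs = AE_lborel_pair(1)[OF w'(2)] AE_lborel_pair(1)[OF G'(2)] AE_lborel_pair(1)[OF this]
    show ?thesis using ae1 ae2 ae3 secs
      by eventually_elim (intro impI, simp add: good_def S_def)
  qed
  have secw: "(\<lambda>x. w' (t, x)) \<in> borel_measurable borel" "(\<lambda>x. G' (t, x)) \<in> borel_measurable borel" for t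
    by (intro borel_section w'(1) G'(1))+
  have sec0: "w' (t, x) = 0" "G' (t, x) = 0" if "x \<notin> \<Omega>" for t x using w'(3) G'(3) outS that by auto
  have goodD: "(\<lambda>x. w (t, x)) \<in> H1 \<Omega>" "weak_gradient \<Omega> (\<lambda>x. w (t, x)) (\<lambda>x. G (t, x))"
    "AE x in lborel. x \<in> \<Omega> \<longrightarrow> w (t, x) = w' (t, x)" "AE x in lborel. x \<in> \<Omega> \<longrightarrow> G (t, x) = G' (t, x)" if "good t" for t
    using that V by (auto simp: good_def)
  have good_norm: "(H1_norm \<Omega> (\<lambda>x. w (t, x)))\<^sup>2 = (LINT x|lborel. (norm (w' (t, x)))\<^sup>2) + (LINT x|lborel. (norm (G' (t, x)))\<^sup>2)"
    "AE x in lborel. x \<in> \<Omega> \<longrightarrow> wgrad \<Omega> (\<lambda>x. w (t, x)) x = G' (t, x)"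
    "integrable lborel (\<lambda>x. (norm (w' (t, x)))\<^sup>2)" "integrable lborel (\<lambda>x. (norm (G' (t, x)))\<^sup>2)" if "good t" for t
    by (rule H1_norm_sq[OF \<Omega>(1) goodD(2)[OF that] secw(1) goodD(3)[OF that] _ secw(2) goodD(4)[OF that]],
      (rule sec0 goodD(1)[OF that]; assumption?)+)+

  \<comment> \<open>The squared \<open>H\<^sup>1\<close> norm in terms of representatives; its integrability puts \<open>w'\<close> and \<open>G'\<close> into \<open>L\<^sub>2\<close> of the cylinder.\<close>
  define N2 where "N2 t = (LINT x|lborel. (norm (w' (t, x)))\<^sup>2) + (LINT x|lborel. (norm (G' (t, x)))\<^sup>2)" for t
  have wpm: "w' \<in> borel_measurable (lborel \<Otimes>\<^sub>M lborel)" "G' \<in> borel_measurable (lborel \<Otimes>\<^sub>M lborel)"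
    using w'(1) G'(1) by (simp_all add: borel_lborel_pair)
  have N2m: "N2 \<in> borel_measurable borel"
  proof -
    note [measurable] = wpm
    have "N2 \<in> borel_measurable lborel" unfolding N2_def[abs_def] by measurable
    then show ?thesis by simp
  qed
  have N2i: "integrable lborel N2"
  proof -
    have "AE t in lborel. t \<in> {0<..<T} \<longrightarrow> (H1_norm \<Omega> (\<lambda>x. w (t, x)))\<^sup>2 = N2 t"
      using good
    proof eventually_elim
      case (elim t) then show ?case using good_norm(1)[of t] by (auto simp: N2_def)
    qed
    moreover have "N2 t = 0" if "t \<notin> {0<..<T}" for t
      using w'(3)[OF outS, of t] G'(3)[OF outS, of t] that by (simp add: N2_def)
    ultimately show ?thesis using normi lebesgue_on_integral_eq_borel(2)[of "{0<..<T}" N2] N2m by auto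
  qed
  have L2: "integrable lborel (\<lambda>q. (norm (F q))\<^sup>2)"
    if F: "F \<in> borel_measurable (lborel \<Otimes>\<^sub>M lborel)"
      and sec: "\<And>t. good t \<Longrightarrow> integrable lborel (\<lambda>x. (norm (F (t, x)))\<^sup>2)"
      and le: "\<And>t. (LINT x|lborel. (norm (F (t, x)))\<^sup>2) \<le> N2 t" and F0: "\<And>t x. t \<notin> {0<..<T} \<Longrightarrow> F (t, x) = 0"
    for F :: "real \<times> (real ^ 'n) \<Rightarrow> 'd::euclidean_space"
  proof -
    note [measurable] = F
    have "integrable (lborel \<Otimes>\<^sub>M lborel) (\<lambda>q. (norm (F q))\<^sup>2)"
    proof (rule lborel_pair.Fubini_integrable)
      show "(\<lambda>q. (norm (F q))\<^sup>2) \<in> borel_measurable (lborel \<Otimes>\<^sub>M lborel)" by measurable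
      show "AE t in lborel. integrable lborel (\<lambda>x. (norm (F (t, x)))\<^sup>2)"
        using good
      proof eventually_elim
        case (elim t) then show ?case using sec[of t] F0[of t] by (cases "t \<in> {0<..<T}") auto
      qed
      show "integrable lborel (\<lambda>t. LINT x|lborel. norm ((norm (F (t, x)))\<^sup>2))"
      proof (rule Bochner_Integration.integrable_bound[OF N2i])
        show "(\<lambda>t. LINT x|lborel. norm ((norm (F (t, x)))\<^sup>2)) \<in> borel_measurable lborel" by measurable
        show "AE t in lborel. norm (LINT x|lborel. norm ((norm (F (t, x)))\<^sup>2)) \<le> norm (N2 t)"
          using le by (auto intro!: AE_I2 order_trans[OF _ abs_ge_self])
      qed
    qed
    then show ?thesis by (simp add: lborel_prod)
  qed
  have w'2: "integrable lborel (\<lambda>q. (norm (w' q))\<^sup>2)"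
    by (rule L2[OF wpm(1)]) (use good_norm(3) w'(3) outS in \<open>auto simp: N2_def\<close>)
  have G'2: "integrable lborel (\<lambda>q. (norm (G' q))\<^sup>2)"
    by (rule L2[OF wpm(2)]) (use good_norm(4) G'(3) outS in \<open>auto simp: N2_def\<close>)
  have G'i: "integrable lborel G'"
  proof -
    have "integrable lborel (\<lambda>q. norm (G' q) powr 1)"
      by (rule integrable_powr_mono[OF G'(1) Sb finS G'(3), of 2]) (use G'2 in auto)
    then show ?thesis using G'(1) by (simp add: integrable_norm_iff)
  qed

  \<comment> \<open>As \<open>a1 u\<^sup>m \<le> w\<close>, the function \<open>u\<close> has the exponent \<open>2 m\<close>, and \<open>m + 1 \<le> 2 m\<close>; all lower exponents follow on a set of finite measure.\<close>
  have u'2m: "integrable lborel (\<lambda>q. norm (u' q) powr (2 * m))"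
  proof (rule Bochner_Integration.integrable_bound)
    show "integrable lborel (\<lambda>q. (norm (w' q))\<^sup>2 / a1\<^sup>2)" using w'2 by simp
    show "(\<lambda>q. norm (u' q) powr (2 * m)) \<in> borel_measurable lborel" using u'm by measurable
    show "AE q in lborel. norm (norm (u' q) powr (2 * m)) \<le> norm ((norm (w' q))\<^sup>2 / a1\<^sup>2)"
      using ww'
    proof eventually_elim
      case (elim q)
      have "(a1 * u' q powr m)\<^sup>2 \<le> (w' q)\<^sup>2" using elim a_pos by (intro power_mono) auto
      moreover have "(u' q powr m)\<^sup>2 = u' q powr (2 * m)"
        by (simp add: power2_eq_square powr_add[symmetric])
      ultimately have "a1\<^sup>2 * u' q powr (2 * m) \<le> (w' q)\<^sup>2" by (simp add: power_mult_distrib)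
      then show ?case using a_pos u'nn[of q] by (simp add: pos_le_divide_eq mult.commute)
    qed
  qed
  note u'_powr = integrable_powr_mono[OF u'm Sb finS u'0 u'2m]
  have u'int: "integrable lborel u'" "integrable lborel (\<lambda>q. (norm (u' q))\<^sup>2)" "integrable lborel (\<lambda>q. u' q powr (m + 1))"
    using u'_powr[of 1] u'_powr[of 2] u'_powr[of "m + 1"] m u'nn by simp_all
  have f'p: "integrable lborel (\<lambda>q. norm (f' q) powr (m + 1))"
    and f'norm: "Lp_norm (m + 1) (lebesgue_on S) f powr (m + 1) = (LINT q|lborel. norm (f' q) powr (m + 1))"
    using Lp_norm_powr_eq_borel[OF Sb f'(1,3,2), of "m + 1"] m assms(7) by (simp_all add: S_def)
  note f'_powr = integrable_powr_mono[OF f'(1) Sb finS f'(3) f'p]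
  have f'int: "integrable lborel f'" "integrable lborel (\<lambda>q. (norm (f' q))\<^sup>2)"
    using f'_powr[of 1] f'_powr[of 2] m f'(1) by (simp_all add: integrable_abs_iff)
  have u0'p: "integrable lborel (\<lambda>x. norm (u0' x) powr (m + 1))"
    and u0'norm: "Lp_norm (m + 1) (lebesgue_on \<Omega>) u0 powr (m + 1) = (LINT x|lborel. norm (u0' x) powr (m + 1))"
    using Lp_norm_powr_eq_borel[OF \<Omega>b u0'(1,3,2), of "m + 1"] m assms(6) by simp_all
  note u0'_powr = integrable_powr_mono[OF u0'(1) \<Omega>b fin\<Omega> u0'(3) u0'p]
  have u0'int: "integrable lborel u0'" "integrable lborel (\<lambda>x. (norm (u0' x))\<^sup>2)"
    using u0'_powr[of 1] u0'_powr[of 2] m u0'(1) by (simp_all add: integrable_abs_iff)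

  \<comment> \<open>Countably many values of \<open>w\<close> at good times are dense among all of them.\<close>
  define D where "D = (\<Union>j. Sim j ` {0<..<T})"
  have "countable D" unfolding D_def using Sim(2) countable_finite by (intro countable_UN) auto
  moreover have "Sim j t \<in> D" if "t \<in> Collect good" for j t
    unfolding D_def using that by (intro UN_I[of j] imageI) (auto simp: good_def)
  moreover have "(\<lambda>j. H1_norm \<Omega> (\<lambda>x. Sim j t x - w (t, x))) \<longlonglongrightarrow> 0" if "t \<in> Collect good" for t using that by (simp add: good_def)
  ultimately obtain C where C: "countable C" "C \<subseteq> Collect good"
    and near: "\<And>t e. t \<in> Collect good \<Longrightarrow> e > 0 \<Longrightarrow> \<exists>c\<in>C. \<exists>z\<in>D. \<bar>H1_norm \<Omega> (\<lambda>x. z x - w (c, x))\<bar> < e \<and> \<bar>H1_norm \<Omega> (\<lambda>x. z x - w (t, x))\<bar> < e"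
    by (rule separable_selection[where \<delta>="\<lambda>z t. H1_norm \<Omega> (\<lambda>x. z x - w (t, x))"]) blast+
  have D_H1: "z \<in> H1 \<Omega>" if "z \<in> D" for z using that Sim(1) V by (auto simp: D_def)
  have dense: "AE t in lborel. 0 < t \<and> t < T \<longrightarrow> (\<forall>e>0. \<exists>c\<in>C.
       (LINT x|lborel. (norm (w' (t, x) - w' (c, x)))\<^sup>2) + (LINT x|lborel. (norm (G' (t, x) - G' (c, x)))\<^sup>2) \<le> e)"
    using good
  proof eventually_elim
    case (elim t)
    show ?case
    proof (intro impI allI)
      fix e :: real assume t: "0 < t \<and> t < T" and e: "e > 0"
      \<comment> \<open>Twice the sum of two squared distances below \<open>d\<close> is at most \<open>4 d\<^sup>2 = e\<close>.\<close>
      define d where "d = sqrt (e / 4)"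
      have d: "d > 0" "d\<^sup>2 = e / 4" using e by (simp_all add: d_def)
      have gt: "good t" using elim t by simp
      then obtain c z where cz: "c \<in> C" "z \<in> D" "\<bar>H1_norm \<Omega> (\<lambda>x. z x - w (c, x))\<bar> < d" "\<bar>H1_norm \<Omega> (\<lambda>x. z x - w (t, x))\<bar> < d"
        using near[of t d] d by blast
      have gc: "good c" using C cz by auto
      have "(LINT x|lborel. (norm (w' (t, x) - w' (c, x)))\<^sup>2) + (LINT x|lborel. (norm (G' (t, x) - G' (c, x)))\<^sup>2)
        \<le> 2 * (H1_norm \<Omega> (\<lambda>x. z x - w (t, x)))\<^sup>2 + 2 * (H1_norm \<Omega> (\<lambda>x. z x - w (c, x)))\<^sup>2"
        by (rule H1_distance_L2[OF \<Omega>(1) D_H1[OF cz(2)] goodD(2)[OF gt] secw(1) goodD(3)[OF gt] sec0(1) secw(2) goodD(4)[OF gt] sec0(2) goodD(1)[OF gt]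
            goodD(2)[OF gc] secw(1) goodD(3)[OF gc] sec0(1) secw(2) goodD(4)[OF gc] sec0(2) goodD(1)[OF gc]])
      also have "\<dots> \<le> 2 * d\<^sup>2 + 2 * d\<^sup>2"
        using cz(3,4) d(1) by (intro add_mono mult_left_mono) (auto simp: abs_le_square_iff[symmetric])
      also have "\<dots> = e" using d by simp
      finally show "\<exists>c\<in>C. (LINT x|lborel. (norm (w' (t, x) - w' (c, x)))\<^sup>2) + (LINT x|lborel. (norm (G' (t, x) - G' (c, x)))\<^sup>2) \<le> e"
        using cz(1) by blast
    qed
  qed

  define v where "v q = u' q - E (fst q) * u0' (snd q)" for q
  have v_eq: "AE x in lborel. x \<in> \<Omega> \<longrightarrow> (AE s in lborel. 0 < s \<and> s < T \<longrightarrow> u (s, x) - u0 x = v (s, x))"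
    using AE_lborel_pair(2)[OF uu'] u0'(2)
  proof eventually_elim
    case (elim x)
    show ?case
    proof
      assume x: "x \<in> \<Omega>"
      show "AE s in lborel. 0 < s \<and> s < T \<longrightarrow> u (s, x) - u0 x = v (s, x)"
        using elim(1) by eventually_elim (use x elim(2) in \<open>auto simp: v_def S_def\<close>)
    qed
  qed
  have vi: "integrable lborel v"
    unfolding v_def[abs_def] by (intro Bochner_Integration.integrable_diff u'int(1) indicator_tensor(1)[OF T u0'int(1)])
  then have vm: "v \<in> borel_measurable borel" by auto
  have v0: "v (s, x) = 0" if "s \<notin> {0<..<T}" for s x using u'0[OF outS] that by (simp add: v_def)
  have G'0: "\<forall>q. q \<notin> S \<longrightarrow> G' q = 0" and f'0: "\<forall>q. q \<notin> S \<longrightarrow> f' q = 0"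
    using G'(3) f'(3) by auto
  have secL1: "AE x in lborel. causal (\<lambda>s. F (s, x))"
    if "integrable lborel F" "\<forall>q. q \<notin> S \<longrightarrow> F q = 0" for F :: "real \<times> (real ^ 'n) \<Rightarrow> 'd::euclidean_space"
    using fubini_sections_x(1)[OF that(1)]
  proof eventually_elim
    case (elim x) then show ?case using that(2) outS by (auto simp: causal_def)
  qed
  have tc: "AE x in lborel. x \<in> \<Omega> \<longrightarrow> (\<forall>t<T. time_conv (h (Suc n)) (\<lambda>s. F (s, x)) t = conv (h' n) (\<lambda>s. F' (s, x)) t)"
    if "integrable lborel F'" "\<forall>q. q \<notin> S \<longrightarrow> F' q = 0" "AE q in lborel. q \<in> S \<longrightarrow> F q = F' q"
    for F F' :: "real \<times> (real ^ 'n) \<Rightarrow> 'd::euclidean_space" and n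
    using secL1[OF that(1,2)] AE_lborel_pair(2)[OF that(3)]
  proof eventually_elim
    case (elim x)
    show ?case
    proof (intro impI allI)
      fix t assume x: "x \<in> \<Omega>" and t: "t < T"
      show "time_conv (h (Suc n)) (\<lambda>s. F (s, x)) t = conv (h' n) (\<lambda>s. F' (s, x)) t"
        by (rule time_conv_eq_conv[OF PC_regularized.h[OF reg] hh' elim(1)])
          (use elim(2) x t in \<open>auto simp: S_def elim!: eventually_mono\<close>)
    qed
  qed
  have convsec: "(\<lambda>x. conv (h' n) (\<lambda>s. F (s, x)) t) \<in> borel_measurable borel"
    if "F \<in> borel_measurable borel" for F :: "real \<times> (real ^ 'n) \<Rightarrow> 'd::euclidean_space" and n t
    using borel_section[OF measurable_conv_param[OF measurable_h that], of n t] by simp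
  \<comment> \<open>The hypothesis for the test function \<open>w(c)\<close>, in terms of representatives.\<close>
  have weak: "AE t in lborel. 0 < t \<and> t < T \<longrightarrow>
       (LINT x|lborel. w' (c, x) * (real (Suc n) * ((u' (t, x) - E t * u0' x) - conv (h' n) (\<lambda>s. u' (s, x) - E s * u0' x) t))
          + conv (h' n) (\<lambda>s. G' (s, x)) t \<bullet> G' (c, x))
         \<le> (LINT x|lborel. conv (h' n) (\<lambda>s. f' (s, x)) t * w' (c, x))"
    if c: "c \<in> C" for c n
  proof -
    have gc: "good c" using C c by auto
    have cV: "(\<lambda>x. w (c, x)) \<in> V" using gc by (simp add: good_def)
    have cpos: "AE x in lebesgue_on \<Omega>. 0 \<le> w (c, x)"
      using gc \<Omega>(1) unfolding good_def by (subst AE_lebesgue_on_iff) auto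
    have "AE t in lebesgue_on {0<..<T}.
          (LINT x|lebesgue_on \<Omega>. w (c, x) * deriv (time_conv (time_conv k (h (Suc n))) (\<lambda>s. u (s, x) - u0 x)) t
             + time_conv (h (Suc n)) (\<lambda>s. G (s, x)) t \<bullet> wgrad \<Omega> (\<lambda>x. w (c, x)) x)
          \<le> (LINT x|lebesgue_on \<Omega>. time_conv (h (Suc n)) (\<lambda>s. f (s, x)) t * w (c, x))"
      by (rule mp[OF spec[OF mp[OF bspec[OF ineq[unfolded regularized_inequality_def] cV] cpos]]]) simp
    then have raw: "AE t in lborel. t \<in> {0<..<T} \<longrightarrow>
          (LINT x|lebesgue_on \<Omega>. w (c, x) * deriv (time_conv (time_conv k (h (Suc n))) (\<lambda>s. u (s, x) - u0 x)) t
             + time_conv (h (Suc n)) (\<lambda>s. G (s, x)) t \<bullet> wgrad \<Omega> (\<lambda>x. w (c, x)) x)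
          \<le> (LINT x|lebesgue_on \<Omega>. time_conv (h (Suc n)) (\<lambda>s. f (s, x)) t * w (c, x))"
      by (subst (asm) AE_lebesgue_on_iff[OF intT])
    have "AE t in lborel. 0 < t \<and> t < T \<longrightarrow> (AE x in lborel. x \<in> \<Omega> \<longrightarrow>
       deriv (time_conv (time_conv k (h (Suc n))) (\<lambda>s. u (s, x) - u0 x)) t = real (Suc n) * (v (t, x) - conv (h' n) (\<lambda>s. v (s, x)) t))"
      by (rule AE_deriv_regularized[OF vi _ kk'_AE hh' v_eq]) (rule v0)
    with raw show ?thesis
    proof eventually_elim
      case (elim t)
      show ?case
      proof
        assume t: "0 < t \<and> t < T"
        define \<phi> where "\<phi> x = w' (c, x) * (real (Suc n) * (v (t, x) - conv (h' n) (\<lambda>s. v (s, x)) t))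
          + conv (h' n) (\<lambda>s. G' (s, x)) t \<bullet> G' (c, x)" for x
        have \<phi>m: "\<phi> \<in> borel_measurable borel" unfolding \<phi>_def[abs_def]
          by (intro borel_measurable_add borel_measurable_times borel_measurable_diff borel_measurable_inner
              borel_measurable_const secw convsec borel_section vm G'(1))
        have \<phi>0: "\<phi> x = 0" if "x \<notin> \<Omega>" for x using sec0[OF that] by (simp add: \<phi>_def)
        have derivs: "AE x in lborel. x \<in> \<Omega> \<longrightarrow> deriv (time_conv (time_conv k (h (Suc n))) (\<lambda>s. u (s, x) - u0 x)) t
           = real (Suc n) * (v (t, x) - conv (h' n) (\<lambda>s. v (s, x)) t)" using elim(2) t by simp
        have L: "(LINT x|lebesgue_on \<Omega>. w (c, x) * deriv (time_conv (time_conv k (h (Suc n))) (\<lambda>s. u (s, x) - u0 x)) t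
             + time_conv (h (Suc n)) (\<lambda>s. G (s, x)) t \<bullet> wgrad \<Omega> (\<lambda>x. w (c, x)) x) = (LINT x|lborel. \<phi> x)"
        proof (rule lebesgue_on_integral_eq_borel(1)[OF \<Omega>b \<phi>m \<phi>0])
          show "AE x in lborel. x \<in> \<Omega> \<longrightarrow> w (c, x) * deriv (time_conv (time_conv k (h (Suc n))) (\<lambda>s. u (s, x) - u0 x)) t
             + time_conv (h (Suc n)) (\<lambda>s. G (s, x)) t \<bullet> wgrad \<Omega> (\<lambda>x. w (c, x)) x = \<phi> x"
            using derivs tc[OF G'i G'0 G'(2), of n] goodD(3)[OF gc] good_norm(2)[OF gc]
            by eventually_elim (use t in \<open>auto simp: \<phi>_def\<close>)
        qed
        define \<theta> where "\<theta> x = conv (h' n) (\<lambda>s. f' (s, x)) t * w' (c, x)" for x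
        have \<theta>m: "\<theta> \<in> borel_measurable borel" unfolding \<theta>_def[abs_def] by (intro borel_measurable_times convsec f'(1) secw)
        have \<theta>0: "\<theta> x = 0" if "x \<notin> \<Omega>" for x using sec0[OF that] by (simp add: \<theta>_def)
        have R: "(LINT x|lebesgue_on \<Omega>. time_conv (h (Suc n)) (\<lambda>s. f (s, x)) t * w (c, x)) = (LINT x|lborel. \<theta> x)"
        proof (rule lebesgue_on_integral_eq_borel(1)[OF \<Omega>b \<theta>m \<theta>0])
          show "AE x in lborel. x \<in> \<Omega> \<longrightarrow> time_conv (h (Suc n)) (\<lambda>s. f (s, x)) t * w (c, x) = \<theta> x"
            using tc[OF f'int(1) f'0 f'(2), of n] goodD(3)[OF gc] by eventually_elim (use t in \<open>auto simp: \<theta>_def\<close>)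
        qed
        show "(LINT x|lborel. w' (c, x) * (real (Suc n) * ((u' (t, x) - E t * u0' x) - conv (h' n) (\<lambda>s. u' (s, x) - E s * u0' x) t))
          + conv (h' n) (\<lambda>s. G' (s, x)) t \<bullet> G' (c, x))
         \<le> (LINT x|lborel. conv (h' n) (\<lambda>s. f' (s, x)) t * w' (c, x))"
          using elim(1) t L R by (simp add: \<phi>_def[abs_def] \<theta>_def[abs_def] v_def)
      qed
    qed
  qed

  have tests: "(\<lambda>x. w' (c, x)) \<in> borel_measurable borel" "integrable lborel (\<lambda>x. (norm (w' (c, x)))\<^sup>2)"
    "(\<lambda>x. G' (c, x)) \<in> borel_measurable borel" "integrable lborel (\<lambda>x. (norm (G' (c, x)))\<^sup>2)" if "c \<in> C" for c
  proof -
    have gc: "good c" using C that by auto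
    show "(\<lambda>x. w' (c, x)) \<in> borel_measurable borel" "(\<lambda>x. G' (c, x)) \<in> borel_measurable borel" by (rule secw)+
    show "integrable lborel (\<lambda>x. (norm (w' (c, x)))\<^sup>2)" "integrable lborel (\<lambda>x. (norm (G' (c, x)))\<^sup>2)"
      using good_norm(3,4)[OF gc] by blast+
  qed
  have out0: "u' (s, x) = 0" "f' (s, x) = 0" "G' (s, x) = 0" "w' (s, x) = 0" if "s \<notin> {0<..<T}" for s x
    using u'0[OF outS] f'(3)[OF outS] G'(3)[OF outS] w'(3)[OF outS] that by auto
  have estimate: "(\<integral>\<^sup>+q. ennreal (u' q powr (m + 1)) \<partial>lborel)
      + ennreal (1 / a1) * (\<integral>\<^sup>+x. (\<integral>\<^sup>+t. ennreal (E t * ((k' (T - t) + k' t) * (norm (dconv l' (\<lambda>s. G' (s, x)) t))\<^sup>2)) \<partial>lborel) \<partial>lborel)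
     \<le> ennreal (2 * (4 * m) powr m / (m + 1) powr (m + 1) * (a2 / a1) powr (m + 1) *
         (T * (LINT x|lborel. \<bar>u0' x\<bar> powr (m + 1)) + (LINT s|lborel. \<bar>l' s\<bar>) powr (m + 1) * (LINT q|lborel. \<bar>f' q\<bar> powr (m + 1))))"
    by (rule borel_estimate[where w=w' and C=C and \<psi>="\<lambda>c x. w' (c, x)" and g="\<lambda>c x. G' (c, x)"])
      (use m a_pos u'int out0 u'nn u0'int u0'p f'int f'p G'i G'2 w'(1) w'2 ww' C(1) tests weak dense in \<open>simp_all\<close>)

  have lnorm: "Lp_norm 1 (lebesgue_on {0<..<T}) l = (LINT s|lborel. \<bar>l' s\<bar>)"
  proof -
    have "AE s in lborel. s \<in> {0<..<T} \<longrightarrow> l s = l' s" using ll' by eventually_elim auto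
    from Lp_norm_powr_eq_borel(1)[OF _ _ l'0 this, of 1]
    have "Lp_norm 1 (lebesgue_on {0<..<T}) l powr 1 = (LINT s|lborel. \<bar>l' s\<bar>)" by simp
    moreover have "0 \<le> Lp_norm 1 (lebesgue_on {0<..<T}) l" by (simp add: Lp_norm_def)
    ultimately show ?thesis by simp
  qed
  have lhs1: "(\<integral>\<^sup>+t\<in>{0<..<T}. (\<integral>\<^sup>+x\<in>\<Omega>. ennreal (u (t, x) powr (m + 1)) \<partial>lebesgue) \<partial>lebesgue)
     = (\<integral>\<^sup>+q. ennreal (u' q powr (m + 1)) \<partial>lborel)"
  proof -
    have "(\<integral>\<^sup>+t\<in>{0<..<T}. (\<integral>\<^sup>+x\<in>\<Omega>. ennreal (u (t, x) powr (m + 1)) \<partial>lebesgue) \<partial>lebesgue)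
      = (\<integral>\<^sup>+t. (\<integral>\<^sup>+x. ennreal (u' (t, x) powr (m + 1)) \<partial>lborel) \<partial>lborel)"
      unfolding nn_integral_completion
    proof (rule nn_integral_cong_AE)
      show "AE t in lborel. (\<integral>\<^sup>+x\<in>\<Omega>. ennreal (u (t, x) powr (m + 1)) \<partial>lborel) * indicator {0<..<T} t
        = (\<integral>\<^sup>+x. ennreal (u' (t, x) powr (m + 1)) \<partial>lborel)"
        using AE_lborel_pair(1)[OF uu']
      proof eventually_elim
        case (elim t)
        show ?case
        proof (cases "t \<in> {0<..<T}")
          case False then show ?thesis using out0(1) m by simp
        next
          case True
          have "(\<integral>\<^sup>+x\<in>\<Omega>. ennreal (u (t, x) powr (m + 1)) \<partial>lborel) = (\<integral>\<^sup>+x. ennreal (u' (t, x) powr (m + 1)) \<partial>lborel)"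
          proof (rule nn_integral_cong_AE)
            show "AE x in lborel. ennreal (u (t, x) powr (m + 1)) * indicator \<Omega> x = ennreal (u' (t, x) powr (m + 1))"
              using elim by eventually_elim (use True u'0[OF outS] m in \<open>auto simp: S_def indicator_def\<close>)
          qed
          then show ?thesis using True by simp
        qed
      qed
    qed
    also have "\<dots> = (\<integral>\<^sup>+q. ennreal (u' q powr (m + 1)) \<partial>(lborel \<Otimes>\<^sub>M lborel))"
    proof (rule lborel.nn_integral_fst)
      have "u' \<in> borel_measurable (lborel \<Otimes>\<^sub>M lborel)" using u'm by (simp add: borel_lborel_pair)
      then show "(\<lambda>q. ennreal (u' q powr (m + 1))) \<in> borel_measurable (lborel \<Otimes>\<^sub>M lborel)" by measurable
    qed
    finally show ?thesis by (simp add: lborel_prod)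
  qed
  define X where "X t x = ennreal (E t * ((k' (T - t) + k' t) * (norm (dconv l' (\<lambda>s. G' (s, x)) t))\<^sup>2))" for t x
  have Xm: "(\<lambda>(t, x). X t x) \<in> borel_measurable (lborel \<Otimes>\<^sub>M lborel)"
  proof -
    note [measurable] = wpm(2)
    have [measurable]: "(\<lambda>q. k' (T - fst q)) \<in> borel_measurable (lborel \<Otimes>\<^sub>M (lborel :: (real ^ 'n) measure))"
      "(\<lambda>q. k' (fst q)) \<in> borel_measurable (lborel \<Otimes>\<^sub>M (lborel :: (real ^ 'n) measure))"
      "(\<lambda>q. E (fst q)) \<in> borel_measurable (lborel \<Otimes>\<^sub>M (lborel :: (real ^ 'n) measure))"
      by measurable
    have [measurable]: "(\<lambda>q. dconv l' (\<lambda>s. G' (s, snd q)) (fst q)) \<in> borel_measurable (lborel \<Otimes>\<^sub>M lborel)"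
      unfolding dconv_def by measurable
    show ?thesis unfolding X_def case_prod_unfold by measurable
  qed
  have lhs2: "(\<integral>\<^sup>+t\<in>{0<..<T}. (\<integral>\<^sup>+x\<in>\<Omega>.
            ennreal ((k (T - t) + k t) * (norm (dual_conv T l (\<lambda>s. G (s, x)) t))\<^sup>2) \<partial>lebesgue) \<partial>lebesgue)
     = (\<integral>\<^sup>+x. (\<integral>\<^sup>+t. X t x \<partial>lborel) \<partial>lborel)"
  proof -
    have dual: "AE x in lborel. x \<in> \<Omega> \<longrightarrow> (\<forall>t\<ge>0. dual_conv T l (\<lambda>s. G (s, x)) t = dconv l' (\<lambda>s. G' (s, x)) t)"
      using secL1[OF G'i G'0] AE_lborel_pair(2)[OF G'(2)]
    proof eventually_elim
      case (elim x)
      show ?case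
      proof (intro impI allI)
        fix t :: real assume x: "x \<in> \<Omega>" and t: "0 \<le> t"
        show "dual_conv T l (\<lambda>s. G (s, x)) t = dconv l' (\<lambda>s. G' (s, x)) t"
        proof (rule dual_conv_eq_dconv[OF l ll' _ _ _ t])
          show "(\<lambda>s. G' (s, x)) \<in> borel_measurable borel" using causalD(1)[OF elim(1)] by auto
          show "G' (s, x) = 0" if "s \<notin> {0<..<T}" for s by (rule out0(3)[OF that])
          show "AE s in lborel. 0 < s \<and> s < T \<longrightarrow> G (s, x) = G' (s, x)"
            using elim(2) by eventually_elim (use x in \<open>auto simp: S_def\<close>)
        qed
      qed
    qed
    have "(\<integral>\<^sup>+t\<in>{0<..<T}. (\<integral>\<^sup>+x\<in>\<Omega>.
            ennreal ((k (T - t) + k t) * (norm (dual_conv T l (\<lambda>s. G (s, x)) t))\<^sup>2) \<partial>lebesgue) \<partial>lebesgue)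
      = (\<integral>\<^sup>+t. (\<integral>\<^sup>+x. X t x \<partial>lborel) \<partial>lborel)"
      unfolding nn_integral_completion
    proof (rule nn_integral_cong)
      fix t
      show "(\<integral>\<^sup>+x\<in>\<Omega>. ennreal ((k (T - t) + k t) * (norm (dual_conv T l (\<lambda>s. G (s, x)) t))\<^sup>2) \<partial>lborel) * indicator {0<..<T} t
        = (\<integral>\<^sup>+x. X t x \<partial>lborel)"
      proof (cases "t \<in> {0<..<T}")
        case False then show ?thesis by (simp add: X_def)
      next
        case True
        have "(\<integral>\<^sup>+x\<in>\<Omega>. ennreal ((k (T - t) + k t) * (norm (dual_conv T l (\<lambda>s. G (s, x)) t))\<^sup>2) \<partial>lborel) = (\<integral>\<^sup>+x. X t x \<partial>lborel)"
        proof (rule nn_integral_cong_AE)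
          show "AE x in lborel. ennreal ((k (T - t) + k t) * (norm (dual_conv T l (\<lambda>s. G (s, x)) t))\<^sup>2) * indicator \<Omega> x = X t x"
            using dual
          proof eventually_elim
            case (elim x)
            show ?case
            proof (cases "x \<in> \<Omega>")
              case True': True
              then show ?thesis using elim True kk'[of t] kk'[of "T - t"] by (simp add: X_def)
            next
              case False
              then have "G' (s, x) = 0" for s by (rule sec0(2))
              then show ?thesis using False by (simp add: X_def dconv_def)
            qed
          qed
        qed
        then show ?thesis using True by simp
      qed
    qed
    also have "\<dots> = (\<integral>\<^sup>+x. (\<integral>\<^sup>+t. X t x \<partial>lborel) \<partial>lborel)"
      using lborel_pair.Fubini'[OF Xm] by simp
    finally show ?thesis .
  qed
  show ?thesis
    unfolding lhs1 lhs2 u0'norm lnorm f'norm[unfolded S_def]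
    using estimate by (simp add: X_def)
qed

end
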